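(* Let $\Omega\subset\mathbb{R}^2$ be an open set. If $u\in W^{1,2}_{\mathrm{ren}}(\Omega,\mathcal{N})$ is a minimal renormalisable singular harmonic map on $\Omega$, then $u$ is a stationary renormalisable singular harmonic map.
   Context: $\mathcal{N}$ is a smooth compact connected Riemannian manifold isometrically embedded in $\mathbb{R}^\nu$; Sobolev and VMO (vanishing mean oscillation) spaces of maps into $\mathcal{N}$ consist of $\mathbb{R}^\nu$-valued maps taking values in $\mathcal{N}$ almost everywhere; $\operatorname{tr}$ with a subscript set is the trace on that set; $M:N=\operatorname{tr}(MN^* )$ is the inner product of matrices and $|M|^2=M:M$. Homotopy in $\mathrm{VMO}(\mathbb{S}^1,\mathcal{N})$ means lying in the same path-connected component. $\lambda(\gamma)=\inf\{\int_{\mathbb{S}^1}|\tilde\gamma'| : \tilde\gamma\in\mathcal{C}^1(\mathbb{S}^1,\mathcal{N})\text{ homotopic to }\gamma\text{ in }\mathrm{VMO}(\mathbb{S}^1,\mathcal{N})\}$. Synharmony: for $\gamma,\beta\in W^{1/2,2}(\mathbb{S}^1,\mathcal{N})$, $d_{\mathrm{synh}}(\gamma,\beta)\in[0,+\infty]$ is the infimum of $\int_{\mathbb{S}^1\times[0,T]}\bigl(\frac{|Du|^2}{2}-\frac{\lambda(\gamma)^2}{8\pi^2}\bigr)$ over $T\in(0,+\infty)$ and $u\in W^{1,2}(\mathbb{S}^1\times[0,T],\mathcal{N})$ with traces $\gamma$ on $\mathbb{S}^1\times\{0\}$ and $\beta$ on $\mathbb{S}^1\times\{T\}$. Renormalisable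 maps: $u:\Omega\to\mathcal{N}$ is renormalisable ($u\in W^{1,2}_{\mathrm{ren}}(\Omega,\mathcal{N})$) if there is a finite set $\mathcal{S}\subset\Omega$ such that for $\rho>0$ small enough $u\in W^{1,2}(\Omega\setminus\bigcup_{a\in\mathcal{S}}\bar B_\rho(a),\mathcal{N})$ and $$\mathcal{E}^{\mathrm{ren}}(u)=\liminf_{\rho\to0}\Bigl(\int_{\Omega\setminus\bigcup_{a\in\mathcal{S}}\bar B_\rho(a)}\frac{|Du|^2}{2}-\sum_{a\in\mathcal{S}}\frac{\lambda(\operatorname{tr}_{\partial B_\rho(a)}u)^2}{4\pi}\log\frac1\rho\Bigr)<+\infty$$ (the value does not depend on the choice of $\mathcal{S}$). One writes $\operatorname{sing}(u)=\{(a_1,\gamma_1),\dots,(a_k,\gamma_k)\}$ (distinct $a_i\in\Omega$) whenever $u\in W^{1,2}_{\mathrm{loc}}(\bar\Omega\setminus\{a_1,\dots,a_k\},\mathcal{N})$ and, for each $i$, $\lim_{\rho\to0}d_{\mathrm{synh}}(\operatorname{tr}_{\mathbb{S}^1}u(a_i+\rho\,\cdot),\gamma_i)=0$ and $\gamma_i$ is not homotopic to a constant map; the charges $\gamma_i$ are defined only up to synharmony ($d_{\mathrm{synh}}=0$). Minimal: a map $u\in W^{1,2}_{\mathrm{ren}}(\Omega,\mathcal{N})$ with $\operatorname{sing}(u)=\{(a_1,\gamma_1),\dots,(a_k,\gamma_k)\}$ is a minimal renormalisable singular harmonic map if $\mathcal{E}^{\mathrm{ren}}(u)\le\mathcal{E}^{\mathrm{ren}}(v)$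 for every map $v\in W^{1,2}_{\mathrm{ren}}(\Omega,\mathcal{N})$ such that $\operatorname{sing}(v)=\{(b_1,\gamma_1),\dots,(b_k,\gamma_k)\}$ for some points $b_1,\dots,b_k$; that is, $u$ is minimal among all renormalisable maps with the same fixed synharmony classes of charges $\gamma_i$, the positions of the singularities being allowed to differ. Stationary: a map $u\in W^{1,2}_{\mathrm{ren}}(\Omega,\mathcal{N})$ is a stationary renormalisable singular harmonic map whenever for every $\psi\in\mathcal{C}^2_c(\Omega,\mathbb{R}^2)$ which is constant in a neighbourhood of $a$ for each $(a,\gamma)\in\operatorname{sing}(u)$, one has $\int_\Omega Du:(Du\,D\psi)=\frac12\int_\Omega|Du|^2\operatorname{div}\psi$. *)

theory Defs
  imports "HOL-Analysis.Analysis"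
begin

section \<open>Smooth maps and embedded submanifolds\<close>

text \<open>Meant for open \<open>S\<close>: all directional derivatives of order at most \<open>k\<close> exist and are continuous,
  and each derivative of order less than \<open>k\<close> is Frechet differentiable.\<close>

fun Ck_on :: "nat \<Rightarrow> ('a::euclidean_space \<Rightarrow> 'b::real_normed_vector) \<Rightarrow> 'a set \<Rightarrow> bool" where
  "Ck_on 0 f S = continuous_on S f"
| "Ck_on (Suc k) f S =
     ((\<forall>x\<in>S. f differentiable (at x)) \<and> (\<forall>v. Ck_on k (\<lambda>x. frechet_derivative f (at x) v) S))"

definition smooth_on :: "('a::euclidean_space \<Rightarrow> 'b::real_normed_vector) \<Rightarrow> 'a set \<Rightarrow> bool" where
  "smooth_on f S \<longleftrightarrow> (\<forall>k. Ck_on k f S)"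

definition Ck_compact_support ::
    "nat \<Rightarrow> 'a set \<Rightarrow> ('a::euclidean_space \<Rightarrow> 'b::real_normed_vector) \<Rightarrow> bool" where
  "Ck_compact_support k U f \<longleftrightarrow>
     Ck_on k f UNIV \<and> compact (closure {x. f x \<noteq> 0}) \<and> closure {x. f x \<noteq> 0} \<subseteq> U"

text \<open>A Riemannian manifold isometrically embedded in Euclidean space is an embedded submanifold
  carrying the induced metric; all lengths and energies below are Euclidean ones.\<close>

definition smooth_submanifold :: "'b::euclidean_space set \<Rightarrow> bool" where
  "smooth_submanifold N \<longleftrightarrow>
     (\<exists>d. \<forall>p\<in>N. \<exists>U V \<Phi> \<Psi> L. open U \<and> p \<in> U \<and> open V \<and> homeomorphism U V \<Phi> \<Psi> \<and>
        smooth_on \<Phi> U \<and> smooth_on \<Psi> V \<and>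
        subspace (L :: 'b set) \<and> dim L = d \<and> \<Phi> ` (U \<inter> N) = V \<inter> L)"

section \<open>Sobolev maps on planar open sets\<close>

definition frob :: "real^'m^'n \<Rightarrow> real^'m^'n \<Rightarrow> real" where
  "frob A B = trace (A ** transpose B)"

text \<open>\<open>Du x $ i $ j\<close> is the weak partial derivative of the \<open>i\<close>-th component in the \<open>j\<close>-th direction.\<close>

definition has_weak_grad ::
    "(real^2) set \<Rightarrow> (real^2 \<Rightarrow> real^'n) \<Rightarrow> (real^2 \<Rightarrow> real^2^'n) \<Rightarrow> bool" where
  "has_weak_grad U u Du \<longleftrightarrow>
     (\<forall>K. compact K \<and> K \<subseteq> U \<longrightarrow> set_integrable lebesgue K u \<and> set_integrable lebesgue K Du) \<and>
     (\<forall>\<phi> :: real^2 \<Rightarrow> real. Ck_compact_support 1 U \<phi> \<longrightarrow>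
        (\<forall>j. (LINT x:U|lebesgue. frechet_derivative \<phi> (at x) (axis j 1) *\<^sub>R u x) =
             - (LINT x:U|lebesgue. \<phi> x *\<^sub>R column j (Du x))))"

definition weak_grad :: "(real^2) set \<Rightarrow> (real^2 \<Rightarrow> real^'n) \<Rightarrow> real^2 \<Rightarrow> real^2^'n" where
  "weak_grad U u = (SOME Du. has_weak_grad U u Du)"

definition W12 :: "(real^2) set \<Rightarrow> (real^'n) set \<Rightarrow> (real^2 \<Rightarrow> real^'n) \<Rightarrow> bool" where
  "W12 U N u \<longleftrightarrow>
     set_integrable lebesgue U (\<lambda>x. (norm (u x))\<^sup>2) \<and>
     (\<exists>Du. has_weak_grad U u Du \<and> set_integrable lebesgue U (\<lambda>x. frob (Du x) (Du x))) \<and>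
     (AE x in lebesgue. x \<in> U \<longrightarrow> u x \<in> N)"

text \<open>\<open>W\<^sup>1\<^sup>,\<^sup>2\<close>-regularity up to the boundary of \<open>\<Omega>\<close> except at the points of \<open>A\<close>.\<close>

definition W12_loc_closure ::
    "(real^2) set \<Rightarrow> (real^2) set \<Rightarrow> (real^'n) set \<Rightarrow> (real^2 \<Rightarrow> real^'n) \<Rightarrow> bool" where
  "W12_loc_closure \<Omega> A N u \<longleftrightarrow> (\<forall>x \<in> closure \<Omega> - A. \<exists>r>0. W12 (\<Omega> \<inter> ball x r) N u)"

text \<open>Convergence in \<open>W\<^sup>1\<^sup>,\<^sup>2(U)\<close> of continuously differentiable maps \<open>w n\<close> to a map \<open>u\<close> with weak gradient \<open>Du\<close>.\<close>

definition W12_approx ::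
    "(real^2) set \<Rightarrow> (nat \<Rightarrow> real^2 \<Rightarrow> real^'n) \<Rightarrow> (real^2 \<Rightarrow> real^'n) \<Rightarrow> (real^2 \<Rightarrow> real^2^'n) \<Rightarrow> bool" where
  "W12_approx U w u Du \<longleftrightarrow>
     (\<lambda>n. \<integral>\<^sup>+x\<in>U. ennreal ((norm (w n x - u x))\<^sup>2 +
          frob (jacobian (w n) (at x) - Du x) (jacobian (w n) (at x) - Du x)) \<partial>lebesgue)
       \<longlonglongrightarrow> 0"

section \<open>Maps on the unit circle\<close>

text \<open>Maps on the unit circle are represented by maps \<open>g\<close> on the plane of which only the
  restriction to the unit circle matters; integration is with respect to arc length.\<close>

definition circ :: "real \<Rightarrow> real^2" where
  "circ \<theta> = vector [cos \<theta>, sin \<theta>]"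

definition W_half_2 :: "(real^'n) set \<Rightarrow> (real^2 \<Rightarrow> real^'n) \<Rightarrow> bool" where
  "W_half_2 N g \<longleftrightarrow>
     (\<lambda>\<theta>. g (circ \<theta>)) \<in> borel_measurable lebesgue \<and>
     (AE \<theta> in lebesgue. g (circ \<theta>) \<in> N) \<and>
     (\<integral>\<^sup>+\<theta>\<in>{0..2*pi}. ennreal ((norm (g (circ \<theta>)))\<^sup>2) \<partial>lebesgue) < \<infinity> \<and>
     (\<integral>\<^sup>+\<theta>\<in>{0..2*pi}. (\<integral>\<^sup>+\<eta>\<in>{0..2*pi}.
        ennreal ((norm (g (circ \<theta>) - g (circ \<eta>)))\<^sup>2 / (norm (circ \<theta> - circ \<eta>))\<^sup>2) \<partial>lebesgue)
        \<partial>lebesgue) < \<infinity>"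

definition arc_mean :: "(real^2 \<Rightarrow> real^'n) \<Rightarrow> real \<Rightarrow> real \<Rightarrow> real^'n" where
  "arc_mean g s r = (1 / (2*r)) *\<^sub>R (LINT \<theta>:{s-r..s+r}|lebesgue. g (circ \<theta>))"

definition mean_osc :: "(real^2 \<Rightarrow> real^'n) \<Rightarrow> real \<Rightarrow> real \<Rightarrow> real" where
  "mean_osc g s r =
     (1 / (2*r)) * (LINT \<theta>:{s-r..s+r}|lebesgue. norm (g (circ \<theta>) - arc_mean g s r))"

definition BMO_seminorm :: "(real^2 \<Rightarrow> real^'n) \<Rightarrow> ereal" where
  "BMO_seminorm g = (SUP r\<in>{0<..pi}. SUP s. ereal (mean_osc g s r))"

definition VMO :: "(real^'n) set \<Rightarrow> (real^2 \<Rightarrow> real^'n) \<Rightarrow> bool" where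
  "VMO N g \<longleftrightarrow>
     set_integrable lebesgue {0..2*pi} (\<lambda>\<theta>. g (circ \<theta>)) \<and>
     (AE \<theta> in lebesgue. g (circ \<theta>) \<in> N) \<and>
     ((\<lambda>r. SUP s. ereal (mean_osc g s r)) \<longlongrightarrow> 0) (at_right 0)"

definition VMO_dist :: "(real^2 \<Rightarrow> real^'n) \<Rightarrow> (real^2 \<Rightarrow> real^'n) \<Rightarrow> ereal" where
  "VMO_dist f g =
     ereal (LINT \<theta>:{0..2*pi}|lebesgue. norm (f (circ \<theta>) - g (circ \<theta>))) +
     BMO_seminorm (\<lambda>x. f x - g x)"

text \<open>Homotopy in VMO: the two maps are joined by a path that is continuous for the VMO norm.\<close>

definition VMO_homotopic ::
    "(real^'n) set \<Rightarrow> (real^2 \<Rightarrow> real^'n) \<Rightarrow> (real^2 \<Rightarrow> real^'n) \<Rightarrow> bool" where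
  "VMO_homotopic N f g \<longleftrightarrow>
     (\<exists>H :: real \<Rightarrow> real^2 \<Rightarrow> real^'n. H 0 = f \<and> H 1 = g \<and> (\<forall>t\<in>{0..1}. VMO N (H t)) \<and>
        (\<forall>t\<in>{0..1}. ((\<lambda>s. VMO_dist (H s) (H t)) \<longlongrightarrow> 0) (at t within {0..1})))"

definition C1_circle :: "(real^'n) set \<Rightarrow> (real^2 \<Rightarrow> real^'n) \<Rightarrow> bool" where
  "C1_circle N g \<longleftrightarrow> (\<lambda>\<theta>. g (circ \<theta>)) C1_differentiable_on UNIV \<and> g ` sphere 0 1 \<subseteq> N"

definition circle_length :: "(real^2 \<Rightarrow> real^'n) \<Rightarrow> real" where
  "circle_length g =
     (LINT \<theta>:{0..2*pi}|lebesgue. norm (vector_derivative (\<lambda>\<theta>. g (circ \<theta>)) (at \<theta>)))"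

text \<open>The quantity \<open>\<lambda>(\<gamma>)\<close>.\<close>

definition min_length :: "(real^'n) set \<Rightarrow> (real^2 \<Rightarrow> real^'n) \<Rightarrow> real" where
  "min_length N \<gamma> = Inf {circle_length g |g. C1_circle N g \<and> VMO_homotopic N g \<gamma>}"

section \<open>Synharmony\<close>

text \<open>Maps on the cylinder are pulled back to the strip by the locally isometric covering
  \<open>(\<theta>, t) \<mapsto> (circ \<theta>, t)\<close>; since weak derivatives are taken on the whole strip, the pulled back
  map is weakly differentiable across \<open>\<theta> = 0\<close>. Integrals run over one period.\<close>

definition cyl_lift :: "((real^2) \<times> real \<Rightarrow> 'b) \<Rightarrow> real^2 \<Rightarrow> 'b" where
  "cyl_lift u x = u (circ (x $ 1), x $ 2)"

definition strip :: "real \<Rightarrow> (real^2) set" where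
  "strip T = {x. 0 < x $ 2 \<and> x $ 2 < T}"

definition cyl_cell :: "real \<Rightarrow> (real^2) set" where
  "cyl_cell T = {x. 0 < x $ 1 \<and> x $ 1 < 2*pi \<and> 0 < x $ 2 \<and> x $ 2 < T}"

definition cyl_grad :: "real \<Rightarrow> ((real^2) \<times> real \<Rightarrow> real^'n) \<Rightarrow> real^2 \<Rightarrow> real^2^'n" where
  "cyl_grad T u = weak_grad (strip T) (cyl_lift u)"

definition W12_cyl :: "real \<Rightarrow> (real^'n) set \<Rightarrow> ((real^2) \<times> real \<Rightarrow> real^'n) \<Rightarrow> bool" where
  "W12_cyl T N u \<longleftrightarrow>
     set_integrable lebesgue (cyl_cell T) (\<lambda>x. (norm (cyl_lift u x))\<^sup>2) \<and>
     (\<exists>Du. has_weak_grad (strip T) (cyl_lift u) Du \<and>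
           set_integrable lebesgue (cyl_cell T) (\<lambda>x. frob (Du x) (Du x))) \<and>
     (AE x in lebesgue. x \<in> strip T \<longrightarrow> cyl_lift u x \<in> N)"

text \<open>Traces are given by the closure of the restriction operator on maps that are \<open>C\<^sup>1\<close> up to
  the boundary. Here \<open>g\<close> is the trace on the circle at height \<open>s\<close>, with \<open>s = 0\<close> or \<open>s = T\<close>.\<close>

definition has_cyl_trace ::
    "real \<Rightarrow> ((real^2) \<times> real \<Rightarrow> real^'n) \<Rightarrow> real \<Rightarrow> (real^2 \<Rightarrow> real^'n) \<Rightarrow> bool" where
  "has_cyl_trace T u s g \<longleftrightarrow>
     (\<lambda>\<theta>. g (circ \<theta>)) \<in> borel_measurable lebesgue \<and>
     (\<exists>w. (\<forall>n. Ck_on 1 (cyl_lift (w n)) UNIV) \<and>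
        W12_approx (cyl_cell T) (\<lambda>n. cyl_lift (w n)) (cyl_lift u) (cyl_grad T u) \<and>
        (\<lambda>n. \<integral>\<^sup>+\<theta>\<in>{0..2*pi}. ennreal ((norm (w n (circ \<theta>, s) - g (circ \<theta>)))\<^sup>2) \<partial>lebesgue)
          \<longlonglongrightarrow> 0)"

definition synh_dist ::
    "(real^'n) set \<Rightarrow> (real^2 \<Rightarrow> real^'n) \<Rightarrow> (real^2 \<Rightarrow> real^'n) \<Rightarrow> ereal" where
  "synh_dist N \<gamma> \<beta> =
     Inf {ereal (LINT x:cyl_cell T|lebesgue.
            frob (cyl_grad T u x) (cyl_grad T u x) / 2 - (min_length N \<gamma>)\<^sup>2 / (8 * pi\<^sup>2)) |T u.
          0 < T \<and> W12_cyl T N u \<and> has_cyl_trace T u 0 \<gamma> \<and> has_cyl_trace T u T \<beta>}"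

section \<open>Renormalisable maps\<close>

text \<open>\<open>g\<close> is the trace on the circle of centre \<open>a\<close> and radius \<open>\<rho>\<close>, taken from the outside and
  rescaled to the unit circle.\<close>

definition has_circle_trace ::
    "(real^2 \<Rightarrow> real^'n) \<Rightarrow> real^2 \<Rightarrow> real \<Rightarrow> (real^2 \<Rightarrow> real^'n) \<Rightarrow> bool" where
  "has_circle_trace u a \<rho> g \<longleftrightarrow>
     (\<lambda>\<theta>. g (circ \<theta>)) \<in> borel_measurable lebesgue \<and>
     (\<exists>\<delta>>0. let U = ball a (\<rho> + \<delta>) - cball a \<rho> in
        W12 U UNIV u \<and>
        (\<exists>w. (\<forall>n. Ck_on 1 (w n) UNIV) \<and> W12_approx U w u (weak_grad U u) \<and>
           (\<lambda>n. \<integral>\<^sup>+\<theta>\<in>{0..2*pi}.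
              ennreal ((norm (w n (a + \<rho> *\<^sub>R circ \<theta>) - g (circ \<theta>)))\<^sup>2) \<partial>lebesgue)
             \<longlonglongrightarrow> 0))"

definition circle_trace :: "(real^2 \<Rightarrow> real^'n) \<Rightarrow> real^2 \<Rightarrow> real \<Rightarrow> real^2 \<Rightarrow> real^'n" where
  "circle_trace u a \<rho> = (SOME g. has_circle_trace u a \<rho> g)"

definition perforated :: "(real^2) set \<Rightarrow> (real^2) set \<Rightarrow> real \<Rightarrow> (real^2) set" where
  "perforated \<Omega> S \<rho> = \<Omega> - (\<Union>a\<in>S. cball a \<rho>)"

definition ren_admissible ::
    "(real^2) set \<Rightarrow> (real^'n) set \<Rightarrow> (real^2 \<Rightarrow> real^'n) \<Rightarrow> (real^2) set \<Rightarrow> bool" where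
  "ren_admissible \<Omega> N u S \<longleftrightarrow>
     finite S \<and> S \<subseteq> \<Omega> \<and> (\<forall>\<^sub>F \<rho> in at_right 0. W12 (perforated \<Omega> S \<rho>) N u)"

definition ren_energy_wrt ::
    "(real^2) set \<Rightarrow> (real^'n) set \<Rightarrow> (real^2 \<Rightarrow> real^'n) \<Rightarrow> (real^2) set \<Rightarrow> ereal" where
  "ren_energy_wrt \<Omega> N u S =
     Liminf (at_right 0) (\<lambda>\<rho>. ereal (
       (LINT x:perforated \<Omega> S \<rho>|lebesgue.
          frob (weak_grad (perforated \<Omega> S \<rho>) u x) (weak_grad (perforated \<Omega> S \<rho>) u x) / 2)
       - (\<Sum>a\<in>S. (min_length N (circle_trace u a \<rho>))\<^sup>2 / (4 * pi) * ln (1 / \<rho>))))"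

text \<open>All admissible sets give the same energy, since near superfluous points the energy is
  integrable and the traces on small circles are homotopic to constants. Admissible sets are closed
  under intersection, and the energy is evaluated on the smallest one.\<close>

definition ren_energy ::
    "(real^2) set \<Rightarrow> (real^'n) set \<Rightarrow> (real^2 \<Rightarrow> real^'n) \<Rightarrow> ereal" where
  "ren_energy \<Omega> N u = ren_energy_wrt \<Omega> N u (\<Inter>{S. ren_admissible \<Omega> N u S})"

definition W12_ren ::
    "(real^2) set \<Rightarrow> (real^'n) set \<Rightarrow> (real^2 \<Rightarrow> real^'n) \<Rightarrow> bool" where
  "W12_ren \<Omega> N u \<longleftrightarrow> (\<exists>S. ren_admissible \<Omega> N u S) \<and> ren_energy \<Omega> N u < \<infinity>"

text \<open>\<open>has_sing \<Omega> N u k a \<gamma>\<close> stands for \<open>sing(u) = {(a 0, \<gamma> 0), \<dots>, (a (k-1), \<gamma> (k-1))}\<close>; it is a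
  relation because the charges are determined only up to synharmony.\<close>

definition has_sing ::
    "(real^2) set \<Rightarrow> (real^'n) set \<Rightarrow> (real^2 \<Rightarrow> real^'n) \<Rightarrow>
     nat \<Rightarrow> (nat \<Rightarrow> real^2) \<Rightarrow> (nat \<Rightarrow> real^2 \<Rightarrow> real^'n) \<Rightarrow> bool" where
  "has_sing \<Omega> N u k a \<gamma> \<longleftrightarrow>
     inj_on a {..<k} \<and> a ` {..<k} \<subseteq> \<Omega> \<and>
     W12_loc_closure \<Omega> (a ` {..<k}) N u \<and>
     (\<forall>i<k. W_half_2 N (\<gamma> i) \<and>
        ((\<lambda>\<rho>. synh_dist N (circle_trace u (a i) \<rho>) (\<gamma> i)) \<longlongrightarrow> 0) (at_right 0) \<and>
        \<not> (\<exists>p\<in>N. VMO_homotopic N (\<gamma> i) (\<lambda>_. p)))"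

definition minimal_ren_singular_harmonic ::
    "(real^2) set \<Rightarrow> (real^'n) set \<Rightarrow> (real^2 \<Rightarrow> real^'n) \<Rightarrow> bool" where
  "minimal_ren_singular_harmonic \<Omega> N u \<longleftrightarrow>
     W12_ren \<Omega> N u \<and>
     (\<exists>k a \<gamma>. has_sing \<Omega> N u k a \<gamma> \<and>
        (\<forall>v b. W12_ren \<Omega> N v \<and> has_sing \<Omega> N v k b \<gamma> \<longrightarrow>
           ren_energy \<Omega> N u \<le> ren_energy \<Omega> N v))"

text \<open>\<open>Du\<close> is the weak gradient away from the singularities, where \<open>D\<psi>\<close> vanishes.\<close>

definition stationary_ren_singular_harmonic ::
    "(real^2) set \<Rightarrow> (real^'n) set \<Rightarrow> (real^2 \<Rightarrow> real^'n) \<Rightarrow> bool" where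
  "stationary_ren_singular_harmonic \<Omega> N u \<longleftrightarrow>
     W12_ren \<Omega> N u \<and>
     (\<exists>k a \<gamma>. has_sing \<Omega> N u k a \<gamma> \<and>
        (\<forall>\<psi> :: real^2 \<Rightarrow> real^2.
           Ck_compact_support 2 \<Omega> \<psi> \<and> (\<forall>i<k. \<exists>r>0. \<forall>x\<in>ball (a i) r. \<psi> x = \<psi> (a i)) \<longrightarrow>
           (let Du = weak_grad (\<Omega> - a ` {..<k}) u; D\<psi> = (\<lambda>x. jacobian \<psi> (at x)) in
            (LINT x:\<Omega>|lebesgue. frob (Du x) (Du x ** D\<psi> x)) =
            1 / 2 * (LINT x:\<Omega>|lebesgue. frob (Du x) (Du x) * trace (D\<psi> x)))))"

end

(* Flowing a minimal map along an admissible vector field psi gives the competitors u o Psi_t, where Psi_t inverts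
   x |-> x + t psi(x). Near each singularity Psi_t is a translation, so the charges and the circle traces are unchanged,
   and the renormalised energy changes by t Q + O(t^2), where Q is the inner variation. Minimality forces Q = 0, provided
   the renormalised energy of u is not -infinity.

   That last point needs an argument. By the definition of sing(u), the trace of u on a fixed small circle is joined to its
   charge by a cylinder of finite energy. In logarithmic polar coordinates, which preserve the Dirichlet energy, u on an
   annulus of inner radius rho followed by a stretched copy of that cylinder competes in the synharmony distance between
   the trace on the circle of radius rho and the charge. This distance tends to 0, hence is > -1 for small rho, and this
   inequality bounds (lambda^2 / 4 pi) log(1/rho) by the energy of u on the annulus plus a constant. *)

theory Submission
  imports Defs "HOL-Real_Asymp.Real_Asymp"
begin

text \<open>Were the renormalised energy of u equal to -infinity, every comparison with a competitor
  would be trivial. Otherwise an upper bound for the competitor suffices: minimality gives 0 \<le> t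
  Q + K t^2 for small t of either sign. Weak gradients and circle traces are chosen by
  \<open>SOME\<close>. A gradient is fixed only almost everywhere, so uniqueness trades all choices
  for one gradient off the singularities. A trace is carried over as the very same function, because
  near a singularity the competitor is a translate of u and the trace predicates coincide. The
  cylinder is stretched because the annulus between radii rho and r0 has height log(r0/rho) only;
  the missing log(1/r0) has to come from the cylinder. Joining the pieces requires gluing W12 maps
  with equal traces. The glued map is reflected at its upper end, so that it is defined beyond both
  ends and mollification yields the approximations, smooth up to the boundary, in the definition of
  a trace. That a trace does not depend on the approximating sequence follows from an integral
  formula on a collar.\<close>

notation scaleR (infixr "*R" 75)

abbreviation C1_on :: "('a::euclidean_space => 'b::real_normed_vector) => 'a set => bool" where
  "C1_on \<equiv> Ck_on (Suc 0)"

abbreviation borel_lebesgue :: "('a::euclidean_space => 'b::topological_space) set" where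
  "borel_lebesgue \<equiv> borel_measurable lebesgue"

abbreviation lset_int :: "'a::euclidean_space set => ('a => 'b::{banach,second_countable_topology}) => bool" where
  "lset_int \<equiv> set_integrable lebesgue"

abbreviation W12_err :: "(real^2) set => (real^2 => real^'n) => (real^2 => real^'n) => (real^2 => real^2^'n) => ennreal" where
  "W12_err U w u Du \<equiv> \<integral>\<^sup>+x\<in>U. ennreal ((norm (w x - u x))^2 + (norm (jacobian w (at x) - Du x))^2) \<partial>lebesgue"

abbreviation trace_cost :: "(real^'n) set => (real^2 => real^'n) => real^2 => real => real" where
  "trace_cost N u s \<rho> \<equiv> (min_length N (circle_trace u s \<rho>))^2 / (4 * pi) * ln (1 / \<rho>)"

section \<open>Calculus of continuously differentiable maps\<close>

lemma frob_inner: "frob A B = A \<bullet> B" by (simp add: frob_def trace_def matrix_matrix_mult_def transpose_def inner_vec_def)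

lemma frob_norm: "frob A A = (norm A)^2" by (simp add: frob_inner power2_norm_eq_inner)

lemma Ck1_iff:
  "C1_on f S \<longleftrightarrow> (\<forall>x\<in>S. f differentiable (at x)) \<and>
     (\<forall>v. continuous_on S (\<lambda>x. frechet_derivative f (at x) v))" by auto

declare Ck_on.simps [simp del]

lemma Ck1I:
  assumes "open S" "\<And>x. x \<in> S ==> (f has_derivative f' x) (at x)"
    "\<And>v. continuous_on S (\<lambda>x. f' x v)"
  shows "C1_on f S"
proof -
  have *: "frechet_derivative f (at x) = f' x" if "x \<in> S" for x using assms(2)[OF that] by (metis frechet_derivative_at)
  have "continuous_on S (\<lambda>x. frechet_derivative f (at x) v)" for v using assms(3)[of v] by (rule continuous_on_eq) (simp add: *)
  then show ?thesis unfolding Ck1_iff using assms(2) by (auto simp: differentiable_def)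
qed

lemma Ck1_has_derivative:
  assumes "C1_on f S" "x \<in> S"
  shows "(f has_derivative frechet_derivative f (at x)) (at x)" using assms by (simp add: Ck1_iff frechet_derivative_works)

lemma Ck1_continuous:
  assumes "C1_on f S"
  shows "continuous_on S f" using assms Ck1_has_derivative has_derivative_continuous by (metis continuous_at_imp_continuous_on)

lemma Ck1_deriv_continuous:
  assumes "C1_on f S"
  shows "continuous_on S (\<lambda>x. frechet_derivative f (at x) v)" using assms unfolding Ck1_iff by auto

lemma Ck1_subset: "C1_on f S ==> T \<subseteq> S ==> C1_on f T" unfolding Ck1_iff by (meson continuous_on_subset subset_iff)

lemma linear_expand:
  fixes L :: "'a::euclidean_space => 'b::real_normed_vector"
  assumes "linear L"
  shows "L w = (\<Sum>b\<in>Basis. (w \<bullet> b) *R L b)" by (metis (no_types, lifting) assms euclidean_representation linear_cmul linear_sum sum.cong)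

text \<open>\<open>Ck_on\<close> controls each fixed direction separately. Expanding the direction
  over the basis reduces a moving direction \<open>h x\<close> at a moving base point
  \<open>g x\<close> to finitely many fixed ones, which is what the chain rule asks for.\<close>

lemma Ck1_deriv_continuous2:
  fixes f :: "'a::euclidean_space => 'b::real_normed_vector"
  assumes "C1_on f S" "continuous_on T g" "g ` T \<subseteq> S" "continuous_on T h"
  shows "continuous_on T (\<lambda>x. frechet_derivative f (at (g x)) (h x))"
proof -
  have "continuous_on T (\<lambda>x. \<Sum>b\<in>Basis. (h x \<bullet> b) *R frechet_derivative f (at (g x)) b)"
    by (intro continuous_intros assms continuous_on_compose2[OF Ck1_deriv_continuous[OF assms(1)]])
  then show ?thesis
  proof (rule continuous_on_eq)
    fix x assume "x \<in> T"
    then have "linear (frechet_derivative f (at (g x)))" using assms by (metis Ck1_has_derivative has_derivative_linear image_subset_iff)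
    then show "(\<Sum>b\<in>Basis. (h x \<bullet> b) *R frechet_derivative f (at (g x)) b)
       = frechet_derivative f (at (g x)) (h x)" using linear_expand by metis
  qed
qed

lemma Ck1_const: "open S ==> C1_on (\<lambda>x. c) S" by (rule Ck1I[where f'="\<lambda>x v. 0"]) auto

lemma Ck1_bounded_linear: "open S ==> bounded_linear L ==> C1_on L S"
  by (rule Ck1I[where f'="\<lambda>x. L"]) (auto simp: bounded_linear_imp_has_derivative)

lemma Ck1_add:
  assumes "open S" "C1_on f S" "C1_on g S"
  shows "C1_on (\<lambda>x. f x + g x) S"
  by (rule Ck1I[OF assms(1) has_derivative_add[OF Ck1_has_derivative[OF assms(2)] Ck1_has_derivative[OF assms(3)]]])
     (auto intro!: continuous_intros Ck1_deriv_continuous assms)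

lemma Ck1_diff:
  assumes "open S" "C1_on f S" "C1_on g S"
  shows "C1_on (\<lambda>x. f x - g x) S"
  by (rule Ck1I[OF assms(1) has_derivative_diff[OF Ck1_has_derivative[OF assms(2)] Ck1_has_derivative[OF assms(3)]]])
     (auto intro!: continuous_intros Ck1_deriv_continuous assms)

lemma Ck1_scaleR:
  assumes "open S" "C1_on f S" "C1_on g S"
  shows "C1_on (\<lambda>x. f x *R g x) S"
  by (rule Ck1I[OF assms(1) has_derivative_scaleR[OF Ck1_has_derivative[OF assms(2)] Ck1_has_derivative[OF assms(3)]]])
     (auto intro!: continuous_intros Ck1_deriv_continuous[OF assms(2)] Ck1_deriv_continuous[OF assms(3)]
       Ck1_continuous[OF assms(2)] Ck1_continuous[OF assms(3)])

lemma Ck1_mult: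
  fixes f g :: "'a::euclidean_space => real"
  assumes "open S" "C1_on f S" "C1_on g S"
  shows "C1_on (\<lambda>x. f x * g x) S" using Ck1_scaleR[OF assms] by simp

lemma Ck1_sum:
  assumes "open S" "\<And>i. i \<in> I ==> C1_on (f i) S"
  shows "C1_on (\<lambda>x. \<Sum>i\<in>I. f i x) S" using assms(2)
  by (induction I rule: infinite_finite_induct) (use assms(1) in \<open>auto intro!: Ck1_add Ck1_const\<close>)

lemma Ck1_compose:
  fixes f :: "'a::euclidean_space => 'b::real_normed_vector"
  assumes "open S" "open T" "C1_on f T" "C1_on g S" "g ` S \<subseteq> T"
  shows "C1_on (\<lambda>x. f (g x)) S"
proof (rule Ck1I[OF assms(1)])
  show "((\<lambda>x. f (g x)) has_derivative (\<lambda>v. frechet_derivative f (at (g x)) (frechet_derivative g (at x) v))) (at x)"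
    if "x \<in> S" for x using has_derivative_compose[OF Ck1_has_derivative[OF assms(4) that]
      Ck1_has_derivative[OF assms(3), of "g x"]] assms(5) that by auto
  show "continuous_on S (\<lambda>x. frechet_derivative f (at (g x)) (frechet_derivative g (at x) v))" for v
    by (intro Ck1_deriv_continuous2[OF assms(3)] Ck1_continuous[OF assms(4)]
      Ck1_deriv_continuous[OF assms(4)] assms)
qed

lemma Ck1_compose_real:
  fixes h :: "real => real"
  assumes "open S" "C1_on g S" "\<And>x. x \<in> S ==> (h has_field_derivative h' (g x)) (at (g x))"
    "continuous_on (g ` S) h'"
  shows "C1_on (\<lambda>x. h (g x)) S"
proof (rule Ck1I[OF assms(1)])
  show "((\<lambda>x. h (g x)) has_derivative (\<lambda>v. h' (g x) * frechet_derivative g (at x) v)) (at x)"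
    if "x \<in> S" for x using has_derivative_compose[OF Ck1_has_derivative[OF assms(2) that]
       assms(3)[OF that, unfolded has_field_derivative_def]] by simp
  show "continuous_on S (\<lambda>x. h' (g x) * frechet_derivative g (at x) v)" for v
    by (intro continuous_intros continuous_on_compose2[OF assms(4)]
      Ck1_continuous[OF assms(2)] Ck1_deriv_continuous[OF assms(2)] assms) auto
qed

lemma Ck1_inverse:
  fixes g :: "'a::euclidean_space => real"
  assumes "open S" "C1_on g S" "\<And>x. x \<in> S ==> g x \<noteq> 0"
  shows "C1_on (\<lambda>x. inverse (g x)) S" by (rule Ck1_compose_real[OF assms(1,2), where h'="\<lambda>y. - (inverse y * inverse y)"])
     (use assms(3) in \<open>auto intro!: derivative_eq_intros continuous_intros simp: power2_eq_square\<close>)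

lemma Ck1_transform:
  assumes "open S" "C1_on f S" "\<And>x. x \<in> S ==> g x = f x"
  shows "C1_on g S" by (rule Ck1I[OF assms(1) has_derivative_transform_within_open[OF Ck1_has_derivative[OF assms(2)] assms(1)]])
     (use assms in \<open>auto intro!: Ck1_deriv_continuous\<close>)

lemma Ck1_Un:
  assumes "open S" "open T" "C1_on f S" "C1_on f T"
  shows "C1_on f (S \<union> T)" using assms unfolding Ck1_iff by (auto intro!: continuous_on_open_Un)

text \<open>Made for products with cutoffs: \<open>S\<close> and the complement of \<open>K\<close>
  form an open cover of the space, and f is C1 on each, being zero on the second.\<close>

lemma Ck1_zero_ext:
  assumes "open S" "closed K" "K \<subseteq> S" "C1_on f S" "\<And>x. x \<notin> K ==> f x = 0"
  shows "C1_on f UNIV"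
proof -
  have "C1_on f (-K)" by (rule Ck1_transform[OF _ Ck1_const[of "-K" 0]]) (use assms in auto)
  then have "C1_on f (S \<union> -K)" using assms by (intro Ck1_Un) auto
  moreover have "S \<union> -K = UNIV" using assms by auto
  ultimately show ?thesis by simp
qed

lemma frechet_zero_outside:
  assumes "closed K" "\<And>x. x \<notin> K ==> f x = 0" "x \<notin> K"
  shows "frechet_derivative f (at x) = (\<lambda>v. 0)"
proof -
  have "(f has_derivative (\<lambda>v. 0)) (at x)" by (rule has_derivative_transform_within_open[of "\<lambda>x. 0" _ _ _ "-K"]) (use assms in auto)
  then show ?thesis using frechet_derivative_at by metis
qed

subsection \<open>Test functions\<close>

text \<open>Building block of all cutoffs and kernels. Test functions need one continuous derivative
  only, so the square of the positive part does the work of the usual smooth bump.\<close>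

definition possq :: "real => real" where
  "possq x = (max 0 x)^2"

text \<open>Differentiability with a quadratic error that is uniform in x. The uniformity is what
  later permits differentiation under the integral of a mollification.\<close>

lemma possq_quad: "\<bar>(possq (x+h) - possq x) - 2 * max 0 x * h\<bar> \<le> h^2"
proof -
    consider "x \<ge> 0" "x + h \<ge> 0" | "x \<ge> 0" "x + h < 0" | "x < 0" "x+h \<ge> 0" | "x < 0" "x+h < 0" by linarith
    then show ?thesis
    proof cases
      case 1 then show ?thesis by (simp add: possq_def max_def power2_eq_square algebra_simps)
    next
      case 2
      then have "x\<^sup>2 + 2 * x * h \<le> 0" "possq (x+h) = 0" "possq x = x^2" "max 0 x = x" using mult_nonneg_nonpos[of x "x+2*h"]
        by (auto simp: power2_eq_square algebra_simps possq_def max_def)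
      moreover have "h\<^sup>2 + (x^2 + 2 * x * h) = (x + h)^2" by (simp add: power2_sum)
      moreover have "\<bar>0 - x^2 - 2 * x * h\<bar> = - (x^2 + 2 * x * h)" using \<open>x\<^sup>2 + 2 * x * h \<le> 0\<close> by linarith
      ultimately show ?thesis using zero_le_power2[of "x + h"] by linarith
    next
      case 3
      then have "(x+h)^2 \<le> h^2" by (intro power_mono) auto
      with 3 show ?thesis by (simp add: possq_def max_def)
    next
      case 4 then show ?thesis by (simp add: possq_def)
    qed
qed

lemma possq_deriv: "(possq has_field_derivative 2 * max 0 x) (at x)" unfolding has_field_derivative_def
proof (rule has_derivativeI_sandwich[of 1 _ _ _ _ "\<lambda>y. \<bar>y - x\<bar>"])
    show "((\<lambda>y. \<bar>y - x\<bar>) \<longlongrightarrow> 0) (at x)" by (rule tendsto_eq_intros refl)+ simp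
    fix y assume "y \<noteq> x"
    then show "norm (possq y - possq x - 2 * max 0 x * (y - x)) / norm (y - x) \<le> \<bar>y - x\<bar>"
      using possq_quad[of x "y - x"] by (simp add: divide_le_eq power2_eq_square)
qed (auto intro!: bounded_linear_intros)

lemma Ck1_possq:
  assumes "open S" "C1_on g S"
  shows "C1_on (\<lambda>x. possq (g x)) S" by (rule Ck1_compose_real[OF assms possq_deriv]) (intro continuous_intros)

lemma possq_pos: "possq x > 0 \<longleftrightarrow> x > 0" and possq_ge: "possq x \<ge> 0" and possq_0: "x \<le> 0 ==> possq x = 0"
  by (auto simp: possq_def max_def zero_less_power2)

lemma Ck1_sqdist: "C1_on (\<lambda>x::'a::euclidean_space. (norm (x - c))^2) UNIV" by (rule Ck1I[where f'="\<lambda>x v. 2 * ((x - c) \<bullet> v)"])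
     (auto simp: power2_norm_eq_inner inner_commute intro!: derivative_eq_intros continuous_intros)

text \<open>For r < R the two squares never vanish together, so the quotient is as regular as
  \<open>possq\<close>; it falls from 1 at r to 0 at R.\<close>

definition ramp :: "real => real => real => real" where
  "ramp r R y = possq (R - y) * inverse (possq (R - y) + possq (y - r))"

lemma ramp_denom: "r < R ==> possq (R - y) + possq (y - r) > 0"
  using possq_pos[of "R-y"] possq_pos[of "y-r"] possq_ge[of "R-y"] possq_ge[of "y-r"] by linarith

lemma ramp_simps: "r < R ==> y \<le> r ==> ramp r R y = 1" "R \<le> y ==> ramp r R y = 0"
  using ramp_denom[of r R y] by (auto simp: ramp_def possq_0)

lemma ramp_range: "r < R ==> 0 \<le> ramp r R y" "r < R ==> ramp r R y \<le> 1" using ramp_denom[of r R y] possq_ge[of "R-y"] possq_ge[of "y-r"]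
  by (auto simp: ramp_def divide_inverse[symmetric])

lemma Ck1_ramp:
  assumes "r < R" "open S" "C1_on g S"
  shows "C1_on (\<lambda>x. ramp r R (g x)) S" unfolding ramp_def using ramp_denom[OF assms(1)]
  by (intro Ck1_mult Ck1_inverse Ck1_add Ck1_possq Ck1_diff Ck1_const assms) (metis less_irrefl)

text \<open>Uses squared distances and squared radii because the norm itself is not differentiable
  at the centre.\<close>

definition ball_cutoff :: "'a::euclidean_space => real => real => 'a => real" where
  "ball_cutoff c r R x = ramp (r^2) (R^2) ((norm (x - c))^2)"

lemma ball_cutoff:
  assumes "0 \<le> r" "r < R"
  shows "C1_on (ball_cutoff c r R) UNIV"
    "x \<in> cball c r ==> ball_cutoff c r R x = 1"
    "x \<notin> ball c R ==> ball_cutoff c r R x = 0"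
    "0 \<le> ball_cutoff c r R x" "ball_cutoff c r R x \<le> 1"
proof -
  have *: "r\<^sup>2 < R^2" using assms by (simp add: power_strict_mono)
  show "C1_on (ball_cutoff c r R) UNIV" unfolding ball_cutoff_def[abs_def] by (intro Ck1_ramp[OF *] Ck1_sqdist) simp
  show "0 \<le> ball_cutoff c r R x" "ball_cutoff c r R x \<le> 1" unfolding ball_cutoff_def by (intro ramp_range *)+
  show "x \<in> cball c r ==> ball_cutoff c r R x = 1"
    unfolding ball_cutoff_def by (intro ramp_simps *) (auto simp: dist_norm norm_minus_commute intro!: power_mono)
  show "x \<notin> ball c R ==> ball_cutoff c r R x = 0"
    unfolding ball_cutoff_def using assms by (intro ramp_simps) (auto simp: dist_norm norm_minus_commute intro!: power_mono)
qed

text \<open>Any compact set outside of which the function vanishes replaces the closure of its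
  support; this makes products, sums and restrictions of test functions immediate.\<close>

definition tst :: "'a::euclidean_space set => ('a => real) => bool" where
  "tst U \<phi> \<longleftrightarrow> C1_on \<phi> UNIV \<and> (\<exists>K. compact K \<and> K \<subseteq> U \<and> (\<forall>x. x \<notin> K --> \<phi> x = 0))"

lemma tst_iff: "Ck_compact_support 1 U \<phi> \<longleftrightarrow> tst U \<phi>"
proof
  assume "Ck_compact_support 1 U \<phi>"
  moreover have "\<phi> x = 0" if "x \<notin> closure {x. \<phi> x \<noteq> 0}" for x using that closure_subset[of "{x. \<phi> x \<noteq> 0}"] by auto
  ultimately show "tst U \<phi>" unfolding Ck_compact_support_def tst_def One_nat_def by blast
next
  assume "tst U \<phi>"
  then obtain K where "compact K" "K \<subseteq> U" "\<forall>x. x \<notin> K --> \<phi> x = 0" "C1_on \<phi> UNIV" unfolding tst_def by blast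
  moreover from this have "closure {x. \<phi> x \<noteq> 0} \<subseteq> K" by (intro closure_minimal) (auto simp: compact_imp_closed)
  moreover from \<open>compact K\<close> this have "compact (closure {x. \<phi> x \<noteq> 0})" by (metis closed_closure compact_Int_closed inf.absorb_iff2)
  ultimately show "Ck_compact_support 1 U \<phi>" unfolding Ck_compact_support_def One_nat_def by auto
qed

lemma tst_subset: "tst V \<phi> ==> V \<subseteq> U ==> tst U \<phi>" unfolding tst_def by blast

lemma tst_mult:
  assumes "tst U \<phi>" "C1_on \<eta> UNIV" "closed C" "C \<inter> U \<subseteq> V" "\<And>x. x \<notin> C ==> \<eta> x = 0"
  shows "tst V (\<lambda>x. \<eta> x * \<phi> x)"
proof -
  obtain K where K: "compact K" "K \<subseteq> U" "\<forall>x. x \<notin> K --> \<phi> x = 0" "C1_on \<phi> UNIV" using assms(1) unfolding tst_def by blast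
  then show ?thesis unfolding tst_def using assms by (intro conjI Ck1_mult exI[of _ "K \<inter> C"]) (auto simp: compact_Int_closed)
qed

abbreviation pd :: "((real^2) => 'b::real_normed_vector) => 2 => real^2 => 'b" where
  "pd f j x \<equiv> frechet_derivative f (at x) (axis j 1)"

section \<open>Local integrability and weak gradients\<close>

lemma continuous_lebesgue_measurable:
  fixes c :: "'a::euclidean_space => 'b::metric_space"
  assumes "continuous_on UNIV c"
  shows "c \<in> borel_lebesgue" by (rule measurable_completion) (simp add: borel_measurable_continuous_onI[OF assms])

lemma continuous_supp_integrable:
  fixes f :: "'a::euclidean_space => 'b::euclidean_space"
  assumes f: "lset_int K f" and K: "compact K"
    and c: "continuous_on UNIV c" "\<And>x. x \<notin> K ==> c x = 0"
  shows "integrable lebesgue (\<lambda>x. c x *R f x)"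
proof -
  have "bounded (c ` K)" using K c(1) by (meson compact_continuous_image compact_imp_bounded continuous_on_subset top_greatest)
  then obtain B where B: "\<And>x. x \<in> K ==> norm (c x) \<le> B" by (auto simp: bounded_iff)
  have eq: "c x *R f x = c x *R (indicator K x *R f x)" for x using c(2) by (auto simp: indicator_def)
  show ?thesis unfolding eq
  proof (rule Bochner_Integration.integrable_bound[of _ "\<lambda>x. B *R (indicator K x *R f x)"])
    show "integrable lebesgue (\<lambda>x. B *R (indicator K x *R f x))" using f unfolding set_integrable_def by (rule integrable_scaleR_right)
    show "(\<lambda>x. c x *R (indicator K x *R f x)) \<in> borel_lebesgue" by (rule borel_measurable_scaleR[OF continuous_lebesgue_measurable[OF c(1)]
        borel_measurable_integrable[OF f[unfolded set_integrable_def]]])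
    show "AE x in lebesgue. norm (c x *R (indicator K x *R f x)) \<le> norm (B *R (indicator K x *R f x))"
    proof (rule AE_I2)
      fix x
      show "norm (c x *R (indicator K x *R f x)) \<le> norm (B *R (indicator K x *R f x))"
        using B[of x] by (cases "x \<in> K") (auto intro!: mult_right_mono)
    qed
  qed
qed

lemma tst_supp:
  assumes "tst U \<phi>"
  obtains K where "compact K" "K \<subseteq> U" "\<And>x. x \<notin> K ==> \<phi> x = 0"
    "\<And>x. x \<notin> K ==> frechet_derivative \<phi> (at x) = (\<lambda>v. 0)"
  using assms frechet_zero_outside[of _ \<phi>] unfolding tst_def by (metis compact_imp_closed)

lemma tst_C1: "tst U \<phi> ==> C1_on \<phi> UNIV" by (simp add: tst_def)

definition loc_int :: "(real^2) set => (real^2 => 'b::euclidean_space) => bool" where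
  "loc_int U f \<longleftrightarrow> (\<forall>K. compact K --> K \<subseteq> U --> lset_int K f)"

lemma tst_integrable:
  fixes f :: "real^2 => 'b::euclidean_space"
  assumes "tst U \<phi>" "loc_int U f"
  shows "integrable lebesgue (\<lambda>x. \<phi> x *R f x)"
    "integrable lebesgue (\<lambda>x. frechet_derivative \<phi> (at x) v *R f x)"
proof -
  obtain K where K: "compact K" "K \<subseteq> U" "\<And>x. x \<notin> K ==> \<phi> x = 0"
    "\<And>x. x \<notin> K ==> frechet_derivative \<phi> (at x) = (\<lambda>v. 0)" using tst_supp[OF assms(1)] by blast
  have f: "lset_int K f" using assms(2) K unfolding loc_int_def by simp
  show "integrable lebesgue (\<lambda>x. \<phi> x *R f x)" by (rule continuous_supp_integrable[OF f K(1) Ck1_continuous[OF tst_C1[OF assms(1)]] K(3)])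
  show "integrable lebesgue (\<lambda>x. frechet_derivative \<phi> (at x) v *R f x)"
    by (rule continuous_supp_integrable[OF f K(1) Ck1_deriv_continuous[OF tst_C1[OF assms(1)]]])
       (simp add: K(4))
qed

lemma column_blinear: "bounded_linear (column j :: real^'m^'n => real^'n)"
  by (rule linear_conv_bounded_linear[THEN iffD1], rule linearI) (auto simp: column_def vec_eq_iff)

lemma loc_int_bounded_linear:
  assumes "bounded_linear L" "loc_int U f"
  shows "loc_int U (\<lambda>x. L (f x))" unfolding loc_int_def set_integrable_def
proof (intro allI impI)
  fix K assume K: "compact K" "K \<subseteq> U"
  then have "integrable lebesgue (\<lambda>x. L (indicator K x *R f x))"
    using assms(2) unfolding loc_int_def set_integrable_def by (intro integrable_bounded_linear[OF assms(1)]) blast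
  then show "integrable lebesgue (\<lambda>x. indicator K x *R L (f x))" by (simp add: linear_cmul[OF bounded_linear.linear[OF assms(1)]])
qed

lemmas loc_int_column = loc_int_bounded_linear[OF column_blinear]

text \<open>A test function and its derivative vanish off a compact subset of U, so the integrals
  over U become integrals over the whole plane and the indicator of U disappears from all later
  computations.\<close>

lemma has_weak_grad_iff:
  "has_weak_grad U u Du \<longleftrightarrow> loc_int U u \<and> loc_int U Du \<and>
     (\<forall>\<phi>. tst U \<phi> --> (\<forall>j. (LINT x|lebesgue. pd \<phi> j x *R u x) = - (LINT x|lebesgue. \<phi> x *R column j (Du x))))"
proof -
  have e: "(LINT x:U|lebesgue. pd \<phi> j x *R u x) = (LINT x|lebesgue. pd \<phi> j x *R u x)"
    "(LINT x:U|lebesgue. \<phi> x *R column j (Du x)) = (LINT x|lebesgue. \<phi> x *R column j (Du x))"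
    if \<phi>: "tst U \<phi>" for \<phi> j
  proof -
    obtain K where K: "compact K" "K \<subseteq> U" "\<And>x. x \<notin> K ==> \<phi> x = 0"
      "\<And>x. x \<notin> K ==> frechet_derivative \<phi> (at x) = (\<lambda>v. 0)" using tst_supp[OF \<phi>] by blast
    have *: "x \<in> U \<or> \<phi> x = 0 \<and> pd \<phi> j x = 0" for x using K(2) K(3)[of x] K(4)[of x] by (cases "x \<in> K") auto
    show "(LINT x:U|lebesgue. pd \<phi> j x *R u x) = (LINT x|lebesgue. pd \<phi> j x *R u x)"
      "(LINT x:U|lebesgue. \<phi> x *R column j (Du x)) = (LINT x|lebesgue. \<phi> x *R column j (Du x))" unfolding set_lebesgue_integral_def
      by (intro Bochner_Integration.integral_cong refl; use * in \<open>force simp: indicator_def\<close>)+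
  qed
  have "(\<forall>\<phi>. tst U \<phi> --> (\<forall>j. (LINT x:U|lebesgue. pd \<phi> j x *R u x) = - (LINT x:U|lebesgue. \<phi> x *R column j (Du x))))
    = (\<forall>\<phi>. tst U \<phi> --> (\<forall>j. (LINT x|lebesgue. pd \<phi> j x *R u x) = - (LINT x|lebesgue. \<phi> x *R column j (Du x))))"
    by (intro all_cong1 imp_cong refl) (simp add: e)
  moreover have "(\<forall>K. compact K \<and> K \<subseteq> U --> lset_int K u \<and> lset_int K Du)
    \<longleftrightarrow> loc_int U u \<and> loc_int U Du" unfolding loc_int_def by auto
  ultimately show ?thesis unfolding has_weak_grad_def tst_iff by simp
qed

lemma has_weak_gradI:
  assumes "loc_int U u" "loc_int U Du"
    "\<And>\<phi> j. tst U \<phi> ==> (LINT x|lebesgue. pd \<phi> j x *R u x) = - (LINT x|lebesgue. \<phi> x *R column j (Du x))"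
  shows "has_weak_grad U u Du" unfolding has_weak_grad_iff using assms by simp

lemma has_weak_gradD:
  assumes "has_weak_grad U u Du"
  shows "loc_int U u" "loc_int U Du"
    "tst U \<phi> ==> (LINT x|lebesgue. pd \<phi> j x *R u x) = - (LINT x|lebesgue. \<phi> x *R column j (Du x))"
  using assms unfolding has_weak_grad_iff by simp_all

lemma loc_int_subset: "loc_int U f ==> V \<subseteq> U ==> loc_int V f" unfolding loc_int_def by (meson order_trans)

lemma has_weak_grad_subset:
  assumes "has_weak_grad U u Du" "V \<subseteq> U"
  shows "has_weak_grad V u Du" using has_weak_gradD[OF assms(1)] assms(2)
  by (intro has_weak_gradI) (auto intro: loc_int_subset dest: tst_subset)

text \<open>By the Lindelof property countably many of the neighbourhoods already cover U, so the
  exceptional null sets add up to a null set.\<close>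

lemma AE_locally:
  assumes "\<And>x. x \<in> U ==> \<exists>V. open V \<and> x \<in> V \<and> (AE y in M. y \<in> V --> P y)"
  shows "AE y in M. y \<in> U --> P (y::'a::second_countable_topology)"
proof -
  define F where "F = {V. open V \<and> (AE y in M. y \<in> V --> P y)}"
  obtain F' where F': "F' \<subseteq> F" "countable F'" "\<Union>F' = \<Union>F" using Lindelof[of F] unfolding F_def by blast
  have U: "U \<subseteq> \<Union>F'" unfolding F' using assms by (auto simp: F_def)
  have "AE y in M. \<forall>V\<in>F'. y \<in> V --> P y" using F' by (subst AE_ball_countable) (auto simp: F_def)
  then show ?thesis by (rule eventually_mono) (use U in blast)
qed

text \<open>Nothing is known about f off U, hence the indicator. The restrictions to a compact
  exhaustion of U are measurable and converge pointwise.\<close>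

lemma loc_int_measurable:
  assumes "open U" "loc_int U f"
  shows "(\<lambda>x. indicator U x *R f x) \<in> borel_lebesgue"
proof -
  obtain C where C: "\<And>n. compact (C n)" "\<And>n. C n \<subseteq> U" "\<And>n. C n \<subseteq> interior(C(Suc n))"
     "\<Union>(range C) = U" "\<And>K. compact K ==> K \<subseteq> U ==> \<exists>N. \<forall>n\<ge>N. K \<subseteq> C n" using open_Union_compact_subsets[OF assms(1)] by metis
  show ?thesis
  proof (rule borel_measurable_LIMSEQ_metric)
    show "(\<lambda>x. indicator (C n) x *R f x) \<in> borel_lebesgue" for n using assms(2)[unfolded loc_int_def, rule_format, OF C(1,2)]
      unfolding set_integrable_def by (rule borel_measurable_integrable)
    show "(\<lambda>n. indicator (C n) x *R f x) \<longlonglongrightarrow> indicator U x *R f x" for x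
    proof (cases "x \<in> U")
      case True
      then obtain N where "\<forall>n\<ge>N. {x} \<subseteq> C n" using C(5)[of "{x}"] by auto
      then show ?thesis using True by (intro tendsto_eventually eventually_sequentiallyI[of N]) auto
    next
      case False
      then have "x \<notin> C n" for n using C(2) by blast
      then show ?thesis using False by simp
    qed
  qed
qed

section \<open>Uniqueness of weak gradients\<close>

lemma Ck1_prod:
  fixes f :: "'i => 'a::euclidean_space => real"
  assumes "open S" "\<And>i. i \<in> I ==> C1_on (f i) S"
  shows "C1_on (\<lambda>x. \<Prod>i\<in>I. f i x) S" using assms(2)
  by (induction I rule: infinite_finite_induct) (use assms(1) in \<open>auto intro!: Ck1_mult Ck1_const\<close>)

lemma Ck1_inner: "C1_on (\<lambda>x. x \<bullet> i) UNIV" by (rule Ck1_bounded_linear) (auto intro: bounded_linear_inner_left)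

lemma box_bump:
  fixes a b :: "'a::euclidean_space"
  obtains \<beta> where "C1_on \<beta> UNIV" "\<And>x. \<beta> x \<ge> (0::real)" "\<And>x. \<beta> x > 0 \<longleftrightarrow> x \<in> box a b"
proof
  define \<beta> where "\<beta> x = (\<Prod>i\<in>Basis. possq (x \<bullet> i - a \<bullet> i) * possq (b \<bullet> i - x \<bullet> i))" for x
  show "C1_on \<beta> UNIV" unfolding \<beta>_def by (intro Ck1_prod Ck1_mult Ck1_possq Ck1_diff Ck1_const Ck1_inner) auto
  show ge: "\<beta> x \<ge> 0" for x unfolding \<beta>_def by (intro prod_nonneg mult_nonneg_nonneg possq_ge ballI)
  show "\<beta> x > 0 \<longleftrightarrow> x \<in> box a b" for x
  proof -
    have "\<beta> x > 0 \<longleftrightarrow> \<beta> x \<noteq> 0" using ge[of x] by linarith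
    also have "\<dots> \<longleftrightarrow> (\<forall>i\<in>Basis. possq (x \<bullet> i - a \<bullet> i) * possq (b \<bullet> i - x \<bullet> i) \<noteq> 0)" unfolding \<beta>_def by simp
    also have "\<dots> \<longleftrightarrow> (\<forall>i\<in>Basis. possq (x \<bullet> i - a \<bullet> i) > 0 \<and> possq (b \<bullet> i - x \<bullet> i) > 0)"
      using possq_ge by (metis less_eq_real_def mult_eq_0_iff less_irrefl)
    finally show ?thesis by (auto simp: possq_pos mem_box)
  qed
qed

lemma test_zero_imp_box_integral_zero:
  fixes f :: "real^2 => real"
  assumes f: "loc_int U f" and z: "\<And>\<phi>. tst U \<phi> ==> (LINT x|lebesgue. \<phi> x *R f x) = 0"
    and sub: "cbox a b \<subseteq> U"
  shows "(LINT x|lebesgue. indicator (box a b) x *R f x) = 0"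
proof -
  obtain \<beta> where \<beta>: "C1_on \<beta> UNIV" "\<And>x. \<beta> x \<ge> (0::real)" "\<And>x. \<beta> x > 0 \<longleftrightarrow> x \<in> box a b" using box_bump by blast
  \<comment> \<open>n beta / (1 + n beta) lies between 0 and 1 and tends to the indicator of the
    open box, since beta is positive exactly there; dominated convergence then applies.\<close>
  define \<phi> where "\<phi> n x = (real n * \<beta> x) * inverse (1 + real n * \<beta> x)" for n x
  have pos: "1 + real n * \<beta> x > 0" for n x using \<beta>(2)[of x] by (simp add: add_pos_nonneg)
  have C1: "C1_on (\<phi> n) UNIV" for n unfolding \<phi>_def[abs_def] using pos
    by (intro Ck1_mult Ck1_inverse Ck1_add Ck1_const \<beta>) (auto simp: less_imp_neq[THEN not_sym])
  have zero: "\<phi> n x = 0" if "x \<notin> box a b" for n x using that \<beta>(2,3)[of x] by (simp add: \<phi>_def)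
  have t: "tst U (\<phi> n)" for n unfolding tst_def
  proof (intro conjI exI[of _ "cbox a b"] allI impI)
    show "\<phi> n x = 0" if "x \<notin> cbox a b" for x using that zero box_subset_cbox[of a b] by blast
  qed (use C1 sub in auto)
  have rng: "\<bar>\<phi> n x\<bar> \<le> 1" for n x using pos[of n x] \<beta>(2)[of x] by (simp add: \<phi>_def divide_inverse[symmetric])
  have int: "integrable lebesgue (\<lambda>x. indicator (cbox a b) x *R f x)" using f sub unfolding loc_int_def set_integrable_def by auto
  have "(\<lambda>n. LINT x|lebesgue. \<phi> n x *R f x) \<longlonglongrightarrow> (LINT x|lebesgue. indicator (box a b) x *R f x)"
  proof (rule integral_dominated_convergence[where w="\<lambda>x. norm (indicator (cbox a b) x *R f x)"])
    show "(\<lambda>x. \<phi> n x *R f x) \<in> borel_lebesgue" for n by (rule borel_measurable_integrable[OF tst_integrable(1)[OF t f]])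
    show "integrable lebesgue (\<lambda>x. norm (indicator (cbox a b) x *R f x))" using int by (rule integrable_norm)
    show "AE x in lebesgue. norm (\<phi> n x *R f x) \<le> norm (indicator (cbox a b) x *R f x)" for n
    proof (rule AE_I2)
      fix x show "norm (\<phi> n x *R f x) \<le> norm (indicator (cbox a b) x *R f x)"
        using rng[of n x] zero[of x n] subsetD[OF box_subset_cbox[of a b], of x]
        by (cases "x \<in> box a b"; cases "x \<in> cbox a b") (auto simp: abs_mult intro!: mult_left_le_one_le)
    qed
    show "AE x in lebesgue. (\<lambda>n. \<phi> n x *R f x) \<longlonglongrightarrow> indicator (box a b) x *R f x"
    proof (rule AE_I2, rule tendsto_scaleR[OF _ tendsto_const])
      fix x show "(\<lambda>n. \<phi> n x) \<longlonglongrightarrow> indicator (box a b) x"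
      proof (cases "x \<in> box a b")
        case True
        then have "\<beta> x > 0" using \<beta> by simp
        then have "(\<lambda>n. (real n * \<beta> x) / (1 + real n * \<beta> x)) \<longlonglongrightarrow> 1" by real_asymp
        then show ?thesis using True by (simp add: \<phi>_def divide_inverse)
      qed (simp add: zero)
    qed
    have "integrable lebesgue (\<lambda>x. indicator (box a b) x *R (indicator (cbox a b) x *R f x))"
      by (rule integrable_mult_indicator[OF _ int]) auto
    then show "(\<lambda>x. indicator (box a b) x *R f x) \<in> borel_lebesgue"
      by (rule borel_measurable_integrable[THEN measurable_cong[THEN iffD1, rotated]])
         (use box_subset_cbox[of a b] in \<open>auto simp: indicator_def\<close>)
  qed
  then show ?thesis using z[OF t] LIMSEQ_unique[OF _ tendsto_const] by (simp add: LIMSEQ_const_iff)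
qed

text \<open>Boxes are an intersection-stable generator of the Borel sets. Hence the integral of g
  vanishes over every Borel set, in particular over the sets where g is positive or
  negative.\<close>

lemma box_integrals_zero_imp_AE:
  fixes g :: "'a::euclidean_space => real"
  assumes g: "integrable lebesgue g"
    and z: "\<And>a b. (LINT x|lebesgue. indicator (box a b) x * g x) = 0" and z0: "(LINT x|lebesgue. g x) = 0"
  shows "AE x in lebesgue. g x = 0"
proof -
  have gi: "integrable lebesgue (\<lambda>x. indicator A x * g x)" if "A \<in> sets borel" for A
    using integrable_mult_indicator[OF _ g, of A] that by simp
  have *: "(LINT x|lebesgue. indicator A x * g x) = 0" if "A \<in> sets borel" for A
  proof -
    have "Int_stable (range (\<lambda>(a, b). box a b :: 'a set))" by (auto simp: Int_stable_def box_Int_box)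
    moreover have "range (\<lambda>(a, b). box a b :: 'a set) \<subseteq> Pow UNIV" by simp
    moreover have "A \<in> sigma_sets UNIV (range (\<lambda>(a, b). box a b :: 'a set))" using that unfolding borel_eq_box by simp
    ultimately show ?thesis
    proof (induction rule: sigma_sets_induct_disjoint)
      case (basic A) then show ?case using z by auto
    next
      case empty then show ?case by simp
    next
      case (compl A)
      then have "A \<in> sets borel" unfolding borel_eq_box by simp
      have "indicator (UNIV - A) x * g x = g x - indicator A x * g x" for x by (auto simp: indicator_def)
      then show ?case using compl gi[OF \<open>A \<in> sets borel\<close>] g z0 by simp
    next
      case (union A)
      then have A: "A i \<in> sets borel" for i unfolding borel_eq_box by auto
      have "(LINT x:(\<Union>i. A i)|lebesgue. g x) = (\<Sum>i. (LINT x:(A i)|lebesgue. g x))"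
      proof (rule lebesgue_integral_countable_add)
        show "A i \<in> sets lebesgue" for i using A by simp
        show "A i \<inter> A j = {}" if "i \<noteq> j" for i j using union(1) that by (auto simp: disjoint_family_on_def)
        have "(\<Union>i. A i) \<in> sets borel" using A by auto
        then show "lset_int (\<Union>i. A i) g" using gi unfolding set_integrable_def by simp
      qed
      then show ?case using union(3) by (simp add: set_lebesgue_integral_def)
    qed
  qed
  \<comment> \<open>The sets where g has a given sign must be Borel to be tested, so a Borel version
    of g defines them.\<close>
  obtain g' where g': "g' \<in> borel_measurable lborel" "AE x in lborel. g x = g' x"
    using completion_ex_borel_measurable_real[OF borel_measurable_integrable[OF g]] by blast
  have ae: "AE x in lebesgue. g x = g' x" using g'(2) by (rule AE_completion)
  have half: "AE x in lebesgue. s * g x \<le> 0" for s :: real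
  proof -
    define A where "A = {x. s * g' x > 0}"
    have A: "A \<in> sets borel" unfolding A_def using g'(1) by measurable
    have "(LINT x|lebesgue. indicator A x * (s * g x)) = 0" using *[OF A] by (simp add: mult.left_commute)
    moreover have "AE x in lebesgue. 0 \<le> indicator A x * (s * g x)" using ae by eventually_elim (auto simp: A_def indicator_def)
    moreover have "integrable lebesgue (\<lambda>x. indicator A x * (s * g x))" using gi[OF A] by (simp add: mult.left_commute)
    ultimately have "AE x in lebesgue. indicator A x * (s * g x) = 0" using integral_nonneg_eq_0_iff_AE by blast
    then show ?thesis using ae by eventually_elim (auto simp: A_def indicator_def split: if_splits)
  qed
  show ?thesis using half[of 1] half[of "-1"] by eventually_elim auto
qed

text \<open>The fundamental lemma of the calculus of variations, reduced to boxes whose closure lies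
  in U. The intersection of such a box with any other box is of the same kind.\<close>

lemma test_zero_imp_AE_zero:
  fixes f :: "real^2 => real"
  assumes "open U" and f: "loc_int U f" and z: "\<And>\<phi>. tst U \<phi> ==> (LINT x|lebesgue. \<phi> x *R f x) = 0"
  shows "AE x in lebesgue. x \<in> U --> f x = 0"
proof (rule AE_locally)
  fix x assume "x \<in> U"
  then obtain a b where ab: "cbox a b \<subseteq> U" "x \<in> box a b" using open_contains_cbox[OF \<open>open U\<close>] by metis
  define g where "g y = indicator (box a b) y * f y" for y
  have "lset_int (cbox a b) f" using f ab(1) unfolding loc_int_def by (meson compact_cbox)
  then have "lset_int (box a b) f" by (rule set_integrable_subset) (simp_all add: box_subset_cbox)
  then have gi: "integrable lebesgue g" by (simp add: set_integrable_def g_def[abs_def])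
  have "AE y in lebesgue. g y = 0"
  proof (rule box_integrals_zero_imp_AE[OF gi])
    show "(LINT y|lebesgue. g y) = 0" using test_zero_imp_box_integral_zero[OF f z ab(1)] by (simp add: g_def)
    fix c d
    obtain e h where eh: "box c d \<inter> box a b = box e h" "cbox e h \<subseteq> cbox a b"
    proof
      show "box c d \<inter> box a b = box (\<Sum>i\<in>Basis. max (c\<bullet>i) (a\<bullet>i) *R i) (\<Sum>i\<in>Basis. min (d\<bullet>i) (b\<bullet>i) *R i)" by (rule box_Int_box)
      show "cbox (\<Sum>i\<in>Basis. max (c\<bullet>i) (a\<bullet>i) *R i) (\<Sum>i\<in>Basis. min (d\<bullet>i) (b\<bullet>i) *R i) \<subseteq> cbox a b" by (auto simp: mem_box)
    qed
    have "(LINT y|lebesgue. indicator (box e h) y *R f y) = 0" by (rule test_zero_imp_box_integral_zero[OF f z]) (use eh ab in auto)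
    moreover have "indicator (box e h) y *R f y = indicator (box c d) y * g y" for y
      unfolding eh(1)[symmetric] g_def by (auto simp: indicator_def)
    ultimately show "(LINT y|lebesgue. indicator (box c d) y * g y) = 0" by simp
  qed
  then have "AE y in lebesgue. y \<in> box a b --> f y = 0" by eventually_elim (auto simp: g_def)
  then show "\<exists>V. open V \<and> x \<in> V \<and> (AE y in lebesgue. y \<in> V --> f y = 0)" using ab(2) by (intro exI[of _ "box a b"]) auto
qed

text \<open>\<open>weak_grad\<close> is an arbitrary choice. Through this lemma every such choice is
  replaced by a concrete gradient, and gradients on overlapping sets are identified.\<close>

lemma has_weak_grad_unique:
  fixes u :: "real^2 => real^'n"
  assumes "open U" and D: "has_weak_grad U u D1" "has_weak_grad U u D2"
  shows "AE x in lebesgue. x \<in> U --> D1 x = D2 x"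
proof -
  have "AE x in lebesgue. x \<in> U --> D1 x $ i $ j - D2 x $ i $ j = 0" for i j
  proof (rule test_zero_imp_AE_zero[OF \<open>open U\<close>])
    have bl: "bounded_linear (\<lambda>A. (A::real^2^'n) $ i $ j)"
      by (intro bounded_linear_compose[OF bounded_linear_vec_nth bounded_linear_vec_nth])
    have l: "loc_int U (\<lambda>x. D1 x $ i $ j)" "loc_int U (\<lambda>x. D2 x $ i $ j)"
      using D[THEN has_weak_gradD(2)] by (auto intro: loc_int_bounded_linear[OF bl])
    show "loc_int U (\<lambda>x. D1 x $ i $ j - D2 x $ i $ j)" using l unfolding loc_int_def by (simp add: set_integral_diff)
    fix \<phi> assume \<phi>: "tst U \<phi>"
    have e: "(LINT x|lebesgue. \<phi> x * D x $ i $ j) = (LINT x|lebesgue. \<phi> x *R column j (D x)) $ i"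
      if "has_weak_grad U u D" for D
    proof -
      have "integrable lebesgue (\<lambda>x. \<phi> x *R column j (D x))" by (rule tst_integrable(1)[OF \<phi> loc_int_column[OF has_weak_gradD(2)[OF that]]])
      then show ?thesis by (subst integral_bounded_linear[OF bounded_linear_vec_nth, symmetric]) (auto simp: column_def)
    qed
    have "integrable lebesgue (\<lambda>x. \<phi> x *R (D1 x $ i $ j))" "integrable lebesgue (\<lambda>x. \<phi> x *R (D2 x $ i $ j))"
      by (intro tst_integrable(1)[OF \<phi>] l)+
    then have "(LINT x|lebesgue. \<phi> x *R (D1 x $ i $ j - D2 x $ i $ j))
      = (LINT x|lebesgue. \<phi> x * D1 x $ i $ j) - (LINT x|lebesgue. \<phi> x * D2 x $ i $ j)" by (simp add: right_diff_distrib)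
    also have "\<dots> = 0" unfolding e[OF D(1)] e[OF D(2)] using has_weak_gradD(3)[OF D(1) \<phi>, of j] has_weak_gradD(3)[OF D(2) \<phi>, of j] by simp
    finally show "(LINT x|lebesgue. \<phi> x *R (D1 x $ i $ j - D2 x $ i $ j)) = 0" .
  qed
  then have "AE x in lebesgue. \<forall>i j. x \<in> U --> D1 x $ i $ j - D2 x $ i $ j = 0" unfolding AE_all_countable by blast
  then show ?thesis by eventually_elim (auto simp: vec_eq_iff)
qed

section \<open>Locality of weak gradients\<close>

lemma frechet_derivative_sum:
  assumes "\<And>i. i \<in> I ==> f i differentiable (at x)"
  shows "frechet_derivative (\<lambda>x. \<Sum>i\<in>I. f i x) (at x) v = (\<Sum>i\<in>I. frechet_derivative (f i) (at x) v)"
proof -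
  have "((\<lambda>x. \<Sum>i\<in>I. f i x) has_derivative (\<lambda>v. \<Sum>i\<in>I. frechet_derivative (f i) (at x) v)) (at x)"
    by (rule has_derivative_sum) (use assms frechet_derivative_works in blast)
  from frechet_derivative_at[OF this] show ?thesis by metis
qed

lemma finite_ball_cover:
  assumes "compact K" "\<And>x. x \<in> K ==> r x > 0"
  obtains F where "finite F" "F \<subseteq> K" "K \<subseteq> (\<Union>c\<in>F. ball c (r c))"
proof (rule compactE_image[OF assms(1), of K "\<lambda>c. ball c (r c)"])
  show "K \<subseteq> (\<Union>c\<in>K. ball c (r c))" using assms(2) by force
qed (use that in auto)

text \<open>A partition of unity by hand: bumps beta_c on finitely many half-size balls, divided by
  their sum sigma and multiplied by phi.\<close>

lemma tst_split:
  fixes U :: "'a::euclidean_space set"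
  assumes \<phi>: "tst U \<phi>" and r: "\<And>x. x \<in> U ==> r x > 0"
  shows "\<exists>F \<kappa>. finite F \<and> F \<subseteq> U \<and> (\<forall>c\<in>F. tst (ball c (r c)) (\<kappa> c)) \<and> \<phi> = (\<lambda>x. \<Sum>c\<in>F. \<kappa> c x)"
proof -
  obtain K where K: "compact K" "K \<subseteq> U" "\<And>x. x \<notin> K ==> \<phi> x = 0"
    "\<And>x. x \<notin> K ==> frechet_derivative \<phi> (at x) = (\<lambda>v. 0)" using tst_supp[OF \<phi>] by blast
  obtain F where F: "finite F" "F \<subseteq> K" "K \<subseteq> (\<Union>c\<in>F. ball c (r c / 2))"
    by (rule finite_ball_cover[OF K(1), of "\<lambda>c. r c / 2"]) (use r K(2) in auto)
  define \<beta> where "\<beta> c x = possq ((r c / 2)^2 - (norm (x - c))^2)" for c x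
  define \<sigma> where "\<sigma> x = (\<Sum>c\<in>F. \<beta> c x)" for x
  have \<beta>C: "C1_on (\<beta> c) UNIV" for c unfolding \<beta>_def[abs_def] by (intro Ck1_possq Ck1_diff Ck1_const Ck1_sqdist) auto
  have \<sigma>C: "C1_on \<sigma> UNIV" unfolding \<sigma>_def[abs_def] by (intro Ck1_sum \<beta>C) auto
  have \<beta>pos: "\<beta> c x > 0" if "x \<in> ball c (r c / 2)" for c x using that unfolding \<beta>_def possq_pos
    by (auto simp: dist_norm norm_minus_commute intro!: power_strict_mono)
  have \<beta>0: "\<beta> c x = 0" if "x \<notin> cball c (r c / 2)" "c \<in> F" for c x using that r[of c] F K(2) unfolding \<beta>_def
    by (intro possq_0) (auto simp: dist_norm norm_minus_commute intro!: power_mono)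
  have \<sigma>pos: "\<sigma> x > 0" if x: "x \<in> K" for x
  proof -
    obtain c where "c \<in> F" "x \<in> ball c (r c / 2)" using F(3) x by blast
    then show ?thesis unfolding \<sigma>_def by (intro sum_pos2[OF F(1) _ \<beta>pos]) (auto simp: \<beta>_def possq_ge)
  qed
  define S where "S = {x. \<sigma> x > 0}"
  have S: "open S" unfolding S_def by (intro open_Collect_less continuous_intros Ck1_continuous[OF \<sigma>C])
  define \<kappa> where "\<kappa> c x = \<beta> c x * (\<phi> x * inverse (\<sigma> x))" for c x
  \<comment> \<open>The quotient is regular where sigma is positive, which is a neighbourhood of K;
    off K the factor phi is zero.\<close>
  have "C1_on (\<lambda>x. \<phi> x * inverse (\<sigma> x)) UNIV"
  proof (rule Ck1_zero_ext[OF S compact_imp_closed[OF K(1)]])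
    show "K \<subseteq> S" using \<sigma>pos by (auto simp: S_def)
    show "C1_on (\<lambda>x. \<phi> x * inverse (\<sigma> x)) S"
      by (intro Ck1_mult Ck1_inverse S Ck1_subset[OF tst_C1[OF \<phi>]] Ck1_subset[OF \<sigma>C]) (auto simp: S_def)
  qed (use K in auto)
  then have t: "tst U (\<lambda>x. \<phi> x * inverse (\<sigma> x))" using K unfolding tst_def by auto
  show ?thesis
  proof (intro exI[of _ F] exI[of _ \<kappa>] conjI ballI)
    show "finite F" "F \<subseteq> U" using F K by auto
    show "tst (ball c (r c)) (\<kappa> c)" if "c \<in> F" for c unfolding \<kappa>_def
    proof (rule tst_mult[OF t \<beta>C])
      show "cball c (r c / 2) \<inter> U \<subseteq> ball c (r c)" using r[of c] that F(2) K(2) by (force simp: subset_iff)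
    qed (use \<beta>0 that in auto)
    show "\<phi> = (\<lambda>x. \<Sum>c\<in>F. \<kappa> c x)"
    proof
      fix x show "\<phi> x = (\<Sum>c\<in>F. \<kappa> c x)" using \<sigma>pos[of x] K(3)[of x] unfolding \<kappa>_def sum_distrib_right[symmetric] \<sigma>_def[symmetric]
        by (cases "x \<in> K") auto
    qed
  qed
qed

lemma loc_int_locally:
  assumes "\<And>x. x \<in> U ==> \<exists>V. open V \<and> x \<in> V \<and> loc_int V f"
  shows "loc_int U f" unfolding loc_int_def
proof (intro allI impI)
  fix K assume K: "compact K" "K \<subseteq> U"
  have "\<exists>r>0. lset_int (cball x r) f" if x: "x \<in> U" for x
  proof -
    obtain V where V: "open V" "x \<in> V" "loc_int V f" using assms[OF x] by blast
    then obtain r where "r > 0" "cball x r \<subseteq> V" using open_contains_cball by blast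
    then show ?thesis using V(3) unfolding loc_int_def by (meson compact_cball)
  qed
  then have "\<exists>r. \<forall>x\<in>U. r x > 0 \<and> lset_int (cball x (r x)) f" by (intro bchoice) blast
  then obtain r where r: "\<And>x. x \<in> U ==> r x > 0" "\<And>x. x \<in> U ==> lset_int (cball x (r x)) f" by blast
  obtain F where F: "finite F" "F \<subseteq> K" "K \<subseteq> (\<Union>c\<in>F. ball c (r c))" by (rule finite_ball_cover[OF K(1), of r]) (use r K(2) in auto)
  have "lset_int (\<Union>c\<in>F. cball c (r c)) f"
  proof (rule set_integrable_UN[OF F(1)])
    show "lset_int (cball c (r c)) f" if "c \<in> F" for c using that F(2) K(2) by (intro r(2)) blast
  qed simp
  moreover have "K \<in> sets lebesgue" using lmeasurable_compact[OF K(1)] by (rule fmeasurableD)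
  moreover have "K \<subseteq> (\<Union>c\<in>F. cball c (r c))" by (rule order_trans[OF F(3)]) (intro UN_mono ball_subset_cball subset_refl)
  ultimately show "lset_int K f" by (rule set_integrable_subset)
qed

text \<open>The defining identity is linear in the test function, and \<open>tst_split\<close>
  writes every test function as a finite sum of test functions supported in the given
  neighbourhoods.\<close>

lemma has_weak_grad_locally:
  fixes u :: "real^2 => real^'n"
  assumes loc: "\<And>x. x \<in> U ==> \<exists>V. open V \<and> x \<in> V \<and> has_weak_grad V u Du"
  shows "has_weak_grad U u Du"
proof (rule has_weak_gradI)
  show l: "loc_int U u" "loc_int U Du" by (rule loc_int_locally, use loc has_weak_gradD(1) in metis)
       (rule loc_int_locally, use loc has_weak_gradD(2) in metis)
  fix \<phi> j assume \<phi>: "tst U \<phi>"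
  have "\<exists>r>0. has_weak_grad (ball x r) u Du" if x: "x \<in> U" for x
  proof -
    obtain V where V: "open V" "x \<in> V" "has_weak_grad V u Du" using loc[OF x] by blast
    then obtain r where "r > 0" "ball x r \<subseteq> V" using open_contains_ball by metis
    then show ?thesis using has_weak_grad_subset[OF V(3)] by blast
  qed
  then have "\<exists>r. \<forall>x\<in>U. r x > 0 \<and> has_weak_grad (ball x (r x)) u Du" by (intro bchoice) blast
  then obtain r where r: "\<And>x. x \<in> U ==> r x > 0" "\<And>x. x \<in> U ==> has_weak_grad (ball x (r x)) u Du" by blast
  obtain F \<kappa> where F: "finite F" "F \<subseteq> U" "\<And>c. c \<in> F ==> tst (ball c (r c)) (\<kappa> c)"
    and eq: "\<phi> = (\<lambda>x. \<Sum>c\<in>F. \<kappa> c x)" using tst_split[of U \<phi> r, OF \<phi> r(1)] by auto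
  have D: "has_weak_grad (ball c (r c)) u Du" if "c \<in> F" for c using r(2) F(2) that by blast
  have d: "pd \<phi> j x = (\<Sum>c\<in>F. pd (\<kappa> c) j x)" for x unfolding eq using F(3)[THEN tst_C1] by (intro frechet_derivative_sum) (simp add: Ck1_iff)
  have i1: "integrable lebesgue (\<lambda>x. pd (\<kappa> c) j x *R u x)" if "c \<in> F" for c
    by (rule tst_integrable(2)[OF F(3)[OF that] has_weak_gradD(1)[OF D[OF that]]])
  have i2: "integrable lebesgue (\<lambda>x. \<kappa> c x *R column j (Du x))" if "c \<in> F" for c
    by (rule tst_integrable(1)[OF F(3)[OF that] loc_int_column[OF has_weak_gradD(2)[OF D[OF that]]]])
  show "(LINT x|lebesgue. pd \<phi> j x *R u x) = - (LINT x|lebesgue. \<phi> x *R column j (Du x))"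
    unfolding d unfolding eq scaleR_sum_left using i1 i2 by (simp add: has_weak_gradD(3)[OF D F(3)] sum_negf)
qed

lemma has_weak_grad_cong_AE:
  fixes u u' :: "real^2 => real^'n"
  assumes D: "has_weak_grad U u Du"
    and ae: "AE x in lebesgue. x \<in> U --> u x = u' x" "AE x in lebesgue. x \<in> U --> Du x = Du' x"
  shows "has_weak_grad U u' Du'"
proof -
  have *: "(\<lambda>x. c x *R g x) \<in> borel_lebesgue"
    if "integrable lebesgue (\<lambda>x. c x *R f x)" "AE x in lebesgue. x \<in> U --> f x = g x" "\<And>x. x \<notin> U ==> c x = 0"
    for c :: "real^2 => real" and f g :: "real^2 => 'b::euclidean_space"
  proof (rule borel_measurable_AE[OF borel_measurable_integrable[OF that(1)]])
    show "AE x in lebesgue. c x *R f x = c x *R g x" using that(2) by eventually_elim (use that(3) in force)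
  qed
  have L: "loc_int U g" if "loc_int U f" "AE x in lebesgue. x \<in> U --> f x = g x" for f g :: "real^2 => 'b::euclidean_space"
    unfolding loc_int_def set_integrable_def
  proof (intro allI impI)
    fix K assume K: "compact K" "K \<subseteq> U"
    then have i: "integrable lebesgue (\<lambda>x. indicator K x *R f x)" using that(1) unfolding loc_int_def set_integrable_def by blast
    show "integrable lebesgue (\<lambda>x. indicator K x *R g x)"
    proof (rule integrable_cong_AE_imp[OF i])
      show "(\<lambda>x. indicator K x *R g x) \<in> borel_lebesgue" using K by (intro *[OF i that(2)]) (auto simp: indicator_def)
      show "AE x in lebesgue. indicator K x *R f x = indicator K x *R g x"
        using that(2) by eventually_elim (use K in \<open>auto simp: indicator_def\<close>)
    qed
  qed
  have l: "loc_int U u'" "loc_int U Du'" using L has_weak_gradD(1,2)[OF D] ae by blast+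
  show ?thesis
  proof (rule has_weak_gradI[OF l])
    fix \<phi> j assume \<phi>: "tst U \<phi>"
    obtain K where K: "compact K" "K \<subseteq> U" "\<And>x. x \<notin> K ==> \<phi> x = 0"
      "\<And>x. x \<notin> K ==> frechet_derivative \<phi> (at x) = (\<lambda>v. 0)" using tst_supp[OF \<phi>] by blast
    have z: "\<phi> x = 0 \<and> pd \<phi> j x = 0" if "x \<notin> U" for x using that K(2) K(3)[of x] K(4)[of x] by (cases "x \<in> K") auto
    have "(LINT x|lebesgue. pd \<phi> j x *R u' x) = (LINT x|lebesgue. pd \<phi> j x *R u x)"
    proof (rule integral_cong_AE)
      show "AE x in lebesgue. pd \<phi> j x *R u' x = pd \<phi> j x *R u x" using ae(1) by eventually_elim (use z in force)
    qed (intro borel_measurable_integrable tst_integrable(2)[OF \<phi>] l has_weak_gradD(1)[OF D])+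
    moreover have "(LINT x|lebesgue. \<phi> x *R column j (Du' x)) = (LINT x|lebesgue. \<phi> x *R column j (Du x))"
    proof (rule integral_cong_AE)
      show "AE x in lebesgue. \<phi> x *R column j (Du' x) = \<phi> x *R column j (Du x)" using ae(2) by eventually_elim (use z in force)
    qed (intro borel_measurable_integrable tst_integrable(1)[OF \<phi>] loc_int_column l has_weak_gradD(2)[OF D])+
    ultimately show "(LINT x|lebesgue. pd \<phi> j x *R u' x) = - (LINT x|lebesgue. \<phi> x *R column j (Du' x))"
      using has_weak_gradD(3)[OF D \<phi>] by simp
  qed
qed

section \<open>Translations and reflections in integrals\<close>

lemma lebesgue_affine_measurable':
  fixes a :: "'a::euclidean_space" and m :: real
  assumes "m = 1 \<or> m = -1"
  shows "(\<lambda>x. m *R x + a) \<in> measurable lebesgue lebesgue"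
proof (rule measurableI)
  fix A :: "'a set" assume A: "A \<in> sets lebesgue"
  have mm: "m * m = 1" using assms by auto
  have "(\<lambda>x. m *R x + a) -` A = (\<lambda>y. m *R (y - a)) ` A"
  proof (intro set_eqI iffI)
    fix x assume "x \<in> (\<lambda>x. m *R x + a) -` A"
    then show "x \<in> (\<lambda>y. m *R (y - a)) ` A" by (intro image_eqI[of _ _ "m *R x + a"]) (auto simp: mm)
  qed (auto simp: mm)
  also have "\<dots> \<in> sets lebesgue"
    by (rule differentiable_image_in_sets_lebesgue[OF A]) (auto intro!: derivative_intros simp: differentiable_on_def)
  finally show "(\<lambda>x. m *R x + a) -` A \<inter> space lebesgue \<in> sets lebesgue" by simp
qed auto

text \<open>Only m = 1 and m = -1 occur: translations, and the reflection z -> x - z inside a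
  convolution. Both preserve the measure.\<close>

lemma lebesgue_affine_distr:
  fixes a :: "'a::euclidean_space" and m :: real
  assumes m: "m = 1 \<or> m = -1"
  shows "distr lebesgue lebesgue (\<lambda>x. m *R x + a) = lebesgue"
proof (rule measure_eqI)
  fix A assume "A \<in> sets (distr lebesgue lebesgue (\<lambda>x. m *R x + a))"
  then have A: "A \<in> sets lebesgue" by simp
  have mm: "m * m = 1" using assms by auto
  have "(\<lambda>x. m *R x + a) -` A = (\<lambda>y. m *R y + (- m) *R a) ` A"
  proof (intro set_eqI iffI)
    fix x assume "x \<in> (\<lambda>x. m *R x + a) -` A"
    then show "x \<in> (\<lambda>y. m *R y + (- m) *R a) ` A" by (intro image_eqI[of _ _ "m *R x + a"]) (auto simp: mm scaleR_add_right)
  qed (auto simp: mm scaleR_diff_right)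
  then show "emeasure (distr lebesgue lebesgue (\<lambda>x. m *R x + a)) A = emeasure lebesgue A"
    using m emeasure_lebesgue_affine[of m "(- m) *R a" A] by (subst emeasure_distr[OF lebesgue_affine_measurable'[OF m] A]) auto
qed simp

lemma
  fixes f :: "'a::euclidean_space => 'b::{banach,second_countable_topology}" and m :: real
  assumes m: "m = 1 \<or> m = -1"
  shows integrable_affine: "integrable lebesgue (\<lambda>x. f (m *R x + a)) \<longleftrightarrow> integrable lebesgue f"
    and integral_affine: "(LINT x|lebesgue. f (m *R x + a)) = (LINT x|lebesgue. f x)"
proof -
  have fwd: "integrable lebesgue (\<lambda>x. g (m *R x + b))" "(LINT x|lebesgue. g (m *R x + b)) = (LINT x|lebesgue. g x)"
    if "integrable lebesgue g" for g :: "'a => 'b" and b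
  proof -
    have "integrable (distr lebesgue lebesgue (\<lambda>x. m *R x + b)) g" unfolding lebesgue_affine_distr[OF m] by (rule that)
    then show "integrable lebesgue (\<lambda>x. g (m *R x + b))" by (rule integrable_distr[OF lebesgue_affine_measurable'[OF m]])
    have "(LINT x|lebesgue. g x) = (LINT x|distr lebesgue lebesgue (\<lambda>x. m *R x + b). g x)" unfolding lebesgue_affine_distr[OF m] ..
    also have "\<dots> = (LINT x|lebesgue. g (m *R x + b))" using that by (intro integral_distr lebesgue_affine_measurable' m) auto
    finally show "(LINT x|lebesgue. g (m *R x + b)) = (LINT x|lebesgue. g x)" ..
  qed
  have inv: "m *R (m *R x + (- m) *R a) + a = x" for x using m by (auto simp: algebra_simps)
  show iff: "integrable lebesgue (\<lambda>x. f (m *R x + a)) \<longleftrightarrow> integrable lebesgue f"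
    using fwd(1)[of "\<lambda>x. f (m *R x + a)" "(- m) *R a"] fwd(1)[of f a] unfolding inv by blast
  show "(LINT x|lebesgue. f (m *R x + a)) = (LINT x|lebesgue. f x)" using fwd(2)[of f a] iff not_integrable_integral_eq by metis
qed

lemma nn_integral_affine:
  fixes f :: "'a::euclidean_space => ennreal" and m :: real
  assumes "m = 1 \<or> m = -1" "f \<in> borel_lebesgue"
  shows "(\<integral>\<^sup>+x. f (m *R x + a) \<partial>lebesgue) = (\<integral>\<^sup>+x. f x \<partial>lebesgue)"
  using nn_integral_distr[OF lebesgue_affine_measurable'[OF assms(1)], of f a] assms(2) unfolding lebesgue_affine_distr[OF assms(1)] by simp

subsection \<open>Integration by parts\<close>

lemma compact_subset_cball:
  assumes "compact (K :: 'a::euclidean_space set)"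
  obtains R where "R > 0" "K \<subseteq> cball 0 R"
proof -
  obtain R where "R > 0" "\<forall>x\<in>K. norm x \<le> R" using compact_imp_bounded[OF assms] by (auto simp: bounded_pos)
  then show ?thesis by (intro that[of R]) auto
qed

lemma continuous_compact_set_integrable:
  fixes f :: "'a::euclidean_space => 'b::euclidean_space"
  assumes "compact K" "continuous_on K f"
  shows "lset_int K f" unfolding set_integrable_def using borel_integrable_compact[OF assms] by (subst integrable_completion) auto

lemma integrable_indicator_compact:
  "compact (K :: 'a::euclidean_space set) ==> integrable lebesgue (indicator K :: 'a => real)"
  using continuous_compact_set_integrable[of K "\<lambda>x. 1::real"] by (simp add: set_integrable_def)

text \<open>Arithmetic in the index type \<open>2\<close>: there 1 = 2 = 1 + 1 would give 1 = 0. The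
  simplifier needs this to tell the two coordinates apart.\<close>

lemma one_neq_two: "(1::2) \<noteq> 2" by (metis zero_neq_one one_add_one add_cancel_right_right)

abbreviation V2 :: "real => real => real^2" where "V2 \<theta> t \<equiv> vector [\<theta>, t]"

lemma Basis_real2: "(Basis :: (real^2) set) = {axis 1 1, axis 2 1}" by (auto simp: Basis_vec_def) (metis exhaust_2)

lemma V2_measurable: "(\<lambda>(\<theta>, t). V2 \<theta> t) \<in> borel_measurable (lborel \<Otimes>\<^sub>M lborel)"
proof -
  have e: "(\<lambda>(\<theta>, t). V2 \<theta> t) = (\<lambda>p. fst p *R axis 1 1 + snd p *R axis 2 1)"
    using one_neq_two by (auto simp: fun_eq_iff vec_eq_iff forall_2 axis_def)
  have "fst \<in> borel_measurable (lborel \<Otimes>\<^sub>M lborel :: (real \<times> real) measure)" "snd \<in> borel_measurable (lborel \<Otimes>\<^sub>M lborel :: (real \<times> real) measure)"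
    using measurable_fst[of lborel lborel] measurable_snd[of lborel lborel] by (simp_all add: measurable_lborel1)
  then show ?thesis unfolding e by (intro borel_measurable_add borel_measurable_scaleR borel_measurable_const)
qed

text \<open>Identifies the plane of vectors with a product of two lines, so that Fubini's theorem
  applies. It is enough to compare the two measures on boxes.\<close>

lemma lborel_V2: "lborel = distr (lborel \<Otimes>\<^sub>M lborel) borel (\<lambda>(\<theta>, t). V2 \<theta> t)"
proof (rule lborel_eqI)
  fix l u :: "real^2" assume le: "\<And>b. b \<in> Basis ==> l \<bullet> b \<le> u \<bullet> b"
  have b: "(axis 1 1 :: real^2) \<in> Basis" "(axis 2 1 :: real^2) \<in> Basis" by (simp_all add: Basis_real2)
  have le': "l $ 1 \<le> u $ 1" "l $ 2 \<le> u $ 2" using le[OF b(1)] le[OF b(2)] by (simp_all add: inner_axis)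
  have v: "(\<lambda>(\<theta>, t). V2 \<theta> t) -` box l u \<inter> space (lborel \<Otimes>\<^sub>M lborel) = {l $ 1 <..< u $ 1} \<times> {l $ 2 <..< u $ 2}"
    by (auto simp: mem_box_cart forall_2 space_pair_measure)
  have "emeasure (distr (lborel \<Otimes>\<^sub>M lborel) borel (\<lambda>(\<theta>, t). V2 \<theta> t)) (box l u)
    = emeasure (lborel \<Otimes>\<^sub>M lborel) ({l $ 1 <..< u $ 1} \<times> {l $ 2 <..< u $ 2})" by (subst emeasure_distr[OF V2_measurable]) (auto simp: v)
  also have "\<dots> = ennreal ((u $ 1 - l $ 1) * (u $ 2 - l $ 2))"
    using le' by (subst lborel.emeasure_pair_measure_Times) (auto simp: ennreal_mult)
  also have "(u $ 1 - l $ 1) * (u $ 2 - l $ 2) = (\<Prod>b\<in>Basis. (u - l) \<bullet> b)"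
    using one_neq_two by (simp add: Basis_real2 axis_eq_axis inner_axis)
  finally show "emeasure (distr (lborel \<Otimes>\<^sub>M lborel) borel (\<lambda>(\<theta>, t). V2 \<theta> t)) (box l u) = (\<Prod>b\<in>Basis. (u - l) \<bullet> b)" .
qed simp

lemma nn_integral_V2:
  assumes [measurable]: "F \<in> borel_measurable borel"
  shows "(\<integral>\<^sup>+x. F x \<partial>lborel) = (\<integral>\<^sup>+\<theta>. \<integral>\<^sup>+t. F (V2 \<theta> t) \<partial>lborel \<partial>lborel)"
proof -
  note [measurable] = V2_measurable
  have "(\<integral>\<^sup>+x. F x \<partial>lborel) = (\<integral>\<^sup>+p. F ((\<lambda>(\<theta>, t). V2 \<theta> t) p) \<partial>(lborel \<Otimes>\<^sub>M lborel))" by (subst lborel_V2, subst nn_integral_distr) simp_all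
  also have "\<dots> = (\<integral>\<^sup>+\<theta>. \<integral>\<^sup>+t. F (V2 \<theta> t) \<partial>lborel \<partial>lborel)" by (subst lborel.nn_integral_fst[symmetric]) simp_all
  finally show ?thesis .
qed

lemma integral_V2:
  fixes F :: "real^2 => 'b::{banach, second_countable_topology}"
  assumes F: "integrable lborel F"
  shows "(LINT x|lborel. F x) = (LINT \<theta>|lborel. (LINT t|lborel. F (V2 \<theta> t)))"
    "(LINT x|lborel. F x) = (LINT t|lborel. (LINT \<theta>|lborel. F (V2 \<theta> t)))"
proof -
  have i: "integrable (lborel \<Otimes>\<^sub>M lborel) (\<lambda>p. F ((\<lambda>(\<theta>, t). V2 \<theta> t) p))"
    using F by (subst (asm) lborel_V2) (rule integrable_distr[OF V2_measurable])
  have e: "(LINT x|lborel. F x) = (LINT p|(lborel \<Otimes>\<^sub>M lborel). F ((\<lambda>(\<theta>, t). V2 \<theta> t) p))"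
    using F by (subst lborel_V2, subst integral_distr[OF V2_measurable]) auto
  show "(LINT x|lborel. F x) = (LINT \<theta>|lborel. (LINT t|lborel. F (V2 \<theta> t)))" unfolding e using lborel_pair.integral_fst'[OF i] by simp
  have i': "integrable (lborel \<Otimes>\<^sub>M lborel) (case_prod (\<lambda>\<theta> t. F (V2 \<theta> t)))" using i by (simp add: case_prod_unfold)
  show "(LINT x|lborel. F x) = (LINT t|lborel. (LINT \<theta>|lborel. F (V2 \<theta> t)))"
    unfolding e using lborel_pair.integral_snd[OF i'] by (simp add: case_prod_unfold)
qed

lemma V2_affine: "V2 \<theta> t = V2 \<theta> 0 + t *R axis 2 1" "V2 \<theta> t = V2 0 t + \<theta> *R axis 1 1"
  using one_neq_two by (simp_all add: vec_eq_iff forall_2 axis_def)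

lemma V2_derivative:
  fixes F :: "real^2 => 'b::real_normed_vector"
  assumes F: "C1_on F UNIV"
  shows "((\<lambda>t. F (V2 \<theta> t)) has_vector_derivative pd F 2 (V2 \<theta> t)) (at t within A)"
    "((\<lambda>\<theta>. F (V2 \<theta> t)) has_vector_derivative pd F 1 (V2 \<theta> t)) (at \<theta> within A)"
proof -
  have *: "((\<lambda>s. F (p + s *R e)) has_vector_derivative frechet_derivative F (at (p + s *R e)) e) (at s within A)" for p e s
  proof -
    have "((\<lambda>s. F (p + s *R e)) has_derivative (\<lambda>k. frechet_derivative F (at (p + s *R e)) (k *R e))) (at s within A)"
      by (rule has_derivative_compose[OF _ Ck1_has_derivative[OF F]]) (auto intro!: derivative_eq_intros)
    moreover have "linear (frechet_derivative F (at (p + s *R e)))" by (rule has_derivative_linear[OF Ck1_has_derivative[OF F]]) simp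
    ultimately show ?thesis by (simp add: has_vector_derivative_def linear_cmul)
  qed
  show "((\<lambda>t. F (V2 \<theta> t)) has_vector_derivative pd F 2 (V2 \<theta> t)) (at t within A)"
    using *[of "V2 \<theta> 0" "axis 2 1" t] unfolding V2_affine(1)[symmetric] .
  show "((\<lambda>\<theta>. F (V2 \<theta> t)) has_vector_derivative pd F 1 (V2 \<theta> t)) (at \<theta> within A)"
    using *[of "V2 0 t" "axis 1 1" \<theta>] unfolding V2_affine(2)[symmetric] .
qed

lemma V2_cont: "continuous_on A (\<lambda>t. V2 \<theta> t)" "continuous_on A (\<lambda>\<theta>. V2 \<theta> t)"
  by (subst V2_affine(1), intro continuous_intros) (subst V2_affine(2), intro continuous_intros)

lemma V2_norm: "\<bar>t\<bar> \<le> norm (V2 \<theta> t)" "\<bar>\<theta>\<bar> \<le> norm (V2 \<theta> t)"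
  using component_le_norm_cart[of "V2 \<theta> t" 2] component_le_norm_cart[of "V2 \<theta> t" 1] by simp_all

text \<open>Fubini and the fundamental theorem of calculus on lines. A derivative along the boundary
  line leaves nothing, a derivative across it leaves the boundary integral; this boundary term is
  the one that gluing has to cancel.\<close>

lemma half_plane_parts:
  fixes F :: "real^2 => 'b::euclidean_space"
  assumes F: "C1_on F UNIV" and K: "compact K" "\<And>x. x \<notin> K ==> F x = 0"
  shows "(LINT x|lebesgue. indicator {x. m < x $ 2} x *R pd F 1 x) = 0"
    "(LINT x|lebesgue. indicator {x. m < x $ 2} x *R pd F 2 x) = - (LINT \<theta>|lborel. F (V2 \<theta> m))"
proof -
  obtain R0 where R0: "R0 > 0" "K \<subseteq> cball 0 R0" by (rule compact_subset_cball[OF K(1)])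
  define R where "R = max R0 \<bar>m\<bar> + 1"
  have R: "R0 < R" "\<bar>m\<bar> < R" by (auto simp: R_def)
  have z: "F x = 0" "frechet_derivative F (at x) = (\<lambda>v. 0)" if "norm x > R0" for x
  proof -
    have n: "x \<notin> K" using that R0(2) by (auto simp: subset_iff)
    show "F x = 0" by (rule K(2)[OF n])
    show "frechet_derivative F (at x) = (\<lambda>v. 0)" by (rule frechet_zero_outside[OF compact_imp_closed[OF K(1)] K(2) n])
  qed
  have c: "continuous_on UNIV (\<lambda>x. pd F j x)" for j by (rule Ck1_deriv_continuous[OF F])
  have op: "open {x::real^2. m < x $ 2}" by (intro open_Collect_less continuous_intros)
  have int: "integrable lborel (\<lambda>x. indicator {x. m < x $ 2} x *R pd F j x)" for j
  proof -
    have "integrable lborel (\<lambda>x. indicator (cball 0 R0) x *R pd F j x)" by (intro borel_integrable_compact continuous_on_subset[OF c]) auto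
    moreover have "indicator (cball 0 R0) x *R pd F j x = pd F j x" for x using z(2)[of x] by (auto simp: indicator_def)
    ultimately have "integrable lborel (\<lambda>x. pd F j x)" by (simp only:)
    then show ?thesis by (rule integrable_mult_indicator[rotated]) (use op in simp)
  qed
  have eq: "(LINT x|lebesgue. indicator {x. m < x $ 2} x *R pd F j x) = (LINT x|lborel. indicator {x. m < x $ 2} x *R pd F j x)" for j
    by (rule integral_completion) (use int in auto)
  have "(LINT \<theta>|lborel. indicator {x. m < x $ 2} (V2 \<theta> t) *R pd F 1 (V2 \<theta> t)) = 0" for t
  proof -
    have "(LINT \<theta>|lborel. indicator {-R..R} \<theta> *R pd F 1 (V2 \<theta> t)) = F (V2 R t) - F (V2 (-R) t)"
      using R by (intro integral_FTC_atLeastAtMost V2_derivative F continuous_on_compose2[OF c] V2_cont) auto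
    also have "\<dots> = 0" using z(1)[of "V2 R t"] z(1)[of "V2 (-R) t"] V2_norm(2)[of R t] V2_norm(2)[of "-R" t] R by simp
    finally have "(LINT \<theta>|lborel. indicator {-R..R} \<theta> *R pd F 1 (V2 \<theta> t)) = 0" .
    moreover have "indicator {-R..R} \<theta> *R pd F 1 (V2 \<theta> t) = pd F 1 (V2 \<theta> t)" for \<theta>
      using z(2)[of "V2 \<theta> t"] V2_norm(2)[of \<theta> t] R by (cases "\<theta> \<in> {-R..R}") auto
    ultimately show ?thesis by (cases "m < t") auto
  qed
  then show "(LINT x|lebesgue. indicator {x. m < x $ 2} x *R pd F 1 x) = 0" unfolding eq integral_V2(2)[OF int] by simp
  have "(LINT t|lborel. indicator {x. m < x $ 2} (V2 \<theta> t) *R pd F 2 (V2 \<theta> t)) = - F (V2 \<theta> m)" for \<theta>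
  proof -
    have "(LINT t|lborel. indicator {m..R} t *R pd F 2 (V2 \<theta> t)) = F (V2 \<theta> R) - F (V2 \<theta> m)"
      using R by (intro integral_FTC_atLeastAtMost V2_derivative F continuous_on_compose2[OF c] V2_cont) auto
    also have "F (V2 \<theta> R) = 0" using z(1)[of "V2 \<theta> R"] V2_norm(1)[of R \<theta>] R by simp
    finally have "(LINT t|lborel. indicator {m..R} t *R pd F 2 (V2 \<theta> t)) = - F (V2 \<theta> m)" by simp
    moreover have "(LINT t|lborel. indicator {x. m < x $ 2} (V2 \<theta> t) *R pd F 2 (V2 \<theta> t)) = (LINT t|lborel. indicator {m..R} t *R pd F 2 (V2 \<theta> t))"
    proof (rule integral_cong_AE)
      \<comment> \<open>The half plane is open at height m while the interval of integration is
        closed there; the two indicators differ in this single point.\<close>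
      have "AE t in lborel. t \<noteq> m" by (rule AE_lborel_singleton)
      then show "AE t in lborel. indicator {x. m < x $ 2} (V2 \<theta> t) *R pd F 2 (V2 \<theta> t) = indicator {m..R} t *R pd F 2 (V2 \<theta> t)"
      proof (rule eventually_mono)
        fix t assume "t \<noteq> m"
        then show "indicator {x. m < x $ 2} (V2 \<theta> t) *R pd F 2 (V2 \<theta> t) = indicator {m..R} t *R pd F 2 (V2 \<theta> t)"
          using z(2)[of "V2 \<theta> t"] V2_norm(1)[of t \<theta>] R by (cases "t \<le> R") (auto simp: indicator_def)
      qed
      have [measurable]: "(\<lambda>t. pd F 2 (V2 \<theta> t)) \<in> borel_measurable borel"
        by (intro borel_measurable_continuous_onI continuous_on_compose2[OF c] V2_cont) auto
      show "(\<lambda>t. indicator {x. m < x $ 2} (V2 \<theta> t) *R pd F 2 (V2 \<theta> t)) \<in> borel_measurable lborel"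
        by (simp add: indicator_def of_bool_def) measurable
      show "(\<lambda>t. indicator {m..R} t *R pd F 2 (V2 \<theta> t)) \<in> borel_measurable lborel" by measurable
    qed
    ultimately show ?thesis by simp
  qed
  then show "(LINT x|lebesgue. indicator {x. m < x $ 2} x *R pd F 2 x) = - (LINT \<theta>|lborel. F (V2 \<theta> m))"
    unfolding eq integral_V2(1)[OF int] by simp
qed

lemma integral_frechet_zero:
  fixes f :: "real^2 => 'b::euclidean_space"
  assumes f: "C1_on f UNIV" and K: "compact K" "\<And>x. x \<notin> K ==> f x = 0"
  shows "(LINT x|lebesgue. frechet_derivative f (at x) v) = 0"
    and "integrable lebesgue (\<lambda>x. frechet_derivative f (at x) v)"
proof -
  have z: "frechet_derivative f (at x) = (\<lambda>v. 0)" if "x \<notin> K" for x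
    by (rule frechet_zero_outside[OF compact_imp_closed[OF K(1)] K(2) that])
  have i: "integrable lebesgue (\<lambda>x. frechet_derivative f (at x) v)" for v
  proof -
    have "lset_int K (\<lambda>x. frechet_derivative f (at x) v)"
      by (intro continuous_compact_set_integrable K continuous_on_subset[OF Ck1_deriv_continuous[OF f]]) auto
    then have "integrable lebesgue (\<lambda>x. indicator K x *R frechet_derivative f (at x) v)" by (simp add: set_integrable_def)
    moreover have "indicator K x *R frechet_derivative f (at x) v = frechet_derivative f (at x) v" for x
      using z[of x] by (auto simp: indicator_def)
    ultimately show ?thesis by simp
  qed
  then show "integrable lebesgue (\<lambda>x. frechet_derivative f (at x) v)" .
  obtain R where R: "R > 0" "K \<subseteq> cball 0 R" by (rule compact_subset_cball[OF K(1)])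
  \<comment> \<open>A height below the whole support, so that the half plane sees all of f and its
    boundary term vanishes.\<close>
  let ?m = "- R - 1"
  have low: "?m < x $ 2" if "x \<in> K" for x
  proof -
    have "norm x \<le> R" using R(2) that by (auto simp: subset_iff)
    then show ?thesis using component_le_norm_cart[of x 2] by linarith
  qed
  have h: "indicator {x. ?m < x $ 2} x *R pd f j x = pd f j x" for j x
    using low[of x] z[of x] by (cases "x \<in> K") auto
  have "f (V2 \<theta> ?m) = 0" for \<theta> using low[of "V2 \<theta> ?m"] by (intro K(2)) auto
  then have "(LINT x|lebesgue. pd f 1 x) = 0" "(LINT x|lebesgue. pd f 2 x) = 0"
    using half_plane_parts[OF f K, of ?m] unfolding h by simp_all
  moreover have "frechet_derivative f (at x) v = v $ 1 *R pd f 1 x + v $ 2 *R pd f 2 x" for x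
  proof -
    have l: "linear (frechet_derivative f (at x))" by (rule has_derivative_linear[OF Ck1_has_derivative[OF f]]) simp
    have "v = v $ 1 *R axis 1 1 + v $ 2 *R axis 2 1" using one_neq_two by (simp add: vec_eq_iff forall_2 axis_def)
    then have "frechet_derivative f (at x) v = frechet_derivative f (at x) (v $ 1 *R axis 1 1 + v $ 2 *R axis 2 1)" by simp
    also have "\<dots> = v $ 1 *R pd f 1 x + v $ 2 *R pd f 2 x" using l by (simp add: linear_add linear_cmul)
    finally show ?thesis .
  qed
  ultimately show "(LINT x|lebesgue. frechet_derivative f (at x) v) = 0" using i by simp
qed

lemma column_jacobian: "column j (jacobian w (at x)) = pd w j x" by (simp add: jacobian_def column_def matrix_def)

lemma jacobian_continuous:
  assumes "C1_on (w :: real^2 => real^'n) U"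
  shows "continuous_on U (\<lambda>x. jacobian w (at x))" unfolding jacobian_def matrix_def by (intro continuous_intros Ck1_deriv_continuous assms)

text \<open>The product of w and a test function, extended by zero, has derivatives of integral
  zero; the product rule turns this into the weak identity.\<close>

lemma Ck1_has_weak_grad:
  fixes w :: "real^2 => real^'n"
  assumes "open U" and w: "C1_on w U"
  shows "has_weak_grad U w (\<lambda>x. jacobian w (at x))"
proof (rule has_weak_gradI)
  show l: "loc_int U w" "loc_int U (\<lambda>x. jacobian w (at x))" unfolding loc_int_def
    by (auto intro!: continuous_compact_set_integrable continuous_on_subset[OF Ck1_continuous[OF w]]
      continuous_on_subset[OF jacobian_continuous[OF w]])
  fix \<phi> j assume \<phi>: "tst U \<phi>"
  obtain K where K: "compact K" "K \<subseteq> U" "\<And>x. x \<notin> K ==> \<phi> x = 0"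
    "\<And>x. x \<notin> K ==> frechet_derivative \<phi> (at x) = (\<lambda>v. 0)" using tst_supp[OF \<phi>] by blast
  let ?F = "\<lambda>x. \<phi> x *R w x"
  have F: "C1_on ?F UNIV"
  proof (rule Ck1_zero_ext[OF \<open>open U\<close> compact_imp_closed[OF K(1)] K(2)])
    show "C1_on ?F U" by (intro Ck1_scaleR assms Ck1_subset[OF tst_C1[OF \<phi>]]) auto
  qed (simp add: K(3))
  have pF: "pd ?F j x = pd \<phi> j x *R w x + \<phi> x *R column j (jacobian w (at x))" for x
  proof (cases "x \<in> K")
    case True
    then have "(?F has_derivative (\<lambda>v. \<phi> x *R frechet_derivative w (at x) v + frechet_derivative \<phi> (at x) v *R w x)) (at x)"
      using K(2) by (intro has_derivative_scaleR Ck1_has_derivative[OF tst_C1[OF \<phi>]] Ck1_has_derivative[OF w]) auto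
    from frechet_derivative_at[OF this, symmetric] show ?thesis unfolding column_jacobian by simp
  next
    case False
    then show ?thesis using frechet_zero_outside[OF compact_imp_closed[OF K(1)], of ?F x] K(3,4) by simp
  qed
  have "(LINT x|lebesgue. pd ?F j x) = 0" by (rule integral_frechet_zero(1)[OF F K(1)]) (simp add: K(3))
  then show "(LINT x|lebesgue. pd \<phi> j x *R w x) = - (LINT x|lebesgue. \<phi> x *R column j (jacobian w (at x)))" unfolding pF
    by (subst (asm) Bochner_Integration.integral_add[OF tst_integrable(2)[OF \<phi> l(1)] tst_integrable(1)[OF \<phi> loc_int_column[OF l(2)]]])
       (simp add: eq_neg_iff_add_eq_0)
qed

section \<open>Cutoffs and the product rule\<close>

lemma loc_int_scaleR:
  fixes f :: "real^2 => 'b::euclidean_space"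
  assumes f: "loc_int U f" and c: "continuous_on UNIV c"
  shows "loc_int U (\<lambda>x. c x *R f x)" unfolding loc_int_def
proof (intro allI impI)
  fix K assume K: "compact K" "K \<subseteq> U"
  obtain R where R: "R > 0" "K \<subseteq> cball 0 R" using compact_subset_cball[OF K(1)] by blast
  let ?\<eta> = "ball_cutoff 0 R (R+1)"
  have fK: "lset_int K f" using f K by (simp add: loc_int_def)
  have "integrable lebesgue (\<lambda>x. (?\<eta> x * c x) *R (indicator K x *R f x))"
  proof (rule continuous_supp_integrable[of "cball 0 (R+1)"])
    show "lset_int (cball 0 (R+1)) (\<lambda>x. indicator K x *R f x)"
      using fK unfolding set_integrable_def by (rule integrable_mult_indicator[rotated]) simp
    show "continuous_on UNIV (\<lambda>x. ?\<eta> x * c x)" using R by (intro continuous_intros c Ck1_continuous[OF ball_cutoff(1)]) auto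
    show "x \<notin> cball 0 (R+1) ==> ?\<eta> x * c x = 0" for x using R ball_cutoff(3)[of R "R+1" x 0] by auto
  qed simp
  moreover have "(?\<eta> x * c x) *R (indicator K x *R f x) = indicator K x *R (c x *R f x)" for x
    using R ball_cutoff(2)[of R "R+1" x 0] by (cases "x \<in> K") auto
  ultimately show "lset_int K (\<lambda>x. c x *R f x)" by (simp only: set_integrable_def)
qed

lemma loc_int_zero_ext:
  assumes f: "loc_int U f" and C: "closed C" "C \<subseteq> U" "\<And>x. x \<notin> C ==> f x = 0"
  shows "loc_int UNIV f" unfolding loc_int_def
proof (intro allI impI)
  fix K :: "(real^2) set" assume "compact K"
  then have "lset_int (K \<inter> C) f" using f C unfolding loc_int_def by (auto simp: compact_Int_closed)
  moreover have "indicator (K \<inter> C) x *R f x = indicator K x *R f x" for x using C(3)[of x] by (auto simp: indicator_def)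
  ultimately show "lset_int K f" by (simp add: set_integrable_def)
qed

lemma loc_int_add: "loc_int U f ==> loc_int U g ==> loc_int U (\<lambda>x. f x + g x)" unfolding loc_int_def by (simp add: set_integral_add)

lemma loc_int_diff: "loc_int U f ==> loc_int U g ==> loc_int U (\<lambda>x. f x - g x)" unfolding loc_int_def by (simp add: set_integral_diff)

text \<open>The rank-one matrix that the product rule adds to the gradient when a map is multiplied
  by a scalar function with partial derivatives d.\<close>

definition outer :: "real^'n => (2 => real) => real^2^'n" where
  "outer a d = (\<chi> i j. d j * a $ i)"

lemma column_outer: "column j (outer a d) = d j *R a" by (simp add: outer_def column_def vec_eq_iff)

lemma column_add: "column j (A + B) = column j A + column j B"
  and column_scaleR: "column j (c *R A) = c *R column j A" by (simp_all add: column_def vec_eq_iff)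

lemma outer_sum: "outer a d = (\<Sum>k\<in>UNIV. d k *R outer a (\<lambda>j. if j = k then 1 else 0))" by (simp add: outer_def vec_eq_iff sum_2 forall_2)

lemma bounded_linear_outer: "bounded_linear (\<lambda>a. outer a d)"
  by (rule linear_conv_bounded_linear[THEN iffD1], rule linearI) (auto simp: outer_def vec_eq_iff algebra_simps)

lemma loc_int_outer:
  assumes "loc_int U u" "\<And>j. continuous_on UNIV (d j)"
  shows "loc_int U (\<lambda>x. outer (u x) (\<lambda>j. d j x))"
proof -
  have "loc_int U (\<lambda>x. d 1 x *R outer (u x) (\<lambda>j. if j = 1 then 1 else 0) + d 2 x *R outer (u x) (\<lambda>j. if j = 2 then 1 else 0))"
    by (intro loc_int_add loc_int_scaleR loc_int_bounded_linear[OF bounded_linear_outer] assms)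
  then show ?thesis by (subst outer_sum) (simp add: sum_2)
qed

lemma frechet_derivative_mult_real:
  assumes "C1_on f UNIV" "C1_on (g :: 'a::euclidean_space => real) UNIV"
  shows "frechet_derivative (\<lambda>x. f x * g x) (at x) v
    = f x * frechet_derivative g (at x) v + frechet_derivative f (at x) v * g x"
  by (subst frechet_derivative_at[OF has_derivative_mult[OF Ck1_has_derivative[OF assms(1)] Ck1_has_derivative[OF assms(2)]], symmetric]) auto

text \<open>Brings a map on U to the whole plane, where convolution is available. The set C is
  closed and may be unbounded, as it is for cutoffs in the height on a cylinder; compactness comes
  from the test function.\<close>

lemma has_weak_grad_cutoff:
  fixes u :: "real^2 => real^'n"
  assumes D: "has_weak_grad U u Du" and \<zeta>: "C1_on \<zeta> UNIV"
    and C: "closed C" "C \<subseteq> U" "\<And>x. x \<notin> C ==> \<zeta> x = 0"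
  shows "has_weak_grad UNIV (\<lambda>x. \<zeta> x *R u x) (\<lambda>x. \<zeta> x *R Du x + outer (u x) (\<lambda>j. pd \<zeta> j x))"
proof -
  have c\<zeta>: "continuous_on UNIV \<zeta>" by (rule Ck1_continuous[OF \<zeta>])
  have l1: "loc_int U (\<lambda>x. \<zeta> x *R u x)" by (intro loc_int_scaleR has_weak_gradD(1)[OF D] c\<zeta>)
  have l2: "loc_int U (\<lambda>x. \<zeta> x *R Du x + outer (u x) (\<lambda>j. pd \<zeta> j x))"
    by (intro loc_int_add loc_int_scaleR loc_int_outer has_weak_gradD[OF D] c\<zeta> Ck1_deriv_continuous \<zeta>)
  have z: "frechet_derivative \<zeta> (at x) = (\<lambda>v. 0)" if "x \<notin> C" for x by (rule frechet_zero_outside[OF C(1,3) that])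
  have z2: "outer (u x) (\<lambda>j. pd \<zeta> j x) = 0" if "x \<notin> C" for x using z[OF that] by (simp add: outer_def vec_eq_iff)
  show ?thesis
  proof (rule has_weak_gradI)
    show L1: "loc_int UNIV (\<lambda>x. \<zeta> x *R u x)" by (rule loc_int_zero_ext[OF l1 C(1,2)]) (simp add: C(3))
    show L2: "loc_int UNIV (\<lambda>x. \<zeta> x *R Du x + outer (u x) (\<lambda>j. pd \<zeta> j x))" by (rule loc_int_zero_ext[OF l2 C(1,2)]) (simp add: C(3) z2)
    fix \<phi> :: "real^2 => real" and j assume \<phi>: "tst UNIV \<phi>"
    \<comment> \<open>The cutoff is moved onto the test function, which is thereby supported in U,
      so the identity for u itself applies.\<close>
    have t: "tst U (\<lambda>x. \<zeta> x * \<phi> x)" by (rule tst_mult[OF \<phi> \<zeta> C(1) _ C(3)]) (use C in auto)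
    note I = has_weak_gradD(3)[OF D t, of j, unfolded frechet_derivative_mult_real[OF \<zeta> tst_C1[OF \<phi>]] scaleR_add_left]
    have Cu: "integrable lebesgue (\<lambda>x. \<phi> x *R (pd \<zeta> j x *R u x))"
    proof (rule tst_integrable(1)[OF \<phi>], rule loc_int_zero_ext[OF _ C(1,2)])
      show "loc_int U (\<lambda>x. pd \<zeta> j x *R u x)" by (intro loc_int_scaleR has_weak_gradD[OF D] Ck1_deriv_continuous \<zeta>)
    qed (simp add: z)
    have Cd: "integrable lebesgue (\<lambda>x. pd \<phi> j x *R (\<zeta> x *R u x))" by (rule tst_integrable(2)[OF \<phi> L1])
    have CD: "integrable lebesgue (\<lambda>x. (\<zeta> x * \<phi> x) *R column j (Du x))"
      by (rule tst_integrable(1)[OF t loc_int_column[OF has_weak_gradD(2)[OF D]]])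
    have "(LINT x|lebesgue. pd \<phi> j x *R (\<zeta> x *R u x)) + (LINT x|lebesgue. \<phi> x *R (pd \<zeta> j x *R u x))
      = - (LINT x|lebesgue. (\<zeta> x * \<phi> x) *R column j (Du x))" using Cd Cu I by (simp add: mult.commute)
    moreover have "(LINT x|lebesgue. \<phi> x *R column j (\<zeta> x *R Du x + outer (u x) (\<lambda>j. pd \<zeta> j x)))
      = (LINT x|lebesgue. (\<zeta> x * \<phi> x) *R column j (Du x)) + (LINT x|lebesgue. \<phi> x *R (pd \<zeta> j x *R u x))"
      using CD Cu by (subst Bochner_Integration.integral_add[symmetric])
        (simp_all add: column_add column_scaleR column_outer scaleR_add_right mult.commute)
    ultimately show "(LINT x|lebesgue. pd \<phi> j x *R (\<zeta> x *R u x))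
      = - (LINT x|lebesgue. \<phi> x *R column j (\<zeta> x *R Du x + outer (u x) (\<lambda>j. pd \<zeta> j x)))" by (simp add: algebra_simps)
  qed
qed

section \<open>Mollification\<close>

definition bump :: "real => real^2 => real" where
  "bump r y = possq (r^2 - (norm y)^2)"

definition kern :: "real => real^2 => real" where
  "kern r y = bump r y / (LINT y|lebesgue. bump r y)"

definition moll :: "real => (real^2 => 'b::euclidean_space) => real^2 => 'b" where
  "moll r f x = (LINT z|lebesgue. kern r (x - z) *R f z)"

lemma bump_C1: "C1_on (bump r) UNIV" unfolding bump_def[abs_def] using Ck1_sqdist[of 0] by (intro Ck1_possq Ck1_diff Ck1_const) auto

lemma bump_ge: "bump r y \<ge> 0" by (simp add: bump_def possq_ge)

lemma bump_zero: "0 \<le> r ==> y \<notin> ball 0 r ==> bump r y = 0" unfolding bump_def by (intro possq_0) (auto intro!: power_mono)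

lemma bump_pos: "0 < r ==> y \<in> ball 0 r ==> bump r y > 0" unfolding bump_def possq_pos by (auto intro!: power_strict_mono)

lemma bump_integral_pos:
  assumes "0 < r"
  shows "(LINT y|lebesgue. bump r y) > 0" "integrable lebesgue (bump r)"
proof -
  have "lset_int (cball 0 r) (bump r)" by (intro continuous_compact_set_integrable continuous_on_subset[OF Ck1_continuous[OF bump_C1]]) auto
  moreover have "indicator (cball 0 r) y *R bump r y = bump r y" for y using bump_zero[of r y] assms by (auto simp: indicator_def)
  ultimately show i: "integrable lebesgue (bump r)" by (simp only: set_integrable_def)
  have "\<not> (AE y in lebesgue. bump r y = 0)"
  proof
    assume "AE y in lebesgue. bump r y = 0"
    then have "AE y::real^2 in lebesgue. y \<notin> ball 0 r" by (rule eventually_mono) (use bump_pos[OF assms] in force)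
    then have "ball (0::real^2) r \<in> null_sets lebesgue" by (subst AE_iff_null_sets) auto
    then show False using assms open_not_negligible[of "ball (0::real^2) r"] negligible_iff_null_sets by auto
  qed
  then have "(LINT y|lebesgue. bump r y) \<noteq> 0" using integral_nonneg_eq_0_iff_AE[OF i] bump_ge by simp
  moreover have "(LINT y|lebesgue. bump r y) \<ge> 0" by (rule integral_nonneg_AE) (simp add: bump_ge)
  ultimately show "(LINT y|lebesgue. bump r y) > 0" by linarith
qed

lemma kern_C1: "C1_on (kern r) UNIV" unfolding kern_def[abs_def] divide_inverse by (intro Ck1_mult Ck1_const bump_C1) auto

lemma kern_cont: "continuous_on UNIV (kern r)" by (rule Ck1_continuous[OF kern_C1])

lemma kern_ge: "0 < r ==> kern r y \<ge> 0" using bump_integral_pos(1)[of r] bump_ge[of r y] by (simp add: kern_def)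

lemma kern_zero: "0 < r ==> y \<notin> ball 0 r ==> kern r y = 0" by (simp add: kern_def bump_zero)

lemma kern_integral:
  assumes "0 < r"
  shows "integrable lebesgue (kern r)" "(LINT y|lebesgue. kern r y) = 1"
    "integrable lebesgue (\<lambda>z. kern r (x - z))" "(LINT z|lebesgue. kern r (x - z)) = 1"
proof -
  note p = bump_integral_pos[OF assms]
  show 1: "integrable lebesgue (kern r)" unfolding kern_def[abs_def] using p(2) by simp
  show 2: "(LINT y|lebesgue. kern r y) = 1" unfolding kern_def[abs_def] using p by simp
  show "integrable lebesgue (\<lambda>z. kern r (x - z))" using integrable_affine[of "-1" "kern r" x] 1 by simp
  show "(LINT z|lebesgue. kern r (x - z)) = 1" using integral_affine[of "-1" "kern r" x] 2 by simp
qed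

text \<open>The chain rule for \<open>possq\<close> applied to r^2 - |y|^2, with an explicit
  quadratic error. Here h is the increment of that argument, and |k| \<le> 1 bounds h linearly in
  |k|.\<close>

lemma possq_quad_bump:
  assumes "norm k \<le> 1"
  shows "\<bar>bump r (y + k) - bump r y - (- 4 * max 0 (r^2 - (norm y)^2) * (y \<bullet> k))\<bar>
    \<le> ((2 * norm y + 1)^2 + 2 * r^2) * (norm k)^2"
proof -
  define a where "a = r^2 - (norm y)^2"
  define h where "h = - 2 * (y \<bullet> k) - (norm k)^2"
  have e: "r\<^sup>2 - (norm (y + k))^2 = a + h" by (simp add: a_def h_def power2_norm_eq_inner inner_add_left inner_add_right inner_commute)
  have "\<bar>h\<bar> \<le> 2 * \<bar>y \<bullet> k\<bar> + (norm k)^2" using zero_le_power2[of "norm k"] abs_ge_self[of "y \<bullet> k"] abs_ge_minus_self[of "y \<bullet> k"]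
    unfolding h_def abs_le_iff by linarith
  also have "\<dots> \<le> 2 * (norm y * norm k) + norm k * norm k" using Cauchy_Schwarz_ineq2[of y k] by (simp add: power2_eq_square)
  also have "\<dots> \<le> (2 * norm y + 1) * norm k" using mult_right_mono[OF assms, of "norm k"] by (simp add: algebra_simps)
  finally have "\<bar>h\<bar> \<le> (2 * norm y + 1) * norm k" .
  then have h2: "h\<^sup>2 \<le> (2 * norm y + 1)^2 * (norm k)^2"
    using power_mono[of "\<bar>h\<bar>" "(2 * norm y + 1) * norm k" 2] by (simp add: power_mult_distrib)
  have m: "0 \<le> max 0 a" "max 0 a \<le> r^2" by (auto simp: a_def)
  have "bump r (y + k) - bump r y - (- 4 * max 0 a * (y \<bullet> k))
    = (possq (a + h) - possq a - 2 * max 0 a * h) - 2 * max 0 a * (norm k)^2"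
    unfolding bump_def e by (simp add: a_def[symmetric] h_def algebra_simps)
  then have "\<bar>bump r (y + k) - bump r y - (- 4 * max 0 a * (y \<bullet> k))\<bar>
    \<le> \<bar>possq (a + h) - possq a - 2 * max 0 a * h\<bar> + \<bar>2 * max 0 a * (norm k)^2\<bar>" by linarith
  also have "\<bar>2 * max 0 a * (norm k)^2\<bar> \<le> 2 * r^2 * (norm k)^2" using m by (auto simp: abs_mult intro!: mult_mono)
  also note order_trans[OF possq_quad[of a h] h2]
  finally show ?thesis by (simp add: a_def algebra_simps)
qed

text \<open>The derivative of \<open>kern\<close> in closed form; continuity and support can then be
  read off directly.\<close>

definition dkern :: "real => real^2 => real^2 => real" where
  "dkern r y v = - 4 * max 0 (r^2 - (norm y)^2) / (LINT y|lebesgue. bump r y) * (y \<bullet> v)"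

lemma dkern_linear: "linear (dkern r y)"
  unfolding dkern_def by (rule linearI) (simp_all only: inner_add_right inner_scaleR_right distrib_left mult.left_commute real_scaleR_def)

lemma dkern_zero: "0 < r ==> y \<notin> ball 0 r ==> dkern r y v = 0" by (auto simp: dkern_def max_def intro: power_mono)

lemma dkern_cont: "continuous_on UNIV (\<lambda>y. dkern r y v)" unfolding dkern_def divide_inverse by (intro continuous_intros)

text \<open>One constant for all y: if |y| > r + 1 and |k| \<le> 1, then y and y + k both lie
  outside the kernel's ball and every term vanishes, so |y| may be replaced by r + 1 in the error
  bound.\<close>

lemma kern_quad:
  assumes "0 < r"
  obtains C where "C \<ge> 0" "\<And>y k. norm k \<le> 1 ==> \<bar>kern r (y + k) - kern r y - dkern r y k\<bar> \<le> C * (norm k)^2"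
proof -
  define c where "c = (LINT y|lebesgue. bump r y)"
  have c: "c > 0" unfolding c_def by (rule bump_integral_pos[OF assms])
  define C where "C = ((2 * (r+1) + 1)^2 + 2 * r^2) / c"
  have "\<bar>kern r (y + k) - kern r y - dkern r y k\<bar> \<le> C * (norm k)^2" if k: "norm k \<le> 1" for y k
  proof (cases "norm y \<le> r + 1")
    case True
    have e: "kern r (y + k) - kern r y - dkern r y k
      = (bump r (y + k) - bump r y - (- 4 * max 0 (r^2 - (norm y)^2) * (y \<bullet> k))) / c"
      using c unfolding kern_def dkern_def c_def[symmetric] by (simp add: field_simps)
    have "\<bar>bump r (y + k) - bump r y - (- 4 * max 0 (r^2 - (norm y)^2) * (y \<bullet> k))\<bar>
      \<le> ((2 * norm y + 1)^2 + 2 * r^2) * (norm k)^2" by (rule possq_quad_bump[OF k])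
    also have "\<dots> \<le> ((2 * (r+1) + 1)^2 + 2 * r^2) * (norm k)^2" using True by (intro mult_right_mono add_right_mono power_mono) auto
    finally show ?thesis unfolding e C_def using c by (simp add: abs_divide divide_right_mono)
  next
    case False
    have "norm y \<le> norm (y + k) + norm k" using norm_triangle_ineq4[of "y + k" k] by simp
    then have "norm (y + k) \<ge> r" "norm y \<ge> r" using False k by auto
    then show ?thesis using assms kern_zero[of r] dkern_zero[of r y k] c by (simp add: C_def)
  qed
  moreover have "C \<ge> 0" using c by (simp add: C_def)
  ultimately show ?thesis using that by blast
qed

lemma kern_has_derivative:
  assumes "0 < r"
  shows "(kern r has_derivative dkern r y) (at y)"
proof -
  obtain C where C: "C \<ge> 0" "\<And>y k. norm k \<le> 1 ==> \<bar>kern r (y + k) - kern r y - dkern r y k\<bar> \<le> C * (norm k)^2"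
    using kern_quad[OF assms] by metis
  show ?thesis
  proof (rule has_derivativeI_sandwich[of 1 _ _ _ _ "\<lambda>z. C * norm (z - y)"])
    show "bounded_linear (dkern r y)" using dkern_linear by (simp add: linear_conv_bounded_linear)
    show "((\<lambda>z. C * norm (z - y)) \<longlongrightarrow> 0) (at y)" by (rule tendsto_eq_intros refl)+ simp
    fix z assume z: "z \<noteq> y" "dist z y < 1"
    have "\<bar>kern r z - kern r y - dkern r y (z - y)\<bar> \<le> C * (norm (z - y))^2" using C(2)[of "z - y" y] z by (simp add: dist_norm)
    then show "norm (kern r z - kern r y - dkern r y (z - y)) / norm (z - y) \<le> C * norm (z - y)"
      using z by (simp add: divide_le_eq power2_eq_square)
  qed simp
qed

lemma conv_integrable:
  fixes f :: "real^2 => 'b::euclidean_space"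
  assumes f: "loc_int UNIV f" and g: "continuous_on UNIV g" "\<And>y. y \<notin> ball 0 r ==> g y = 0"
  shows "integrable lebesgue (\<lambda>z. g (x - z) *R f z)"
proof (rule continuous_supp_integrable[of "cball x r"])
  show "lset_int (cball x r) f" using f by (simp add: loc_int_def)
  show "continuous_on UNIV (\<lambda>z. g (x - z))" by (intro continuous_on_compose2[OF g(1)] continuous_intros) auto
  show "z \<notin> cball x r ==> g (x - z) = 0" for z by (rule g(2)) (auto simp: dist_norm norm_minus_commute)
qed auto

text \<open>A convergent sequence of centres is bounded, so all translated kernels live in one ball,
  over which |f| is integrable and serves as dominating function.\<close>

lemma conv_continuous:
  fixes f :: "real^2 => 'b::euclidean_space"
  assumes f: "loc_int UNIV f" and g: "continuous_on UNIV g" "\<And>y. y \<notin> ball 0 r ==> g y = 0"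
  shows "continuous_on UNIV (\<lambda>x. LINT z|lebesgue. g (x - z) *R f z)"
proof -
  have "bounded (g ` cball 0 r)" by (intro compact_imp_bounded compact_continuous_image continuous_on_subset[OF g(1)]) auto
  then obtain B where B: "B > 0" "\<And>y. y \<in> cball 0 r ==> \<bar>g y\<bar> \<le> B" by (auto simp: bounded_pos)
  have B': "\<bar>g y\<bar> \<le> B" for y using B g(2)[of y] by (cases "y \<in> cball 0 r") auto
  have "(\<lambda>n. LINT z|lebesgue. g (X n - z) *R f z) \<longlonglongrightarrow> (LINT z|lebesgue. g (x - z) *R f z)"
    if X: "X \<longlonglongrightarrow> x" for X x
  proof -
    obtain R where R: "\<And>n. norm (X n) \<le> R" using convergent_imp_bounded[OF X] by (auto simp: bounded_iff)
    have fi: "integrable lebesgue (\<lambda>z. indicator (cball 0 (R + r)) z *R f z)" using f by (simp add: loc_int_def set_integrable_def)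
    show ?thesis
    proof (rule integral_dominated_convergence[where w="\<lambda>z. B * norm (indicator (cball 0 (R + r)) z *R f z)"])
      show "(\<lambda>z. g (y - z) *R f z) \<in> borel_lebesgue" for y by (rule borel_measurable_integrable[OF conv_integrable[OF f g]])
      then show "(\<lambda>z. g (X n - z) *R f z) \<in> borel_lebesgue" for n .
      show "integrable lebesgue (\<lambda>z. B * norm (indicator (cball 0 (R + r)) z *R f z))" using integrable_norm[OF fi] by simp
      show "AE z in lebesgue. norm (g (X n - z) *R f z) \<le> B * norm (indicator (cball 0 (R + r)) z *R f z)" for n
      proof (rule AE_I2)
        fix z
        show "norm (g (X n - z) *R f z) \<le> B * norm (indicator (cball 0 (R + r)) z *R f z)"
        proof (cases "z \<in> cball 0 (R + r)")
          case True then show ?thesis using B' by (auto intro!: mult_right_mono)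
        next
          case False
          have "norm z \<le> norm (X n) + norm (X n - z)" using norm_triangle_ineq4[of "X n" "X n - z"] by simp
          then have "norm (X n - z) \<ge> r" using R[of n] False by auto
          then show ?thesis using g(2) B by simp
        qed
      qed
      show "AE z in lebesgue. (\<lambda>n. g (X n - z) *R f z) \<longlonglongrightarrow> g (x - z) *R f z"
        by (intro AE_I2 tendsto_intros X continuous_on_tendsto_compose[OF g(1)]) auto
    qed
  qed
  then show ?thesis unfolding continuous_on_sequentially by (auto simp: o_def)
qed

text \<open>Differentiation under the integral sign: the error of \<open>kern_quad\<close> is at
  most C |y - x|^2, uniformly in z, and is integrated against |f| over one ball containing both
  kernels.\<close>

lemma moll_C1:
  fixes f :: "real^2 => 'b::euclidean_space"
  assumes f: "loc_int UNIV f" and r: "0 < r"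
  shows "C1_on (moll r f) UNIV"
    and "frechet_derivative (moll r f) (at x) v = (LINT z|lebesgue. dkern r (x - z) v *R f z)"
proof -
  obtain C where C: "C \<ge> 0" "\<And>y k. norm k \<le> 1 ==> \<bar>kern r (y + k) - kern r y - dkern r y k\<bar> \<le> C * (norm k)^2" using kern_quad[OF r] by metis
  have ik: "integrable lebesgue (\<lambda>z. kern r (x - z) *R f z)" for x by (rule conv_integrable[OF f kern_cont kern_zero[OF r]])
  have id: "integrable lebesgue (\<lambda>z. dkern r (x - z) v *R f z)" for x v by (rule conv_integrable[OF f dkern_cont dkern_zero[OF r]])
  have D: "(moll r f has_derivative (\<lambda>v. LINT z|lebesgue. dkern r (x - z) v *R f z)) (at x)" for x
  proof -
    define I where "I = (LINT z|lebesgue. norm (indicator (cball x (r + 1)) z *R f z))"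
    have fi: "integrable lebesgue (\<lambda>z. norm (indicator (cball x (r + 1)) z *R f z))"
      using f by (intro integrable_norm) (simp add: loc_int_def set_integrable_def)
    show ?thesis
    proof (rule has_derivativeI_sandwich[of 1 _ _ _ _ "\<lambda>y. C * I * norm (y - x)"])
      show "((\<lambda>y. C * I * norm (y - x)) \<longlongrightarrow> 0) (at x)" by (rule tendsto_eq_intros refl)+ simp
      have "linear (\<lambda>v. LINT z|lebesgue. dkern r (x - z) v *R f z)"
      proof (rule linearI)
        fix v w :: "real^2" and c :: real
        have "dkern r y (v + w) = dkern r y v + dkern r y w" "dkern r y (c *R v) = c * dkern r y v" for y
          using linear_add[OF dkern_linear] linear_cmul[OF dkern_linear] by simp_all
        then show "(LINT z|lebesgue. dkern r (x - z) (v + w) *R f z) =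
          (LINT z|lebesgue. dkern r (x - z) v *R f z) + (LINT z|lebesgue. dkern r (x - z) w *R f z)"
          "(LINT z|lebesgue. dkern r (x - z) (c *R v) *R f z) = c *R (LINT z|lebesgue. dkern r (x - z) v *R f z)"
          using id by (simp_all add: scaleR_add_left flip: scaleR_scaleR)
      qed
      then show "bounded_linear (\<lambda>v. LINT z|lebesgue. dkern r (x - z) v *R f z)" by (simp add: linear_conv_bounded_linear)
      fix y assume y: "y \<noteq> x" "dist y x < 1"
      let ?q = "\<lambda>z. kern r (y - z) - kern r (x - z) - dkern r (x - z) (y - x)"
      have "norm (moll r f y - moll r f x - (LINT z|lebesgue. dkern r (x - z) (y - x) *R f z))
        = norm (LINT z|lebesgue. ?q z *R f z)" unfolding moll_def using ik id by (simp add: scaleR_diff_left)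
      also have "\<dots> \<le> (LINT z|lebesgue. C * (norm (y - x))^2 * norm (indicator (cball x (r + 1)) z *R f z))"
      proof (rule Bochner_Integration.integral_norm_bound_integral)
        show "integrable lebesgue (\<lambda>z. ?q z *R f z)" using ik id by (simp add: scaleR_diff_left)
        show "integrable lebesgue (\<lambda>z. C * (norm (y - x))^2 * norm (indicator (cball x (r + 1)) z *R f z))" using fi by simp
        fix z
        show "norm (?q z *R f z) \<le> C * (norm (y - x))^2 * norm (indicator (cball x (r + 1)) z *R f z)"
        proof (cases "z \<in> cball x (r + 1)")
          case True
          have "\<bar>?q z\<bar> \<le> C * (norm (y - x))^2" using C(2)[of "y - x" "x - z"] y by (simp add: dist_norm)
          then show ?thesis using True by (auto intro!: mult_right_mono)
        next
          case False
          have "norm (x - z) \<le> norm (y - z) + norm (y - x)" using norm_triangle_ineq4[of "y - z" "y - x"] by simp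
          then have "norm (y - z) \<ge> r" "norm (x - z) \<ge> r" using False y by (auto simp: dist_norm)
          then show ?thesis using False r kern_zero[of r] dkern_zero[of r "x - z"] by simp
        qed
      qed
      also have "\<dots> = C * (norm (y - x))^2 * I" unfolding I_def using fi by simp
      finally show "norm (moll r f y - moll r f x - (LINT z|lebesgue. dkern r (x - z) (y - x) *R f z)) / norm (y - x)
        \<le> C * I * norm (y - x)" using y by (simp add: divide_le_eq power2_eq_square mult.assoc mult.commute mult.left_commute)
    qed simp
  qed
  show "C1_on (moll r f) UNIV" by (rule Ck1I[OF _ D]) (auto intro: conv_continuous[OF f dkern_cont dkern_zero[OF r]])
  show "frechet_derivative (moll r f) (at x) v = (LINT z|lebesgue. dkern r (x - z) v *R f z)"
    by (subst frechet_derivative_at[OF D, symmetric]) simp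
qed

text \<open>For fixed x the function z -> kern r (x - z) is a test function whose derivative is
  minus that of the kernel, so the definition of a weak gradient moves the derivative from the
  kernel to f.\<close>

lemma moll_jacobian:
  fixes f :: "real^2 => real^'n"
  assumes D: "has_weak_grad UNIV f Df" and r: "0 < r"
  shows "jacobian (moll r f) (at x) = moll r Df x"
proof -
  have "column j (jacobian (moll r f) (at x)) = column j (moll r Df x)" for j
  proof -
    let ?\<phi> = "\<lambda>z. kern r (x - z)"
    have "C1_on (\<lambda>z. x - z) UNIV" by (intro Ck1_diff Ck1_const Ck1_bounded_linear) (auto intro: bounded_linear_ident)
    then have C: "C1_on ?\<phi> UNIV" by (intro Ck1_compose[OF _ _ kern_C1]) auto
    have t: "tst UNIV ?\<phi>" unfolding tst_def
      using C kern_zero[OF r] by (intro conjI exI[of _ "cball x r"]) (auto simp: dist_norm norm_minus_commute)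
    have d: "pd ?\<phi> j z = - dkern r (x - z) (axis j 1)" for z
    proof -
      have "(?\<phi> has_derivative (\<lambda>v. dkern r (x - z) (- v))) (at z)"
        by (rule has_derivative_compose[OF _ kern_has_derivative[OF r]]) (auto intro!: derivative_eq_intros)
      then show ?thesis by (subst frechet_derivative_at[symmetric]) (auto simp: dkern_def)
    qed
    have "column j (jacobian (moll r f) (at x)) = (LINT z|lebesgue. dkern r (x - z) (axis j 1) *R f z)"
      unfolding column_jacobian by (rule moll_C1(2)[OF has_weak_gradD(1)[OF D] r])
    also have "\<dots> = (LINT z|lebesgue. ?\<phi> z *R column j (Df z))" using has_weak_gradD(3)[OF D t, of j] unfolding d by simp
    also have "\<dots> = (LINT z|lebesgue. column j (?\<phi> z *R Df z))" by (simp add: column_scaleR)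
    also have "\<dots> = column j (moll r Df x)" unfolding moll_def by (rule integral_bounded_linear[OF column_blinear])
         (rule conv_integrable[OF has_weak_gradD(2)[OF D] kern_cont kern_zero[OF r]])
    finally show ?thesis .
  qed
  then show ?thesis by (simp add: vec_eq_iff column_def)
qed

text \<open>Smoothing commutes with translations; this is what keeps lifts of maps on the cylinder
  periodic.\<close>

lemma moll_periodic:
  assumes "\<And>x. f (x + p) = f x"
  shows "moll r f (x + p) = moll r f x" using integral_affine[of 1 "\<lambda>z. kern r (x + p - z) *R f z" p] assms
  by (simp add: moll_def algebra_simps)

lemma sq_integrable_imp_set_integrable:
  fixes f :: "'a::euclidean_space => 'b::euclidean_space"
  assumes K: "K \<in> lmeasurable" and f: "(\<lambda>x. indicator K x *R f x) \<in> borel_lebesgue"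
    and s: "lset_int K (\<lambda>x. (norm (f x))^2)"
  shows "lset_int K f" unfolding set_integrable_def
proof (rule Bochner_Integration.integrable_bound[OF _ f])
  show "integrable lebesgue (\<lambda>x. indicator K x + indicator K x *R (norm (f x))^2)"
    using s K unfolding set_integrable_def by (intro Bochner_Integration.integrable_add) (auto simp: fmeasurable_def)
  show "AE x in lebesgue. norm (indicator K x *R f x) \<le> norm (indicator K x + indicator K x *R (norm (f x))^2)"
  proof (rule AE_I2)
    fix x
    have "2 * norm (f x) \<le> (norm (f x))^2 + 1" using sum_squares_bound[of "norm (f x)" 1] by simp
    then have "norm (f x) \<le> 1 + (norm (f x))^2" using norm_ge_zero[of "f x"] by linarith
    then show "norm (indicator K x *R f x) \<le> norm (indicator K x + indicator K x *R (norm (f x))^2)" by (auto simp: indicator_def)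
  qed
qed

lemma ennreal3: "0 \<le> y ==> 3 * ennreal y = ennreal (3 * y)" by (simp add: ennreal_mult)

definition nn2 :: "('a::euclidean_space => 'b::euclidean_space) => ennreal" where
  "nn2 f = (\<integral>\<^sup>+x. ennreal ((norm (f x))^2) \<partial>lebesgue)"

lemma norm_add3_sq: "(norm (a + b + c))^2 \<le> 3 * ((norm a)^2 + (norm b)^2 + (norm (c::'a::real_normed_vector))^2)"
proof -
  have "norm (a + b + c) \<le> norm a + norm b + norm c" using norm_triangle_ineq[of "a + b" c] norm_triangle_ineq[of a b] by linarith
  then have "(norm (a + b + c))^2 \<le> (norm a + norm b + norm c)^2" by (intro power_mono) auto
  also have "\<dots> \<le> 3 * ((norm a)^2 + (norm b)^2 + (norm c)^2)"
    using sum_squares_bound[of "norm a" "norm b"] sum_squares_bound[of "norm a" "norm c"] sum_squares_bound[of "norm b" "norm c"]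
    by (simp add: power2_eq_square algebra_simps)
  finally show ?thesis .
qed

text \<open>Jensen's inequality for the probability density \<open>kern r (x - \<cdot>)\<close>, followed by Tonelli.\<close>

lemma moll_contraction:
  fixes f :: "real^2 => 'b::euclidean_space"
  assumes f: "integrable lebesgue f" "integrable lebesgue (\<lambda>x. (norm (f x))^2)" and r: "0 < r"
  shows "nn2 (moll r f) \<le> nn2 f"
proof -
  have li: "loc_int UNIV g" if "integrable lebesgue g" for g :: "real^2 => 'c::euclidean_space"
    using that unfolding loc_int_def set_integrable_def by (auto intro!: integrable_mult_indicator fmeasurableD lmeasurable_compact)
  have ci: "integrable lebesgue (\<lambda>z. kern r (x - z) *R g z)" if "integrable lebesgue g" for x and g :: "real^2 => 'c::euclidean_space"
    by (rule conv_integrable[OF li[OF that] kern_cont kern_zero[OF r]])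
  \<comment> \<open>Tonelli's theorem is applied over the Borel product measure, so the square of
    |f| is first replaced by a Borel version.\<close>
  obtain g' where g': "g' \<in> borel_measurable lborel" "AE x in lborel. (norm (f x))^2 = g' x"
    using completion_ex_borel_measurable_real[OF borel_measurable_integrable[OF f(2)]] by blast
  define g where "g x = ennreal (g' x)" for x
  have gm[measurable]: "g \<in> borel_measurable borel" using g'(1) unfolding g_def by simp
  have ae: "AE x in lebesgue. ennreal ((norm (f x))^2) = g x" using AE_completion[OF g'(2)] by eventually_elim (simp add: g_def)
  have km[measurable]: "kern r \<in> borel_measurable borel" by (rule borel_measurable_continuous_onI[OF kern_cont])
  have pt: "ennreal ((norm (moll r f x))^2) \<le> (\<integral>\<^sup>+z. ennreal (kern r (x - z)) * g z \<partial>lborel)" for x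
  proof -
    define m where "m = (LINT z|lebesgue. kern r (x - z) * norm (f z))"
    have i1: "integrable lebesgue (\<lambda>z. kern r (x - z) * norm (f z))" using ci[OF integrable_norm[OF f(1)]] by simp
    have i2: "integrable lebesgue (\<lambda>z. kern r (x - z) * (norm (f z))^2)" using ci[OF f(2)] by simp
    have k: "integrable lebesgue (\<lambda>z. kern r (x - z))" "(LINT z|lebesgue. kern r (x - z)) = 1" using kern_integral(3,4)[OF r] by simp_all
    have "norm (moll r f x) \<le> m"
    proof -
      have "norm (moll r f x) \<le> (LINT z|lebesgue. norm (kern r (x - z) *R f z))" unfolding moll_def by (rule integral_norm_bound)
      also have "\<dots> = m" unfolding m_def using kern_ge[OF r] by simp
      finally show ?thesis .
    qed
    then have "(norm (moll r f x))^2 \<le> m^2" by (intro power_mono) auto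
    also have "\<dots> \<le> (LINT z|lebesgue. kern r (x - z) * (norm (f z))^2)"
    proof -
      \<comment> \<open>Jensen's inequality for the square is the nonnegativity of the variance of
        |f| under the probability density given by the kernel.\<close>
      have "0 \<le> (LINT z|lebesgue. kern r (x - z) * (norm (f z) - m)^2)" by (rule integral_nonneg_AE) (simp add: kern_ge[OF r])
      also have "\<dots> = (LINT z|lebesgue. kern r (x - z) * (norm (f z))^2 - 2 * m * (kern r (x - z) * norm (f z)) + m^2 * kern r (x - z))"
        by (simp add: power2_diff algebra_simps)
      also have "\<dots> = (LINT z|lebesgue. kern r (x - z) * (norm (f z))^2) - 2 * m * m + m^2" using i1 i2 k by (simp add: m_def)
      finally show ?thesis by (simp add: power2_eq_square)
    qed
    finally have "ennreal ((norm (moll r f x))^2) \<le> ennreal (LINT z|lebesgue. kern r (x - z) * (norm (f z))^2)" by (rule ennreal_leI)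
    also have "\<dots> = (\<integral>\<^sup>+z. ennreal (kern r (x - z) * (norm (f z))^2) \<partial>lebesgue)"
      by (rule nn_integral_eq_integral[symmetric, OF i2]) (simp add: kern_ge[OF r])
    also have "\<dots> = (\<integral>\<^sup>+z. ennreal (kern r (x - z)) * g z \<partial>lebesgue)"
      by (rule nn_integral_cong_AE) (use ae in eventually_elim, simp add: ennreal_mult kern_ge[OF r])
    also have "\<dots> = (\<integral>\<^sup>+z. ennreal (kern r (x - z)) * g z \<partial>lborel)" by (rule nn_integral_completion)
    finally show ?thesis .
  qed
  have mc: "continuous_on UNIV (moll r f)" by (rule Ck1_continuous[OF moll_C1(1)[OF li[OF f(1)] r]])
  have "nn2 (moll r f) = (\<integral>\<^sup>+x. ennreal ((norm (moll r f x))^2) \<partial>lborel)" unfolding nn2_def by (rule nn_integral_completion)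
  also have "\<dots> \<le> (\<integral>\<^sup>+x. \<integral>\<^sup>+z. ennreal (kern r (x - z)) * g z \<partial>lborel \<partial>lborel)" by (intro nn_integral_mono pt)
  also have "\<dots> = (\<integral>\<^sup>+z. \<integral>\<^sup>+x. ennreal (kern r (x - z)) * g z \<partial>lborel \<partial>lborel)" by (rule lborel_pair.Fubini'[symmetric]) simp
  also have "\<dots> = (\<integral>\<^sup>+z. g z \<partial>lborel)"
  proof (rule nn_integral_cong)
    fix z
    have "(\<integral>\<^sup>+x. ennreal (kern r (x - z)) \<partial>lborel) = (\<integral>\<^sup>+x. ennreal (kern r (x - z)) \<partial>lebesgue)" by (rule nn_integral_completion[symmetric])
    also have "\<dots> = ennreal (LINT x|lebesgue. kern r (x - z))"
      using integrable_affine[of 1 "kern r" "-z"] kern_integral(1)[OF r] kern_ge[OF r] by (intro nn_integral_eq_integral) auto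
    also have "\<dots> = 1" using integral_affine[of 1 "kern r" "-z"] kern_integral(2)[OF r] by simp
    finally show "(\<integral>\<^sup>+x. ennreal (kern r (x - z)) * g z \<partial>lborel) = g z" by (subst nn_integral_multc) auto
  qed
  also have "\<dots> = (\<integral>\<^sup>+z. g z \<partial>lebesgue)" by (rule nn_integral_completion[symmetric])
  also have "\<dots> = nn2 f" unfolding nn2_def by (rule nn_integral_cong_AE) (use ae in eventually_elim, simp)
  finally show ?thesis .
qed

lemma nn2_tendsto:
  fixes s :: "nat => 'a::euclidean_space => 'b::euclidean_space"
  assumes "integrable lebesgue w" "\<And>n. s n \<in> borel_lebesgue"
    and b: "\<And>n. AE x in lebesgue. (norm (s n x))^2 \<le> w x"
    and lim: "AE x in lebesgue. (\<lambda>n. s n x) \<longlonglongrightarrow> 0"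
  shows "(\<lambda>n. nn2 (s n)) \<longlonglongrightarrow> 0"
proof -
  have i: "integrable lebesgue (\<lambda>x. (norm (s n x))^2)" for n
    by (rule Bochner_Integration.integrable_bound[OF assms(1)]) (use assms(2) b[of n] in \<open>auto elim!: eventually_mono\<close>)
  have "(\<lambda>n. LINT x|lebesgue. (norm (s n x))^2) \<longlonglongrightarrow> (LINT x::'a|lebesgue. (0::real))"
  proof (rule integral_dominated_convergence[where w=w])
    show "AE x in lebesgue. (\<lambda>n. (norm (s n x))^2) \<longlonglongrightarrow> 0" using lim by (rule eventually_mono) (auto intro!: tendsto_eq_intros)
    show "AE x in lebesgue. norm ((norm (s n x))^2) \<le> w x" for n using b[of n] by simp
  qed (use assms(1,2) in auto)
  then have "(\<lambda>n. ennreal (LINT x|lebesgue. (norm (s n x))^2)) \<longlonglongrightarrow> ennreal 0" by (intro tendsto_ennrealI) simp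
  moreover have "nn2 (s n) = ennreal (LINT x|lebesgue. (norm (s n x))^2)" for n
    unfolding nn2_def by (rule nn_integral_eq_integral[OF i]) simp
  ultimately show ?thesis by simp
qed

lemma lebesgue_continuous_approx:
  fixes f :: "'a::euclidean_space => 'b::euclidean_space"
  assumes "f \<in> borel_lebesgue"
  obtains g where "\<And>n. continuous_on UNIV (g n)" "AE x in lebesgue. (\<lambda>n. g n x) \<longlonglongrightarrow> f x"
proof -
  have "f measurable_on UNIV" using assms by (simp add: lebesgue_measurable_imp_measurable_on)
  then obtain N g where N: "negligible N" "\<And>n. continuous_on UNIV (g n)"
    "\<And>x. x \<notin> N ==> (\<lambda>n. g n x) \<longlonglongrightarrow> f x" unfolding measurable_on_def by auto
  then have "AE x in lebesgue. (\<lambda>n. g n x) \<longlonglongrightarrow> f x" by (intro AE_I'[of N]) (auto simp: negligible_iff_null_sets)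
  then show ?thesis using that N(2) by blast
qed

lemma nn2_triangle3:
  assumes "f \<in> borel_lebesgue" "g \<in> borel_lebesgue" "h \<in> borel_lebesgue"
  shows "nn2 (\<lambda>x. f x + g x + h x) \<le> 3 * (nn2 f + nn2 g + nn2 h)"
proof -
  have "nn2 (\<lambda>x. f x + g x + h x)
    \<le> (\<integral>\<^sup>+x. 3 * (ennreal ((norm (f x))^2) + ennreal ((norm (g x))^2) + ennreal ((norm (h x))^2)) \<partial>lebesgue)" unfolding nn2_def
  proof (rule nn_integral_mono)
    fix x
    have "ennreal ((norm (f x + g x + h x))^2) \<le> ennreal (3 * ((norm (f x))^2 + (norm (g x))^2 + (norm (h x))^2))"
      by (intro ennreal_leI norm_add3_sq)
    then show "ennreal ((norm (f x + g x + h x))^2)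
      \<le> 3 * (ennreal ((norm (f x))^2) + ennreal ((norm (g x))^2) + ennreal ((norm (h x))^2))" by (simp add: ennreal_mult'' ennreal_plus)
  qed
  also have "\<dots> = 3 * (nn2 f + nn2 g + nn2 h)" unfolding nn2_def using assms by (simp add: nn_integral_cmult nn_integral_add)
  finally show ?thesis .
qed

text \<open>f is truncated in value; continuous functions converging almost everywhere to the
  truncation are projected onto the ball of radius n and cut off in space. The projection fixes the
  truncation and supplies the bound for dominated convergence.\<close>

lemma L2_continuous_dense:
  fixes f :: "'a::euclidean_space => 'b::euclidean_space"
  assumes f: "f \<in> borel_lebesgue" "integrable lebesgue (\<lambda>x. (norm (f x))^2)"
    and R: "0 < R" "\<And>x. x \<notin> cball 0 R ==> f x = 0" and e: "0 < (e::real)"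
  obtains g where "continuous_on UNIV g" "\<And>x. x \<notin> cball 0 (R+1) ==> g x = 0" "nn2 (\<lambda>x. f x - g x) < ennreal e"
proof -
  define T where "T n x = (if norm (f x) \<le> real n then f x else 0)" for n x
  have Tm: "T n \<in> borel_lebesgue" for n unfolding T_def[abs_def] using f(1) by measurable
  have "(\<lambda>n. nn2 (\<lambda>x. f x - T n x)) \<longlonglongrightarrow> 0"
  proof (rule nn2_tendsto[OF f(2)])
    show "(\<lambda>x. f x - T n x) \<in> borel_lebesgue" for n using f(1) Tm by simp
    show "AE x in lebesgue. (norm (f x - T n x))^2 \<le> (norm (f x))^2" for n by (simp add: T_def)
    have "(\<lambda>n. f x - T n x) \<longlonglongrightarrow> 0" for x
    proof (rule tendsto_eventually)
      obtain n0 where "norm (f x) \<le> real n0" using real_arch_simple by blast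
      then show "\<forall>\<^sub>F n in sequentially. f x - T n x = 0" by (intro eventually_sequentiallyI[of n0]) (auto simp: T_def)
    qed
    then show "AE x in lebesgue. (\<lambda>n. f x - T n x) \<longlonglongrightarrow> 0" by simp
  qed
  \<comment> \<open>Two errors enter, each with the factor 3 of \<open>nn2_triangle3\<close>, and
    6/7 < 1.\<close>
  moreover have e6: "0 < ennreal (e / 7)" using e by simp
  ultimately obtain n where n: "nn2 (\<lambda>x. f x - T n x) < ennreal (e / 7)"
    using eventually_happens[OF order_tendstoD(2)] by (metis (no_types, lifting) sequentially_bot)
  obtain g where g: "\<And>k. continuous_on UNIV (g k)" "AE x in lebesgue. (\<lambda>k. g k x) \<longlonglongrightarrow> T n x" using lebesgue_continuous_approx[OF Tm] by metis
  define P where "P = closest_point (cball (0::'b) (real n))"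
  have Pc: "continuous_on UNIV P" unfolding P_def by (intro continuous_on_closest_point) auto
  have PT: "P (T n x) = T n x" for x unfolding P_def by (rule closest_point_self) (simp add: T_def)
  have Pn: "norm (P y) \<le> real n" for y using closest_point_in_set[of "cball (0::'b) (real n)" y] unfolding P_def by simp
  define G where "G k x = ball_cutoff 0 R (R+1) x *R P (g k x)" for k x
  have Gc: "continuous_on UNIV (G k)" for k unfolding G_def[abs_def] using R(1)
    by (intro continuous_intros Ck1_continuous[OF ball_cutoff(1)] continuous_on_compose2[OF Pc g(1)]) auto
  have G0: "G k x = 0" if "x \<notin> cball 0 (R+1)" for k x using that R(1) ball_cutoff(3)[of R "R+1" x 0] by (simp add: G_def)
  have "(\<lambda>k. nn2 (\<lambda>x. T n x - G k x)) \<longlonglongrightarrow> 0"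
  proof (rule nn2_tendsto)
    show "integrable lebesgue (\<lambda>x. (2 * real n)^2 * indicator (cball 0 (R+1)) (x::'a))" by (simp add: integrable_indicator_compact)
    show "(\<lambda>x. T n x - G k x) \<in> borel_lebesgue" for k using Tm continuous_lebesgue_measurable[OF Gc] by simp
    show "AE x in lebesgue. (norm (T n x - G k x))^2 \<le> (2 * real n)^2 * indicator (cball 0 (R+1)) x" for k
    proof (rule AE_I2)
      fix x
      show "(norm (T n x - G k x))^2 \<le> (2 * real n)^2 * indicator (cball 0 (R+1)) x"
      proof (cases "x \<in> cball 0 (R+1)")
        case True
        have "norm (G k x) \<le> 1 * real n" unfolding G_def norm_scaleR
          using ball_cutoff(4,5)[of R "R+1" 0 x] R(1) Pn by (intro mult_mono) auto
        moreover have "norm (T n x) \<le> real n" by (simp add: T_def)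
        ultimately have "norm (T n x - G k x) \<le> 2 * real n" using norm_triangle_ineq4[of "T n x" "G k x"] by linarith
        then have "(norm (T n x - G k x))^2 \<le> (2 * real n)^2" by (intro power_mono) auto
        then show ?thesis using True by simp
      next
        case False
        then show ?thesis using G0 R(2)[of x] by (simp add: T_def)
      qed
    qed
    show "AE x in lebesgue. (\<lambda>k. T n x - G k x) \<longlonglongrightarrow> 0" using g(2)
    proof eventually_elim
      fix x assume lim: "(\<lambda>k. g k x) \<longlonglongrightarrow> T n x"
      have "(\<lambda>k. P (g k x)) \<longlonglongrightarrow> P (T n x)" by (rule continuous_on_tendsto_compose[OF Pc lim]) auto
      then have "(\<lambda>k. T n x - G k x) \<longlonglongrightarrow> T n x - ball_cutoff 0 R (R+1) x *R T n x" unfolding G_def PT by (intro tendsto_intros)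
      moreover have "T n x - ball_cutoff 0 R (R+1) x *R T n x = 0"
        using ball_cutoff(2)[of R "R+1" x 0] R by (cases "x \<in> cball 0 R") (auto simp: T_def)
      ultimately show "(\<lambda>k. T n x - G k x) \<longlonglongrightarrow> 0" by simp
    qed
  qed
  then obtain k where k: "nn2 (\<lambda>x. T n x - G k x) < ennreal (e / 7)"
    using eventually_happens[OF order_tendstoD(2)[OF _ e6]] by (metis (no_types, lifting) sequentially_bot)
  have "nn2 (\<lambda>x. f x - G k x) = nn2 (\<lambda>x. (f x - T n x) + (T n x - G k x) + 0)" by simp
  also have "\<dots> \<le> 3 * (nn2 (\<lambda>x. f x - T n x) + nn2 (\<lambda>x. T n x - G k x) + nn2 (\<lambda>x::'a. 0::'b))"
    using f(1) Tm continuous_lebesgue_measurable[OF Gc] by (intro nn2_triangle3) auto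
  also have "\<dots> = 3 * (nn2 (\<lambda>x. f x - T n x) + nn2 (\<lambda>x. T n x - G k x))" by (simp add: nn2_def)
  also have "\<dots> \<le> 3 * (ennreal (e / 7) + ennreal (e / 7))" using n k by (intro mult_left_mono add_mono) auto
  also have "\<dots> = ennreal (3 * (e / 7 + e / 7))" using e by (simp add: ennreal3 ennreal_plus[symmetric] del: ennreal_plus)
  also have "\<dots> < ennreal e" using e by (intro ennreal_lessI) auto
  finally show ?thesis using that[OF Gc G0] by blast
qed

text \<open>Compare f with a continuous G close to it in L2. Mollification is a contraction on f -
  G, and on G it converges uniformly on compact sets.\<close>

lemma moll_L2:
  fixes f :: "real^2 => 'b::euclidean_space"
  assumes f: "loc_int UNIV f" "loc_int UNIV (\<lambda>x. (norm (f x))^2)" and R: "0 < R"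
  shows "(\<lambda>n. \<integral>\<^sup>+x\<in>cball 0 R. ennreal ((norm (moll (1 / real (Suc n)) f x - f x))^2) \<partial>lebesgue) \<longlonglongrightarrow> 0"
    (is "?L \<longlonglongrightarrow> 0")
proof (rule order_tendstoI)
  fix a :: ennreal assume "0 < a"
  then obtain e where e: "0 < e" "ennreal e \<le> a"
  proof (cases a)
    case (real r) then show ?thesis using that[of r] \<open>0 < a\<close> by auto
  next
    case top then show ?thesis using that[of 1] by auto
  qed
  \<comment> \<open>Kernels of radius below 1 cannot distinguish f from F at points of the ball of
    radius R, and F is globally square integrable.\<close>
  define F where "F x = indicator (cball 0 (R+1)) x *R f x" for x
  have Fi: "integrable lebesgue F" using f(1) unfolding F_def[abs_def] by (simp add: loc_int_def set_integrable_def)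
  have "(norm (F x))^2 = indicator (cball 0 (R+1)) x *R (norm (f x))^2" for x by (auto simp: F_def indicator_def)
  then have Fi2: "integrable lebesgue (\<lambda>x. (norm (F x))^2)" using f(2) by (simp add: loc_int_def set_integrable_def)
  obtain G where G: "continuous_on UNIV G" "\<And>x. x \<notin> cball 0 (R+1+1) ==> G x = 0"
    "nn2 (\<lambda>x. F x - G x) < ennreal (e / 12)" by (rule L2_continuous_dense[OF borel_measurable_integrable[OF Fi] Fi2, of "R+1" "e/12"])
       (use R e(1) in \<open>auto simp: F_def\<close>)
  have Gs: "lset_int (cball 0 (R+1+1)) G" "lset_int (cball 0 (R+1+1)) (\<lambda>x. (norm (G x))^2)"
    by (intro continuous_compact_set_integrable continuous_intros continuous_on_subset[OF G(1)]; simp)+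
  have "indicator (cball 0 (R+1+1)) x *R G x = G x" for x using G(2)[of x] by (auto simp: indicator_def)
  then have Gi: "integrable lebesgue G" using Gs(1) by (simp only: set_integrable_def)
  have "indicator (cball 0 (R+1+1)) x *R (norm (G x))^2 = (norm (G x))^2" for x using G(2)[of x] by (auto simp: indicator_def)
  then have Gi2: "integrable lebesgue (\<lambda>x. (norm (G x))^2)" using Gs(2) by (simp only: set_integrable_def)
  have Hi: "integrable lebesgue (\<lambda>x. F x - G x)" using Fi Gi by simp
  have Hi2: "integrable lebesgue (\<lambda>x. (norm (F x - G x))^2)"
  proof (rule Bochner_Integration.integrable_bound[where f="\<lambda>x. 3 * ((norm (F x))^2 + (norm (G x))^2)"])
    show "integrable lebesgue (\<lambda>x. 3 * ((norm (F x))^2 + (norm (G x))^2))" using Fi2 Gi2 by simp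
    show "(\<lambda>x. (norm (F x - G x))^2) \<in> borel_lebesgue" using borel_measurable_integrable[OF Hi] by measurable
    show "AE x in lebesgue. norm ((norm (F x - G x))^2) \<le> norm (3 * ((norm (F x))^2 + (norm (G x))^2))"
      using norm_add3_sq[of "F _" "- G _" 0] by simp
  qed
  define \<mu> where "\<mu> = measure lebesgue (cball (0::real^2) R)"
  \<comment> \<open>The uniform error for G: d^2 times the area of the ball is at most e / 12. With
    mu + 1 in place of mu the quotient makes sense without knowing that mu is positive. Three errors
    of e / 12, tripled, stay below e.\<close>
  define d where "d = sqrt (e / (12 * (\<mu> + 1)))"
  have mu: "0 \<le> \<mu>" by (simp add: \<mu>_def)
  have d: "0 < d" "d\<^sup>2 * \<mu> \<le> e / 12"
  proof -
    show "0 < d" using e(1) mu by (simp add: d_def)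
    have "d\<^sup>2 * \<mu> \<le> d^2 * (\<mu> + 1)" by (intro mult_left_mono) auto
    also have "\<dots> = e / 12"
    proof -
      have "e / (12 * m) * m = e / 12" if "0 < m" for m using that by simp
      from this[of "\<mu> + 1"] show ?thesis using e(1) mu by (simp add: d_def del: distrib_left_numeral)
    qed
    finally show "d\<^sup>2 * \<mu> \<le> e / 12" .
  qed
  have "uniformly_continuous_on (cball 0 (R+1)) G" by (intro compact_uniformly_continuous continuous_on_subset[OF G(1)]) auto
  then obtain \<delta> where \<delta>: "\<delta> > 0" "\<And>x y. x \<in> cball 0 (R+1) ==> y \<in> cball 0 (R+1) ==> dist y x < \<delta> ==> dist (G y) (G x) < d"
    unfolding uniformly_continuous_on_def using d(1) by metis
  have "\<forall>\<^sub>F n in sequentially. 1 / real (Suc n) < min \<delta> 1"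
    using order_tendstoD(2)[OF LIMSEQ_inverse_real_of_nat, of "min \<delta> 1"] \<delta>(1) by (simp add: inverse_eq_divide)
  then show "\<forall>\<^sub>F n in sequentially. ?L n < a"
  proof eventually_elim
    fix n
    define r where "r = 1 / real (Suc n)"
    assume "1 / real (Suc n) < min \<delta> 1"
    then have r: "0 < r" "r < \<delta>" "r < 1" by (auto simp: r_def)
    let ?I = "indicator (cball 0 R) :: real^2 => real"
    let ?b = "\<lambda>x. ?I x *R (moll r G x - G x)"
    have li: "loc_int UNIV h" if "integrable lebesgue h" for h :: "real^2 => 'b" using that unfolding loc_int_def set_integrable_def
      by (auto intro!: integrable_mult_indicator fmeasurableD lmeasurable_compact)
    have ci: "integrable lebesgue (\<lambda>z. kern r (x - z) *R h z)" if "integrable lebesgue h" for x and h :: "real^2 => 'b"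
      by (rule conv_integrable[OF li[OF that] kern_cont kern_zero[OF r(1)]])
    have Mm: "moll r h \<in> borel_lebesgue" if "integrable lebesgue h" for h :: "real^2 => 'b"
      by (intro continuous_lebesgue_measurable Ck1_continuous[OF moll_C1(1)] li that r)
    have fF: "moll r f x = moll r F x" "f x = F x" if x: "x \<in> cball 0 R" for x
    proof -
      have "kern r (x - z) *R f z = kern r (x - z) *R F z" for z
      proof (cases "x - z \<in> ball 0 r")
        case True
        have "norm z \<le> norm x + norm (x - z)" using norm_triangle_ineq4[of x "x - z"] by simp
        then have "z \<in> cball 0 (R+1)" using True x r by auto
        then show ?thesis by (simp add: F_def)
      qed (simp add: kern_zero[OF r(1)])
      then show "moll r f x = moll r F x" unfolding moll_def by presburger
      show "f x = F x" using x by (simp add: F_def)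
    qed
    have MH: "moll r F x = moll r (\<lambda>x. F x - G x) x + moll r G x" for x
      unfolding moll_def using ci[OF Fi] ci[OF Gi] by (simp add: scaleR_diff_right)
    have bd: "norm (?b x) \<le> d * ?I x" for x
    proof (cases "x \<in> cball 0 R")
      case True
      have k: "integrable lebesgue (\<lambda>z. kern r (x - z))" "(LINT z|lebesgue. kern r (x - z)) = 1"
        using kern_integral(3,4)[OF r(1)] by simp_all
      have "moll r G x - G x = (LINT z|lebesgue. kern r (x - z) *R (G z - G x))"
        unfolding moll_def using ci[OF Gi] k by (simp add: scaleR_diff_right)
      also have "norm \<dots> \<le> (LINT z|lebesgue. d * kern r (x - z))"
      proof (rule Bochner_Integration.integral_norm_bound_integral)
        show "integrable lebesgue (\<lambda>z. kern r (x - z) *R (G z - G x))" using ci[OF Gi] k by (simp add: scaleR_diff_right)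
        show "integrable lebesgue (\<lambda>z. d * kern r (x - z))" using k by simp
        fix z
        show "norm (kern r (x - z) *R (G z - G x)) \<le> d * kern r (x - z)"
        proof (cases "x - z \<in> ball 0 r")
          case in_ball: True
          have "norm z \<le> norm x + norm (x - z)" using norm_triangle_ineq4[of x "x - z"] by simp
          then have "z \<in> cball 0 (R+1)" using True in_ball r by auto
          moreover have "x \<in> cball 0 (R+1)" using True by auto
          moreover have "dist z x < \<delta>" using in_ball r(2) by (auto simp: dist_norm norm_minus_commute)
          ultimately have "dist (G z) (G x) < d" using \<delta>(2) by blast
          then show ?thesis using kern_ge[OF r(1), of "x - z"]
            using mult_right_mono[of "norm (G z - G x)" d "kern r (x - z)"] by (simp add: dist_norm mult.commute)
        qed (simp add: kern_zero[OF r(1)])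
      qed
      also have "\<dots> = d" using k by simp
      finally show ?thesis using True by simp
    qed auto
    have nb: "nn2 ?b \<le> ennreal (e / 12)"
    proof -
      have "nn2 ?b \<le> (\<integral>\<^sup>+(x::real^2). ennreal (d^2) * indicator (cball 0 R) x \<partial>lebesgue)" unfolding nn2_def
      proof (rule nn_integral_mono)
        fix x
        have "(norm (?b x))^2 \<le> (d * ?I x)^2" by (intro power_mono bd norm_ge_zero)
        then have "ennreal ((norm (?b x))^2) \<le> ennreal ((d * ?I x)^2)" by (rule ennreal_leI)
        then show "ennreal ((norm (?b x))^2) \<le> ennreal (d^2) * indicator (cball 0 R) x" by (cases "x \<in> cball 0 R") auto
      qed
      also have "\<dots> = ennreal (d^2) * emeasure lebesgue (cball (0::real^2) R)" by (simp add: nn_integral_cmult_indicator)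
      also have "\<dots> = ennreal (d^2 * \<mu>)"
        unfolding \<mu>_def using lmeasurable_cball[of "0::real^2" R] by (simp add: emeasure_eq_measure2 ennreal_mult'')
      also have "\<dots> \<le> ennreal (e / 12)" by (rule ennreal_leI[OF d(2)])
      finally show ?thesis .
    qed
    have "?L n = nn2 (\<lambda>x. ?I x *R (moll r f x - f x))" unfolding nn2_def r_def by (rule nn_integral_cong) (auto simp: indicator_def)
    also have "\<dots> = nn2 (\<lambda>x. ?I x *R moll r (\<lambda>x. F x - G x) x + ?b x + ?I x *R (G x - F x))"
      unfolding nn2_def by (rule nn_integral_cong) (auto simp: indicator_def fF MH algebra_simps)
    also have "\<dots> \<le> 3 * (nn2 (\<lambda>x. ?I x *R moll r (\<lambda>x. F x - G x) x) + nn2 ?b + nn2 (\<lambda>x. ?I x *R (G x - F x)))"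
      by (intro nn2_triangle3 borel_measurable_scaleR borel_measurable_diff Mm Hi Gi Fi borel_measurable_integrable
        integrable_indicator_compact compact_cball)
    also have "\<dots> \<le> 3 * (ennreal (e / 12) + ennreal (e / 12) + ennreal (e / 12))"
    proof (intro mult_left_mono add_mono nb)
      have "nn2 (\<lambda>x. ?I x *R moll r (\<lambda>x. F x - G x) x) \<le> nn2 (moll r (\<lambda>x. F x - G x))"
        unfolding nn2_def by (rule nn_integral_mono) (auto simp: indicator_def)
      also have "\<dots> \<le> nn2 (\<lambda>x. F x - G x)" by (rule moll_contraction[OF Hi Hi2 r(1)])
      finally show "nn2 (\<lambda>x. ?I x *R moll r (\<lambda>x. F x - G x) x) \<le> ennreal (e / 12)" using G(3) by simp
      have "nn2 (\<lambda>x. ?I x *R (G x - F x)) \<le> nn2 (\<lambda>x. F x - G x)"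
        unfolding nn2_def by (rule nn_integral_mono) (auto simp: indicator_def norm_minus_commute)
      then show "nn2 (\<lambda>x. ?I x *R (G x - F x)) \<le> ennreal (e / 12)" using G(3) by simp
    qed simp
    also have "\<dots> = ennreal (3 * (e / 12 + e / 12 + e / 12))" using e(1) by (simp add: ennreal3 ennreal_plus[symmetric] del: ennreal_plus)
    also have "\<dots> < ennreal e" using e(1) by (intro ennreal_lessI) auto
    also have "\<dots> \<le> a" by (rule e(2))
    finally show "?L n < a" .
  qed
qed simp

lemma W12_approx_norm:
  "W12_approx U w u Du \<longleftrightarrow>
     (\<lambda>n. W12_err U (w n) u Du)
       \<longlonglongrightarrow> 0" unfolding W12_approx_def frob_norm ..

lemma nn_integral_norm_sq_add:
  fixes p :: "'a::euclidean_space => 'b::euclidean_space" and q :: "'a => 'c::euclidean_space"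
  assumes [measurable]: "p \<in> borel_lebesgue" "q \<in> borel_lebesgue" "A \<in> sets lebesgue"
  shows "(\<integral>\<^sup>+x\<in>A. ennreal ((norm (p x))^2 + (norm (q x))^2) \<partial>lebesgue)
    = (\<integral>\<^sup>+x\<in>A. ennreal ((norm (p x))^2) \<partial>lebesgue) + (\<integral>\<^sup>+x\<in>A. ennreal ((norm (q x))^2) \<partial>lebesgue)"
proof -
  have "(\<integral>\<^sup>+x\<in>A. ennreal ((norm (p x))^2 + (norm (q x))^2) \<partial>lebesgue)
    = (\<integral>\<^sup>+x. ennreal ((norm (p x))^2) * indicator A x + ennreal ((norm (q x))^2) * indicator A x \<partial>lebesgue)"
    by (intro nn_integral_cong) (simp add: ennreal_plus distrib_right)
  also have "\<dots> = (\<integral>\<^sup>+x\<in>A. ennreal ((norm (p x))^2) \<partial>lebesgue) + (\<integral>\<^sup>+x\<in>A. ennreal ((norm (q x))^2) \<partial>lebesgue)"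
    by (intro nn_integral_add; measurable)
  finally show ?thesis .
qed

lemma W12_mollify:
  fixes u :: "real^2 => real^'n"
  assumes D: "has_weak_grad UNIV u Du"
    and s: "loc_int UNIV (\<lambda>x. (norm (u x))^2)" "loc_int UNIV (\<lambda>x. (norm (Du x))^2)"
  obtains w where "\<And>n. C1_on (w n) UNIV" "\<And>R. 0 < R ==> W12_approx (cball 0 R) w u Du"
    "\<And>p n x. (\<And>y. u (y + p) = u y) ==> w n (x + p) = w n x"
proof
  define w where "w n = moll (1 / real (Suc n)) u" for n
  note l = has_weak_gradD(1,2)[OF D]
  show C: "C1_on (w n) UNIV" for n unfolding w_def by (rule moll_C1(1)[OF l(1)]) simp
  show "W12_approx (cball 0 R) w u Du" if R: "0 < R" for R
  proof -
    have m: "(\<lambda>x. indicator UNIV x *R u x) \<in> borel_lebesgue"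
      "(\<lambda>x. indicator UNIV x *R Du x) \<in> borel_lebesgue" by (rule loc_int_measurable[OF open_UNIV]; rule l)+
    have e: "W12_err (cball 0 R) (w n) u Du
      = (\<integral>\<^sup>+x\<in>cball 0 R. ennreal ((norm (moll (1 / real (Suc n)) u x - u x))^2) \<partial>lebesgue)
      + (\<integral>\<^sup>+x\<in>cball 0 R. ennreal ((norm (moll (1 / real (Suc n)) Du x - Du x))^2) \<partial>lebesgue)" for n
    proof -
      have j: "jacobian (w n) (at x) = moll (1 / real (Suc n)) Du x" for x unfolding w_def by (rule moll_jacobian[OF D]) simp
      have c: "moll (1 / real (Suc n)) u \<in> borel_lebesgue" "moll (1 / real (Suc n)) Du \<in> borel_lebesgue"
        by (intro continuous_lebesgue_measurable Ck1_continuous[OF moll_C1(1)] l; simp)+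
      show ?thesis unfolding j unfolding w_def by (rule nn_integral_norm_sq_add) (use c m in auto)
    qed
    show ?thesis unfolding W12_approx_norm e using tendsto_add[OF moll_L2[OF l(1) s(1) R] moll_L2[OF l(2) s(2) R]] by simp
  qed
  show "w n (x + p) = w n x" if "\<And>y. u (y + p) = u y" for p n x unfolding w_def by (rule moll_periodic[where f=u and p=p]) (rule that)
qed

section \<open>Matrix norms and change of variables\<close>

lemma norm_matrix_sq: "(norm (A :: real^'m^'n))^2 = (\<Sum>i\<in>UNIV. (norm (A $ i))^2)" by (simp add: power2_norm_eq_inner inner_vec_def)

lemma norm_matrix_sq2: "(norm (A :: real^'m^'n))^2 = (\<Sum>i\<in>UNIV. \<Sum>j\<in>UNIV. (A $ i $ j)^2)"
  unfolding power2_norm_eq_inner inner_vec_def inner_real_def by (simp add: power2_eq_square)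

lemma norm_matrix_mul: "norm ((A :: real^'m^'n) ** (B :: real^'k^'m)) \<le> norm A * norm B"
proof -
  have *: "(A ** B) $ i $ j = (A $ i) \<bullet> column j B" for i j by (simp add: matrix_matrix_mult_def inner_vec_def column_def)
  have "(norm (A ** B))^2 = (\<Sum>i\<in>UNIV. \<Sum>j\<in>UNIV. ((A $ i) \<bullet> column j B)^2)" by (simp only: norm_matrix_sq2 *)
  also have "\<dots> \<le> (\<Sum>i\<in>UNIV. \<Sum>j\<in>UNIV. (norm (A $ i))^2 * (norm (column j B))^2)"
    by (intro sum_mono) (metis Cauchy_Schwarz_ineq power2_norm_eq_inner)
  also have "\<dots> = (\<Sum>i\<in>UNIV. (norm (A $ i))^2) * (\<Sum>j\<in>UNIV. (norm (column j B))^2)"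
    by (simp add: sum_distrib_left sum_distrib_right) (rule sum.swap)
  also have "(\<Sum>j\<in>UNIV. (norm (column j B))^2) = (norm B)^2" unfolding norm_matrix_sq2 power2_norm_eq_inner inner_vec_def inner_real_def
    by (subst sum.swap) (simp add: column_def power2_eq_square)
  finally have "(norm (A ** B))^2 \<le> (norm A * norm B)^2" by (simp add: norm_matrix_sq[of A] power_mult_distrib)
  then show ?thesis by (rule power2_le_imp_le) simp
qed

lemma matrix_diff_mult: "((A :: real^'m^'n) - B) ** C = A ** C - B ** C"
  by (simp add: matrix_matrix_mult_def vec_eq_iff sum_subtractf left_diff_distrib)

lemma cov_real:
  fixes f :: "real^2 => real" and g :: "real^2 => real^2"
  assumes S: "S \<in> sets lebesgue" and g: "\<And>x. x \<in> S ==> (g has_derivative g' x) (at x within S)" "inj_on g S"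
    and f: "lset_int (g ` S) f"
  shows "lset_int S (\<lambda>x. \<bar>det (matrix (g' x))\<bar> * f (g x))"
    "(LINT x:S|lebesgue. \<bar>det (matrix (g' x))\<bar> * f (g x)) = (LINT x:g ` S|lebesgue. f x)"
proof -
  \<comment> \<open>The change of variables formula is phrased for vector values, so the scalar f is
    read as a map into \<open>real^1\<close>.\<close>
  let ?f = "\<lambda>x. vec (f x) :: real^1"
  have "?f absolutely_integrable_on (g ` S)" using f by (subst absolutely_integrable_on_1_iff) simp
  then have *: "(\<lambda>x. \<bar>det (matrix (g' x))\<bar> *R ?f (g x)) absolutely_integrable_on S \<and>
     integral S (\<lambda>x. \<bar>det (matrix (g' x))\<bar> *R ?f (g x)) = integral (g ` S) ?f"
    using has_absolute_integral_change_of_variables[OF S g, of ?f "integral (g ` S) ?f"] by blast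
  then have 1: "lset_int S (\<lambda>x. \<bar>det (matrix (g' x))\<bar> * f (g x))" by (subst (asm) absolutely_integrable_on_1_iff) simp
  have "integral S (\<lambda>x. \<bar>det (matrix (g' x))\<bar> * f (g x)) = integral (g ` S) f" using * by (simp add: integral_on_1_eq vec_eq_iff)
  then show "(LINT x:S|lebesgue. \<bar>det (matrix (g' x))\<bar> * f (g x)) = (LINT x:g ` S|lebesgue. f x)"
    using set_lebesgue_integral_eq_integral(2)[OF 1] set_lebesgue_integral_eq_integral(2)[OF f] by simp
  show "lset_int S (\<lambda>x. \<bar>det (matrix (g' x))\<bar> * f (g x))" by (rule 1)
qed

lemma cov_vector:
  fixes f :: "real^2 => 'b::euclidean_space" and g :: "real^2 => real^2"
  assumes S: "S \<in> sets lebesgue" and g: "\<And>x. x \<in> S ==> (g has_derivative g' x) (at x within S)" "inj_on g S"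
    and f: "lset_int (g ` S) f"
  shows "lset_int S (\<lambda>x. \<bar>det (matrix (g' x))\<bar> *R f (g x))"
proof (subst absolutely_integrable_componentwise_iff, rule ballI)
  fix b :: 'b assume b: "b \<in> Basis"
  have "lset_int (g ` S) (\<lambda>x. f x \<bullet> b)" using f b by (subst (asm) absolutely_integrable_componentwise_iff) blast
  from cov_real(1)[OF S g this]
  show "lset_int S (\<lambda>x. (\<bar>det (matrix (g' x))\<bar> *R f (g x)) \<bullet> b)" by simp
qed

text \<open>In nonnegative form no integrability is presupposed: if the right side is infinite there
  is nothing to show, otherwise h is integrable over the image and the formula for real functions
  applies.\<close>

lemma nn_cov_le:
  fixes h :: "real^2 => real" and g :: "real^2 => real^2"
  assumes S: "S \<in> sets lebesgue" and g: "\<And>x. x \<in> S ==> (g has_derivative g' x) (at x within S)" "inj_on g S"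
    and h: "(\<lambda>x. indicator (g ` S) x * h x) \<in> borel_lebesgue" "\<And>x. 0 \<le> h x"
  shows "(\<integral>\<^sup>+x\<in>S. ennreal (\<bar>det (matrix (g' x))\<bar> * h (g x)) \<partial>lebesgue) \<le> (\<integral>\<^sup>+x\<in>g ` S. ennreal (h x) \<partial>lebesgue)"
proof (cases "(\<integral>\<^sup>+x\<in>g ` S. ennreal (h x) \<partial>lebesgue) = \<infinity>")
  case False
  have e: "ennreal (indicator A x * k) = ennreal k * indicator A x" for A k and x :: "real^2" by (auto simp: indicator_def)
  have "lset_int (g ` S) h" unfolding set_integrable_def
  proof (rule integrableI_bounded)
    have "(\<integral>\<^sup>+x. ennreal (norm (indicator (g ` S) x *R h x)) \<partial>lebesgue) = (\<integral>\<^sup>+x\<in>g ` S. ennreal (h x) \<partial>lebesgue)"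
      using h(2) by (intro nn_integral_cong) (auto simp: indicator_def)
    then show "(\<integral>\<^sup>+x. ennreal (norm (indicator (g ` S) x *R h x)) \<partial>lebesgue) < \<infinity>" using False by (simp add: top.not_eq_extremum)
  qed (use h in simp)
  note c = cov_real[OF S g this] this
  have "(\<integral>\<^sup>+x\<in>S. ennreal (\<bar>det (matrix (g' x))\<bar> * h (g x)) \<partial>lebesgue)
    = ennreal (LINT x:S|lebesgue. \<bar>det (matrix (g' x))\<bar> * h (g x))" unfolding set_lebesgue_integral_def e[symmetric] real_scaleR_def
    by (rule nn_integral_eq_integral) (use c(1) h(2) in \<open>auto simp: set_integrable_def\<close>)
  also have "\<dots> = ennreal (LINT x:g ` S|lebesgue. h x)" by (simp only: c(2))
  also have "\<dots> = (\<integral>\<^sup>+x\<in>g ` S. ennreal (h x) \<partial>lebesgue)" unfolding set_lebesgue_integral_def e[symmetric] real_scaleR_def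
    by (rule nn_integral_eq_integral[symmetric]) (use c(3) h(2) in \<open>auto simp: set_integrable_def\<close>)
  finally show ?thesis by simp
qed simp

section \<open>Composition with local diffeomorphisms\<close>

lemma integrable_loc_int:
  fixes f :: "real^2 => 'b::euclidean_space"
  shows "integrable lebesgue f ==> loc_int U f" unfolding loc_int_def set_integrable_def
  by (intro allI impI integrable_mult_indicator fmeasurableD lmeasurable_compact)

lemma jacobian_has_derivative:
  fixes g :: "real^2 => real^2"
  assumes "C1_on g V" "x \<in> V"
  shows "(g has_derivative (*v) (jacobian g (at x))) (at x)" "matrix ((*v) (jacobian g (at x))) = jacobian g (at x)"
proof -
  have "g differentiable (at x)" using assms by (simp add: Ck1_iff)
  then show "(g has_derivative (*v) (jacobian g (at x))) (at x)" using jacobian_works by blast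
qed simp

lemma det_jacobian_continuous:
  assumes "C1_on (g :: real^2 => real^2) V"
  shows "continuous_on V (\<lambda>x. det (jacobian g (at x)))" unfolding det_2 by (intro continuous_intros jacobian_continuous assms)

text \<open>Injectivity is asked for only near each point because polar coordinates wind around the
  circle. It is assumed rather than drawn from the inverse function theorem; every instance has it
  by direct computation.\<close>

locale local_diffeo =
  fixes g :: "real^2 => real^2" and V :: "(real^2) set"
  assumes open_dom: "open V" and C1: "C1_on g V"
    and det: "\<And>x. x \<in> V ==> det (jacobian g (at x)) \<noteq> 0"
    and inj: "\<And>x. x \<in> V ==> \<exists>r>0. inj_on g (ball x r)"
begin

lemma cov: "x \<in> S ==> S \<subseteq> V ==> (g has_derivative (*v) (jacobian g (at x))) (at x within S)"
  by (rule has_derivative_at_withinI, rule jacobian_has_derivative(1)[OF C1]) auto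

lemma nn_le:
  assumes S: "S \<in> sets lebesgue" "S \<subseteq> V" "inj_on g S"
    and h: "(\<lambda>x. indicator (g ` S) x * h x) \<in> borel_lebesgue" "\<And>x. 0 \<le> (h x :: real)"
  shows "(\<integral>\<^sup>+x\<in>S. ennreal (\<bar>det (jacobian g (at x))\<bar> * h (g x)) \<partial>lebesgue) \<le> (\<integral>\<^sup>+x\<in>g ` S. ennreal (h x) \<partial>lebesgue)"
  using nn_cov_le[OF S(1) cov[OF _ S(2)] S(3) h] by simp

lemma det_bound:
  assumes "compact K" "K \<subseteq> V"
  obtains c where "c > 0" "\<And>x. x \<in> K ==> c \<le> \<bar>det (jacobian g (at x))\<bar>"
proof (cases "K = {}")
  case False
  have "continuous_on K (\<lambda>x. \<bar>det (jacobian g (at x))\<bar>)"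
    by (intro continuous_intros continuous_on_subset[OF det_jacobian_continuous[OF C1]] assms)
  then obtain y where y: "y \<in> K" "\<forall>x\<in>K. \<bar>det (jacobian g (at y))\<bar> \<le> \<bar>det (jacobian g (at x))\<bar>"
    using continuous_attains_inf[OF assms(1) False] by blast
  show ?thesis by (rule that[of "\<bar>det (jacobian g (at y))\<bar>"]) (use y det[of y] assms in auto)
qed (use that[of 1] in auto)

lemma inj_cball:
  assumes "x \<in> V" "open W" "g x \<in> W"
  obtains r where "r > 0" "cball x r \<subseteq> V" "inj_on g (cball x r)" "g ` cball x r \<subseteq> W"
proof -
  obtain r1 where r1: "r1 > 0" "inj_on g (ball x r1)" using inj[OF assms(1)] by blast
  have "open (V \<inter> g -` W)" by (rule continuous_open_preimage[OF Ck1_continuous[OF C1] open_dom assms(2)])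
  then obtain r2 where r2: "r2 > 0" "cball x r2 \<subseteq> V \<inter> g -` W" using assms open_contains_cball by (metis IntI vimageI)
  let ?r = "min (r1/2) r2"
  have "cball x ?r \<subseteq> ball x r1" "cball x ?r \<subseteq> cball x r2" using r1(1) by auto
  then show ?thesis using r1 r2 by (intro that[of ?r]) (auto intro: inj_on_subset)
qed

text \<open>The change of variables formula gives integrability with the Jacobian as weight. On a
  compact set the weight is bounded below, so it can be divided out.\<close>

lemma set_integrable_compose:
  fixes f :: "real^2 => 'b::euclidean_space"
  assumes K: "compact K" "K \<subseteq> V" "inj_on g K" and f: "lset_int (g ` K) f"
  shows "lset_int K (\<lambda>x. f (g x))"
proof -
  have m: "K \<in> sets lebesgue" using lmeasurable_compact[OF K(1)] by (rule fmeasurableD)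
  have i: "lset_int K (\<lambda>x. \<bar>det (jacobian g (at x))\<bar> *R f (g x))" using cov_vector[OF m cov[OF _ K(2)] K(3) f] by simp
  obtain c where c: "c > 0" "\<And>x. x \<in> K ==> c \<le> \<bar>det (jacobian g (at x))\<bar>" using det_bound[OF K(1,2)] by blast
  let ?d = "\<lambda>x. indicator K x *R inverse \<bar>det (jacobian g (at x))\<bar>"
  have d: "?d \<in> borel_lebesgue"
  proof -
    have "?d \<in> borel_measurable borel"
    proof (rule borel_measurable_continuous_on_indicator)
      show "K \<in> sets borel" using K(1) by (simp add: borel_compact)
      show "continuous_on K (\<lambda>x. inverse \<bar>det (jacobian g (at x))\<bar>)"
        using det K(2) by (intro continuous_intros continuous_on_subset[OF det_jacobian_continuous[OF C1]]) auto
    qed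
    then show ?thesis by (intro measurable_completion) simp
  qed
  have e: "indicator K x *R f (g x) = ?d x *R (indicator K x *R (\<bar>det (jacobian g (at x))\<bar> *R f (g x)))" for x
    using det[of x] K(2) by (cases "x \<in> K") auto
  show ?thesis unfolding set_integrable_def
  proof (rule Bochner_Integration.integrable_bound[where f="\<lambda>x. inverse c *R (indicator K x *R (\<bar>det (jacobian g (at x))\<bar> *R f (g x)))"])
    show "integrable lebesgue (\<lambda>x. inverse c *R (indicator K x *R (\<bar>det (jacobian g (at x))\<bar> *R f (g x))))"
      using i unfolding set_integrable_def by (rule integrable_scaleR_right)
    show "(\<lambda>x. indicator K x *R f (g x)) \<in> borel_lebesgue"
      unfolding e by (intro borel_measurable_scaleR d borel_measurable_integrable[OF i[unfolded set_integrable_def]])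
    show "AE x in lebesgue. norm (indicator K x *R f (g x)) \<le>
      norm (inverse c *R (indicator K x *R (\<bar>det (jacobian g (at x))\<bar> *R f (g x))))"
    proof (rule AE_I2)
      fix x
      show "norm (indicator K x *R f (g x)) \<le>
        norm (inverse c *R (indicator K x *R (\<bar>det (jacobian g (at x))\<bar> *R f (g x))))"
      proof (cases "x \<in> K")
        case True
        have "1 * norm (f (g x)) \<le> (inverse c * \<bar>det (jacobian g (at x))\<bar>) * norm (f (g x))"
          using c(1) c(2)[OF True] by (intro mult_right_mono) (auto simp: field_simps)
        then show ?thesis using True c(1) by (simp add: mult.assoc)
      qed simp
    qed
  qed
qed

lemma loc_int_compose:
  assumes "loc_int U f" "open U" "g ` V \<subseteq> U"
  shows "loc_int V (\<lambda>x. f (g x))"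
proof (rule loc_int_locally)
  fix x assume x: "x \<in> V"
  obtain r where r: "r > 0" "cball x r \<subseteq> V" "inj_on g (cball x r)" "g ` cball x r \<subseteq> U" using inj_cball[OF x assms(2)] x assms(3) by blast
  have "compact (g ` cball x r)" by (intro compact_continuous_image continuous_on_subset[OF Ck1_continuous[OF C1]] r) auto
  then have "lset_int (g ` cball x r) f" using assms(1) r(4) by (simp add: loc_int_def)
  then have i: "lset_int (cball x r) (\<lambda>x. f (g x))" by (intro set_integrable_compose r) auto
  have "loc_int (ball x r) (\<lambda>x. f (g x))" unfolding loc_int_def
  proof (intro allI impI)
    fix K assume "compact K" "K \<subseteq> ball x r"
    then show "lset_int K (\<lambda>x. f (g x))"
      using ball_subset_cball[of x r] by (intro set_integrable_subset[OF i] fmeasurableD lmeasurable_compact) auto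
  qed
  then show "\<exists>W. open W \<and> x \<in> W \<and> loc_int W (\<lambda>x. f (g x))" using r(1) by (intro exI[of _ "ball x r"]) auto
qed

text \<open>Preimages of null sets are null: the indicator of a null set N has integral zero also
  after composition and weighting with the Jacobian, and the weight is at least c > 0 on a closed
  ball.\<close>

lemma AE_compose:
  assumes ae: "AE y in lebesgue. y \<in> U --> P y" and U: "open U" "g ` V \<subseteq> U"
  shows "AE x in lebesgue. x \<in> V --> P (g x)"
proof (rule AE_locally)
  fix x assume x: "x \<in> V"
  obtain r where r: "r > 0" "cball x r \<subseteq> V" "inj_on g (cball x r)" "g ` cball x r \<subseteq> U" using inj_cball[OF x U(1)] x U(2) by blast
  obtain N where N: "{y. \<not> (y \<in> U --> P y)} \<subseteq> N" "emeasure lebesgue N = 0" "N \<in> sets lebesgue" using AE_E[OF ae] by auto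
  let ?h = "indicator N :: real^2 => real"
  have K: "cball x r \<in> sets lebesgue" by simp
  have gK: "g ` cball x r \<in> sets lebesgue"
    by (intro fmeasurableD lmeasurable_compact compact_continuous_image continuous_on_subset[OF Ck1_continuous[OF C1]] r) auto
  have "integrable lebesgue ?h" using N by (intro integrable_real_indicator) auto
  then have "loc_int U ?h" by (rule integrable_loc_int)
  from loc_int_compose[OF this U] have "lset_int (cball x r) (\<lambda>y. ?h (g y))" using r(2) by (simp add: loc_int_def)
  then have m: "(\<lambda>y. indicator (cball x r) y *R ?h (g y)) \<in> borel_lebesgue"
    unfolding set_integrable_def by (rule borel_measurable_integrable)
  obtain c where c: "c > 0" "\<And>y. y \<in> cball x r ==> c \<le> \<bar>det (jacobian g (at y))\<bar>" using det_bound[of "cball x r"] r(2) by auto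
  have "(\<integral>\<^sup>+y. ennreal (c * (indicator (cball x r) y *R ?h (g y))) \<partial>lebesgue)
    \<le> (\<integral>\<^sup>+x\<in>cball x r. ennreal (\<bar>det (jacobian g (at x))\<bar> * ?h (g x)) \<partial>lebesgue)"
    using c(2) by (intro nn_integral_mono) (auto simp: indicator_def intro!: ennreal_leI)
  also have "\<dots> \<le> (\<integral>\<^sup>+x\<in>g ` cball x r. ennreal (?h x) \<partial>lebesgue)" by (rule nn_le[OF K r(2,3)]) (use gK N in auto)
  also have "\<dots> \<le> (\<integral>\<^sup>+x. indicator N x \<partial>lebesgue)" by (intro nn_integral_mono) (auto simp: indicator_def)
  also have "\<dots> = 0" using N by simp
  finally have "(\<integral>\<^sup>+y. ennreal (c * (indicator (cball x r) y *R ?h (g y))) \<partial>lebesgue) = 0" by simp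
  then have "AE y in lebesgue. ennreal (c * (indicator (cball x r) y *R ?h (g y))) = 0"
    by (subst (asm) nn_integral_0_iff_AE) (intro measurable_compose[OF _ measurable_ennreal] borel_measurable_times borel_measurable_const m)
  then have "AE y in lebesgue. y \<in> ball x r --> P (g y)"
  proof (rule eventually_mono)
    fix y assume *: "ennreal (c * (indicator (cball x r) y *R ?h (g y))) = 0"
    show "y \<in> ball x r --> P (g y)"
    proof
      assume y: "y \<in> ball x r"
      then have "y \<in> cball x r" by simp
      then have "g y \<in> U" "c * ?h (g y) \<le> 0" using r(4) * by (auto simp: ennreal_eq_0_iff)
      then show "P (g y)" using c(1) N(1) by (auto simp: indicator_def split: if_splits)
    qed
  qed
  then show "\<exists>W. open W \<and> x \<in> W \<and> (AE y in lebesgue. y \<in> W --> P (g y))" using r(1) by (intro exI[of _ "ball x r"]) auto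
qed

lemma jacobian_compose:
  fixes w :: "real^2 => real^'n"
  assumes "C1_on w W" "open W" "x \<in> V" "g x \<in> W"
  shows "jacobian (\<lambda>x. w (g x)) (at x) = jacobian w (at (g x)) ** jacobian g (at x)"
proof -
  have "((\<lambda>x. w (g x)) has_derivative (\<lambda>v. frechet_derivative w (at (g x)) (frechet_derivative g (at x) v))) (at x)"
    by (rule has_derivative_compose[OF Ck1_has_derivative[OF C1 assms(3)] Ck1_has_derivative[OF assms(1,4)]])
  then have "frechet_derivative (\<lambda>x. w (g x)) (at x) = frechet_derivative w (at (g x)) \<circ> frechet_derivative g (at x)"
    by (subst frechet_derivative_at[symmetric]) (auto simp: o_def)
  moreover have "linear (frechet_derivative w (at (g x)))" "linear (frechet_derivative g (at x))"
    using has_derivative_linear[OF Ck1_has_derivative[OF C1 assms(3)]]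
      has_derivative_linear[OF Ck1_has_derivative[OF assms(1,4)]] by auto
  ultimately show ?thesis by (simp add: jacobian_def matrix_compose)
qed

lemma jacobian_bound:
  assumes "compact K" "K \<subseteq> V"
  obtains B where "B > 0" "\<And>x. x \<in> K ==> norm (jacobian g (at x)) \<le> B"
proof -
  have "bounded ((\<lambda>x. jacobian g (at x)) ` K)"
    by (intro compact_imp_bounded compact_continuous_image assms continuous_on_subset[OF jacobian_continuous[OF C1]])
  then show ?thesis using that by (auto simp: bounded_pos)
qed

lemma W12_approx_compose:
  fixes u :: "real^2 => real^'n"
  assumes K: "S \<subseteq> K" "compact K" "K \<subseteq> V" and S: "S \<in> sets lebesgue" "inj_on g S" "g ` S \<subseteq> U"
    and U: "open U" "loc_int U u" "loc_int U Du"
    and w: "\<And>n. C1_on (w n) UNIV" "W12_approx U w u Du"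
  shows "W12_approx S (\<lambda>n x. w n (g x)) (\<lambda>x. u (g x)) (\<lambda>x. Du (g x) ** jacobian g (at x))"
proof -
  obtain c where c: "c > 0" "\<And>x. x \<in> K ==> c \<le> \<bar>det (jacobian g (at x))\<bar>" using det_bound[OF K(2,3)] by blast
  obtain B where B: "B > 0" "\<And>x. x \<in> K ==> norm (jacobian g (at x)) \<le> B" using jacobian_bound[OF K(2,3)] by blast
  define h where "h n y = (norm (w n y - u y))^2 + (norm (jacobian (w n) (at y) - Du y))^2" for n y
  \<comment> \<open>The chain rule costs a factor B on the gradient, the change of variables a
    factor 1/c. These uniform bounds are the reason for enclosing S in a compact set K.\<close>
  define M where "M = (1 + B^2) / c"
  have M: "0 \<le> M" using c by (simp add: M_def)
  have gS: "g ` S \<in> sets lebesgue" using K by (intro differentiable_image_in_sets_lebesgue S differentiable_at_imp_differentiable_on)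
      (use C1 in \<open>auto simp: Ck1_iff\<close>)
  have le: "(\<integral>\<^sup>+x\<in>S. ennreal ((norm (w n (g x) - u (g x)))^2 +
      (norm (jacobian (\<lambda>x. w n (g x)) (at x) - Du (g x) ** jacobian g (at x)))^2) \<partial>lebesgue)
    \<le> ennreal M * (\<integral>\<^sup>+x\<in>U. ennreal (h n x) \<partial>lebesgue)" for n
  proof -
    have mw: "w n \<in> borel_lebesgue" "(\<lambda>y. jacobian (w n) (at y)) \<in> borel_lebesgue"
      by (intro continuous_lebesgue_measurable Ck1_continuous[OF w(1)] jacobian_continuous[OF w(1)])+
    have "(\<lambda>y. indicator U y * h n y) = (\<lambda>y. indicator U y * ((norm (w n y - indicator U y *R u y))^2 + (norm (jacobian (w n) (at y) - indicator U y *R Du y))^2))"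
      by (auto simp: h_def indicator_def)
    moreover have "\<dots> \<in> borel_lebesgue"
    proof -
      have [measurable]: "U \<in> sets lebesgue" using U(1) by simp
      note [measurable] = borel_measurable_diff[OF mw(1) loc_int_measurable[OF U(1,2)]]
        borel_measurable_diff[OF mw(2) loc_int_measurable[OF U(1,3)]]
      show ?thesis by measurable
    qed
    ultimately have hm: "(\<lambda>y. indicator U y * h n y) \<in> borel_lebesgue" by simp
    have "(\<lambda>y. indicator (g ` S) y * h n y) = (\<lambda>y. indicator (g ` S) y * (indicator U y * h n y))"
    proof
      fix y show "indicator (g ` S) y * h n y = indicator (g ` S) y * (indicator U y * h n y)" using S(3) by (cases "y \<in> g ` S") auto
    qed
    also have "\<dots> \<in> borel_lebesgue" by (intro borel_measurable_times borel_measurable_indicator gS hm)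
    finally have hm': "(\<lambda>y. indicator (g ` S) y * h n y) \<in> borel_lebesgue" .
    have "(\<integral>\<^sup>+x\<in>S. ennreal ((norm (w n (g x) - u (g x)))^2 +
        (norm (jacobian (\<lambda>x. w n (g x)) (at x) - Du (g x) ** jacobian g (at x)))^2) \<partial>lebesgue)
      \<le> (\<integral>\<^sup>+x\<in>S. ennreal (\<bar>det (jacobian g (at x))\<bar> * (M * h n (g x))) \<partial>lebesgue)"
    proof (rule nn_integral_mono)
      fix x
      show "ennreal ((norm (w n (g x) - u (g x)))^2 +
        (norm (jacobian (\<lambda>x. w n (g x)) (at x) - Du (g x) ** jacobian g (at x)))^2) * indicator S x
        \<le> ennreal (\<bar>det (jacobian g (at x))\<bar> * (M * h n (g x))) * indicator S x"
      proof (cases "x \<in> S")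
        case True
        then have x: "x \<in> K" "x \<in> V" using K by auto
        let ?A = "jacobian (w n) (at (g x)) - Du (g x)"
        have j: "jacobian (\<lambda>x. w n (g x)) (at x) - Du (g x) ** jacobian g (at x) = ?A ** jacobian g (at x)"
          using jacobian_compose[OF w(1) open_UNIV x(2)] by (simp add: matrix_diff_mult)
        have "norm (?A ** jacobian g (at x)) \<le> norm ?A * B"
          using norm_matrix_mul[of ?A "jacobian g (at x)"] mult_left_mono[OF B(2)[OF x(1)] norm_ge_zero[of ?A]] by linarith
        then have "(norm (?A ** jacobian g (at x)))^2 \<le> (norm ?A * B)^2" by (intro power_mono) auto
        then have "(norm (w n (g x) - u (g x)))^2 + (norm (?A ** jacobian g (at x)))^2
          \<le> (norm (w n (g x) - u (g x)))^2 + (norm ?A)^2 * B^2" by (simp add: power_mult_distrib)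
        also have "\<dots> \<le> (1 + B^2) * h n (g x)" unfolding h_def by (simp add: algebra_simps)
        also have "\<dots> = M * (c * h n (g x))" using c(1) by (simp add: M_def)
        also have "\<dots> \<le> M * (\<bar>det (jacobian g (at x))\<bar> * h n (g x))"
          using M c(2)[OF x(1)] by (intro mult_left_mono mult_right_mono) (auto simp: h_def)
        finally show ?thesis using True M unfolding j by (simp add: h_def ennreal_leI mult.left_commute del: ennreal_plus)
      qed simp
    qed
    also have "\<dots> \<le> (\<integral>\<^sup>+x\<in>g ` S. ennreal (M * h n x) \<partial>lebesgue)"
    proof (rule nn_le[OF S(1) _ S(2)])
      show "S \<subseteq> V" using K by auto
      show "(\<lambda>y. indicator (g ` S) y * (M * h n y)) \<in> borel_lebesgue"
        using borel_measurable_times[OF borel_measurable_const[of M] hm'] by (simp add: mult.left_commute)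
      show "0 \<le> M * h n x" for x using M by (simp add: h_def)
    qed
    also have "\<dots> \<le> (\<integral>\<^sup>+x. ennreal M * ennreal (indicator U x * h n x) \<partial>lebesgue)"
      using S(3) M by (intro nn_integral_mono) (auto simp: indicator_def ennreal_mult h_def)
    also have "\<dots> = ennreal M * (\<integral>\<^sup>+x. ennreal (indicator U x * h n x) \<partial>lebesgue)" using hm by (intro nn_integral_cmult) simp
    also have "(\<integral>\<^sup>+x. ennreal (indicator U x * h n x) \<partial>lebesgue) = (\<integral>\<^sup>+x\<in>U. ennreal (h n x) \<partial>lebesgue)"
      by (intro nn_integral_cong) (auto simp: indicator_def)
    finally show ?thesis .
  qed
  have "(\<lambda>n. ennreal M * (\<integral>\<^sup>+x\<in>U. ennreal (h n x) \<partial>lebesgue)) \<longlonglongrightarrow> ennreal M * 0"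
    using w(2) unfolding W12_approx_norm h_def by (intro ennreal_tendsto_cmult) auto
  then have T: "(\<lambda>n. ennreal M * (\<integral>\<^sup>+x\<in>U. ennreal (h n x) \<partial>lebesgue)) \<longlonglongrightarrow> 0" unfolding mult_zero_right .
  show ?thesis unfolding W12_approx_norm by (rule tendsto_sandwich[OF _ _ tendsto_const T]) (use le in auto)
qed

end

section \<open>Weak limits and the chain rule\<close>

text \<open>Cauchy-Schwarz in disguise: |h| \<le> d + |h|^2 / d for every d > 0, integrated over K,
  with d = sqrt (E n) balancing the two terms.\<close>

lemma weak_convergence:
  fixes f :: "real^2 => 'b::euclidean_space"
  assumes c: "continuous_on UNIV c" "compact K" "K \<subseteq> B" "\<And>x. x \<notin> K ==> c x = 0"
    and l: "loc_int B f" "\<And>n. loc_int B (fs n)"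
    and lim: "(\<lambda>n. \<integral>\<^sup>+x\<in>B. ennreal ((norm (fs n x - f x))^2) \<partial>lebesgue) \<longlonglongrightarrow> 0" (is "?e \<longlonglongrightarrow> 0")
  shows "(\<lambda>n. LINT x|lebesgue. c x *R fs n x) \<longlonglongrightarrow> (LINT x|lebesgue. c x *R f x)"
proof -
  define E where "E n = enn2real (?e n)" for n
  have E0: "0 \<le> E n" for n by (simp add: E_def)
  have E: "E \<longlonglongrightarrow> 0" unfolding E_def[abs_def] using tendsto_enn2real[of _ 0] lim by simp
  obtain M where M: "M > 0" "\<And>x. \<bar>c x\<bar> \<le> M"
  proof -
    have "bounded (c ` K)" by (intro compact_imp_bounded compact_continuous_image c continuous_on_subset[OF c(1)]) auto
    then obtain M where "M > 0" "\<forall>x\<in>K. \<bar>c x\<bar> \<le> M" by (auto simp: bounded_pos)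
    then show ?thesis using c(4) that[of M] by (metis abs_zero less_eq_real_def)
  qed
  define \<mu> where "\<mu> = measure lebesgue K"
  have K: "K \<in> lmeasurable" by (rule lmeasurable_compact[OF c(2)])
  have int: "integrable lebesgue (\<lambda>x. c x *R h x)" if "loc_int B h" for h :: "real^2 => 'b"
    using that c by (intro continuous_supp_integrable[of K]) (auto simp: loc_int_def)
  have bd: "norm ((LINT x|lebesgue. c x *R fs n x) - (LINT x|lebesgue. c x *R f x)) \<le> M * \<mu> * d + M / d * E n"
    if d: "0 < d" and fin: "?e n < \<infinity>" for n d
  proof -
    define h where "h x = fs n x - f x" for x
    have lh: "loc_int B h" unfolding h_def by (intro loc_int_diff l)
    have hm: "(\<lambda>x. indicator K x *R h x) \<in> borel_lebesgue"
      using lh c unfolding loc_int_def set_integrable_def by (auto intro: borel_measurable_integrable)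
    have "(LINT x|lebesgue. c x *R fs n x) - (LINT x|lebesgue. c x *R f x) = (LINT x|lebesgue. c x *R h x)"
      using int[OF l(1)] int[OF l(2)] by (simp add: h_def scaleR_diff_right)
    then have "ennreal (norm ((LINT x|lebesgue. c x *R fs n x) - (LINT x|lebesgue. c x *R f x)))
      \<le> (\<integral>\<^sup>+x. ennreal (norm (c x *R h x)) \<partial>lebesgue)" using integral_norm_bound_ennreal[OF int[OF lh]] by simp
    also have "\<dots> \<le> (\<integral>\<^sup>+x. ennreal (M * d) * indicator K x + ennreal (M / d) * ennreal ((norm (indicator K x *R h x))^2) \<partial>lebesgue)"
    proof (rule nn_integral_mono)
      fix x
      show "ennreal (norm (c x *R h x)) \<le> ennreal (M * d) * indicator K x + ennreal (M / d) * ennreal ((norm (indicator K x *R h x))^2)"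
      proof (cases "x \<in> K")
        case True
        have "0 \<le> (norm (h x) - d)^2 + norm (h x) * d" using d by (simp add: add_nonneg_nonneg)
        then have "norm (h x) * d \<le> d^2 + (norm (h x))^2" by (simp add: power2_diff algebra_simps)
        then have "norm (h x) \<le> d + (norm (h x))^2 / d" using d by (simp add: field_simps power2_eq_square)
        then have "M * norm (h x) \<le> M * (d + (norm (h x))^2 / d)" using M by (intro mult_left_mono) auto
        moreover have "norm (c x *R h x) \<le> M * norm (h x)" using M(2)[of x] by (simp add: mult_right_mono)
        ultimately have "norm (c x *R h x) \<le> M * d + M / d * (norm (h x))^2" by (simp add: algebra_simps)
        then show ?thesis using True M d by (simp add: ennreal_mult[symmetric] ennreal_plus[symmetric] ennreal_leI del: ennreal_plus)
      qed (simp add: c)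
    qed
    also have "\<dots> = ennreal (M * d) * emeasure lebesgue K + ennreal (M / d) * (\<integral>\<^sup>+x. ennreal ((norm (indicator K x *R h x))^2) \<partial>lebesgue)"
    proof -
      define q where "q x = ennreal ((norm (indicator K x *R h x))^2)" for x
      have q[measurable]: "q \<in> borel_lebesgue" unfolding q_def[abs_def] using hm by measurable
      have [measurable]: "K \<in> sets lebesgue" by (rule fmeasurableD[OF K])
      have "(\<integral>\<^sup>+x. ennreal (M * d) * indicator K x + ennreal (M / d) * q x \<partial>lebesgue)
        = (\<integral>\<^sup>+x. ennreal (M * d) * indicator K x \<partial>lebesgue) + (\<integral>\<^sup>+x. ennreal (M / d) * q x \<partial>lebesgue)" by (rule nn_integral_add) measurable
      also have "\<dots> = ennreal (M * d) * emeasure lebesgue K + ennreal (M / d) * (\<integral>\<^sup>+x. q x \<partial>lebesgue)"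
        by (simp only: nn_integral_cmult[OF q] nn_integral_cmult_indicator[OF fmeasurableD[OF K]])
      finally show ?thesis by (simp only: q_def)
    qed
    also have "\<dots> \<le> ennreal (M * d) * ennreal \<mu> + ennreal (M / d) * ennreal (E n)"
    proof (intro add_mono mult_left_mono)
      show "emeasure lebesgue K \<le> ennreal \<mu>" using K by (simp add: \<mu>_def emeasure_eq_measure2)
      have "(\<integral>\<^sup>+x. ennreal ((norm (indicator K x *R h x))^2) \<partial>lebesgue) \<le> ?e n"
        using c(3) by (intro nn_integral_mono) (auto simp: indicator_def h_def)
      also have "\<dots> = ennreal (E n)" using fin by (simp add: E_def)
      finally show "(\<integral>\<^sup>+x. ennreal ((norm (indicator K x *R h x))^2) \<partial>lebesgue) \<le> ennreal (E n)" .
    qed auto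
    also have "\<dots> = ennreal (M * \<mu> * d + M / d * E n)"
      using M d E0[of n] by (simp add: ennreal_mult[symmetric] ennreal_plus[symmetric] \<mu>_def mult.assoc mult.commute del: ennreal_plus)
    finally show ?thesis using M d E0[of n] by (subst (asm) ennreal_le_iff) (auto simp: \<mu>_def)
  qed
  have bd2: "norm ((LINT x|lebesgue. c x *R fs n x) - (LINT x|lebesgue. c x *R f x)) \<le> (M * \<mu> + M) * sqrt (E n)"
    if fin: "?e n < \<infinity>" for n
  proof (cases "E n = 0")
    case False
    then have "E n > 0" using E0[of n] by simp
    then have "M / sqrt (E n) * E n = M * sqrt (E n)"
      using real_div_sqrt[of "E n"] by (metis less_imp_le mult.commute times_divide_eq_left times_divide_eq_right)
    then show ?thesis using bd[OF _ fin, of "sqrt (E n)"] \<open>E n > 0\<close> by (simp add: algebra_simps)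
  next
    case True
    have m: "M * \<mu> \<ge> 0" using M by (simp add: \<mu>_def)
    have "norm ((LINT x|lebesgue. c x *R fs n x) - (LINT x|lebesgue. c x *R f x)) \<le> 0"
    proof (rule field_le_epsilon)
      fix e :: real assume e: "0 < e"
      have "M * \<mu> * (e / (M * \<mu> + 1)) \<le> e" using e m by (simp add: field_simps)
      then show "norm ((LINT x|lebesgue. c x *R fs n x) - (LINT x|lebesgue. c x *R f x)) \<le> 0 + e"
        using bd[OF _ fin, of "e / (M * \<mu> + 1)"] e m True by simp
    qed
    then show ?thesis using True by simp
  qed
  have "\<forall>\<^sub>F n in sequentially. ?e n < \<infinity>" using order_tendstoD(2)[OF lim, of \<infinity>] by simp
  then have "\<forall>\<^sub>F n in sequentially. norm ((LINT x|lebesgue. c x *R fs n x) - (LINT x|lebesgue. c x *R f x)) \<le> (M * \<mu> + M) * sqrt (E n)"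
    by eventually_elim (rule bd2)
  moreover have "(\<lambda>n. (M * \<mu> + M) * sqrt (E n)) \<longlonglongrightarrow> 0" using tendsto_mult[OF tendsto_const tendsto_real_sqrt[OF E], of "M * \<mu> + M"] by simp
  ultimately have "(\<lambda>n. (LINT x|lebesgue. c x *R fs n x) - (LINT x|lebesgue. c x *R f x)) \<longlonglongrightarrow> 0" by (rule Lim_null_comparison)
  then show ?thesis by (simp add: LIM_zero_iff)
qed

lemma W12_approx_parts:
  assumes "W12_approx U w u Du"
  shows "(\<lambda>n. \<integral>\<^sup>+x\<in>U. ennreal ((norm (w n x - u x))^2) \<partial>lebesgue) \<longlonglongrightarrow> 0"
    "(\<lambda>n. \<integral>\<^sup>+x\<in>U. ennreal ((norm (jacobian (w n) (at x) - Du x))^2) \<partial>lebesgue) \<longlonglongrightarrow> 0" using assms unfolding W12_approx_norm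
  by (rule tendsto_sandwich[OF _ _ tendsto_const, rotated 2];
      intro always_eventually allI nn_integral_mono; auto simp: indicator_def intro!: ennreal_leI)+

lemma norm_column_le: "norm (column j A) \<le> norm (A :: real^'m^'n)"
proof -
  have "(norm (column j A))^2 = (\<Sum>i\<in>UNIV. (A $ i $ j)^2)"
    unfolding power2_norm_eq_inner inner_vec_def inner_real_def by (simp add: column_def power2_eq_square)
  also have "\<dots> \<le> (\<Sum>i\<in>UNIV. \<Sum>j\<in>UNIV. (A $ i $ j)^2)" by (intro sum_mono member_le_sum) auto
  finally show ?thesis unfolding norm_matrix_sq2[symmetric] by (rule power2_le_imp_le) simp
qed

text \<open>The weak gradient is a closed operator: each side of the tested identity is a weak limit
  in the sense of \<open>weak_convergence\<close>.\<close>

lemma has_weak_grad_limit: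
  fixes f :: "real^2 => real^'n"
  assumes w: "\<And>n. has_weak_grad B (w n) (\<lambda>x. jacobian (w n) (at x))"
    and l: "loc_int B f" "loc_int B Df" and lim: "W12_approx B w f Df"
  shows "has_weak_grad B f Df"
proof (rule has_weak_gradI[OF l])
  fix \<phi> j assume \<phi>: "tst B \<phi>"
  obtain K where K: "compact K" "K \<subseteq> B" "\<And>x. x \<notin> K ==> \<phi> x = 0"
    "\<And>x. x \<notin> K ==> frechet_derivative \<phi> (at x) = (\<lambda>v. 0)" using tst_supp[OF \<phi>] by blast
  have "(\<lambda>n. LINT x|lebesgue. pd \<phi> j x *R w n x) \<longlonglongrightarrow> (LINT x|lebesgue. pd \<phi> j x *R f x)"
    by (rule weak_convergence[OF Ck1_deriv_continuous[OF tst_C1[OF \<phi>]] K(1,2) _ l(1) has_weak_gradD(1)[OF w] W12_approx_parts(1)[OF lim]])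
       (simp add: K(4))
  moreover have "(\<lambda>n. LINT x|lebesgue. \<phi> x *R column j (jacobian (w n) (at x))) \<longlonglongrightarrow> (LINT x|lebesgue. \<phi> x *R column j (Df x))"
  proof (rule weak_convergence[OF Ck1_continuous[OF tst_C1[OF \<phi>]] K(1,2,3) loc_int_column[OF l(2)] loc_int_column[OF has_weak_gradD(2)[OF w]]])
    show "(\<lambda>n. \<integral>\<^sup>+x\<in>B. ennreal ((norm (column j (jacobian (w n) (at x)) - column j (Df x)))^2) \<partial>lebesgue) \<longlonglongrightarrow> 0"
    proof (rule tendsto_sandwich[OF _ _ tendsto_const W12_approx_parts(2)[OF lim]]; intro always_eventually allI nn_integral_mono)
      fix n x
      have "column j (jacobian (w n) (at x)) - column j (Df x) = column j (jacobian (w n) (at x) - Df x)"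
        by (simp add: column_def vec_eq_iff)
      then show "ennreal ((norm (column j (jacobian (w n) (at x)) - column j (Df x)))^2) * indicator B x
        \<le> ennreal ((norm (jacobian (w n) (at x) - Df x))^2) * indicator B x"
        by (auto simp: indicator_def intro!: ennreal_leI power_mono norm_column_le)
    qed simp
  qed
  moreover have "(LINT x|lebesgue. pd \<phi> j x *R w n x) = - (LINT x|lebesgue. \<phi> x *R column j (jacobian (w n) (at x)))" for n
    by (rule has_weak_gradD(3)[OF w \<phi>])
  ultimately have "(\<lambda>n. - (LINT x|lebesgue. \<phi> x *R column j (jacobian (w n) (at x)))) \<longlonglongrightarrow> (LINT x|lebesgue. pd \<phi> j x *R f x)"
    "(\<lambda>n. - (LINT x|lebesgue. \<phi> x *R column j (jacobian (w n) (at x)))) \<longlonglongrightarrow> - (LINT x|lebesgue. \<phi> x *R column j (Df x))"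
    by (simp_all add: tendsto_minus)
  then show "(LINT x|lebesgue. pd \<phi> j x *R f x) = - (LINT x|lebesgue. \<phi> x *R column j (Df x))" by (rule LIMSEQ_unique)
qed

text \<open>Local W12 regularity with the gradient carried as an argument. Local arguments can thus
  name their gradient explicitly and never touch the choice in \<open>weak_grad\<close>.\<close>

definition w12l :: "(real^2) set => (real^2 => real^'n) => (real^2 => real^2^'n) => bool" where
  "w12l U u Du \<longleftrightarrow> has_weak_grad U u Du \<and> loc_int U (\<lambda>x. (norm (u x))^2) \<and> loc_int U (\<lambda>x. (norm (Du x))^2)"

lemma loc_int_norm_sq_bound:
  fixes f :: "real^2 => 'b::euclidean_space"
  assumes "loc_int U f" "loc_int U h" "\<And>x. x \<in> U ==> (norm (f x))^2 \<le> h x"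
  shows "loc_int U (\<lambda>x. (norm (f x))^2)" unfolding loc_int_def set_integrable_def
proof (intro allI impI)
  fix K assume K: "compact K" "K \<subseteq> U"
  have h: "integrable lebesgue (\<lambda>x. indicator K x *R h x)" and f: "integrable lebesgue (\<lambda>x. indicator K x *R f x)"
    using assms(1,2) K unfolding loc_int_def set_integrable_def by blast+
  have e: "indicator K x *R (norm (f x))^2 = (norm (indicator K x *R f x))^2" for x by (auto simp: indicator_def)
  show "integrable lebesgue (\<lambda>x. indicator K x *R (norm (f x))^2)" unfolding e
  proof (rule Bochner_Integration.integrable_bound[OF h])
    show "(\<lambda>x. (norm (indicator K x *R f x))^2) \<in> borel_lebesgue" using borel_measurable_integrable[OF f] by measurable
    show "AE x in lebesgue. norm ((norm (indicator K x *R f x))^2) \<le> norm (indicator K x *R h x)"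
      using assms(3) K(2) by (auto simp: indicator_def subset_iff intro!: order_trans[OF _ abs_ge_self])
  qed
qed

lemma loc_int_scaleR_on:
  fixes f :: "real^2 => 'b::euclidean_space"
  assumes f: "loc_int U f" and c: "continuous_on U c"
  shows "loc_int U (\<lambda>x. c x *R f x)" unfolding loc_int_def
proof (intro allI impI)
  fix K assume K: "compact K" "K \<subseteq> U"
  have fK: "integrable lebesgue (\<lambda>x. indicator K x *R f x)" using f K by (simp add: loc_int_def set_integrable_def)
  have cK: "continuous_on K c" by (rule continuous_on_subset[OF c K(2)])
  have "(\<lambda>x. indicator K x *R c x) \<in> borel_measurable borel"
    by (rule borel_measurable_continuous_on_indicator[OF _ cK]) (simp add: borel_compact K)
  then have cm: "(\<lambda>x. indicator K x *R c x) \<in> borel_lebesgue" by (intro measurable_completion) simp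
  obtain M where M: "M > 0" "\<And>x. x \<in> K ==> \<bar>c x\<bar> \<le> M"
    using compact_imp_bounded[OF compact_continuous_image[OF cK K(1)]] by (auto simp: bounded_pos)
  have e: "indicator K x *R (c x *R f x) = (indicator K x *R c x) *R (indicator K x *R f x)" for x by (auto simp: indicator_def)
  show "lset_int K (\<lambda>x. c x *R f x)" unfolding set_integrable_def
  proof (rule Bochner_Integration.integrable_bound[OF integrable_scaleR_right[OF fK, of M]])
    show "(\<lambda>x. indicator K x *R (c x *R f x)) \<in> borel_lebesgue"
      unfolding e by (intro borel_measurable_scaleR cm borel_measurable_integrable[OF fK])
    show "AE x in lebesgue. norm (indicator K x *R (c x *R f x)) \<le> norm (M *R (indicator K x *R f x))"
    proof (rule AE_I2)
      fix x show "norm (indicator K x *R (c x *R f x)) \<le> norm (M *R (indicator K x *R f x))"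
        using M(1) M(2)[of x] by (cases "x \<in> K") (auto intro: mult_right_mono)
    qed
  qed
qed

text \<open>Matrix units: a product A J is a combination of the products of A with these constant
  matrices, weighted by the entries of J, so its integrability reduces to that of scalar
  multiples.\<close>

definition munit :: "2 => 2 => real^2^2" where
  "munit k l = (\<chi> i j. if i = k \<and> j = l then 1 else 0)"

lemma matrix_mult_munit:
  "(A :: real^2^'n) ** J = (\<Sum>k\<in>UNIV. \<Sum>l\<in>UNIV. J $ k $ l *R (A ** munit k l))"
  by (simp add: vec_eq_iff matrix_matrix_mult_def munit_def sum_2 forall_2)

lemma bounded_linear_matrix_mult: "bounded_linear (\<lambda>A. (A :: real^2^'n) ** (B :: real^2^2))"
  by (rule linear_conv_bounded_linear[THEN iffD1], rule linearI)
     (auto simp: matrix_matrix_mult_def vec_eq_iff sum_2 algebra_simps)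

lemma loc_int_matrix_mult:
  fixes A :: "real^2 => real^2^'n" and J :: "real^2 => real^2^2"
  assumes "loc_int U A" "continuous_on U J"
  shows "loc_int U (\<lambda>x. A x ** J x)"
proof -
  have e: "(\<lambda>x. A x ** J x) = (\<lambda>x. \<Sum>k\<in>UNIV. \<Sum>l\<in>UNIV. J x $ k $ l *R (A x ** munit k l))" by (rule ext) (rule matrix_mult_munit)
  show ?thesis unfolding e sum_2
  by (intro loc_int_add loc_int_scaleR_on loc_int_bounded_linear[OF bounded_linear_matrix_mult] assms continuous_intros)
qed

lemma W12_approx_subset:
  assumes "W12_approx U w u Du" "V \<subseteq> U"
  shows "W12_approx V w u Du" unfolding W12_approx_norm by (rule tendsto_sandwich[OF _ _ tendsto_const assms(1)[unfolded W12_approx_norm]];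
      intro always_eventually allI nn_integral_mono) (use assms(2) in \<open>auto simp: indicator_def\<close>)

lemma W12_approx_cong_AE:
  assumes "W12_approx U w u Du" "AE x in lebesgue. x \<in> U --> u x = u' x \<and> Du x = Du' x"
  shows "W12_approx U w u' Du'"
proof -
  have "W12_err U (w n) u Du
    = W12_err U (w n) u' Du'" for n
    by (rule nn_integral_cong_AE) (use assms(2) in eventually_elim, auto simp: indicator_def)
  then show ?thesis using assms(1) unfolding W12_approx_norm by simp
qed

lemma norm_outer: "(norm (outer a d))^2 = ((d 1)^2 + (d 2)^2) * (norm a)^2"
proof -
  have "(norm (outer a d))^2 = (\<Sum>i\<in>UNIV. ((d 1)^2 + (d 2)^2) * (a $ i)^2)"
    unfolding norm_matrix_sq2 by (simp add: outer_def sum_2 power_mult_distrib algebra_simps)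
  also have "\<dots> = ((d 1)^2 + (d 2)^2) * (norm a)^2"
    unfolding sum_distrib_left[symmetric] power2_norm_eq_inner inner_vec_def inner_real_def by (simp add: power2_eq_square)
  finally show ?thesis .
qed

lemma w12l_cutoff:
  fixes u :: "real^2 => real^'n"
  assumes w: "w12l U u Du" and \<zeta>: "C1_on \<zeta> UNIV"
    and C: "closed C" "C \<subseteq> U" "\<And>x. x \<notin> C ==> \<zeta> x = 0"
  shows "w12l UNIV (\<lambda>x. \<zeta> x *R u x) (\<lambda>x. \<zeta> x *R Du x + outer (u x) (\<lambda>j. pd \<zeta> j x))"
proof -
  have D: "has_weak_grad U u Du" and sq: "loc_int U (\<lambda>x. (norm (u x))^2)" "loc_int U (\<lambda>x. (norm (Du x))^2)"
    using w by (simp_all add: w12l_def)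
  have c\<zeta>: "continuous_on UNIV \<zeta>" by (rule Ck1_continuous[OF \<zeta>])
  have z: "frechet_derivative \<zeta> (at x) = (\<lambda>v. 0)" if "x \<notin> C" for x by (rule frechet_zero_outside[OF C(1,3) that])
  let ?v = "\<lambda>x. \<zeta> x *R u x" and ?Dv = "\<lambda>x. \<zeta> x *R Du x + outer (u x) (\<lambda>j. pd \<zeta> j x)"
  have Dv: "has_weak_grad UNIV ?v ?Dv" by (rule has_weak_grad_cutoff[OF D \<zeta> C])
  have "loc_int U (\<lambda>x. (\<zeta> x)^2 *R (norm (u x))^2)" by (intro loc_int_scaleR sq continuous_intros c\<zeta>)
  then have "loc_int U (\<lambda>x. (norm (?v x))^2)" by (simp add: power_mult_distrib)
  then have 1: "loc_int UNIV (\<lambda>x. (norm (?v x))^2)" by (rule loc_int_zero_ext[OF _ C(1,2)]) (simp add: C(3))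
  have "loc_int U (\<lambda>x. (norm (?Dv x))^2)"
  proof (rule loc_int_norm_sq_bound[OF loc_int_subset[OF has_weak_gradD(2)[OF Dv] subset_UNIV]])
    show "loc_int U (\<lambda>x. (2 * (\<zeta> x)^2) *R (norm (Du x))^2 + (2 * ((pd \<zeta> 1 x)^2 + (pd \<zeta> 2 x)^2)) *R (norm (u x))^2)"
      by (intro loc_int_add loc_int_scaleR sq continuous_intros c\<zeta> Ck1_deriv_continuous \<zeta>)
    fix x
    have "(norm (a + b))^2 \<le> 2 * (norm a)^2 + 2 * (norm b)^2" for a b :: "real^2^'n"
    proof -
      have "(norm (a + b))^2 \<le> (norm a + norm b)^2" by (intro power_mono norm_triangle_ineq) auto
      also have "\<dots> \<le> 2 * (norm a)^2 + 2 * (norm b)^2" using sum_squares_bound[of "norm a" "norm b"] by (simp add: power2_sum)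
      finally show ?thesis .
    qed
    from this[of "\<zeta> x *R Du x" "outer (u x) (\<lambda>j. pd \<zeta> j x)"]
    show "(norm (?Dv x))^2 \<le> (2 * (\<zeta> x)^2) *R (norm (Du x))^2 + (2 * ((pd \<zeta> 1 x)^2 + (pd \<zeta> 2 x)^2)) *R (norm (u x))^2"
      by (simp add: norm_outer power_mult_distrib algebra_simps)
  qed
  then have "loc_int UNIV (\<lambda>x. (norm (?Dv x))^2)"
    by (rule loc_int_zero_ext[OF _ C(1,2)]) (simp add: C(3) z norm_eq_zero outer_def vec_eq_iff)
  with 1 Dv show ?thesis by (simp add: w12l_def)
qed

lemma w12l_mollify:
  fixes u :: "real^2 => real^'n"
  assumes "w12l UNIV u Du"
  shows "\<exists>w. (\<forall>n. C1_on (w n) UNIV) \<and> (\<forall>R. W12_approx (cball 0 R) w u Du) \<and>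
    (\<forall>p. (\<forall>y. u (y + p) = u y) --> (\<forall>n x. w n (x + p) = w n x))"
proof -
  have D: "has_weak_grad UNIV u Du" "loc_int UNIV (\<lambda>x. (norm (u x))^2)" "loc_int UNIV (\<lambda>x. (norm (Du x))^2)"
    using assms by (simp_all add: w12l_def)
  show ?thesis
  proof (rule W12_mollify[OF D])
    fix w
    assume 1: "\<And>n. C1_on (w n) UNIV" and 2: "\<And>R. 0 < R ==> W12_approx (cball 0 R) w u Du"
      and 3: "\<And>p n x. (\<And>y. u (y + p) = u y) ==> w n (x + p) = w n x"
    have R: "W12_approx (cball 0 R) w u Du" for R by (rule W12_approx_subset[OF 2[of "max R 1"]]) auto
    have "\<forall>p. (\<forall>y. u (y + p) = u y) --> (\<forall>n x. w n (x + p) = w n x)"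
    proof (intro allI impI)
      fix p n x assume "\<forall>y. u (y + p) = u y"
      then show "w n (x + p) = w n x" by (intro 3) (rule spec)
    qed
    then show ?thesis using 1 R by (intro exI[of _ w] conjI allI) simp_all
  qed
qed

text \<open>Multiplying by a cutoff and mollifying reduces the chain rule to that for \<open>C\<^sup>1\<close> maps.\<close>

lemma w12l_ball_approx:
  fixes u :: "real^2 => real^'n"
  assumes w: "w12l U u Du" and s: "0 < s" "cball y (2 * s) \<subseteq> U"
  obtains w where "\<And>n. C1_on (w n) UNIV" "W12_approx (ball y s) w u Du"
proof -
  let ?\<zeta> = "ball_cutoff y s (2 * s)"
  have \<zeta>: "C1_on ?\<zeta> UNIV" by (rule ball_cutoff) (use s in auto)
  have z: "?\<zeta> x = 0" if "x \<notin> cball y (2 * s)" for x by (rule ball_cutoff) (use s that in auto)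
  have p: "frechet_derivative ?\<zeta> (at x) = (\<lambda>v. 0)" if "x \<in> ball y s" for x
  proof -
    have "(?\<zeta> has_derivative (\<lambda>v. 0)) (at x)" by (rule has_derivative_transform_within_open[OF has_derivative_const[of 1] open_ball that])
         (use ball_cutoff(2)[of s "2 * s" _ y] s in auto)
    then show ?thesis by (rule frechet_derivative_at[symmetric])
  qed
  obtain w where w: "\<And>n. C1_on (w n) UNIV"
    "\<And>R. W12_approx (cball 0 R) w (\<lambda>x. ?\<zeta> x *R u x) (\<lambda>x. ?\<zeta> x *R Du x + outer (u x) (\<lambda>j. pd ?\<zeta> j x))"
    using w12l_mollify[OF w12l_cutoff[OF w \<zeta> closed_cball s(2) z]] by blast
  have "ball y s \<subseteq> cball 0 (norm y + s)"
  proof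
    fix x assume "x \<in> ball y s"
    then show "x \<in> cball 0 (norm y + s)" using norm_triangle_sub[of x y] by (auto simp: dist_norm norm_minus_commute)
  qed
  then have "W12_approx (ball y s) w (\<lambda>x. ?\<zeta> x *R u x) (\<lambda>x. ?\<zeta> x *R Du x + outer (u x) (\<lambda>j. pd ?\<zeta> j x))"
    by (rule W12_approx_subset[OF w(2)])
  then have "W12_approx (ball y s) w u Du" by (rule W12_approx_cong_AE)
       (use p ball_cutoff(2)[of s "2 * s" _ y] s in \<open>auto simp: outer_def vec_eq_iff\<close>)
  then show ?thesis using that w(1) by blast
qed

context local_diffeo
begin

text \<open>Near a point u is a W12 limit of C1 maps, for which the chain rule is classical.
  Composition with g preserves the convergence on a ball where g is injective, the weak gradient
  passes to the limit, and locality assembles the balls.\<close>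

lemma w12l_compose:
  fixes u :: "real^2 => real^'n"
  assumes w: "w12l U u Du" and U: "open U" "g ` V \<subseteq> U"
  shows "w12l V (\<lambda>x. u (g x)) (\<lambda>x. Du (g x) ** jacobian g (at x))"
proof -
  have D: "has_weak_grad U u Du" and sq: "loc_int U (\<lambda>x. (norm (u x))^2)" "loc_int U (\<lambda>x. (norm (Du x))^2)"
    using w by (simp_all add: w12l_def)
  have l1: "loc_int V (\<lambda>x. u (g x))" by (rule loc_int_compose[OF has_weak_gradD(1)[OF D] U])
  have l2: "loc_int V (\<lambda>x. Du (g x) ** jacobian g (at x))"
    by (intro loc_int_matrix_mult jacobian_continuous C1 loc_int_compose[OF has_weak_gradD(2)[OF D] U])
  have s1: "loc_int V (\<lambda>x. (norm (u (g x)))^2)" by (rule loc_int_compose[OF sq(1) U])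
  have s2: "loc_int V (\<lambda>x. (norm (Du (g x) ** jacobian g (at x)))^2)"
  proof (rule loc_int_norm_sq_bound[OF l2])
    show "loc_int V (\<lambda>x. (norm (jacobian g (at x)))^2 *R (norm (Du (g x)))^2)"
      by (intro loc_int_scaleR_on loc_int_compose[OF sq(2) U] continuous_intros jacobian_continuous C1)
    show "(norm (Du (g x) ** jacobian g (at x)))^2 \<le> (norm (jacobian g (at x)))^2 *R (norm (Du (g x)))^2" for x
      using power_mono[OF norm_matrix_mul[of "Du (g x)" "jacobian g (at x)"], of 2] by (simp add: power_mult_distrib mult.commute)
  qed
  have "has_weak_grad V (\<lambda>x. u (g x)) (\<lambda>x. Du (g x) ** jacobian g (at x))"
  proof (rule has_weak_grad_locally)
    fix x assume x: "x \<in> V"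
    have "g x \<in> U" using x U by blast
    then obtain t where t: "t > 0" "cball (g x) t \<subseteq> U" using U(1) open_contains_cball by blast
    obtain r where r: "r > 0" "cball x r \<subseteq> V" "inj_on g (cball x r)" "g ` cball x r \<subseteq> ball (g x) (t/2)"
      using inj_cball[OF x open_ball, of "g x" "t/2"] t(1) by auto
    obtain w where w: "\<And>n. C1_on (w n) UNIV" "W12_approx (ball (g x) (t/2)) w u Du"
      by (rule w12l_ball_approx[OF w, of "t/2" "g x"]) (use t in auto)
    have bU: "ball (g x) (t/2) \<subseteq> U" using t by (auto simp: subset_iff)
    have A: "W12_approx (ball x r) (\<lambda>n x. w n (g x)) (\<lambda>x. u (g x)) (\<lambda>x. Du (g x) ** jacobian g (at x))"
      by (rule W12_approx_compose[OF ball_subset_cball compact_cball r(2) _ _ _ open_ball _ _ w])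
         (use r(3,4) loc_int_subset[OF _ bU] has_weak_gradD(1,2)[OF D] ball_subset_cball[of x r] in \<open>auto intro: inj_on_subset\<close>)
    have bV: "ball x r \<subseteq> V" using r(2) ball_subset_cball by blast
    have "has_weak_grad (ball x r) (\<lambda>x. u (g x)) (\<lambda>x. Du (g x) ** jacobian g (at x))"
    proof (rule has_weak_grad_limit[OF _ _ _ A])
      show "has_weak_grad (ball x r) (\<lambda>x. w n (g x)) (\<lambda>y. jacobian (\<lambda>x. w n (g x)) (at y))" for n
        by (intro Ck1_has_weak_grad Ck1_compose[OF _ open_UNIV w(1)] Ck1_subset[OF C1] bV) auto
    qed (rule loc_int_subset[OF l1 bV] loc_int_subset[OF l2 bV])+
    then show "\<exists>W. open W \<and> x \<in> W \<and> has_weak_grad W (\<lambda>x. u (g x)) (\<lambda>x. Du (g x) ** jacobian g (at x))"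
      using r(1) by (intro exI[of _ "ball x r"]) auto
  qed
  then show ?thesis using s1 s2 by (simp add: w12l_def)
qed

end

section \<open>Sobolev maps, perforated domains and the singular set\<close>

lemma set_integrable_loc_int:
  fixes f :: "real^2 => 'b::euclidean_space"
  assumes "lset_int U f"
  shows "loc_int U f" unfolding loc_int_def using set_integrable_subset[OF assms] by (auto intro: fmeasurableD lmeasurable_compact)

text \<open>Square integrability over U contains the local one, so \<open>w12l\<close> can carry all
  local arguments and W12 adds only two global integrals and the constraint.\<close>

lemma W12_iff:
  "W12 U N u \<longleftrightarrow> lset_int U (\<lambda>x. (norm (u x))^2) \<and>
     (\<exists>Du. w12l U u Du \<and> lset_int U (\<lambda>x. (norm (Du x))^2)) \<and>
     (AE x in lebesgue. x \<in> U --> u x \<in> N)" unfolding W12_def w12l_def frob_norm using set_integrable_loc_int by blast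

lemma has_weak_grad_weak_grad: "has_weak_grad U u Du ==> has_weak_grad U u (weak_grad U u)"
  unfolding weak_grad_def by (rule someI[of "has_weak_grad U u" Du])

lemma weak_grad_AE:
  assumes "open V" "V \<subseteq> U" "has_weak_grad U u Du" "has_weak_grad V u D'"
  shows "AE x in lebesgue. x \<in> V --> weak_grad U u x = D' x"
  by (rule has_weak_grad_unique[OF assms(1) has_weak_grad_subset[OF has_weak_grad_weak_grad[OF assms(3)] assms(2)] assms(4)])

lemma set_integrable_cong_AE':
  fixes f g :: "real^2 => 'b::euclidean_space"
  assumes f: "lset_int U f" and ae: "AE x in lebesgue. x \<in> U --> f x = g x"
  shows "lset_int U g" "(LINT x:U|lebesgue. f x) = (LINT x:U|lebesgue. g x)"
proof -
  have i: "integrable lebesgue (\<lambda>x. indicator U x *R f x)" using f by (simp add: set_integrable_def)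
  have ae': "AE x in lebesgue. indicator U x *R f x = indicator U x *R g x" using ae by (rule eventually_mono) (auto simp: indicator_def)
  have m: "(\<lambda>x. indicator U x *R g x) \<in> borel_lebesgue" by (rule borel_measurable_AE[OF borel_measurable_integrable[OF i] ae'])
  show "lset_int U g" unfolding set_integrable_def by (rule integrable_cong_AE_imp[OF i m ae'])
  show "(LINT x:U|lebesgue. f x) = (LINT x:U|lebesgue. g x)" unfolding set_lebesgue_integral_def
    by (rule integral_cong_AE[OF borel_measurable_integrable[OF i] m ae'])
qed

lemma w12l_cong_AE:
  assumes w: "w12l U u Du" and ae: "AE x in lebesgue. x \<in> U --> u x = u' x" "AE x in lebesgue. x \<in> U --> Du x = Du' x"
  shows "w12l U u' Du'"
proof -
  have "has_weak_grad U u' Du'" using w has_weak_grad_cong_AE[OF _ ae] by (simp add: w12l_def)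
  moreover have L: "loc_int U (\<lambda>x. (norm (g x))^2)" if "loc_int U (\<lambda>x. (norm (f x))^2)" "AE x in lebesgue. x \<in> U --> f x = g x"
    for f g :: "real^2 => 'b::euclidean_space" unfolding loc_int_def
  proof (intro allI impI)
    fix K assume K: "compact K" "K \<subseteq> U"
    then have "lset_int K (\<lambda>x. (norm (f x))^2)" using that(1) by (simp add: loc_int_def)
    then show "lset_int K (\<lambda>x. (norm (g x))^2)" by (rule set_integrable_cong_AE'(1)) (use that(2) K in \<open>auto elim!: eventually_mono\<close>)
  qed
  ultimately show ?thesis using w L[OF _ ae(1)] L[OF _ ae(2)] by (simp add: w12l_def)
qed

lemma w12l_subset: "w12l U u Du ==> V \<subseteq> U ==> w12l V u Du" unfolding w12l_def using has_weak_grad_subset loc_int_subset by blast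

lemma w12l_locally:
  assumes "\<And>x. x \<in> U ==> \<exists>V. open V \<and> x \<in> V \<and> w12l V u Du"
  shows "w12l U u Du" unfolding w12l_def
proof (intro conjI)
  show "has_weak_grad U u Du" by (rule has_weak_grad_locally) (use assms in \<open>auto simp: w12l_def\<close>)
  show "loc_int U (\<lambda>x. (norm (u x))^2)" "loc_int U (\<lambda>x. (norm (Du x))^2)" by (rule loc_int_locally; use assms in \<open>auto simp: w12l_def\<close>)+
qed

text \<open>Weak gradients on countably many open sets agree almost everywhere on overlaps, so they can be patched.\<close>

lemma w12l_UN:
  fixes U :: "nat => (real^2) set"
  assumes U: "\<And>n. open (U n)" and D: "\<And>n. w12l (U n) u (D n)"
  shows "\<exists>Du. w12l (\<Union>n. U n) u Du \<and> (\<forall>n. AE x in lebesgue. x \<in> U n --> Du x = D n x)"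
proof -
  \<comment> \<open>At each point the gradient of the first set containing it is taken; outside a
    null set the choice makes no difference.\<close>
  define Du where "Du x = D (LEAST n. x \<in> U n) x" for x
  have "AE x in lebesgue. \<forall>m n. x \<in> U m \<inter> U n --> D m x = D n x" unfolding AE_all_countable
  proof (intro allI)
    fix m n
    have h: "has_weak_grad (U k) u (D k)" for k using D by (simp add: w12l_def)
    show "AE x in lebesgue. x \<in> U m \<inter> U n --> D m x = D n x"
      by (rule has_weak_grad_unique[OF open_Int[OF U U] has_weak_grad_subset[OF h] has_weak_grad_subset[OF h]]) auto
  qed
  then have ae: "AE x in lebesgue. x \<in> U n --> Du x = D n x" for n
  proof (rule eventually_mono, intro impI)
    fix x assume *: "\<forall>m n. x \<in> U m \<inter> U n --> D m x = D n x" and x: "x \<in> U n"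
    have "x \<in> U (LEAST n. x \<in> U n)" using x by (rule LeastI)
    then show "Du x = D n x" unfolding Du_def using * x by blast
  qed
  have "w12l (\<Union>n. U n) u Du"
  proof (rule w12l_locally)
    fix x assume "x \<in> (\<Union>n. U n)"
    then obtain n where "x \<in> U n" by blast
    moreover have "w12l (U n) u Du" by (rule w12l_cong_AE[OF D]) (use ae[of n] in \<open>auto elim!: eventually_mono\<close>)
    ultimately show "\<exists>V. open V \<and> x \<in> V \<and> w12l V u Du" using U by blast
  qed
  then show ?thesis using ae by blast
qed

lemma W12_subset:
  assumes "W12 U N u" "V \<subseteq> U" "open V"
  shows "W12 V N u"
proof -
  have V: "V \<in> sets lebesgue" using assms(3) by simp
  show ?thesis using assms(1) unfolding W12_iff using set_integrable_subset[OF _ V assms(2)] w12l_subset[OF _ assms(2)] assms(2)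
    by (blast intro: eventually_mono)
qed

lemma W12_Un:
  assumes U: "open U" "open V" and W: "W12 U N u" "W12 V N u"
  shows "W12 (U \<union> V) N u"
proof -
  obtain D1 D2 where D: "w12l U u D1" "lset_int U (\<lambda>x. (norm (D1 x))^2)"
    "w12l V u D2" "lset_int V (\<lambda>x. (norm (D2 x))^2)" using W unfolding W12_iff by blast
  obtain Du where Du: "w12l (\<Union>n::nat. if n = 0 then U else V) u Du"
    "\<And>n::nat. AE x in lebesgue. x \<in> (if n = 0 then U else V) --> Du x = (if n = 0 then D1 else D2) x"
  proof -
    \<comment> \<open>The pair is read as the sequence U, V, V, V, ... in order to use the patching
      result for countable unions.\<close>
    let ?U = "\<lambda>n::nat. if n = 0 then U else V" and ?D = "\<lambda>n::nat. if n = 0 then D1 else D2"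
    have 1: "open (?U n)" for n using U by simp
    have 2: "w12l (?U n) u (?D n)" for n using D by simp
    from w12l_UN[of ?U u ?D, OF 1 2] show ?thesis using that by blast
  qed
  have e: "(\<Union>n::nat. if n = 0 then U else V) = U \<union> V" by (auto split: if_splits intro: exI[of _ 1])
  have s: "U \<in> sets lebesgue" "V \<in> sets lebesgue" using U by auto
  have "lset_int U (\<lambda>x. (norm (Du x))^2)" by (rule set_integrable_cong_AE'(1)[OF D(2)]) (use Du(2)[of 0] in \<open>auto elim!: eventually_mono\<close>)
  moreover have "lset_int V (\<lambda>x. (norm (Du x))^2)"
    by (rule set_integrable_cong_AE'(1)[OF D(4)]) (use Du(2)[of 1] in \<open>auto elim!: eventually_mono\<close>)
  ultimately have "lset_int (U \<union> V) (\<lambda>x. (norm (Du x))^2)" using s by (intro set_integrable_Un) auto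
  moreover have "lset_int (U \<union> V) (\<lambda>x. (norm (u x))^2)" using W s unfolding W12_iff by (intro set_integrable_Un) auto
  moreover have "AE x in lebesgue. x \<in> U \<union> V --> u x \<in> N" using W unfolding W12_iff by (auto elim: eventually_elim2)
  ultimately show ?thesis using Du(1) unfolding W12_iff e by blast
qed

lemma open_perforated: "open \<Omega> ==> finite S ==> open (perforated \<Omega> S \<rho>)" unfolding perforated_def by (intro open_Diff closed_UN) auto

lemma perforated_mono: "S \<subseteq> T ==> \<rho> \<le> \<sigma> ==> perforated \<Omega> T \<sigma> \<subseteq> perforated \<Omega> S \<rho>" unfolding perforated_def by (force simp: subset_iff)

text \<open>If u is W12 on a ball around s, then this ball fills the hole around s as soon as the
  hole has smaller radius, and W12 regularity survives the union of two open sets.\<close>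

lemma ren_admissible_remove:
  assumes \<Omega>: "open \<Omega>" and S: "ren_admissible \<Omega> N u S" and r: "0 < r" "W12 (ball s r) N u"
  shows "ren_admissible \<Omega> N u (S - {s})"
proof -
  have f: "finite S" using S by (simp add: ren_admissible_def)
  have "\<forall>\<^sub>F \<rho> in at_right 0. \<rho> < r" using r(1) by (auto simp: eventually_at_right_field)
  moreover have "\<forall>\<^sub>F \<rho> in at_right 0. W12 (perforated \<Omega> S \<rho>) N u" using S by (simp add: ren_admissible_def)
  ultimately have "\<forall>\<^sub>F \<rho> in at_right 0. W12 (perforated \<Omega> (S - {s}) \<rho>) N u"
  proof eventually_elim
    fix \<rho> assume *: "\<rho> < r" "W12 (perforated \<Omega> S \<rho>) N u"
    have "W12 (perforated \<Omega> S \<rho> \<union> ball s r) N u" by (rule W12_Un[OF open_perforated[OF \<Omega> f] open_ball *(2) r(2)])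
    moreover have "perforated \<Omega> (S - {s}) \<rho> \<subseteq> perforated \<Omega> S \<rho> \<union> ball s r" using *(1) unfolding perforated_def by auto
    ultimately show "W12 (perforated \<Omega> (S - {s}) \<rho>) N u" by (rule W12_subset) (rule open_perforated[OF \<Omega>], simp add: f)
  qed
  then show ?thesis using S unfolding ren_admissible_def by auto
qed

text \<open>An intrinsic description of the smallest admissible set, on which
  \<open>ren_energy\<close> is evaluated. Unlike an intersection over admissible sets it is visibly
  transported by diffeomorphisms.\<close>

definition bad_pts :: "(real^2) set => (real^'n) set => (real^2 => real^'n) => (real^2) set" where
  "bad_pts \<Omega> N u = {s \<in> \<Omega>. \<not> (\<exists>r>0. W12 (ball s r) N u)}"

lemma eventually_at_right_zero: "0 < (c::real) ==> \<forall>\<^sub>F \<rho> in at_right 0. 0 < \<rho> \<and> \<rho> < c"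
  by (auto simp: eventually_at_right_field intro!: exI[of _ c])

lemma ball_subset_perforated:
  assumes "open \<Omega>" "finite S" "s \<in> \<Omega>" "s \<notin> S"
  shows "\<exists>r>0. ball s r \<subseteq> perforated \<Omega> S r"
proof -
  obtain r1 where r1: "r1 > 0" "ball s r1 \<subseteq> \<Omega>" using assms open_contains_ball by blast
  obtain d where d: "d > 0" "\<forall>a\<in>S. s \<noteq> a --> d \<le> dist s a" using finite_set_avoid[OF assms(2), of s] by auto
  let ?r = "min r1 (d / 2)"
  have "ball s ?r \<subseteq> perforated \<Omega> S ?r"
  proof
    fix x assume x: "x \<in> ball s ?r"
    have "x \<notin> cball a ?r" if "a \<in> S" for a
    proof
      assume "x \<in> cball a ?r"
      then have "dist s a < d" using x dist_triangle[of s a x] by (auto simp: dist_commute)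
      then show False using d assms(4) that by force
    qed
    then show "x \<in> perforated \<Omega> S ?r" using x r1 by (auto simp: perforated_def)
  qed
  then show ?thesis using r1 d by (intro exI[of _ ?r]) auto
qed

text \<open>Admissibility promises regularity for small radii only; larger holes leave a smaller
  domain, so it extends to every positive radius.\<close>

lemma W12_perforated:
  assumes \<Omega>: "open \<Omega>" and S: "ren_admissible \<Omega> N u S" and "0 < \<rho>"
  shows "W12 (perforated \<Omega> S \<rho>) N u"
proof -
  have "\<forall>\<^sub>F \<sigma> in at_right 0. W12 (perforated \<Omega> S \<sigma>) N u" using S by (simp add: ren_admissible_def)
  then have "\<forall>\<^sub>F \<sigma> in at_right 0. W12 (perforated \<Omega> S \<sigma>) N u \<and> 0 < \<sigma> \<and> \<sigma> < \<rho>"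
    using eventually_at_right_zero[OF assms(3)] by (rule eventually_conj)
  then obtain \<sigma> where s: "W12 (perforated \<Omega> S \<sigma>) N u" "\<sigma> < \<rho>"
    using eventually_happens[of _ "at_right (0::real)"] by (auto simp: trivial_limit_at_right_real)
  show ?thesis by (rule W12_subset[OF s(1) perforated_mono[OF subset_refl] open_perforated[OF \<Omega>]])
       (use S s(2) in \<open>auto simp: ren_admissible_def\<close>)
qed

lemma bad_pts_subset:
  assumes \<Omega>: "open \<Omega>" and S: "ren_admissible \<Omega> N u S"
  shows "bad_pts \<Omega> N u \<subseteq> S"
proof
  fix s assume s: "s \<in> bad_pts \<Omega> N u"
  show "s \<in> S"
  proof (rule ccontr)
    assume "s \<notin> S"
    moreover have "finite S" "s \<in> \<Omega>" using S s by (auto simp: ren_admissible_def bad_pts_def)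
    ultimately obtain r where r: "r > 0" "ball s r \<subseteq> perforated \<Omega> S r" using ball_subset_perforated[OF \<Omega>] by blast
    have "W12 (ball s r) N u" by (rule W12_subset[OF W12_perforated[OF \<Omega> S r(1)] r(2) open_ball])
    then show False using s r(1) by (auto simp: bad_pts_def)
  qed
qed

lemma ren_admissible_bad_pts:
  assumes \<Omega>: "open \<Omega>" and S: "ren_admissible \<Omega> N u S"
  shows "ren_admissible \<Omega> N u (bad_pts \<Omega> N u)"
proof -
  have SO: "finite S" "S \<subseteq> \<Omega>" using S by (auto simp: ren_admissible_def)
  have "ren_admissible \<Omega> N u (S - F)" if "finite F" "F \<subseteq> S - bad_pts \<Omega> N u" for F using that
  proof (induction F)
    case empty then show ?case using S by simp
  next
    case (insert s F)
    then have "s \<in> \<Omega>" "s \<notin> bad_pts \<Omega> N u" using SO by auto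
    then obtain r where "r > 0" "W12 (ball s r) N u" by (auto simp: bad_pts_def)
    then have "ren_admissible \<Omega> N u ((S - F) - {s})" using insert by (intro ren_admissible_remove[OF \<Omega>]) auto
    moreover have "(S - F) - {s} = S - insert s F" by auto
    ultimately show ?case by simp
  qed
  from this[of "S - bad_pts \<Omega> N u"] bad_pts_subset[OF \<Omega> S] SO show ?thesis by (simp add: double_diff)
qed

lemma Inter_ren_admissible:
  assumes \<Omega>: "open \<Omega>" and S: "ren_admissible \<Omega> N u S"
  shows "\<Inter>{S. ren_admissible \<Omega> N u S} = bad_pts \<Omega> N u" using ren_admissible_bad_pts[OF assms] bad_pts_subset[OF \<Omega>] by blast

text \<open>Ties the points that enter the energy to the listed singularities, near which the vector
  field is constant and the synharmony limits are known.\<close>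

lemma bad_pts_loc_closure:
  assumes \<Omega>: "open \<Omega>" and W: "W12_loc_closure \<Omega> A N u"
  shows "bad_pts \<Omega> N u \<subseteq> A"
proof
  fix s assume s: "s \<in> bad_pts \<Omega> N u"
  show "s \<in> A"
  proof (rule ccontr)
    assume "s \<notin> A"
    then have "s \<in> closure \<Omega> - A" using s closure_subset by (auto simp: bad_pts_def)
    then obtain r where r: "r > 0" "W12 (\<Omega> \<inter> ball s r) N u" using W unfolding W12_loc_closure_def by blast
    have "s \<in> \<Omega> \<inter> ball s r" using s r by (auto simp: bad_pts_def)
    then obtain t where t: "t > 0" "ball s t \<subseteq> \<Omega> \<inter> ball s r" using \<Omega> open_contains_ball by (metis open_Int open_ball)
    then show False using W12_subset[OF r(2) t(2)] s by (auto simp: bad_pts_def)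
  qed
qed

text \<open>A single gradient off S replaces the gradients that \<open>weak_grad\<close> picks
  separately on every perforated domain. It comes from patching along the radii 1/(n+1).\<close>

lemma w12l_off_singularities:
  assumes \<Omega>: "open \<Omega>" and S: "ren_admissible \<Omega> N u S"
  obtains Du where "w12l (\<Omega> - S) u Du" "\<And>\<rho>. 0 < \<rho> ==> lset_int (perforated \<Omega> S \<rho>) (\<lambda>x. (norm (Du x))^2)"
proof -
  have fS: "finite S" using S by (simp add: ren_admissible_def)
  define U where "U n = perforated \<Omega> S (1 / real (Suc n))" for n
  have oU: "open (U n)" for n unfolding U_def by (rule open_perforated[OF \<Omega> fS])
  have "\<exists>D. w12l (U n) u D \<and> lset_int (U n) (\<lambda>x. (norm (D x))^2)" for n
    using W12_perforated[OF \<Omega> S, of "1 / real (Suc n)"] unfolding W12_iff U_def by auto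
  then obtain D where D: "\<And>n. w12l (U n) u (D n)" "\<And>n. lset_int (U n) (\<lambda>x. (norm (D n x))^2)" by metis
  obtain Du where Du: "w12l (\<Union>n. U n) u Du" "\<And>n. AE x in lebesgue. x \<in> U n --> Du x = D n x" using w12l_UN[of U u D, OF oU D(1)] by blast
  have "(\<Union>n. U n) = \<Omega> - S"
  proof (intro set_eqI iffI)
    fix x assume x: "x \<in> \<Omega> - S"
    then obtain r where r: "r > 0" "ball x r \<subseteq> perforated \<Omega> S r" using ball_subset_perforated[OF \<Omega> fS] by blast
    obtain n where "1 / real (Suc n) < r" using nat_approx_posE[OF r(1)] by blast
    then have "perforated \<Omega> S r \<subseteq> U n" unfolding U_def by (intro perforated_mono) auto
    then show "x \<in> (\<Union>n. U n)" using r by force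
  next
    fix x assume "x \<in> (\<Union>n. U n)"
    then obtain n where n: "x \<in> U n" by blast
    then have "x \<notin> cball a (1 / real (Suc n))" if "a \<in> S" for a using that by (auto simp: U_def perforated_def)
    then have "x \<notin> S" using centre_in_cball[of x "1 / real (Suc n)"] by fastforce
    then show "x \<in> \<Omega> - S" using n by (auto simp: U_def perforated_def)
  qed
  moreover have "lset_int (perforated \<Omega> S \<rho>) (\<lambda>x. (norm (Du x))^2)" if "0 < \<rho>" for \<rho>
  proof -
    obtain n where n: "1 / real (Suc n) < \<rho>" using nat_approx_posE[OF \<open>0 < \<rho>\<close>] by blast
    have "lset_int (U n) (\<lambda>x. (norm (Du x))^2)"
      by (rule set_integrable_cong_AE'(1)[OF D(2)]) (use Du(2)[of n] in \<open>auto elim!: eventually_mono\<close>)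
    then show ?thesis
    proof (rule set_integrable_subset)
      show "perforated \<Omega> S \<rho> \<in> sets lebesgue" using open_perforated[OF \<Omega> fS, of \<rho>] by simp
      show "perforated \<Omega> S \<rho> \<subseteq> U n" unfolding U_def using n by (intro perforated_mono) auto
    qed
  qed
  ultimately show ?thesis using Du(1) by (intro that[of Du]) simp_all
qed

section \<open>Global diffeomorphisms\<close>

text \<open>Uniform bounds on the Jacobian carry integrability over arbitrary open sets, possibly
  unbounded or reaching up to the boundary of \<Omega>, where compactness arguments would
  not.\<close>

locale global_diffeo =
  fixes g :: "real^2 => real^2" and c L :: real
  assumes gC1: "C1_on g UNIV" and ginj: "inj g" and c: "0 < c"
    and gdet: "\<And>x. c \<le> \<bar>det (jacobian g (at x))\<bar>" and gbound: "\<And>x. norm (jacobian g (at x)) \<le> L"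
begin

lemma local: "open V ==> local_diffeo g V"
proof
  show "\<exists>r>0. inj_on g (ball x r)" for x using ginj by (intro exI[of _ 1]) (auto intro: inj_on_subset)
  show "det (jacobian g (at x)) \<noteq> 0" for x using gdet[of x] c by auto
qed (use gC1 in \<open>auto intro: Ck1_subset\<close>)

lemma open_vimage: "open U ==> open (g -` U)" using continuous_open_preimage[OF Ck1_continuous[OF gC1] open_UNIV] by simp

lemma set_integrable_comp:
  fixes f :: "real^2 => real"
  assumes U: "open U" "U \<subseteq> range g" and f: "lset_int U f"
  shows "lset_int (g -` U) (\<lambda>x. f (g x))"
proof -
  interpret local_diffeo g "g -` U" by (rule local[OF open_vimage[OF U(1)]])
  have im: "g ` (g -` U) = U" using U(2) by auto
  have m: "g -` U \<in> sets lebesgue" using open_vimage[OF U(1)] by simp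
  have i: "lset_int (g -` U) (\<lambda>x. \<bar>det (jacobian g (at x))\<bar> * f (g x))"
  proof -
    have f': "lset_int (g ` (g -` U)) f" using f by (simp only: im)
    have "lset_int (g -` U) (\<lambda>x. \<bar>det (matrix ((*v) (jacobian g (at x))))\<bar> * f (g x))"
      by (rule cov_real(1)[OF m cov _ f']) (use ginj in \<open>auto intro: inj_on_subset\<close>)
    then show ?thesis by simp
  qed
  have l: "loc_int (g -` U) (\<lambda>x. f (g x))" by (rule loc_int_compose[OF set_integrable_loc_int[OF f] U(1)]) auto
  show ?thesis unfolding set_integrable_def
  proof (rule Bochner_Integration.integrable_bound)
    show "integrable lebesgue (\<lambda>x. inverse c *R (indicator (g -` U) x *R (\<bar>det (jacobian g (at x))\<bar> * f (g x))))"
      using i unfolding set_integrable_def by (rule integrable_scaleR_right)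
    show "(\<lambda>x. indicator (g -` U) x *R f (g x)) \<in> borel_lebesgue" by (rule loc_int_measurable[OF open_dom l])
    show "AE x in lebesgue. norm (indicator (g -` U) x *R f (g x)) \<le>
      norm (inverse c *R (indicator (g -` U) x *R (\<bar>det (jacobian g (at x))\<bar> * f (g x))))"
    proof (rule AE_I2)
      fix x
      have "1 * \<bar>f (g x)\<bar> \<le> (inverse c * \<bar>det (jacobian g (at x))\<bar>) * \<bar>f (g x)\<bar>"
        using c gdet[of x] by (intro mult_right_mono) (auto simp: field_simps)
      then show "norm (indicator (g -` U) x *R f (g x)) \<le>
        norm (inverse c *R (indicator (g -` U) x *R (\<bar>det (jacobian g (at x))\<bar> * f (g x))))"
        using c by (cases "g x \<in> U") (auto simp: abs_mult mult.assoc)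
    qed
  qed
qed

lemma w12l_comp:
  assumes "open U" "w12l U u Du"
  shows "w12l (g -` U) (\<lambda>x. u (g x)) (\<lambda>x. Du (g x) ** jacobian g (at x))"
proof -
  interpret local_diffeo g "g -` U" by (rule local[OF open_vimage[OF assms(1)]])
  show ?thesis by (rule w12l_compose[OF assms(2,1)]) auto
qed

lemma W12_comp:
  assumes U: "open U" "U \<subseteq> range g" and W: "W12 U N u"
  shows "W12 (g -` U) N (\<lambda>x. u (g x))"
proof -
  interpret local_diffeo g "g -` U" by (rule local[OF open_vimage[OF U(1)]])
  obtain Du where D: "w12l U u Du" "lset_int U (\<lambda>x. (norm (Du x))^2)"
    and u: "lset_int U (\<lambda>x. (norm (u x))^2)" "AE x in lebesgue. x \<in> U --> u x \<in> N" using W unfolding W12_iff by blast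
  let ?D = "\<lambda>x. Du (g x) ** jacobian g (at x)"
  have w: "w12l (g -` U) (\<lambda>x. u (g x)) ?D" by (rule w12l_comp[OF U(1) D(1)])
  have "lset_int (g -` U) (\<lambda>x. (norm (?D x))^2)" unfolding set_integrable_def
  proof (rule Bochner_Integration.integrable_bound)
    show "integrable lebesgue (\<lambda>x. L\<^sup>2 *R (indicator (g -` U) x *R (norm (Du (g x)))^2))"
      using set_integrable_comp[OF U D(2)] unfolding set_integrable_def by (rule integrable_scaleR_right)
    show "(\<lambda>x. indicator (g -` U) x *R (norm (?D x))^2) \<in> borel_lebesgue"
      using w by (intro loc_int_measurable open_dom) (simp add: w12l_def)
    show "AE x in lebesgue. norm (indicator (g -` U) x *R (norm (?D x))^2)
      \<le> norm (L^2 *R (indicator (g -` U) x *R (norm (Du (g x)))^2))"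
    proof (rule AE_I2)
      fix x
      have "norm (?D x) \<le> norm (Du (g x)) * L"
        using norm_matrix_mul[of "Du (g x)" "jacobian g (at x)"] mult_left_mono[OF gbound[of x] norm_ge_zero[of "Du (g x)"]] by linarith
      then have "(norm (?D x))^2 \<le> (norm (Du (g x)) * L)^2" by (intro power_mono) auto
      then show "norm (indicator (g -` U) x *R (norm (?D x))^2)
        \<le> norm (L^2 *R (indicator (g -` U) x *R (norm (Du (g x)))^2))" by (auto simp: indicator_def power_mult_distrib mult.commute)
    qed
  qed
  moreover have "AE x in lebesgue. x \<in> g -` U --> u (g x) \<in> N" by (rule AE_compose[OF u(2) U(1)]) auto
  ultimately show ?thesis unfolding W12_iff using w set_integrable_comp[OF U u(1)] by blast
qed

end

section \<open>Planar matrices and the expansion of the energy\<close>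

text \<open>For planar matrices the adjugate is linear and keeps the norm. The inverse Jacobian thus
  inherits continuity and bounds, and the energy expansion becomes polynomial algebra.\<close>

definition adj2 :: "real^2^2 => real^2^2" where
  "adj2 M = (\<chi> i j. if i = 1 then (if j = 1 then M $ 2 $ 2 else - M $ 1 $ 2) else (if j = 1 then - M $ 2 $ 1 else M $ 1 $ 1))"

definition inv2 :: "real^2^2 => real^2^2" where
  "inv2 M = (1 / det M) *R adj2 M"

lemma scaleR_matmul: "(c *R (A :: real^'m^'n)) ** B = c *R (A ** B)" "A ** (c *R B) = c *R (A ** B)"
  by (simp_all add: vec_eq_iff matrix_matrix_mult_def sum_distrib_left mult_ac)

lemma adj2_mult: "adj2 M ** M = det M *R mat 1" "M ** adj2 M = det M *R mat 1" using one_neq_two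
  by (simp_all add: adj2_def vec_eq_iff forall_2 matrix_matrix_mult_def sum_2 mat_def det_2 algebra_simps)

lemma inv2_mult:
  assumes "det M \<noteq> 0"
  shows "inv2 M ** M = mat 1" "M ** inv2 M = mat 1" using assms by (simp_all add: inv2_def scaleR_matmul adj2_mult)

lemma norm_adj2: "norm (adj2 M) = norm M"
proof -
  have "(norm (adj2 M))^2 = (norm M)^2" unfolding norm_matrix_sq2 using one_neq_two by (simp add: adj2_def sum_2)
  then show ?thesis by simp
qed

lemma det_inv2: "det M \<noteq> 0 ==> det (inv2 M) = 1 / det M" using arg_cong[OF inv2_mult(1), of M det] by (simp add: det_mul field_simps)

lemma entry_le_norm: "\<bar>(M :: real^'m^'n) $ i $ j\<bar> \<le> norm M"
  using component_le_norm_cart[of "M $ i" j] Finite_Cartesian_Product.norm_nth_le[where x=M and i=i] by linarith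

lemma norm_matrix_vector: "norm ((A :: real^'m^'n) *v x) \<le> norm A * norm x"
proof -
  have "(norm (A *v x))^2 = (\<Sum>i\<in>UNIV. ((A $ i) \<bullet> x)^2)"
    unfolding power2_norm_eq_inner inner_vec_def[of "A *v x"] by (simp add: matrix_vector_mul_component power2_eq_square)
  also have "\<dots> \<le> (\<Sum>i\<in>UNIV. (norm (A $ i))^2 * (norm x)^2)" by (intro sum_mono) (metis Cauchy_Schwarz_ineq power2_norm_eq_inner)
  also have "\<dots> = (norm A * norm x)^2" by (simp add: sum_distrib_right[symmetric] norm_matrix_sq power_mult_distrib)
  finally show ?thesis by (rule power2_le_imp_le) simp
qed

text \<open>The entries of B are at most b, so the linear term of the determinant is at most 2/8 and
  the quadratic one at most 2/64; together they stay below 1/2. This is the origin of the bound 1/8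
  on |t| b.\<close>

lemma det_perturb:
  assumes b: "norm (B :: real^2^2) \<le> b" and t: "\<bar>t\<bar> * b \<le> 1/8"
  shows "det (mat 1 + t *R B) = 1 + t * trace B + t^2 * det B" "\<bar>trace B\<bar> \<le> 2 * b" "\<bar>det B\<bar> \<le> 2 * b^2"
    "1/2 \<le> det (mat 1 + t *R B)" "det (mat 1 + t *R B) \<le> 2"
proof -
  show e: "det (mat 1 + t *R B) = 1 + t * trace B + t^2 * det B"
    using one_neq_two by (simp add: det_2 trace_def sum_2 mat_def power2_eq_square algebra_simps)
  have en: "\<bar>B $ i $ j\<bar> \<le> b" for i j using entry_le_norm[of B i j] b by linarith
  show tr: "\<bar>trace B\<bar> \<le> 2 * b" using en[of 1 1] en[of 2 2] by (simp add: trace_def sum_2)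
  have b0: "0 \<le> b" using b norm_ge_zero[of B] by linarith
  have m: "\<bar>B $ i $ j * B $ k $ l\<bar> \<le> b * b" for i j k l unfolding abs_mult using en b0 by (intro mult_mono) auto
  show dt: "\<bar>det B\<bar> \<le> 2 * b^2" using m[of 1 1 2 2] m[of 1 2 2 1] unfolding det_2 power2_eq_square by linarith
  define s where "s = \<bar>t\<bar> * b"
  have s: "0 \<le> s" "s \<le> 1/8" using t b0 by (simp_all add: s_def)
  have "\<bar>t * trace B\<bar> \<le> \<bar>t\<bar> * (2 * b)" unfolding abs_mult using tr by (intro mult_left_mono) auto
  then have 1: "\<bar>t * trace B\<bar> \<le> 2 * s" by (simp add: s_def)
  have 2: "\<bar>t^2 * det B\<bar> \<le> 2 * s^2" using mult_left_mono[OF dt, of "t\<^sup>2"] by (simp add: s_def abs_mult power_mult_distrib algebra_simps)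
  have "s\<^sup>2 \<le> 1/64" using power_mono[OF s(2,1), of 2] by (simp add: power2_eq_square)
  then have "\<bar>t * trace B + t^2 * det B\<bar> \<le> 1/2" using 1 2 s by linarith
  then show "1/2 \<le> det (mat 1 + t *R B)" "det (mat 1 + t *R B) \<le> 2" unfolding e by linarith+
qed

text \<open>A is the gradient of u at a point, B that of the vector field, and the left side is the
  competitor's energy density after the change of variables. An upper bound is enough because t may
  have either sign.\<close>

lemma energy_expansion:
  fixes A :: "real^2^'n"
  assumes b: "norm (B :: real^2^2) \<le> b" and t: "\<bar>t\<bar> * b \<le> 1/8"
  defines "M \<equiv> mat 1 + t *R B"
  shows "(norm (A ** inv2 M))^2 * det M
    \<le> (norm A)^2 + t * ((norm A)^2 * trace B - 2 * (A \<bullet> (A ** B))) + 40 * b^2 * t^2 * (norm A)^2"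
proof -
  define a where "a = (norm A)^2"
  define p where "p = A \<bullet> (A ** B)"
  define \<tau> where "\<tau> = trace B"
  define \<delta> where "\<delta> = det B"
  define e where "e = (norm (A ** adj2 B))^2"
  define d where "d = det M"
  define q where "q = a * \<tau> - 2 * p"
  note dp = det_perturb[OF b t, folded M_def, folded \<tau>_def \<delta>_def d_def]
  have b0: "0 \<le> b" using b norm_ge_zero[of B] by linarith
  have a0: "0 \<le> a" by (simp add: a_def)
  \<comment> \<open>By linearity the adjugate of I + t B is I + t adj B, and adj B is (tr B) I -
    B.\<close>
  have adj: "A ** adj2 M = A + t *R (A ** adj2 B)" "A ** adj2 B = \<tau> *R A - A ** B" using one_neq_two
    by (simp_all add: M_def \<tau>_def adj2_def vec_eq_iff forall_2 matrix_matrix_mult_def sum_2 mat_def trace_def algebra_simps)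
  have ip: "A \<bullet> (A ** adj2 B) = a * \<tau> - p" unfolding adj(2) by (simp add: inner_diff_right a_def p_def power2_norm_eq_inner)
  have "(norm (A ** adj2 M))^2 = a + 2 * t * (A \<bullet> (A ** adj2 B)) + t^2 * e" unfolding adj(1) e_def a_def power2_norm_eq_inner
    by (simp add: inner_add_left inner_add_right inner_commute power2_eq_square algebra_simps)
  then have N: "(norm (A ** adj2 M))^2 = a + 2 * t * (a * \<tau> - p) + t^2 * e" by (simp add: ip)
  have "A ** inv2 M = (1 / d) *R (A ** adj2 M)" by (simp add: inv2_def d_def vec_eq_iff matrix_matrix_mult_def sum_2 add_divide_distrib)
  then have L: "(norm (A ** inv2 M))^2 * d = (norm (A ** adj2 M))^2 / d"
    using dp(4) by (simp add: power_mult_distrib power2_eq_square field_simps)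
  have "e \<le> (norm A * norm (adj2 B))^2" unfolding e_def by (intro power_mono norm_matrix_mul) auto
  also have "\<dots> \<le> a * b^2" unfolding norm_adj2 power_mult_distrib a_def using b by (intro mult_left_mono power_mono) auto
  finally have e: "e \<le> a * b^2" .
  have "\<bar>p\<bar> \<le> norm A * norm (A ** B)" unfolding p_def by (rule Cauchy_Schwarz_ineq2)
  also have "\<dots> \<le> norm A * (norm A * b)" using norm_matrix_mul[of A B] mult_left_mono[OF b norm_ge_zero[of A]] by (intro mult_left_mono) auto
  finally have p: "\<bar>p\<bar> \<le> a * b" by (simp add: a_def power2_eq_square mult.assoc)
  have "\<bar>a * \<tau>\<bar> \<le> a * (2 * b)" unfolding abs_mult using dp(2) a0 by (auto intro: mult_left_mono)
  then have q: "\<bar>q\<bar> \<le> 4 * (a * b)" unfolding q_def using p by linarith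
  have "\<bar>\<tau> * q\<bar> \<le> (2 * b) * (4 * (a * b))" unfolding abs_mult using dp(2) q b0 by (intro mult_mono) auto
  then have 1: "\<bar>\<tau> * q\<bar> \<le> 8 * (a * b^2)" by (simp add: power2_eq_square algebra_simps)
  have "\<bar>\<delta> * a\<bar> \<le> (2 * b^2) * a" unfolding abs_mult using dp(3) a0 by (intro mult_mono) auto
  then have 2: "\<bar>\<delta> * a\<bar> \<le> 2 * (a * b^2)" by (simp add: algebra_simps)
  have "\<bar>t * \<delta> * q\<bar> \<le> (\<bar>t\<bar> * (2 * b^2)) * (4 * (a * b))" unfolding abs_mult using dp(3) q b0 by (intro mult_mono) auto
  also have "\<dots> = 8 * (\<bar>t\<bar> * b) * (a * b^2)" by (simp add: power2_eq_square algebra_simps)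
  also have "\<dots> \<le> 8 * (1/8) * (a * b^2)" using t a0 by (intro mult_right_mono) auto
  finally have 3: "\<bar>t * \<delta> * q\<bar> \<le> a * b^2" by simp
  \<comment> \<open>The four second-order quantities e, tau q, delta a and t delta q are at most 1 +
    8 + 2 + 1 = 12 times a b^2 in size. The constant 40 leaves 20 a b^2 after multiplication by d
    \<ge> 1/2.\<close>
  have "20 * (a * b^2) \<le> 40 * b^2 * a * d" using mult_left_mono[OF dp(4), of "40 * (b^2 * a)"] a0 by (simp add: algebra_simps)
  then have "e \<le> 40 * b^2 * a * d + \<tau> * q + \<delta> * a + t * \<delta> * q" using e 1 2 3 a0 by (smt (verit) mult_nonneg_nonneg zero_le_power2)
  then have "t\<^sup>2 * e \<le> t^2 * (40 * b^2 * a * d + \<tau> * q + \<delta> * a + t * \<delta> * q)" by (intro mult_left_mono) auto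
  \<comment> \<open>After multiplication by d = 1 + t tau + t^2 delta the terms of order 0 and 1
    agree on both sides, as a tau + q = 2 (a tau - p). What is left is the inequality for the
    coefficient of t^2.\<close>
  then have "(norm (A ** adj2 M))^2 \<le> (a + t * q + 40 * b^2 * t^2 * a) * d"
    unfolding N dp(1) q_def by (simp add: algebra_simps power2_eq_square)
  then have "(norm (A ** adj2 M))^2 / d \<le> a + t * q + 40 * b^2 * t^2 * a" using dp(4) by (simp add: pos_divide_le_eq)
  then show ?thesis unfolding L[unfolded d_def] d_def a_def q_def \<tau>_def p_def by simp
qed

section \<open>The deformation x + t psi(x) and its inverse\<close>

text \<open>The smallness condition makes t psi Lipschitz with constant 1/8 and keeps the Jacobian
  determinant of the deformation between 1/2 and 2, so that both the map and its inverse are global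
  diffeomorphisms with uniform bounds.\<close>

locale deformation =
  fixes \<psi> :: "real^2 => real^2" and b t :: real
  assumes psi: "C1_on \<psi> UNIV" and psib: "\<And>x. norm (jacobian \<psi> (at x)) \<le> b" and t: "\<bar>t\<bar> * b \<le> 1/8"
begin

definition \<Phi> where "\<Phi> x = x + t *R \<psi> x"
definition \<Psi> where "\<Psi> = inv \<Phi>"

lemma Phi_C1: "C1_on \<Phi> UNIV" unfolding \<Phi>_def[abs_def]
  by (intro Ck1_add Ck1_scaleR Ck1_const psi Ck1_bounded_linear bounded_linear_ident) auto

lemma psi_der: "(\<psi> has_derivative (*v) (jacobian \<psi> (at x))) (at x)" by (rule jacobian_has_derivative(1)[OF psi]) simp

lemma Phi_jac: "jacobian \<Phi> (at x) = mat 1 + t *R jacobian \<psi> (at x)"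
proof -
  have "(\<Phi> has_derivative (\<lambda>v. v + t *R (jacobian \<psi> (at x) *v v))) (at x)"
    unfolding \<Phi>_def[abs_def] by (intro has_derivative_add has_derivative_ident has_derivative_scaleR_right psi_der)
  then have "frechet_derivative \<Phi> (at x) = (\<lambda>v. v + t *R (jacobian \<psi> (at x) *v v))" by (rule frechet_derivative_at[symmetric])
  also have "\<dots> = (*v) (mat 1 + t *R jacobian \<psi> (at x))" by (simp add: fun_eq_iff matrix_vector_mult_add_rdistrib scaleR_matrix_vector_assoc)
  finally show ?thesis by (simp add: jacobian_def)
qed

lemma psi_lip: "norm (\<psi> x - \<psi> y) \<le> b * norm (x - y)"
proof (rule differentiable_bound[of UNIV])
  show "(\<psi> has_derivative (*v) (jacobian \<psi> (at x))) (at x within UNIV)" for x using psi_der by simp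
  show "onorm ((*v) (jacobian \<psi> (at x))) \<le> b" for x
  proof (rule onorm_le)
    fix v show "norm (jacobian \<psi> (at x) *v v) \<le> b * norm v"
      using norm_matrix_vector[of "jacobian \<psi> (at x)" v] mult_right_mono[OF psib[of x] norm_ge_zero[of v]] by linarith
  qed
qed auto

lemma tpsi_lip: "norm (t *R \<psi> x - t *R \<psi> y) \<le> 1/8 * norm (x - y)"
proof -
  have "norm (t *R \<psi> x - t *R \<psi> y) = \<bar>t\<bar> * norm (\<psi> x - \<psi> y)" by (simp flip: scaleR_diff_right)
  also have "\<dots> \<le> \<bar>t\<bar> * (b * norm (x - y))" by (intro mult_left_mono psi_lip) auto
  also have "\<dots> \<le> 1/8 * norm (x - y)" using mult_right_mono[OF t norm_ge_zero[of "x - y"]] by (simp add: mult.assoc)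
  finally show ?thesis .
qed

lemma Phi_expand: "norm (x - y) \<le> 2 * norm (\<Phi> x - \<Phi> y)"
proof -
  have "x - y = (\<Phi> x - \<Phi> y) - (t *R \<psi> x - t *R \<psi> y)" by (simp add: \<Phi>_def)
  then have "norm (x - y) \<le> norm (\<Phi> x - \<Phi> y) + norm (t *R \<psi> x - t *R \<psi> y)" by (metis norm_triangle_ineq4)
  then show ?thesis using tpsi_lip[of x y] norm_ge_zero[of "\<Phi> x - \<Phi> y"] by linarith
qed

lemma Phi_inj: "inj \<Phi>"
proof (rule injI)
  fix x y assume "\<Phi> x = \<Phi> y"
  then show "x = y" using Phi_expand[of x y] by simp
qed

text \<open>A preimage of y is a fixed point of the contraction x -> y - t psi(x).\<close>

lemma Phi_surj: "surj \<Phi>"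
proof -
  have "\<exists>x. y = \<Phi> x" for y
  proof -
    have "\<exists>!x. y - t *R \<psi> x = x"
    proof (rule banach_fix_type[of "1/8"])
      show "\<forall>u v. dist (y - t *R \<psi> u) (y - t *R \<psi> v) \<le> 1/8 * dist u v" using tpsi_lip by (simp add: dist_norm norm_minus_commute)
    qed auto
    then obtain x where "y - t *R \<psi> x = x" by blast
    then have "y = \<Phi> x" unfolding \<Phi>_def by (metis diff_add_cancel)
    then show ?thesis ..
  qed
  then show ?thesis by (auto simp: surj_def)
qed

lemma Phi_Psi [simp]: "\<Phi> (\<Psi> x) = x" and Psi_Phi [simp]: "\<Psi> (\<Phi> x) = x" unfolding \<Psi>_def using Phi_inj Phi_surj by (simp_all add: surj_f_inv_f)

lemma Phi_det: "1/2 \<le> det (jacobian \<Phi> (at x))" "det (jacobian \<Phi> (at x)) \<le> 2" unfolding Phi_jac by (rule det_perturb[OF psib t])+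

lemma Phi_norm: "norm (jacobian \<Phi> (at x)) \<le> 4"
proof -
  have "norm (mat 1 :: real^2^2) \<le> 2"
  proof -
    have "(norm (mat 1 :: real^2^2))^2 = 2" unfolding norm_matrix_sq2 using one_neq_two by (simp add: mat_def sum_2)
    then show ?thesis using power2_le_imp_le[of "norm (mat 1 :: real^2^2)" 2] by simp
  qed
  moreover have "norm (t *R jacobian \<psi> (at x)) \<le> 1/8" using t mult_left_mono[OF psib[of x] abs_ge_zero[of t]] by simp
  ultimately show ?thesis unfolding Phi_jac using norm_triangle_ineq[of "mat 1 :: real^2^2" "t *R jacobian \<psi> (at x)"] by linarith
qed

sublocale Phi: global_diffeo \<Phi> "1/2" 4 by unfold_locales (rule Phi_C1 Phi_inj Phi_norm order_trans[OF Phi_det(1) abs_ge_self] | simp)+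

lemma Psi_cont: "continuous_on UNIV \<Psi>"
proof (rule lipschitz_on_continuous_on[of 2])
  show "2-lipschitz_on UNIV \<Psi>" by (rule lipschitz_onI) (use Phi_expand[of "\<Psi> _" "\<Psi> _"] in \<open>auto simp: dist_norm\<close>)
qed

lemma Psi_der: "(\<Psi> has_derivative (*v) (inv2 (jacobian \<Phi> (at (\<Psi> x))))) (at x)"
proof (rule has_derivative_inverse_basic[where f=\<Phi> and T=UNIV])
  show "(\<Phi> has_derivative (*v) (jacobian \<Phi> (at (\<Psi> x)))) (at (\<Psi> x))" by (rule jacobian_has_derivative(1)[OF Phi_C1]) simp
  show "bounded_linear ((*v) (inv2 (jacobian \<Phi> (at (\<Psi> x)))))" by (rule matrix_vector_mul_bounded_linear)
  have "det (jacobian \<Phi> (at (\<Psi> x))) \<noteq> 0" using Phi_det(1)[of "\<Psi> x"] by linarith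
  then show "(*v) (inv2 (jacobian \<Phi> (at (\<Psi> x)))) \<circ> (*v) (jacobian \<Phi> (at (\<Psi> x))) = id"
    by (simp add: fun_eq_iff matrix_vector_mul_assoc inv2_mult)
  show "continuous (at x) \<Psi>" using Psi_cont by (simp add: continuous_on_eq_continuous_at)
qed auto

lemma Psi_jac: "jacobian \<Psi> (at x) = inv2 (jacobian \<Phi> (at (\<Psi> x)))"
  unfolding jacobian_def[of \<Psi>] frechet_derivative_at[OF Psi_der, symmetric] by simp

lemma Psi_C1: "C1_on \<Psi> UNIV"
proof (rule Ck1I[OF open_UNIV Psi_der])
  fix v
  have J: "continuous_on UNIV (\<lambda>x. jacobian \<Phi> (at (\<Psi> x)))" by (rule continuous_on_compose2[OF jacobian_continuous[OF Phi_C1] Psi_cont]) simp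
  have nz: "det (jacobian \<Phi> (at (\<Psi> x))) \<noteq> 0" for x using Phi_det(1)[of "\<Psi> x"] by linarith
  have d: "continuous_on UNIV (\<lambda>x. 1 / det (jacobian \<Phi> (at (\<Psi> x))))" using nz unfolding det_2 by (intro continuous_intros J) auto
  have c: "continuous_on UNIV (\<lambda>x. adj2 (jacobian \<Phi> (at (\<Psi> x))) $ i $ j)" for i j
    unfolding adj2_def by (cases "i = 1"; cases "j = 1"; simp; intro continuous_intros J)
  show "continuous_on UNIV (\<lambda>x. inv2 (jacobian \<Phi> (at (\<Psi> x))) *v v)"
    unfolding inv2_def matrix_vector_mult_def sum_2 vector_scaleR_component by (intro continuous_intros d c)
qed

sublocale Psi: global_diffeo \<Psi> "1/2" 8
proof
  show "C1_on \<Psi> UNIV" by (rule Psi_C1)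
  show "inj \<Psi>" by (rule inj_on_inverseI[of _ \<Phi>]) simp
  fix x
  have d: "1/2 \<le> det (jacobian \<Phi> (at (\<Psi> x)))" "det (jacobian \<Phi> (at (\<Psi> x))) \<le> 2" by (rule Phi_det)+
  then show "1/2 \<le> \<bar>det (jacobian \<Psi> (at x))\<bar>" unfolding Psi_jac by (subst det_inv2) (auto simp: field_simps)
  have "norm (jacobian \<Psi> (at x)) = norm (jacobian \<Phi> (at (\<Psi> x))) / det (jacobian \<Phi> (at (\<Psi> x)))"
    unfolding Psi_jac inv2_def using d by (simp add: norm_adj2)
  \<comment> \<open>The adjugate has the norm of the Jacobian, at most 4, and the determinant is at
    least 1/2.\<close>
  also have "\<dots> \<le> 8" using d Phi_norm[of "\<Psi> x"] by (simp add: divide_le_eq)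
  finally show "norm (jacobian \<Psi> (at x)) \<le> 8" .
qed simp

lemma vimage_Psi: "\<Psi> -` U = \<Phi> ` U" and vimage_Phi: "\<Phi> -` U = \<Psi> ` U" by (auto simp: image_iff) (metis Phi_Psi, metis Psi_Phi)

lemma range_Phi: "range \<Phi> = UNIV" and range_Psi: "range \<Psi> = UNIV" by (metis Phi_Psi surjI, metis Psi_Phi surjI)

text \<open>The deformation fixes the complement of \<Omega> pointwise; being injective, it cannot
  send a point of \<Omega> there.\<close>

lemma invariant:
  assumes "\<And>x. x \<notin> \<Omega> ==> \<psi> x = 0"
  shows "\<Phi> ` \<Omega> = \<Omega>" "\<Psi> ` \<Omega> = \<Omega>"
proof -
  have o: "\<Phi> x = x" if "x \<notin> \<Omega>" for x using assms[OF that] by (simp add: \<Phi>_def)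
  have i: "\<Phi> x \<in> \<Omega> \<longleftrightarrow> x \<in> \<Omega>" for x
  proof
    assume "x \<in> \<Omega>"
    then show "\<Phi> x \<in> \<Omega>" using o[of "\<Phi> x"] Phi_inj by (metis inj_eq)
  qed (use o[of x] in force)
  show "\<Phi> ` \<Omega> = \<Omega>" unfolding vimage_Psi[symmetric] using i[of "\<Psi> _"] by auto
  show "\<Psi> ` \<Omega> = \<Omega>" unfolding vimage_Phi[symmetric] using i by auto
qed

text \<open>Where psi is constant the deformation is a translation, so small closed balls go to
  closed balls of the same radius. Holes of perforated domains therefore correspond to
  holes.\<close>

lemma Phi_cball:
  assumes "\<And>x. x \<in> ball a r ==> \<psi> x = \<psi> a" "\<rho> < r"
  shows "\<Phi> ` cball a \<rho> = cball (\<Phi> a) \<rho>" "x \<in> ball (\<Phi> a) r ==> \<Psi> x = x - t *R \<psi> a"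
proof -
  have e: "\<Phi> x = x + t *R \<psi> a" if "x \<in> ball a r" for x using assms(1)[OF that] by (simp add: \<Phi>_def)
  show P: "\<Psi> x = x - t *R \<psi> a" if "x \<in> ball (\<Phi> a) r" for x
  proof -
    have "x - t *R \<psi> a \<in> ball a r" using that by (simp add: \<Phi>_def dist_norm algebra_simps)
    then show ?thesis using e[of "x - t *R \<psi> a"] Psi_Phi[of "x - t *R \<psi> a"] by simp
  qed
  have "\<Phi> ` cball a \<rho> = (\<lambda>x. x + t *R \<psi> a) ` cball a \<rho>" using assms(2) by (intro image_cong refl e) auto
  also have "\<dots> = cball (\<Phi> a) \<rho>" using cball_translation[of "t *R \<psi> a" a \<rho>] by (simp add: \<Phi>_def add.commute)
  finally show "\<Phi> ` cball a \<rho> = cball (\<Phi> a) \<rho>" .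
qed

end

section \<open>Circle traces under translation\<close>

lemma W12_cong:
  assumes "W12 U N u" "\<And>x. x \<in> U ==> u x = v x"
  shows "W12 U N v"
proof -
  obtain D where D: "w12l U u D" "lset_int U (\<lambda>x. (norm (D x))^2)"
    and u: "lset_int U (\<lambda>x. (norm (u x))^2)" "AE x in lebesgue. x \<in> U --> u x \<in> N" using assms(1) unfolding W12_iff by blast
  have "w12l U v D" by (rule w12l_cong_AE[OF D(1)]) (use assms(2) in auto)
  moreover have "lset_int U (\<lambda>x. (norm (v x))^2)" by (rule set_integrable_cong_AE'(1)[OF u(1)]) (use assms(2) in auto)
  moreover have "AE x in lebesgue. x \<in> U --> v x \<in> N" using u(2) by (rule eventually_mono) (use assms(2) in auto)
  ultimately show ?thesis using D(2) unfolding W12_iff by blast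
qed

lemma jacobian_translation: "jacobian (\<lambda>x. x - d) (at x) = mat 1"
proof -
  have "((\<lambda>x. x - d) has_derivative (\<lambda>v. v)) (at x)" by (auto intro!: derivative_eq_intros)
  then have "frechet_derivative (\<lambda>x. x - d) (at x) = (\<lambda>v. v)" by (rule frechet_derivative_at[symmetric])
  then show ?thesis by (simp add: jacobian_def matrix_def mat_def axis_def vec_eq_iff)
qed

interpretation translation: global_diffeo "\<lambda>x. x - d" 1 "norm (mat 1 :: real^2^2)" for d by unfold_locales
    (auto simp: jacobian_translation inj_on_def intro: Ck1_diff[OF open_UNIV Ck1_bounded_linear[OF open_UNIV bounded_linear_ident] Ck1_const[OF open_UNIV]])

lemma has_circle_trace_translate:
  assumes tr: "has_circle_trace u a \<rho> g" and r: "\<rho> < r" "\<And>x. x \<in> ball a r ==> v (x + d) = u x"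
  shows "has_circle_trace v (a + d) \<rho> g"
proof -
  obtain \<delta> w where \<delta>: "0 < \<delta>" and W: "W12 (ball a (\<rho> + \<delta>) - cball a \<rho>) UNIV u"
    and w: "\<And>n. C1_on (w n) UNIV" "W12_approx (ball a (\<rho> + \<delta>) - cball a \<rho>) w u (weak_grad (ball a (\<rho> + \<delta>) - cball a \<rho>) u)"
    and lim: "(\<lambda>n. \<integral>\<^sup>+\<theta>\<in>{0..2*pi}. ennreal ((norm (w n (a + \<rho> *R circ \<theta>) - g (circ \<theta>)))^2) \<partial>lebesgue) \<longlonglongrightarrow> 0"
    and m: "(\<lambda>\<theta>. g (circ \<theta>)) \<in> borel_lebesgue" using tr unfolding has_circle_trace_def Let_def One_nat_def by blast
  define U where "U = ball a (\<rho> + \<delta>) - cball a \<rho>"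
  \<comment> \<open>The annulus is thinned until it lies in the ball where v is a translate of
    u.\<close>
  define \<delta>' where "\<delta>' = min \<delta> (r - \<rho>)"
  define U0 where "U0 = ball a (\<rho> + \<delta>') - cball a \<rho>"
  define U' where "U' = ball (a + d) (\<rho> + \<delta>') - cball (a + d) \<rho>"
  have op: "open U" "open U0" "open U'" unfolding U_def U0_def U'_def by auto
  have sub: "U0 \<subseteq> U" unfolding U0_def U_def \<delta>'_def by auto
  have vi: "(\<lambda>x. x - d) -` U0 = U'" unfolding U0_def U'_def by (auto simp: dist_norm algebra_simps)
  have veq: "u (x - d) = v x" if "x \<in> U'" for x using r(2)[of "x - d"] that unfolding U'_def \<delta>'_def by (auto simp: dist_norm algebra_simps)
  have im: "(\<lambda>x. x - d) ` U' \<subseteq> U" using vi sub by auto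
  have "W12 ((\<lambda>x. x - d) -` U0) UNIV (\<lambda>x. u (x - d))"
    by (rule translation.W12_comp[OF op(2) _ W12_subset[OF W[folded U_def] sub op(2)]]) (auto simp: image_iff intro: exI[of _ "_ + d"])
  then have W': "W12 U' UNIV v" unfolding vi by (rule W12_cong) (rule veq)
  obtain D where "w12l U u D" using W unfolding W12_iff U_def by blast
  then have hD: "has_weak_grad U u (weak_grad U u)" by (intro has_weak_grad_weak_grad[of U u D]) (simp add: w12l_def)
  have "w12l U u (weak_grad U u)" by (rule w12l_cong_AE[OF \<open>w12l U u D\<close>])
      (use has_weak_grad_unique[OF op(1) _ hD] \<open>w12l U u D\<close> in \<open>auto simp: w12l_def\<close>)
  from translation.w12l_comp[OF op(1) this, of d]
  have "w12l ((\<lambda>x. x - d) -` U) (\<lambda>x. u (x - d)) (\<lambda>x. weak_grad U u (x - d))" by (simp add: jacobian_translation)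
  then have "w12l U' (\<lambda>x. u (x - d)) (\<lambda>x. weak_grad U u (x - d))" by (rule w12l_subset) (use im in auto)
  then have "w12l U' v (\<lambda>x. weak_grad U u (x - d))" by (rule w12l_cong_AE) (use veq in auto)
  then have ae: "AE x in lebesgue. x \<in> U' --> weak_grad U' v x = weak_grad U u (x - d)"
    unfolding w12l_def using weak_grad_AE[OF op(3) subset_refl] by blast
  interpret local_diffeo "\<lambda>x. x - d" UNIV by (rule translation.local) simp
  have "W12_approx U' (\<lambda>n x. w n (x - d)) (\<lambda>x. u (x - d)) (\<lambda>x. weak_grad U u (x - d) ** jacobian (\<lambda>x. x - d) (at x))"
  proof (rule W12_approx_compose[of U' "cball (a + d) (\<rho> + \<delta>')", OF _ compact_cball subset_UNIV _ _ im op(1) _ _ w(1) w(2)[folded U_def]])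
    show "U' \<subseteq> cball (a + d) (\<rho> + \<delta>')" by (auto simp: U'_def)
    show "U' \<in> sets lebesgue" using op(3) by simp
  qed (use hD[THEN has_weak_gradD(1)] hD[THEN has_weak_gradD(2)] in \<open>auto simp: inj_on_def\<close>)
  then have "W12_approx U' (\<lambda>n x. w n (x - d)) v (weak_grad U' v)"
    by (rule W12_approx_cong_AE) (use ae veq in \<open>auto simp: jacobian_translation elim!: eventually_mono\<close>)
  moreover have "C1_on (\<lambda>x. w n (x - d)) UNIV" for n by (rule Ck1_compose[OF open_UNIV open_UNIV w(1) C1]) simp
  moreover have "0 < \<delta>'" using \<delta> r(1) by (simp add: \<delta>'_def)
  ultimately show ?thesis using W' lim m unfolding has_circle_trace_def Let_def One_nat_def U'_def
    by (intro conjI exI[of _ \<delta>'] exI[of _ "\<lambda>n x. w n (x - d)"]) (simp_all add: algebra_simps)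
qed

text \<open>A trace is selected by Hilbert choice, so equality of traces is obtained from
  equivalence of the predicates. The reverse implication is the translation by -d.\<close>

lemma circle_trace_translate:
  assumes "\<rho> < r" "\<And>x. x \<in> ball a r ==> v (x + d) = u x"
  shows "circle_trace v (a + d) \<rho> = circle_trace u a \<rho>"
proof -
  have "has_circle_trace v (a + d) \<rho> g \<longleftrightarrow> has_circle_trace u a \<rho> g" for g
  proof
    assume "has_circle_trace v (a + d) \<rho> g"
    then have "has_circle_trace u (a + d + - d) \<rho> g"
    proof (rule has_circle_trace_translate[OF _ assms(1)])
      fix x assume "x \<in> ball (a + d) r"
      then show "u (x + - d) = v x" using assms(2)[of "x - d"] by (simp add: dist_norm algebra_simps)
    qed
    then show "has_circle_trace u a \<rho> g" by simp
  qed (rule has_circle_trace_translate[where r=r and u=u and v=v, OF _ assms(1)], assumption, rule assms(2))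
  then show ?thesis by (simp add: circle_trace_def)
qed

section \<open>Transport of energy and singularities\<close>

context deformation
begin

lemma W12_push: "open U ==> W12 U N u ==> W12 (\<Phi> ` U) N (\<lambda>x. u (\<Psi> x))" using Psi.W12_comp[of U N u] by (simp add: vimage_Psi range_Psi)

lemma W12_pull:
  assumes "open U" "W12 U N (\<lambda>x. u (\<Psi> x))"
  shows "W12 (\<Psi> ` U) N u" using Phi.W12_comp[OF assms(1) _ assms(2)] by (simp add: vimage_Phi range_Phi)

lemma open_Phi: "open U ==> open (\<Phi> ` U)" and open_Psi: "open U ==> open (\<Psi> ` U)"
  using Psi.open_vimage Phi.open_vimage by (simp_all add: vimage_Psi vimage_Phi)

lemma ball_image:
  assumes "open U" "x \<in> U"
  shows "\<exists>r>0. ball (\<Phi> x) r \<subseteq> \<Phi> ` U" "\<exists>r>0. ball (\<Psi> x) r \<subseteq> \<Psi> ` U"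
  using open_Phi[OF assms(1)] open_Psi[OF assms(1)] assms(2) by (meson imageI open_contains_ball)+

context
  fixes \<Omega> :: "(real^2) set" and N :: "(real^'n) set" and u :: "real^2 => real^'n" and S :: "(real^2) set" and r :: real
  assumes \<Omega>: "open \<Omega>" and out: "\<And>x. x \<notin> \<Omega> ==> \<psi> x = 0"
    and adm: "ren_admissible \<Omega> N u S" and r: "0 < r" "\<And>a x. a \<in> S ==> x \<in> ball a r ==> \<psi> x = \<psi> a"
begin

abbreviation "v \<equiv> \<lambda>x. u (\<Psi> x)"

lemma perforated_Phi: "\<rho> < r ==> perforated \<Omega> (\<Phi> ` S) \<rho> = \<Phi> ` perforated \<Omega> S \<rho>" unfolding perforated_def
  using Phi_cball(1)[OF r(2)] by (simp add: image_set_diff[OF Phi_inj] invariant(1)[OF out] image_UN)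

lemma adm_push: "ren_admissible \<Omega> N v (\<Phi> ` S)"
proof -
  have f: "finite S" "S \<subseteq> \<Omega>" using adm by (auto simp: ren_admissible_def)
  have "\<forall>\<^sub>F \<rho> in at_right 0. W12 (perforated \<Omega> (\<Phi> ` S) \<rho>) N v" using eventually_at_right_zero[OF r(1)]
  proof eventually_elim
    fix \<rho> assume \<rho>: "0 < \<rho> \<and> \<rho> < r"
    show "W12 (perforated \<Omega> (\<Phi> ` S) \<rho>) N v"
      using \<rho> W12_push[OF open_perforated[OF \<Omega> f(1)] W12_perforated[OF \<Omega> adm]] by (simp add: perforated_Phi)
  qed
  then show ?thesis using f invariant(1)[OF out] by (auto simp: ren_admissible_def)
qed

text \<open>Both the deformation and its inverse map neighbourhoods onto neighbourhoods and preserve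
  W12, so a regular point on one side gives a regular point on the other.\<close>

lemma bad_push: "bad_pts \<Omega> N v = \<Phi> ` bad_pts \<Omega> N u"
proof (intro set_eqI iffI)
  fix s assume s: "s \<in> bad_pts \<Omega> N v"
  have "\<Psi> s \<in> \<Omega>" using s invariant(2)[OF out] by (auto simp: bad_pts_def)
  moreover have False if e: "0 < e" "W12 (ball (\<Psi> s) e) N u" for e
  proof -
    obtain e' where "e' > 0" "ball (\<Phi> (\<Psi> s)) e' \<subseteq> \<Phi> ` ball (\<Psi> s) e" using ball_image(1)[of "ball (\<Psi> s) e" "\<Psi> s"] e by auto
    then show False using W12_subset[OF W12_push[OF open_ball e(2)]] s by (auto simp: bad_pts_def)
  qed
  ultimately have "\<Psi> s \<in> bad_pts \<Omega> N u" by (auto simp: bad_pts_def)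
  then show "s \<in> \<Phi> ` bad_pts \<Omega> N u" by (metis Phi_Psi imageI)
next
  fix s assume "s \<in> \<Phi> ` bad_pts \<Omega> N u"
  then obtain p where p: "p \<in> bad_pts \<Omega> N u" "s = \<Phi> p" by blast
  have "s \<in> \<Omega>" using p invariant(1)[OF out] by (auto simp: bad_pts_def)
  moreover have False if e: "0 < e" "W12 (ball s e) N v" for e
  proof -
    obtain e' where "e' > 0" "ball (\<Psi> s) e' \<subseteq> \<Psi> ` ball s e" using ball_image(2)[of "ball s e" s] e by auto
    then show False using W12_subset[OF W12_pull[OF open_ball e(2)]] p by (auto simp: bad_pts_def)
  qed
  ultimately show "s \<in> bad_pts \<Omega> N v" by (auto simp: bad_pts_def)
qed

lemma trace_push:
  assumes "a \<in> S" "\<rho> < r"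
  shows "circle_trace v (\<Phi> a) \<rho> = circle_trace u a \<rho>"
proof -
  have "circle_trace v (a + t *R \<psi> a) \<rho> = circle_trace u a \<rho>"
  proof (rule circle_trace_translate[OF assms(2)])
    fix x assume x: "x \<in> ball a r"
    then have "x + t *R \<psi> a = \<Phi> x" using r(2)[OF assms(1) x] by (simp add: \<Phi>_def)
    then show "v (x + t *R \<psi> a) = u x" by simp
  qed
  then show ?thesis by (simp add: \<Phi>_def)
qed

text \<open>The inner variation on a perforated domain. The correction is an integral over
  \<open>W\<close>, the set where D psi does not vanish, and hence the same for all small radii; it
  survives the lower limit as a constant.\<close>

lemma energy_push:
  assumes D: "w12l (\<Omega> - S) u D" "\<And>\<rho>. 0 < \<rho> ==> lset_int (perforated \<Omega> S \<rho>) (\<lambda>x. (norm (D x))^2)"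
    and \<rho>: "0 < \<rho>" "\<rho> < r"
  defines "B \<equiv> \<lambda>x. jacobian \<psi> (at x)"
  defines "W \<equiv> {x. B x \<noteq> 0}" and "q \<equiv> \<lambda>x. (norm (D x))^2 * trace (B x) - 2 * (D x \<bullet> (D x ** B x))"
  assumes W: "W \<subseteq> perforated \<Omega> S \<rho>" and qi: "lset_int W q"
  shows "(LINT x:perforated \<Omega> (\<Phi> ` S) \<rho>|lebesgue. frob (weak_grad (perforated \<Omega> (\<Phi> ` S) \<rho>) v x) (weak_grad (perforated \<Omega> (\<Phi> ` S) \<rho>) v x) / 2)
    \<le> (LINT x:perforated \<Omega> S \<rho>|lebesgue. frob (weak_grad (perforated \<Omega> S \<rho>) u x) (weak_grad (perforated \<Omega> S \<rho>) u x) / 2)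
      + (t * (LINT x:W|lebesgue. q x) + 40 * b^2 * t^2 * (LINT x:W|lebesgue. (norm (D x))^2)) / 2"
proof -
  define P where "P = perforated \<Omega> S \<rho>"
  have f: "finite S" using adm by (simp add: ren_admissible_def)
  have oP: "open P" unfolding P_def by (rule open_perforated[OF \<Omega> f])
  have mP: "P \<in> sets lebesgue" using oP by simp
  have sub: "P \<subseteq> \<Omega> - S"
  proof
    fix x assume "x \<in> P"
    then show "x \<in> \<Omega> - S" using centre_in_cball[of x \<rho>] \<rho>(1) unfolding P_def perforated_def by fastforce
  qed
  have oW: "open W"
  proof -
    have "W = - (B -` {0} \<inter> UNIV)" by (auto simp: W_def)
    then show ?thesis unfolding B_def using continuous_closed_preimage[OF jacobian_continuous[OF psi] closed_UNIV closed_singleton[of 0]]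
      by (simp add: Int_commute open_Compl)
  qed
  have mW: "W \<in> sets lebesgue" using oW by simp
  have wP: "w12l P u D" by (rule w12l_subset[OF D(1) sub])
  have iP: "lset_int P (\<lambda>x. (norm (D x))^2)" unfolding P_def by (rule D(2)[OF \<rho>(1)])
  have iW: "lset_int W (\<lambda>x. (norm (D x))^2)" by (rule set_integrable_subset[OF iP mW W[folded P_def]])
  have e1: "(LINT x:P|lebesgue. frob (weak_grad P u x) (weak_grad P u x) / 2) = (LINT x:P|lebesgue. (norm (D x))^2) / 2"
  proof -
    have "AE x in lebesgue. x \<in> P --> weak_grad P u x = D x" using weak_grad_AE[OF oP subset_refl] wP unfolding w12l_def by blast
    then have ae: "AE x in lebesgue. x \<in> P --> (norm (D x))^2 / 2 = frob (weak_grad P u x) (weak_grad P u x) / 2"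
      by (rule eventually_mono) (simp add: frob_norm)
    have "lset_int P (\<lambda>x. (norm (D x))^2 / 2)" using iP by simp
    from set_integrable_cong_AE'(2)[OF this ae] show ?thesis by simp
  qed
  define P' where "P' = \<Phi> ` P"
  have oP': "open P'" unfolding P'_def by (rule open_Phi[OF oP])
  define Dv where "Dv x = D (\<Psi> x) ** jacobian \<Psi> (at x)" for x
  have wP': "w12l P' v Dv" using Psi.w12l_comp[OF oP wP] unfolding P'_def Dv_def vimage_Psi .
  have "W12 P' N v" unfolding P'_def by (rule W12_push[OF oP]) (unfold P_def, rule W12_perforated[OF \<Omega> adm \<rho>(1)])
  then obtain D' where D': "w12l P' v D'" "lset_int P' (\<lambda>x. (norm (D' x))^2)" unfolding W12_iff by blast
  have "AE x in lebesgue. x \<in> P' --> D' x = Dv x" using has_weak_grad_unique[OF oP'] D'(1) wP' unfolding w12l_def by blast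
  then have iP': "lset_int P' (\<lambda>x. (norm (Dv x))^2)" by (intro set_integrable_cong_AE'(1)[OF D'(2)]) (auto elim!: eventually_mono)
  have e2: "(LINT x:P'|lebesgue. frob (weak_grad P' v x) (weak_grad P' v x) / 2) = (LINT x:P'|lebesgue. (norm (Dv x))^2) / 2"
  proof -
    have "AE x in lebesgue. x \<in> P' --> weak_grad P' v x = Dv x" using weak_grad_AE[OF oP' subset_refl] wP' unfolding w12l_def by blast
    then have ae: "AE x in lebesgue. x \<in> P' --> (norm (Dv x))^2 / 2 = frob (weak_grad P' v x) (weak_grad P' v x) / 2"
      by (rule eventually_mono) (simp add: frob_norm)
    have "lset_int P' (\<lambda>x. (norm (Dv x))^2 / 2)" using iP' by simp
    from set_integrable_cong_AE'(2)[OF this ae] show ?thesis by simp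
  qed
  interpret local_diffeo \<Phi> P by (rule Phi.local[OF oP])
  have inj: "inj_on \<Phi> P" using Phi_inj by (auto intro: inj_on_subset)
  have cov': "lset_int P (\<lambda>x. \<bar>det (jacobian \<Phi> (at x))\<bar> * (norm (Dv (\<Phi> x)))^2)"
    "(LINT x:P|lebesgue. \<bar>det (jacobian \<Phi> (at x))\<bar> * (norm (Dv (\<Phi> x)))^2) = (LINT x:P'|lebesgue. (norm (Dv x))^2)"
    using cov_real[OF mP cov[OF _ subset_refl] inj iP'[unfolded P'_def]] by (simp_all add: P'_def)
  \<comment> \<open>Pointwise majorant of the transported energy density: the old density, corrected
    on \<open>W\<close> only.\<close>
  define k where "k x = (norm (D x))^2 + indicator W x * (t * q x + 40 * b^2 * t^2 * (norm (D x))^2)" for x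
  have pt: "\<bar>det (jacobian \<Phi> (at x))\<bar> * (norm (Dv (\<Phi> x)))^2 \<le> k x" for x
  proof -
    have d: "\<bar>det (jacobian \<Phi> (at x))\<bar> = det (jacobian \<Phi> (at x))" using Phi_det(1)[of x] by linarith
    have j: "jacobian \<Phi> (at x) = mat 1 + t *R B x" unfolding Phi_jac B_def ..
    have Dv: "Dv (\<Phi> x) = D x ** inv2 (jacobian \<Phi> (at x))" by (simp add: Dv_def Psi_jac)
    show ?thesis
    proof (cases "x \<in> W")
      case True
      then show ?thesis using energy_expansion[OF psib[of x] t, of "D x"] unfolding d Dv unfolding k_def q_def j B_def
        by (simp add: mult.commute)
    next
      case False
      \<comment> \<open>Off \<open>W\<close> the matrix B vanishes, and the expansion with bound b =
        0 has no correction at all.\<close>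
      then show ?thesis
        using energy_expansion[of "B x" 0 t "D x"] unfolding d Dv unfolding k_def j W_def by (simp add: mult.commute trace_def)
    qed
  qed
  have iw: "lset_int W (\<lambda>x. t * q x + 40 * b^2 * t^2 * (norm (D x))^2)" using qi iW by (intro set_integral_add(1)) auto
  have si: "indicator P x * (indicator W x * y) = indicator W x * y" for x and y :: real using W[folded P_def] by (auto simp: indicator_def)
  have i2: "lset_int P (\<lambda>x. indicator W x * (t * q x + 40 * b^2 * t^2 * (norm (D x))^2))"
    using iw unfolding set_integrable_def by (simp add: si)
  have ki: "lset_int P k" unfolding k_def by (rule set_integral_add(1)[OF iP i2])
  have "(LINT x:P'|lebesgue. (norm (Dv x))^2) \<le> (LINT x:P|lebesgue. k x)"
    unfolding cov'(2)[symmetric] by (rule set_integral_mono[OF cov'(1) ki]) (rule pt)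
  also have "\<dots> = (LINT x:P|lebesgue. (norm (D x))^2) + (LINT x:P|lebesgue. indicator W x * (t * q x + 40 * b^2 * t^2 * (norm (D x))^2))"
    unfolding k_def by (rule set_integral_add(2)[OF iP i2])
  also have "(LINT x:P|lebesgue. indicator W x * (t * q x + 40 * b^2 * t^2 * (norm (D x))^2)) = (LINT x:W|lebesgue. t * q x + 40 * b^2 * t^2 * (norm (D x))^2)"
    unfolding set_lebesgue_integral_def by (simp add: si)
  also have "\<dots> = t * (LINT x:W|lebesgue. q x) + 40 * b^2 * t^2 * (LINT x:W|lebesgue. (norm (D x))^2)"
    using qi iW by (subst set_integral_add(2)) auto
  finally have F: "(LINT x:P'|lebesgue. (norm (Dv x))^2) \<le> (LINT x:P|lebesgue. (norm (D x))^2) +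
    (t * (LINT x:W|lebesgue. q x) + 40 * b^2 * t^2 * (LINT x:W|lebesgue. (norm (D x))^2))" .
  show ?thesis unfolding perforated_Phi[OF \<rho>(2)] P_def[symmetric] P'_def[symmetric] e1 e2
    using divide_right_mono[OF F, of 2] by (simp only: add_divide_distrib)
qed

end

text \<open>The charges stay literally the same maps: near a singularity the deformation is a
  translation, so the traces on small circles around the moved point are the old ones and the
  synharmony limits carry over.\<close>

lemma has_sing_push:
  assumes \<Omega>: "open \<Omega>" and out: "\<And>x. x \<notin> \<Omega> ==> \<psi> x = 0" and hs: "has_sing \<Omega> N u k a \<gamma>"
    and loc: "\<And>i. i < k ==> \<exists>r>0. \<forall>x\<in>ball (a i) r. \<psi> x = \<psi> (a i)"
  shows "has_sing \<Omega> N (\<lambda>x. u (\<Psi> x)) k (\<lambda>i. \<Phi> (a i)) \<gamma>" unfolding has_sing_def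
proof (intro conjI allI impI)
  have A: "inj_on a {..<k}" "a ` {..<k} \<subseteq> \<Omega>" "W12_loc_closure \<Omega> (a ` {..<k}) N u" using hs by (auto simp: has_sing_def)
  show "inj_on (\<lambda>i. \<Phi> (a i)) {..<k}" using A(1) Phi_inj by (auto simp: inj_on_def)
  show "(\<lambda>i. \<Phi> (a i)) ` {..<k} \<subseteq> \<Omega>" using A(2) invariant(1)[OF out] by blast
  show "W12_loc_closure \<Omega> ((\<lambda>i. \<Phi> (a i)) ` {..<k}) N (\<lambda>x. u (\<Psi> x))" unfolding W12_loc_closure_def
  proof
    fix x assume x: "x \<in> closure \<Omega> - (\<lambda>i. \<Phi> (a i)) ` {..<k}"
    have "\<Psi> x \<in> closure \<Omega>"
    proof -
      have "\<Psi> ` closure \<Omega> \<subseteq> closure \<Omega>" by (rule image_closure_subset[OF continuous_on_subset[OF Psi_cont subset_UNIV] closed_closure])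
           (simp add: invariant(2)[OF out] closure_subset)
      then show ?thesis using x by blast
    qed
    moreover have "\<Psi> x \<notin> a ` {..<k}"
    proof
      assume "\<Psi> x \<in> a ` {..<k}"
      then obtain i where "i < k" "\<Psi> x = a i" by auto
      then show False using x Phi_Psi[of x] by auto
    qed
    ultimately obtain e where e: "e > 0" "W12 (\<Omega> \<inter> ball (\<Psi> x) e) N u" using A(3) unfolding W12_loc_closure_def by blast
    obtain e' where e': "e' > 0" "ball x e' \<subseteq> \<Phi> ` ball (\<Psi> x) e" using ball_image(1)[of "ball (\<Psi> x) e" "\<Psi> x"] e(1) by auto
    have "W12 (\<Phi> ` (\<Omega> \<inter> ball (\<Psi> x) e)) N (\<lambda>x. u (\<Psi> x))" by (rule W12_push[OF open_Int[OF \<Omega> open_ball] e(2)])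
    moreover have "\<Phi> ` (\<Omega> \<inter> ball (\<Psi> x) e) = \<Omega> \<inter> \<Phi> ` ball (\<Psi> x) e" by (simp add: image_Int[OF Phi_inj] invariant(1)[OF out])
    ultimately have "W12 (\<Omega> \<inter> \<Phi> ` ball (\<Psi> x) e) N (\<lambda>x. u (\<Psi> x))" by simp
    then have "W12 (\<Omega> \<inter> ball x e') N (\<lambda>x. u (\<Psi> x))" by (rule W12_subset[OF _ Int_mono[OF subset_refl e'(2)] open_Int[OF \<Omega> open_ball]])
    then show "\<exists>r>0. W12 (\<Omega> \<inter> ball x r) N (\<lambda>x. u (\<Psi> x))" using e'(1) by blast
  qed
  fix i assume i: "i < k"
  show "W_half_2 N (\<gamma> i)" "\<not> (\<exists>p\<in>N. VMO_homotopic N (\<gamma> i) (\<lambda>_. p))" using hs i by (auto simp: has_sing_def)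
  obtain r where r: "r > 0" "\<And>x. x \<in> ball (a i) r ==> \<psi> x = \<psi> (a i)" using loc[OF i] by blast
  have eq: "circle_trace (\<lambda>x. u (\<Psi> x)) (\<Phi> (a i)) \<rho> = circle_trace u (a i) \<rho>" if "\<rho> < r" for \<rho>
  proof -
    have "circle_trace (\<lambda>x. u (\<Psi> x)) (a i + t *R \<psi> (a i)) \<rho> = circle_trace u (a i) \<rho>"
    proof (rule circle_trace_translate[OF that])
      fix x assume x: "x \<in> ball (a i) r"
      then have "x + t *R \<psi> (a i) = \<Phi> x" using r(2)[OF x] by (simp add: \<Phi>_def)
      then show "u (\<Psi> (x + t *R \<psi> (a i))) = u x" by simp
    qed
    then show ?thesis by (simp add: \<Phi>_def)
  qed
  have "((\<lambda>\<rho>. synh_dist N (circle_trace u (a i) \<rho>) (\<gamma> i)) \<longlongrightarrow> 0) (at_right 0)" using hs i by (auto simp: has_sing_def)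
  then show "((\<lambda>\<rho>. synh_dist N (circle_trace (\<lambda>x. u (\<Psi> x)) (\<Phi> (a i)) \<rho>) (\<gamma> i)) \<longlongrightarrow> 0) (at_right 0)"
  proof (rule Lim_transform_eventually)
    show "\<forall>\<^sub>F \<rho> in at_right 0. synh_dist N (circle_trace u (a i) \<rho>) (\<gamma> i) = synh_dist N (circle_trace (\<lambda>x. u (\<Psi> x)) (\<Phi> (a i)) \<rho>) (\<gamma> i)"
      using eventually_at_right_zero[OF r(1)] by eventually_elim (simp add: eq)
  qed
qed

end

section \<open>From minimality to the stationarity identity\<close>

text \<open>The lower limits may be infinite, so they are compared through the values y below the
  first one; for real y the constant can be moved across.\<close>

lemma Liminf_shift:
  assumes "\<forall>\<^sub>F \<rho> in F. g \<rho> \<le> f \<rho> + (c::real)"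
  shows "Liminf F (\<lambda>\<rho>. ereal (g \<rho>)) \<le> Liminf F (\<lambda>\<rho>. ereal (f \<rho>)) + ereal c"
proof (rule dense_le)
  fix y assume y: "y < Liminf F (\<lambda>\<rho>. ereal (g \<rho>))"
  show "y \<le> Liminf F (\<lambda>\<rho>. ereal (f \<rho>)) + ereal c"
  proof (cases y)
    case (real r)
    have "\<forall>\<^sub>F \<rho> in F. y < ereal (g \<rho>)" using y le_Liminf_iff[of "Liminf F (\<lambda>\<rho>. ereal (g \<rho>))" F "\<lambda>\<rho>. ereal (g \<rho>)"] by auto
    then have "\<forall>\<^sub>F \<rho> in F. ereal (r - c) \<le> ereal (f \<rho>)" using assms by eventually_elim (simp add: real)
    then have "ereal (r - c) \<le> Liminf F (\<lambda>\<rho>. ereal (f \<rho>))" by (rule Liminf_bounded)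
    then have "ereal (r - c) + ereal c \<le> Liminf F (\<lambda>\<rho>. ereal (f \<rho>)) + ereal c" by (rule add_right_mono)
    then show ?thesis by (simp add: real)
  qed (use y in auto)
qed

lemma quadratic_zero:
  assumes t0: "0 < t0" and K: "0 \<le> (K::real)" and h: "\<And>t. \<bar>t\<bar> \<le> t0 ==> 0 \<le> t * Q + K * t^2"
  shows "Q = 0"
proof (rule ccontr)
  assume Q: "Q \<noteq> 0"
  \<comment> \<open>Used with t = - s Q, for which the expression is - s Q^2 (1 - K s). The first
    bound on s keeps |t| within t0, the second makes K s < 1.\<close>
  define s where "s = min (t0 / \<bar>Q\<bar>) (1 / (K + 1))"
  have s: "0 < s" "s \<le> t0 / \<bar>Q\<bar>" "s \<le> 1 / (K + 1)" using Q t0 K by (auto simp: s_def)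
  have "K * s \<le> K * (1 / (K + 1))" using s K by (intro mult_left_mono) auto
  also have "\<dots> < 1" using K by simp
  finally have Ks: "K * s < 1" .
  have "0 \<le> (- s * Q) * Q + K * (- s * Q)^2" using s(1,2) Q by (intro h) (simp add: abs_mult field_simps)
  also have "\<dots> = - (s * Q^2 * (1 - K * s))" by (simp add: power2_eq_square algebra_simps)
  also have "\<dots> < 0" using s(1) Q Ks by simp
  finally show False by simp
qed

text \<open>For each fixed t the energies at radius rho differ by at most a constant c that is
  independent of rho, so the comparison passes to the lower limits. Minimality then reads 0 \<le> c
  for all small t.\<close>

lemma minimal_imp_stationary_identity:
  fixes u :: "real^2 => real^'n"
  assumes \<Omega>: "open \<Omega>" and ren: "W12_ren \<Omega> N u" and hs: "has_sing \<Omega> N u k a \<gamma>"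
    and mini: "\<And>v b. W12_ren \<Omega> N v ==> has_sing \<Omega> N v k b \<gamma> ==> ren_energy \<Omega> N u \<le> ren_energy \<Omega> N v"
    and low: "ren_energy \<Omega> N u \<noteq> -\<infinity>"
    and \<psi>: "Ck_compact_support 2 \<Omega> \<psi>" and const: "\<And>i. i < k ==> \<exists>r>0. \<forall>x\<in>ball (a i) r. \<psi> x = \<psi> (a i)"
  defines "Du \<equiv> weak_grad (\<Omega> - a ` {..<k}) u" and "B \<equiv> \<lambda>x. jacobian \<psi> (at x)"
  shows "(LINT x:\<Omega>|lebesgue. frob (Du x) (Du x ** B x)) = 1 / 2 * (LINT x:\<Omega>|lebesgue. frob (Du x) (Du x) * trace (B x))"
proof -
  define S where "S = bad_pts \<Omega> N u"
  obtain S1 where S1: "ren_admissible \<Omega> N u S1" using ren by (auto simp: W12_ren_def)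
  have adm: "ren_admissible \<Omega> N u S" unfolding S_def by (rule ren_admissible_bad_pts[OF \<Omega> S1])
  have SA: "S \<subseteq> a ` {..<k}" unfolding S_def using hs by (intro bad_pts_loc_closure[OF \<Omega>]) (simp add: has_sing_def)
  have fS: "finite S" using adm by (simp add: ren_admissible_def)
  define K where "K = closure {x. \<psi> x \<noteq> 0}"
  have K: "compact K" "K \<subseteq> \<Omega>" and C2: "Ck_on (Suc (Suc 0)) \<psi> UNIV" using \<psi> unfolding Ck_compact_support_def K_def numeral_2_eq_2 by auto
  have K0: "\<psi> x = 0" if "x \<notin> K" for x using that closure_subset[of "{x. \<psi> x \<noteq> 0}"] unfolding K_def by auto
  \<comment> \<open>\<open>Ck_on\<close> at order 2 says that the first derivatives are
    differentiable; their continuity follows.\<close>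
  have psi: "C1_on \<psi> UNIV" using C2 unfolding Ck1_iff Ck_on.simps(2)[of "Suc 0"]
    by (auto intro!: continuous_at_imp_continuous_on differentiable_imp_continuous_within)
  have out: "\<psi> x = 0" if "x \<notin> \<Omega>" for x using K0 K(2) that by blast
  have Bc: "continuous_on UNIV B" unfolding B_def by (rule jacobian_continuous[OF psi])
  have B0: "B x = 0" if "x \<notin> K" for x using frechet_zero_outside[OF compact_imp_closed[OF K(1)] K0 that]
    by (simp add: B_def jacobian_def matrix_def vec_eq_iff)
  \<comment> \<open>A strictly positive bound even if the gradient of psi vanishes, since the
    admissible range of t is 1/(8 b).\<close>
  obtain b where b: "0 < b" "\<And>x. norm (B x) \<le> b"
  proof -
    obtain b where h: "b > 0" "\<forall>x\<in>K. norm (B x) \<le> b"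
      using compact_imp_bounded[OF compact_continuous_image[OF continuous_on_subset[OF Bc subset_UNIV] K(1)]] by (auto simp: bounded_pos)
    have "norm (B x) \<le> b" for x using h B0[of x] by (cases "x \<in> K") auto
    then show ?thesis using h(1) by (intro that[of b])
  qed
  obtain r where r: "0 < r" "\<And>s x. s \<in> S ==> x \<in> ball s r ==> \<psi> x = \<psi> s"
  proof -
    have "\<forall>s\<in>S. \<forall>\<^sub>F r in at_right 0. \<forall>x\<in>ball s r. \<psi> x = \<psi> s"
    proof
      fix s assume "s \<in> S"
      then obtain i where i: "i < k" "s = a i" using SA by auto
      then obtain r where r: "r > 0" "\<forall>x\<in>ball s r. \<psi> x = \<psi> s" using const by blast
      show "\<forall>\<^sub>F r in at_right 0. \<forall>x\<in>ball s r. \<psi> x = \<psi> s" using eventually_at_right_zero[OF r(1)]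
      proof eventually_elim
        fix r' assume "0 < r' \<and> r' < r"
        then have "ball s r' \<subseteq> ball s r" by (intro subset_ball) simp
        then show "\<forall>x\<in>ball s r'. \<psi> x = \<psi> s" using r(2) by blast
      qed
    qed
    then have "\<forall>\<^sub>F r in at_right 0. \<forall>s\<in>S. \<forall>x\<in>ball s r. \<psi> x = \<psi> s" by (rule eventually_ball_finite[OF fS])
    then have "\<forall>\<^sub>F r in at_right (0::real). (\<forall>s\<in>S. \<forall>x\<in>ball s r. \<psi> x = \<psi> s) \<and> 0 < r \<and> r < 1"
      using eventually_at_right_zero[of 1] by (auto elim: eventually_conj)
    then have "\<exists>r::real. (\<forall>s\<in>S. \<forall>x\<in>ball s r. \<psi> x = \<psi> s) \<and> 0 < r \<and> r < 1" by (rule eventually_happens'[rotated]) simp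
    then show ?thesis using that by blast
  qed
  \<comment> \<open>The only place where the variation contributes. It misses the balls of radius r
    around the singularities, so the energy of u on it is finite.\<close>
  define W where "W = {x. B x \<noteq> 0}"
  have WP: "W \<subseteq> perforated \<Omega> S \<rho>" if \<rho>: "0 < \<rho>" "\<rho> < r" for \<rho>
  proof
    fix x assume x: "x \<in> W"
    then have "x \<in> \<Omega>" using B0 K(2) by (auto simp: W_def)
    moreover have "x \<notin> cball s \<rho>" if s: "s \<in> S" for s
    proof
      assume "x \<in> cball s \<rho>"
      then have xb: "x \<in> ball s r" using \<rho> by auto
      have "(\<psi> has_derivative (\<lambda>v. 0)) (at x)"
        by (rule has_derivative_transform_within_open[OF has_derivative_const[of "\<psi> s"] open_ball xb]) (use r(2)[OF s] in auto)
      from frechet_derivative_at[OF this, symmetric] have "B x = 0" by (simp add: B_def jacobian_def matrix_def vec_eq_iff)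
      then show False using x by (simp add: W_def)
    qed
    ultimately show "x \<in> perforated \<Omega> S \<rho>" by (auto simp: perforated_def)
  qed
  obtain D where D: "w12l (\<Omega> - S) u D" "\<And>\<rho>. 0 < \<rho> ==> lset_int (perforated \<Omega> S \<rho>) (\<lambda>x. (norm (D x))^2)"
    using w12l_off_singularities[OF \<Omega> adm] by blast
  have oW: "open W"
  proof -
    have "W = - (B -` {0} \<inter> UNIV)" by (auto simp: W_def)
    then show ?thesis using continuous_closed_preimage[OF Bc closed_UNIV closed_singleton[of 0]] by (simp add: Int_commute open_Compl)
  qed
  have mW: "W \<in> sets lebesgue" using oW by simp
  have r2: "0 < r / 2" "r / 2 < r" using r(1) by auto
  have WS: "W \<subseteq> \<Omega> - S"
  proof
    fix x assume "x \<in> W"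
    then show "x \<in> \<Omega> - S" using WP[OF r2] centre_in_cball[of x "r/2"] r2(1) unfolding perforated_def by fastforce
  qed
  have iW: "lset_int W (\<lambda>x. (norm (D x))^2)" by (rule set_integrable_subset[OF D(2)[OF r2(1)] mW WP[OF r2]])
  have lW: "loc_int W D" "loc_int W (\<lambda>x. D x ** B x)" using has_weak_gradD(2)[of "\<Omega> - S" u D] D(1) WS
    by (auto simp: w12l_def intro!: loc_int_matrix_mult continuous_on_subset[OF Bc] intro: loc_int_subset)
  have bi: "lset_int W f"
    if fm: "(\<lambda>x. indicator W x *R f x) \<in> borel_lebesgue" and fb: "\<And>x. \<bar>f x\<bar> \<le> c * (norm (D x))^2" for f :: "real^2 => real" and c
    unfolding set_integrable_def
  proof (rule Bochner_Integration.integrable_bound[OF _ fm])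
    show "integrable lebesgue (\<lambda>x. c *R (indicator W x *R (norm (D x))^2))"
      using iW unfolding set_integrable_def by (rule integrable_scaleR_right)
    show "AE x in lebesgue. norm (indicator W x *R f x) \<le> norm (c *R (indicator W x *R (norm (D x))^2))"
      using fb by (auto simp: indicator_def intro!: AE_I2 order_trans[OF _ abs_ge_self])
  qed
  have i1: "lset_int W (\<lambda>x. D x \<bullet> (D x ** B x))"
  proof (rule bi)
    have e: "indicator W x *R (D x \<bullet> (D x ** B x)) = (indicator W x *R D x) \<bullet> (indicator W x *R (D x ** B x))" for x
      by (auto simp: indicator_def)
    show "(\<lambda>x. indicator W x *R (D x \<bullet> (D x ** B x))) \<in> borel_lebesgue"
      unfolding e by (intro borel_measurable_inner loc_int_measurable[OF oW] lW)
    fix x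
    have "\<bar>D x \<bullet> (D x ** B x)\<bar> \<le> norm (D x) * norm (D x ** B x)" by (rule Cauchy_Schwarz_ineq2)
    also have "\<dots> \<le> norm (D x) * (norm (D x) * b)"
      using norm_matrix_mul[of "D x" "B x"] mult_left_mono[OF b(2) norm_ge_zero[of "D x"]] by (intro mult_left_mono) (auto intro: order_trans)
    finally show "\<bar>D x \<bullet> (D x ** B x)\<bar> \<le> b * (norm (D x))^2" by (simp add: power2_eq_square mult_ac)
  qed
  have i2: "lset_int W (\<lambda>x. (norm (D x))^2 * trace (B x))"
  proof (rule bi)
    have "continuous_on UNIV (\<lambda>x. trace (B x))" unfolding trace_def sum_2 by (intro continuous_intros Bc)
    from borel_measurable_times[OF borel_measurable_integrable[OF iW[unfolded set_integrable_def]] continuous_lebesgue_measurable[OF this]]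
    show "(\<lambda>x. indicator W x *R ((norm (D x))^2 * trace (B x))) \<in> borel_lebesgue" by (simp add: mult.assoc)
    fix x
    have "\<bar>trace (B x)\<bar> \<le> 2 * b" by (rule det_perturb(2)[OF b(2), of 0]) simp
    then show "\<bar>(norm (D x))^2 * trace (B x)\<bar> \<le> (2 * b) * (norm (D x))^2"
      using mult_right_mono[of "\<bar>trace (B x)\<bar>" "2 * b" "(norm (D x))^2"] by (simp add: abs_mult mult.commute)
  qed
  define q where "q x = (norm (D x))^2 * trace (B x) - 2 * (D x \<bullet> (D x ** B x))" for x
  have qi: "lset_int W q" unfolding q_def by (intro set_integral_diff(1) i2) (use i1 in simp)
  define Q where "Q = (LINT x:W|lebesgue. q x)"
  define I where "I = (LINT x:W|lebesgue. (norm (D x))^2)"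
  have I0: "0 \<le> I" unfolding I_def set_lebesgue_integral_def by (rule integral_nonneg_AE) simp
  define f where "f \<rho> = (LINT x:perforated \<Omega> S \<rho>|lebesgue. frob (weak_grad (perforated \<Omega> S \<rho>) u x) (weak_grad (perforated \<Omega> S \<rho>) u x) / 2)
     - (\<Sum>a\<in>S. (min_length N (circle_trace u a \<rho>))^2 / (4 * pi) * ln (1 / \<rho>))" for \<rho>
  have Eu: "ren_energy \<Omega> N u = Liminf (at_right 0) (\<lambda>\<rho>. ereal (f \<rho>))"
    unfolding ren_energy_def Inter_ren_admissible[OF \<Omega> S1] S_def[symmetric] ren_energy_wrt_def f_def ..
  have "Q = 0"
  proof (rule quadratic_zero)
    show "0 < 1 / (8 * b)" "0 \<le> 40 * b^2 * I" using b(1) I0 by auto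
    fix t assume "\<bar>t\<bar> \<le> 1 / (8 * b)"
    then have t: "\<bar>t\<bar> * b \<le> 1 / 8" using b(1) by (simp add: field_simps)
    interpret deformation \<psi> b t by unfold_locales (use psi b(2) t in \<open>auto simp: B_def\<close>)
    let ?v = "\<lambda>x. u (\<Psi> x)"
    define g where "g \<rho> = (LINT x:perforated \<Omega> (\<Phi> ` S) \<rho>|lebesgue. frob (weak_grad (perforated \<Omega> (\<Phi> ` S) \<rho>) ?v x) (weak_grad (perforated \<Omega> (\<Phi> ` S) \<rho>) ?v x) / 2)
     - (\<Sum>a\<in>\<Phi> ` S. (min_length N (circle_trace ?v a \<rho>))^2 / (4 * pi) * ln (1 / \<rho>))" for \<rho>
    have admv: "ren_admissible \<Omega> N ?v (\<Phi> ` S)" by (rule adm_push[OF \<Omega> out adm r])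
    have bp: "bad_pts \<Omega> N ?v = \<Phi> ` S" unfolding S_def by (rule bad_push[OF \<Omega> out adm r])
    have Ev: "ren_energy \<Omega> N ?v = Liminf (at_right 0) (\<lambda>\<rho>. ereal (g \<rho>))"
      unfolding ren_energy_def Inter_ren_admissible[OF \<Omega> admv] bp ren_energy_wrt_def g_def ..
    define c where "c = (t * Q + 40 * b^2 * t^2 * I) / 2"
    have "\<forall>\<^sub>F \<rho> in at_right 0. g \<rho> \<le> f \<rho> + c" using eventually_at_right_zero[OF r(1)]
    proof eventually_elim
      fix \<rho> assume \<rho>: "0 < \<rho> \<and> \<rho> < r"
      have tp: "circle_trace ?v (\<Phi> s) \<rho> = circle_trace u s \<rho>" if s: "s \<in> S" for s by (rule trace_push[OF \<Omega> out adm r]) (use s \<rho> in simp_all)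
      have "(\<Sum>a\<in>\<Phi> ` S. (min_length N (circle_trace ?v a \<rho>))^2 / (4 * pi) * ln (1 / \<rho>))
        = (\<Sum>a\<in>S. (min_length N (circle_trace u a \<rho>))^2 / (4 * pi) * ln (1 / \<rho>))"
        by (subst sum.reindex) (auto intro!: sum.cong inj_on_subset[OF Phi_inj] simp: tp)
      then show "g \<rho> \<le> f \<rho> + c" using energy_push[OF \<Omega> out adm r D conjunct1[OF \<rho>] conjunct2[OF \<rho>],
          folded B_def[THEN meta_eq_to_obj_eq, THEN fun_cong], folded W_def q_def] WP[OF conjunct1[OF \<rho>] conjunct2[OF \<rho>]] qi
        unfolding g_def f_def c_def Q_def I_def by simp
    qed
    then have le: "ren_energy \<Omega> N ?v \<le> ren_energy \<Omega> N u + ereal c" unfolding Eu Ev by (rule Liminf_shift)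
    have fin: "ren_energy \<Omega> N u < \<infinity>" using ren by (simp add: W12_ren_def)
    then have "ren_energy \<Omega> N ?v < \<infinity>" using le by (auto intro: order.strict_trans1)
    then have "W12_ren \<Omega> N ?v" using admv by (auto simp: W12_ren_def)
    moreover have "has_sing \<Omega> N ?v k (\<lambda>i. \<Phi> (a i)) \<gamma>" by (rule has_sing_push[OF \<Omega> out hs const])
    ultimately have "ren_energy \<Omega> N u \<le> ren_energy \<Omega> N u + ereal c" using mini le by (meson order_trans)
    \<comment> \<open>The energy of u can be cancelled because it is finite: \<open>fin\<close>
      excludes +infinity and \<open>low\<close> excludes -infinity, where the inequality would carry
      no information.\<close>
    then have "0 \<le> c" using low fin by (cases "ren_energy \<Omega> N u") auto
    then show "0 \<le> t * Q + 40 * b^2 * I * t^2" by (simp add: c_def mult_ac)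
  qed
  then have "(LINT x:W|lebesgue. (norm (D x))^2 * trace (B x)) - (LINT x:W|lebesgue. 2 * (D x \<bullet> (D x ** B x))) = 0"
    unfolding Q_def q_def using i1 i2 by (subst (asm) set_integral_diff(2)) auto
  then have fin: "(LINT x:W|lebesgue. D x \<bullet> (D x ** B x)) = 1 / 2 * (LINT x:W|lebesgue. (norm (D x))^2 * trace (B x))" by simp
  define A where "A = a ` {..<k}"
  have fA: "finite A" by (simp add: A_def)
  have oA: "open (\<Omega> - A)" by (intro open_Diff \<Omega> finite_imp_closed fA)
  have "has_weak_grad (\<Omega> - A) u D" using D(1) SA unfolding w12l_def A_def by (auto intro: has_weak_grad_subset)
  then have ae1: "AE x in lebesgue. x \<in> \<Omega> - A --> Du x = D x" unfolding Du_def A_def[symmetric] by (intro weak_grad_AE[OF oA subset_refl])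
  \<comment> \<open>The gradient in the statement lives off the listed singularities; these form a
    null set, so the integrals over \<Omega> do not see them.\<close>
  have "AE x in lebesgue. x \<notin> A" using fA by (intro AE_not_in) (simp add: finite_imp_null_set_lborel null_sets_completionI)
  then have ae: "AE x in lebesgue. x \<in> \<Omega> --> Du x = D x" using ae1 by eventually_elim auto
  have WO: "W \<subseteq> \<Omega>" using WS by auto
  \<comment> \<open>Both integrands contain the gradient of psi as a factor, so the integrals over
    \<Omega> shrink to \<open>W\<close>.\<close>
  have tr: "(LINT x:\<Omega>|lebesgue. F x) = (LINT x:W|lebesgue. G x)"
    if "lset_int W G" "AE x in lebesgue. x \<in> \<Omega> --> F x = G x" "\<And>x. x \<notin> W ==> G x = 0" for F G :: "real^2 => real"
  proof -
    have e: "indicator \<Omega> x *R G x = indicator W x *R G x" for x using WO that(3)[of x] by (auto simp: indicator_def)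
    have "lset_int \<Omega> G" using that(1) unfolding set_integrable_def e .
    moreover have "AE x in lebesgue. x \<in> \<Omega> --> G x = F x" using that(2) by eventually_elim auto
    ultimately have "(LINT x:\<Omega>|lebesgue. G x) = (LINT x:\<Omega>|lebesgue. F x)" by (rule set_integrable_cong_AE'(2))
    then show ?thesis unfolding set_lebesgue_integral_def e by simp
  qed
  have z: "D x ** 0 = 0" for x by (simp add: matrix_matrix_mult_def vec_eq_iff)
  have "(LINT x:\<Omega>|lebesgue. frob (Du x) (Du x ** B x)) = (LINT x:W|lebesgue. D x \<bullet> (D x ** B x))"
    by (rule tr[OF i1]) (use ae in \<open>auto simp: frob_inner W_def z elim!: eventually_mono\<close>)
  moreover have "(LINT x:\<Omega>|lebesgue. frob (Du x) (Du x) * trace (B x)) = (LINT x:W|lebesgue. (norm (D x))^2 * trace (B x))"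
    by (rule tr[OF i2]) (use ae in \<open>auto simp: frob_norm W_def trace_def elim!: eventually_mono\<close>)
  ultimately show ?thesis using fin by simp
qed

section \<open>Traces on horizontal lines\<close>

lemma lebesgue_borel_version:
  fixes f :: "'a::euclidean_space => 'b::euclidean_space"
  assumes f: "f \<in> borel_lebesgue"
  obtains g where "g \<in> borel_measurable borel" "AE x in lebesgue. f x = g x"
proof -
  have "\<forall>b. \<exists>g\<in>borel_measurable lborel. AE x in lborel. f x \<bullet> b = g x" using f by (intro allI completion_ex_borel_measurable_real) simp
  then obtain G where G: "\<And>b. G b \<in> borel_measurable lborel" "\<And>b. AE x in lborel. f x \<bullet> b = G b x" by metis
  define g where "g x = (\<Sum>b\<in>Basis. G b x *R b)" for x
  have "g \<in> borel_measurable borel" unfolding g_def[abs_def] using G(1) by simp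
  moreover have "AE x in lborel. \<forall>b\<in>Basis. f x \<bullet> b = G b x" using G(2) by (intro AE_finite_allI) auto
  then have "AE x in lborel. f x = g x"
  proof (rule eventually_mono)
    fix x assume *: "\<forall>b\<in>Basis. f x \<bullet> b = G b x"
    have "f x = (\<Sum>b\<in>Basis. (f x \<bullet> b) *R b)" by (rule euclidean_representation[symmetric])
    also have "\<dots> = g x" unfolding g_def using * by (intro sum.cong) auto
    finally show "f x = g x" .
  qed
  ultimately show ?thesis using AE_completion that by blast
qed

text \<open>Cauchy-Schwarz on an interval, in a form that allows an infinite right side. In the
  finite case it follows from the nonnegative variance of |k| around its mean m.\<close>

lemma square_integral_le:
  fixes k :: "real => 'b::euclidean_space"
  assumes k: "k \<in> borel_measurable borel" and ab: "a < b"
  shows "ennreal ((norm (LINT t|lborel. indicator {a<..<b} t *R k t))^2) \<le> ennreal (b - a) * (\<integral>\<^sup>+t\<in>{a<..<b}. ennreal ((norm (k t))^2) \<partial>lborel)"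
    and "(\<integral>\<^sup>+t\<in>{a<..<b}. ennreal ((norm (k t))^2) \<partial>lborel) \<noteq> \<infinity> ==> integrable lborel (\<lambda>t. indicator {a<..<b} t *R k t)"
proof -
  let ?I = "indicator {a<..<b} :: real => real"
  let ?E = "\<integral>\<^sup>+t\<in>{a<..<b}. ennreal ((norm (k t))^2) \<partial>lborel"
  define \<tau> where "\<tau> = b - a"
  have \<tau>: "0 < \<tau>" using ab by (simp add: \<tau>_def)
  have e: "?E = (\<integral>\<^sup>+t. ennreal (?I t * (norm (k t))^2) \<partial>lborel)" by (intro nn_integral_cong) (auto simp: indicator_def)
  have I: "integrable lborel ?I" using ab by simp
  have s: "integrable lborel (\<lambda>t. ?I t * (norm (k t))^2)" if "?E \<noteq> \<infinity>"
    by (rule integrableI_bounded) (use k that in \<open>auto simp: e top.not_eq_extremum\<close>)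
  have n: "integrable lborel (\<lambda>t. ?I t * norm (k t))" if "?E \<noteq> \<infinity>"
  proof (rule Bochner_Integration.integrable_bound[OF Bochner_Integration.integrable_add[OF I s[OF that]]])
    show "AE t in lborel. norm (?I t * norm (k t)) \<le> norm (?I t + ?I t * (norm (k t))^2)"
    proof (rule AE_I2)
      fix t
      have "2 * norm (k t) \<le> (norm (k t))^2 + 1" using sum_squares_bound[of "norm (k t)" 1] by simp
      then have "norm (k t) \<le> 1 + (norm (k t))^2" using norm_ge_zero[of "k t"] by linarith
      then show "norm (?I t * norm (k t)) \<le> norm (?I t + ?I t * (norm (k t))^2)" by (auto simp: indicator_def)
    qed
  qed (use k in measurable)
  show "integrable lborel (\<lambda>t. ?I t *R k t)" if "?E \<noteq> \<infinity>"
  proof (rule Bochner_Integration.integrable_bound[OF n[OF that]])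
    show "(\<lambda>t. ?I t *R k t) \<in> borel_measurable lborel" using k by measurable
  qed simp
  show "ennreal ((norm (LINT t|lborel. ?I t *R k t))^2) \<le> ennreal (b - a) * ?E"
  proof (cases "?E = \<infinity>")
    case True
    then show ?thesis using ab by (simp add: ennreal_mult_top)
  next
    case False
    note s = s[OF False] and n = n[OF False]
    define m where "m = (LINT t|lborel. ?I t * norm (k t)) / \<tau>"
    have mI: "(LINT t|lborel. ?I t) = \<tau>" using ab by (simp add: \<tau>_def)
    have "0 \<le> (LINT t|lborel. ?I t * (norm (k t) - m)^2)" by (rule integral_nonneg_AE) simp
    also have "\<dots> = (LINT t|lborel. ?I t * (norm (k t))^2 - 2 * m * (?I t * norm (k t)) + m^2 * ?I t)"
      by (simp add: power2_diff algebra_simps)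
    also have "\<dots> = (LINT t|lborel. ?I t * (norm (k t))^2) - 2 * m * (LINT t|lborel. ?I t * norm (k t)) + m^2 * \<tau>" using s n I mI by simp
    also have "(LINT t|lborel. ?I t * norm (k t)) = m * \<tau>" using \<tau> by (simp add: m_def)
    finally have "m\<^sup>2 * \<tau> \<le> (LINT t|lborel. ?I t * (norm (k t))^2)" by (simp add: power2_eq_square algebra_simps)
    then have "\<tau> * (m^2 * \<tau>) \<le> \<tau> * (LINT t|lborel. ?I t * (norm (k t))^2)" using \<tau> by (intro mult_left_mono) auto
    then have q: "(m * \<tau>)^2 \<le> \<tau> * (LINT t|lborel. ?I t * (norm (k t))^2)" by (simp add: power2_eq_square mult_ac)
    have "norm (LINT t|lborel. ?I t *R k t) \<le> (LINT t|lborel. norm (?I t *R k t))" by (rule integral_norm_bound)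
    also have "\<dots> = m * \<tau>" using \<tau> by (simp add: m_def)
    finally have "(norm (LINT t|lborel. ?I t *R k t))^2 \<le> (m * \<tau>)^2" by (intro power_mono) auto
    with q have "ennreal ((norm (LINT t|lborel. ?I t *R k t))^2) \<le> ennreal (\<tau> * (LINT t|lborel. ?I t * (norm (k t))^2))"
      by (intro ennreal_leI) linarith
    also have "\<dots> = ennreal \<tau> * (\<integral>\<^sup>+t. ennreal (?I t * (norm (k t))^2) \<partial>lborel)"
      using \<tau> by (subst nn_integral_eq_integral[OF s]) (auto simp: ennreal_mult)
    finally show ?thesis unfolding e \<tau>_def .
  qed
qed

text \<open>Integrating the derivative of (t - tau) w along a vertical segment of length tau leaves
  tau times the value of w at its foot. The map h takes the place of the corresponding integrand of
  the limit, so the error of the trace is bounded by the error of the integrands.\<close>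

lemma trace_pointwise:
  fixes w :: "real^2 => real^'n"
  assumes w: "C1_on w UNIV" and h: "h \<in> borel_measurable borel" and \<tau>: "0 < \<tau>"
  shows "ennreal ((norm (w (V2 \<theta> m) - (1 / \<tau>) *R (LINT t|lborel. indicator {0<..<\<tau>} t *R h (V2 \<theta> (m + \<sigma> * t)))))^2)
    \<le> ennreal (1 / \<tau>) * (\<integral>\<^sup>+t\<in>{0<..<\<tau>}. ennreal ((norm (w (V2 \<theta> (m + \<sigma> * t))
         - (\<sigma> * (\<tau> - t)) *R pd w 2 (V2 \<theta> (m + \<sigma> * t)) - h (V2 \<theta> (m + \<sigma> * t))))^2) \<partial>lborel)"
proof -
  let ?I = "indicator {0<..<\<tau>} :: real => real"
  define y where "y t = V2 \<theta> (m + \<sigma> * t)" for t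
  define k where "k t = w (y t) - (\<sigma> * (\<tau> - t)) *R pd w 2 (y t)" for t
  have yc: "continuous_on A y" for A
    unfolding y_def[abs_def] by (intro continuous_on_compose2[OF V2_cont(1)[of UNIV]] continuous_intros) auto
  have kc: "continuous_on A k" for A unfolding k_def[abs_def] by (intro continuous_intros continuous_on_compose2[OF Ck1_continuous[OF w] yc]
        continuous_on_compose2[OF Ck1_deriv_continuous[OF w] yc]) auto
  have [measurable]: "k \<in> borel_measurable borel" "y \<in> borel_measurable borel" "h \<in> borel_measurable borel"
    using h by (auto intro: borel_measurable_continuous_onI kc yc)
  have d: "((\<lambda>t. (t - \<tau>) *R w (y t)) has_vector_derivative k t) (at t within A)" for t A
  proof -
    have "((w \<circ> V2 \<theta>) \<circ> (\<lambda>t. m + \<sigma> * t) has_vector_derivative \<sigma> *R pd w 2 (y t)) (at t)" unfolding y_def by (rule vector_diff_chain_at)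
        (use V2_derivative(1)[OF w, of \<theta> "m + \<sigma> * t" UNIV] in \<open>auto intro!: derivative_eq_intros simp: o_def\<close>)
    then have 1: "((\<lambda>t. w (y t)) has_vector_derivative \<sigma> *R pd w 2 (y t)) (at t within A)"
      unfolding o_def y_def by (rule has_vector_derivative_at_within)
    have "((\<lambda>t. t - \<tau>) has_field_derivative 1) (at t within A)" by (auto intro!: derivative_eq_intros)
    from has_vector_derivative_scaleR[OF this 1] show ?thesis by (simp add: k_def algebra_simps)
  qed
  have AEI: "AE t in lborel. indicator {0..\<tau>} t *R k t = ?I t *R k t"
    using AE_lborel_singleton[of 0] AE_lborel_singleton[of \<tau>] by eventually_elim (auto simp: indicator_def)
  have kI: "(LINT t|lborel. ?I t *R k t) = \<tau> *R w (V2 \<theta> m)"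
  proof -
    have "(LINT t|lborel. ?I t *R k t) = (LINT t|lborel. indicator {0..\<tau>} t *R k t)"
      by (rule integral_cong_AE) (use AEI in \<open>auto elim: eventually_mono\<close>)
    also have "\<dots> = (\<tau> - \<tau>) *R w (y \<tau>) - (0 - \<tau>) *R w (y 0)" using \<tau> by (intro integral_FTC_atLeastAtMost d kc) auto
    finally show ?thesis by (simp add: y_def)
  qed
  have ki: "integrable lborel (\<lambda>t. ?I t *R k t)"
  proof -
    have "integrable lborel (\<lambda>t. indicator {0..\<tau>} t *R k t)" by (intro borel_integrable_compact kc) auto
    then show ?thesis by (rule integrable_cong_AE_imp) (use AEI in auto)
  qed
  define E where "E = (\<integral>\<^sup>+t\<in>{0<..<\<tau>}. ennreal ((norm (k t - h (y t)))^2) \<partial>lborel)"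
  have "ennreal ((norm (w (V2 \<theta> m) - (1 / \<tau>) *R (LINT t|lborel. ?I t *R h (y t))))^2) \<le> ennreal (1 / \<tau>) * E"
  proof (cases "E = \<infinity>")
    case True
    then show ?thesis using \<tau> by (simp add: ennreal_mult_top)
  next
    case False
    have i: "integrable lborel (\<lambda>t. ?I t *R (k t - h (y t)))" by (rule square_integral_le(2)[OF _ \<tau>]) (use False in \<open>simp_all add: E_def\<close>)
    have "integrable lborel (\<lambda>t. ?I t *R k t - ?I t *R (k t - h (y t)))" by (rule Bochner_Integration.integrable_diff[OF ki i])
    then have hi: "integrable lborel (\<lambda>t. ?I t *R h (y t))" by (simp add: scaleR_diff_right)
    have "(LINT t|lborel. ?I t *R (k t - h (y t))) = \<tau> *R w (V2 \<theta> m) - (LINT t|lborel. ?I t *R h (y t))"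
      unfolding scaleR_diff_right kI[symmetric] by (rule Bochner_Integration.integral_diff[OF ki hi])
    then have "w (V2 \<theta> m) - (1 / \<tau>) *R (LINT t|lborel. ?I t *R h (y t)) = (1 / \<tau>) *R (LINT t|lborel. ?I t *R (k t - h (y t)))"
      using \<tau> by (simp add: scaleR_diff_right)
    then have "ennreal ((norm (w (V2 \<theta> m) - (1 / \<tau>) *R (LINT t|lborel. ?I t *R h (y t))))^2)
      = ennreal ((1 / \<tau>)^2) * ennreal ((norm (LINT t|lborel. ?I t *R (k t - h (y t))))^2)"
      using \<tau> by (simp add: power_mult_distrib ennreal_mult power_divide divide_inverse)
    also have "\<dots> \<le> ennreal ((1 / \<tau>)^2) * (ennreal (\<tau> - 0) * E)"
      unfolding E_def by (intro mult_left_mono square_integral_le(1)) (use \<tau> in auto)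
    also have "\<dots> = ennreal (1 / \<tau>) * E" using \<tau> by (simp add: mult.assoc[symmetric] ennreal_mult[symmetric] power2_eq_square)
    finally show ?thesis .
  qed
  then show ?thesis by (simp add: E_def k_def y_def)
qed

lemma ennreal_squeeze_zero:
  assumes "\<And>n. a n \<le> (b n :: ennreal)" "b \<longlonglongrightarrow> 0"
  shows "a \<longlonglongrightarrow> 0" by (rule tendsto_sandwich[OF _ _ tendsto_const assms(2)]) (simp_all add: assms(1))

text \<open>A one-sided collar of height tau along the line at height m, over one period: above the
  line for sigma = 1, below it for sigma = -1.\<close>

definition tcell :: "real => real => real => (real^2) set" where
  "tcell m \<sigma> \<tau> = {x. 0 < x $ 1 \<and> x $ 1 < 2 * pi \<and> 0 < \<sigma> * (x $ 2 - m) \<and> \<sigma> * (x $ 2 - m) < \<tau>}"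

lemma open_tcell: "open (tcell m \<sigma> \<tau>)" unfolding tcell_def by (intro open_Collect_conj open_Collect_less continuous_intros)

lemma norm_diff_sq_le: "(norm (a - b))^2 \<le> 2 * (norm a)^2 + 2 * (norm (b :: 'a::real_normed_vector))^2"
proof -
  have "(norm (a - b))^2 \<le> (norm a + norm b)^2" by (intro power_mono norm_triangle_ineq4) auto
  also have "\<dots> \<le> 2 * (norm a)^2 + 2 * (norm b)^2" using sum_squares_bound[of "norm a" "norm b"] by (simp add: power2_sum)
  finally show ?thesis .
qed

text \<open>The trace is read off from the identity
  \<open>\<tau> w(\<theta>, m) = \<integral>\<^sub>0\<^sup>\<tau> w - \<sigma> (\<tau> - t) \<partial>\<^sub>2 w\<close>, the integrand taken at \<open>(\<theta>, m + \<sigma> t)\<close>.\<close>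

lemma strip_trace:
  fixes f :: "real^2 => real^'n"
  assumes \<tau>: "0 < \<tau>" and \<sigma>: "\<sigma> = 1 \<or> \<sigma> = -1"
    and f: "(\<lambda>x. indicator (tcell m \<sigma> \<tau>) x *R f x) \<in> borel_lebesgue"
      "(\<lambda>x. indicator (tcell m \<sigma> \<tau>) x *R Df x) \<in> borel_lebesgue"
  shows "\<exists>g\<in>borel_measurable borel. \<forall>w. (\<forall>n. C1_on (w n) UNIV) --> W12_approx (tcell m \<sigma> \<tau>) w f Df -->
    (\<lambda>n. \<integral>\<^sup>+\<theta>\<in>{0..2*pi}. ennreal ((norm (w n (V2 \<theta> m) - g \<theta>))^2) \<partial>lebesgue) \<longlonglongrightarrow> 0"
proof -
  let ?S = "tcell m \<sigma> \<tau>"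
  have oS[measurable]: "?S \<in> sets borel" using open_tcell by simp
  \<comment> \<open>The weight sigma (tau - t) of the identity, written as a function of the point;
    it is bounded by tau on the collar.\<close>
  define c where "c x = \<sigma> * (\<tau> - \<sigma> * (x $ 2 - m))" for x :: "real^2"
  have cc: "continuous_on A c" for A unfolding c_def[abs_def] by (intro continuous_intros)
  define h where "h x = indicator ?S x *R f x - c x *R column 2 (indicator ?S x *R Df x)" for x
  have cm: "c \<in> borel_lebesgue" by (rule continuous_lebesgue_measurable[OF cc])
  have colm: "(\<lambda>x. column 2 (indicator ?S x *R Df x)) \<in> borel_lebesgue" by (rule measurable_compose[OF f(2)])
       (intro borel_measurable_continuous_onI linear_continuous_on column_blinear)
  have "h \<in> borel_lebesgue" unfolding h_def[abs_def] by (intro borel_measurable_diff borel_measurable_scaleR f(1) cm colm)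
  then obtain h' where h'[measurable]: "h' \<in> borel_measurable borel" and hh: "AE x in lebesgue. h x = h' x" by (rule lebesgue_borel_version)
  \<comment> \<open>The candidate is computed from f and Df alone, which is why one g serves every
    approximating sequence.\<close>
  define g where "g \<theta> = (1 / \<tau>) *R (LINT t|lborel. indicator {0<..<\<tau>} t *R h' (V2 \<theta> (m + \<sigma> * t)))" for \<theta>
  have V2m[measurable]: "(\<lambda>p. V2 (fst p) (m + \<sigma> * snd p)) \<in> borel_measurable (borel \<Otimes>\<^sub>M lborel)"
  proof -
    have "(\<lambda>p. V2 (fst p) (m + \<sigma> * snd p)) = (\<lambda>p. fst p *R axis 1 1 + (m + \<sigma> * snd p) *R axis 2 1)"
      using one_neq_two by (auto simp: fun_eq_iff vec_eq_iff forall_2 axis_def)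
    then show ?thesis by simp
  qed
  have gm: "g \<in> borel_measurable borel"
  proof -
    have "(\<lambda>\<theta>. LINT t|lborel. indicator {0<..<\<tau>} t *R h' (V2 \<theta> (m + \<sigma> * t))) \<in> borel_measurable borel"
      by (rule lborel.borel_measurable_lebesgue_integral) (simp add: case_prod_unfold)
    then show ?thesis unfolding g_def[abs_def] by simp
  qed
  have main: "(\<integral>\<^sup>+\<theta>\<in>{0..2*pi}. ennreal ((norm (w (V2 \<theta> m) - g \<theta>))^2) \<partial>lebesgue)
    \<le> ennreal ((1 / \<tau>) * (2 + 2 * \<tau>^2)) * (W12_err ?S w f Df)"
    if w: "C1_on w UNIV" for w
  proof -
    define q where "q x = ennreal ((norm (w x - c x *R pd w 2 x - h' x))^2)" for x
    have [measurable]: "w \<in> borel_measurable borel" "(\<lambda>x. pd w 2 x) \<in> borel_measurable borel" "c \<in> borel_measurable borel"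
      by (intro borel_measurable_continuous_onI Ck1_continuous w Ck1_deriv_continuous cc)+
    have qm[measurable]: "q \<in> borel_measurable borel" unfolding q_def[abs_def] by measurable
    have s2: "\<sigma> * \<sigma> = 1" using \<sigma> by auto
    have "(\<integral>\<^sup>+\<theta>\<in>{0..2*pi}. ennreal ((norm (w (V2 \<theta> m) - g \<theta>))^2) \<partial>lebesgue)
      = (\<integral>\<^sup>+\<theta>\<in>{0..2*pi}. ennreal ((norm (w (V2 \<theta> m) - g \<theta>))^2) \<partial>lborel)" by (rule nn_integral_completion)
    also have "\<dots> \<le> (\<integral>\<^sup>+\<theta>. ennreal (1 / \<tau>) * (\<integral>\<^sup>+t. q (V2 \<theta> t) * indicator ?S (V2 \<theta> t) \<partial>lborel) \<partial>lborel)"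
    proof (rule nn_integral_mono_AE)
      \<comment> \<open>The trace is integrated over a closed period but the collar lies over the
        open one.\<close>
      have "AE \<theta> in lborel. \<theta> \<noteq> 0 \<and> \<theta> \<noteq> 2 * pi" using AE_lborel_singleton[of 0] AE_lborel_singleton[of "2*pi"] by auto
      then show "AE \<theta> in lborel. ennreal ((norm (w (V2 \<theta> m) - g \<theta>))^2) * indicator {0..2*pi} \<theta>
        \<le> ennreal (1 / \<tau>) * (\<integral>\<^sup>+t. q (V2 \<theta> t) * indicator ?S (V2 \<theta> t) \<partial>lborel)"
      proof (rule eventually_mono)
        fix \<theta> :: real assume \<theta>: "\<theta> \<noteq> 0 \<and> \<theta> \<noteq> 2 * pi"
        show "ennreal ((norm (w (V2 \<theta> m) - g \<theta>))^2) * indicator {0..2*pi} \<theta>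
          \<le> ennreal (1 / \<tau>) * (\<integral>\<^sup>+t. q (V2 \<theta> t) * indicator ?S (V2 \<theta> t) \<partial>lborel)"
        proof (cases "\<theta> \<in> {0..2*pi}")
          case True
          have [measurable]: "(\<lambda>t. V2 \<theta> t) \<in> borel_measurable borel" by (intro borel_measurable_continuous_onI V2_cont)
          have "(\<integral>\<^sup>+t. q (V2 \<theta> t) * indicator ?S (V2 \<theta> t) \<partial>lborel)
            = ennreal \<bar>\<sigma>\<bar> * (\<integral>\<^sup>+t. q (V2 \<theta> (m + \<sigma> * t)) * indicator ?S (V2 \<theta> (m + \<sigma> * t)) \<partial>lborel)"
            by (rule nn_integral_real_affine) (use \<sigma> in auto)
          also have "\<dots> = (\<integral>\<^sup>+t\<in>{0<..<\<tau>}. q (V2 \<theta> (m + \<sigma> * t)) \<partial>lborel)"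
            using \<sigma> True \<theta> by (auto simp: tcell_def indicator_def intro!: nn_integral_cong)
          finally have e: "(\<integral>\<^sup>+t. q (V2 \<theta> t) * indicator ?S (V2 \<theta> t) \<partial>lborel) = (\<integral>\<^sup>+t\<in>{0<..<\<tau>}. q (V2 \<theta> (m + \<sigma> * t)) \<partial>lborel)" .
          have "c (V2 \<theta> (m + \<sigma> * t)) = \<sigma> * (\<tau> - t)" for t using \<sigma> by (auto simp: c_def)
          then show ?thesis using trace_pointwise[OF w h' \<tau>, of \<theta> m \<sigma>] True unfolding e unfolding q_def g_def by simp
        qed simp
      qed
    qed
    also have "\<dots> = ennreal (1 / \<tau>) * (\<integral>\<^sup>+x. q x * indicator ?S x \<partial>lborel)"
    proof -
      have [measurable]: "(\<lambda>p. V2 (fst p) (snd p)) \<in> borel_measurable (lborel \<Otimes>\<^sub>M lborel)"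
        using V2_measurable by (simp add: case_prod_unfold)
      have "(\<lambda>\<theta>. \<integral>\<^sup>+t. q (V2 \<theta> t) * indicator ?S (V2 \<theta> t) \<partial>lborel) \<in> borel_measurable lborel"
        by (rule lborel.borel_measurable_nn_integral) (simp add: case_prod_unfold)
      then show ?thesis by (subst nn_integral_V2) (simp_all add: nn_integral_cmult)
    qed
    also have "(\<integral>\<^sup>+x. q x * indicator ?S x \<partial>lborel) = (\<integral>\<^sup>+x. q x * indicator ?S x \<partial>lebesgue)" by (rule nn_integral_completion[symmetric])
    also have "\<dots> \<le> (\<integral>\<^sup>+x. ennreal (2 + 2 * \<tau>^2) * (ennreal ((norm (w x - f x))^2 + (norm (jacobian w (at x) - Df x))^2) * indicator ?S x) \<partial>lebesgue)"
    proof (rule nn_integral_mono_AE, rule eventually_mono[OF hh])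
      fix x assume hx: "h x = h' x"
      show "q x * indicator ?S x \<le> ennreal (2 + 2 * \<tau>^2) * (ennreal ((norm (w x - f x))^2 + (norm (jacobian w (at x) - Df x))^2) * indicator ?S x)"
      proof (cases "x \<in> ?S")
        case True
        have cb: "(c x)^2 \<le> \<tau>^2"
        proof -
          have "\<bar>c x\<bar> \<le> \<bar>\<tau>\<bar>" using True \<sigma> by (auto simp: c_def tcell_def)
          then show ?thesis by (simp add: abs_le_square_iff)
        qed
        let ?a = "w x - f x" and ?b = "column 2 (jacobian w (at x) - Df x)"
        have cd: "column 2 (A - B) = column 2 A - column 2 B" for A B :: "real^2^'n" by (simp add: column_def vec_eq_iff)
        have "w x - c x *R pd w 2 x - h' x = ?a - c x *R ?b"
          using True unfolding hx[symmetric] h_def cd column_jacobian by (simp add: algebra_simps)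
        then have "(norm (w x - c x *R pd w 2 x - h' x))^2 \<le> 2 * (norm ?a)^2 + 2 * (norm (c x *R ?b))^2" using norm_diff_sq_le by metis
        also have "\<dots> \<le> 2 * (norm ?a)^2 + 2 * (\<tau>^2 * (norm (jacobian w (at x) - Df x))^2)"
          using cb by (auto simp: power_mult_distrib intro!: mult_mono power_mono norm_column_le)
        also have "\<dots> \<le> (2 + 2 * \<tau>^2) * ((norm ?a)^2 + (norm (jacobian w (at x) - Df x))^2)" by (simp add: algebra_simps)
        finally show ?thesis using True ennreal_leI by (simp add: q_def ennreal_mult'[symmetric] del: ennreal_plus)
      qed simp
    qed
    also have "\<dots> \<le> ennreal (2 + 2 * \<tau>^2) * (W12_err ?S w f Df)"
    proof -
      have e: "ennreal ((norm (w x - f x))^2 + (norm (jacobian w (at x) - Df x))^2) * indicator ?S x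
        = ennreal ((norm (indicator ?S x *R w x - indicator ?S x *R f x))^2 + (norm (indicator ?S x *R jacobian w (at x) - indicator ?S x *R Df x))^2)" for x
        by (auto simp: indicator_def)
      have [measurable]: "w \<in> borel_lebesgue" "(\<lambda>x. jacobian w (at x)) \<in> borel_lebesgue"
        by (intro continuous_lebesgue_measurable Ck1_continuous w jacobian_continuous)+
      have [measurable]: "?S \<in> sets lebesgue" using oS by simp
      note [measurable] = f
      show ?thesis unfolding e by (subst nn_integral_cmult) simp_all
    qed
    finally have "(\<integral>\<^sup>+\<theta>\<in>{0..2*pi}. ennreal ((norm (w (V2 \<theta> m) - g \<theta>))^2) \<partial>lebesgue)
      \<le> ennreal (1 / \<tau>) * (ennreal (2 + 2 * \<tau>^2) * (W12_err ?S w f Df))"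
      by (simp only: mult_left_mono zero_le)
    moreover have "ennreal ((1 / \<tau>) * (2 + 2 * \<tau>^2)) = ennreal (1 / \<tau>) * ennreal (2 + 2 * \<tau>^2)" by (rule ennreal_mult) (use \<tau> in auto)
    ultimately show ?thesis by (simp only: mult.assoc)
  qed
  show ?thesis
  proof (intro bexI[OF _ gm] allI impI)
    fix w :: "nat => real^2 => real^'n" assume w: "\<forall>n. C1_on (w n) UNIV" and a: "W12_approx ?S w f Df"
    have "(\<lambda>n. ennreal ((1 / \<tau>) * (2 + 2 * \<tau>^2)) * (W12_err ?S (w n) f Df))
      \<longlonglongrightarrow> ennreal ((1 / \<tau>) * (2 + 2 * \<tau>^2)) * 0" by (intro ennreal_tendsto_cmult a[unfolded W12_approx_norm]) simp
    then have l: "(\<lambda>n. ennreal ((1 / \<tau>) * (2 + 2 * \<tau>^2)) * (W12_err ?S (w n) f Df)) \<longlonglongrightarrow> 0"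
      by (simp only: mult_zero_right)
    show "(\<lambda>n. \<integral>\<^sup>+\<theta>\<in>{0..2*pi}. ennreal ((norm (w n (V2 \<theta> m) - g \<theta>))^2) \<partial>lebesgue) \<longlonglongrightarrow> 0"
      by (rule ennreal_squeeze_zero[OF main l]) (rule spec[OF w])
  qed
qed

text \<open>Both arguments are sequences, so the relation is symmetric and, for measurable maps,
  transitive; a limit is a constant sequence.\<close>

definition L2conv :: "(nat => real => real^'n) => (nat => real => real^'n) => bool" where
  "L2conv p q \<longleftrightarrow> (\<lambda>n. \<integral>\<^sup>+\<theta>\<in>{0..2*pi}. ennreal ((norm (p n \<theta> - q n \<theta>))^2) \<partial>lebesgue) \<longlonglongrightarrow> 0"

lemma L2conv_sym: "L2conv p q ==> L2conv q p" by (simp add: L2conv_def norm_minus_commute)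

lemma nn_integral_two:
  assumes "A \<in> borel_measurable M" "B \<in> borel_measurable M"
  shows "(\<integral>\<^sup>+x. 2 * A x + 2 * B x \<partial>M) = 2 * (\<integral>\<^sup>+x. A x \<partial>M) + 2 * (\<integral>\<^sup>+x. B x \<partial>M)"
  using assms by (simp add: nn_integral_add nn_integral_cmult)

lemma L2conv_trans:
  assumes m: "\<And>n. p n \<in> borel_lebesgue" "\<And>n. q n \<in> borel_lebesgue" "\<And>n. r n \<in> borel_lebesgue"
    and pq: "L2conv p q" "L2conv q r"
  shows "L2conv p r"
proof -
  note [measurable] = m
  have I[measurable]: "{0..2*pi} \<in> sets lebesgue" by simp
  have ms[measurable]: "(\<lambda>\<theta>. ennreal ((norm (a \<theta> - b \<theta>))^2) * indicator {0..2*pi} \<theta>) \<in> borel_lebesgue"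
    if [measurable]: "a \<in> borel_lebesgue" "b \<in> borel_lebesgue" for a b :: "real => real^'n" by measurable
  let ?e = "\<lambda>p q n. \<integral>\<^sup>+\<theta>\<in>{0..2*pi}. ennreal ((norm (p n \<theta> - q n \<theta>))^2) \<partial>lebesgue"
  have "?e p r n \<le> 2 * ?e p q n + 2 * ?e q r n" for n
  proof -
    have "?e p r n \<le> (\<integral>\<^sup>+\<theta>. 2 * (ennreal ((norm (p n \<theta> - q n \<theta>))^2) * indicator {0..2*pi} \<theta>) + 2 * (ennreal ((norm (q n \<theta> - r n \<theta>))^2) * indicator {0..2*pi} \<theta>) \<partial>lebesgue)"
    proof (intro nn_integral_mono)
      fix \<theta>
      have "(norm (p n \<theta> - r n \<theta>))^2 \<le> 2 * (norm (p n \<theta> - q n \<theta>))^2 + 2 * (norm (q n \<theta> - r n \<theta>))^2"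
        using norm_diff_sq_le[of "p n \<theta> - q n \<theta>" "r n \<theta> - q n \<theta>"] by (simp add: norm_minus_commute)
      then have "ennreal ((norm (p n \<theta> - r n \<theta>))^2) \<le> ennreal (2 * (norm (p n \<theta> - q n \<theta>))^2 + 2 * (norm (q n \<theta> - r n \<theta>))^2)" by (rule ennreal_leI)
      also have "\<dots> = 2 * ennreal ((norm (p n \<theta> - q n \<theta>))^2) + 2 * ennreal ((norm (q n \<theta> - r n \<theta>))^2)"
        by (subst ennreal_plus) (simp_all add: ennreal_mult)
      finally show "ennreal ((norm (p n \<theta> - r n \<theta>))^2) * indicator {0..2*pi} \<theta>
        \<le> 2 * (ennreal ((norm (p n \<theta> - q n \<theta>))^2) * indicator {0..2*pi} \<theta>) + 2 * (ennreal ((norm (q n \<theta> - r n \<theta>))^2) * indicator {0..2*pi} \<theta>)"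
        by (auto simp: indicator_def)
    qed
    also have "\<dots> = 2 * ?e p q n + 2 * ?e q r n" by (rule nn_integral_two[OF ms[OF m(1,2)] ms[OF m(2,3)]])
    finally show ?thesis .
  qed
  moreover have "(\<lambda>n. 2 * ?e p q n + 2 * ?e q r n) \<longlonglongrightarrow> 2 * 0 + 2 * 0"
    using pq unfolding L2conv_def by (intro tendsto_add ennreal_tendsto_cmult) auto
  then have "(\<lambda>n. 2 * ?e p q n + 2 * ?e q r n) \<longlonglongrightarrow> 0" by simp
  ultimately show ?thesis unfolding L2conv_def by (rule ennreal_squeeze_zero)
qed

text \<open>Every approximating sequence converges on the line to the map supplied by
  \<open>strip_trace\<close>, so a trace witnessed by one sequence is witnessed by all
  others.\<close>

lemma strip_trace_unique:
  fixes f :: "real^2 => real^'n"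
  assumes \<tau>: "0 < \<tau>" and \<sigma>: "\<sigma> = 1 \<or> \<sigma> = -1"
    and f: "(\<lambda>x. indicator (tcell m \<sigma> \<tau>) x *R f x) \<in> borel_lebesgue"
      "(\<lambda>x. indicator (tcell m \<sigma> \<tau>) x *R Df x) \<in> borel_lebesgue"
    and v: "\<And>n. C1_on (v n) UNIV" "W12_approx (tcell m \<sigma> \<tau>) v f Df"
    and w: "\<And>n. C1_on (w n) UNIV" "W12_approx (tcell m \<sigma> \<tau>) w f Df"
    and G: "G \<in> borel_lebesgue" "L2conv (\<lambda>n \<theta>. v n (V2 \<theta> m)) (\<lambda>n. G)"
  shows "L2conv (\<lambda>n \<theta>. w n (V2 \<theta> m)) (\<lambda>n. G)"
proof -
  obtain g where g: "g \<in> borel_measurable borel"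
    "\<forall>w. (\<forall>n. C1_on (w n) UNIV) --> W12_approx (tcell m \<sigma> \<tau>) w f Df --> L2conv (\<lambda>n \<theta>. w n (V2 \<theta> m)) (\<lambda>n. g)"
    using strip_trace[OF \<tau> \<sigma> f] unfolding L2conv_def by blast
  have c: "L2conv (\<lambda>n \<theta>. w n (V2 \<theta> m)) (\<lambda>n. g)" "L2conv (\<lambda>n \<theta>. v n (V2 \<theta> m)) (\<lambda>n. g)" using g(2) v w by auto
  have m: "(\<lambda>\<theta>. F (V2 \<theta> m)) \<in> borel_lebesgue" if "C1_on F UNIV" for F :: "real^2 => real^'n"
    by (intro continuous_lebesgue_measurable continuous_on_compose2[OF Ck1_continuous[OF that] V2_cont(2)]) auto
  have gm: "g \<in> borel_lebesgue" by (rule measurable_completion) (use g(1) in simp)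
  have "L2conv (\<lambda>n. g) (\<lambda>n. G)" by (rule L2conv_trans[OF gm m[OF v(1)] G(1) L2conv_sym[OF c(2)] G(2)])
  then show ?thesis by (rule L2conv_trans[OF m[OF w(1)] gm G(1) c(1)])
qed

section \<open>Periodicity and gluing along a line\<close>

lemma int_period:
  assumes "\<And>x. h (x + d) = h (x :: 'a::real_vector)"
  shows "h (x + of_int k *R d) = h x"
proof (induction k rule: int_induct[of _ 0])
  case (step1 i)
  then show ?case using assms[of "x + of_int i *R d"] by (simp add: algebra_simps)
next
  case (step2 i)
  then show ?case using assms[of "x + of_int (i - 1) *R d"] by (simp add: algebra_simps)
qed simp

text \<open>B is covered by finitely many translates of S by multiples of the period, and each of
  them carries the same integral.\<close>

lemma nn_periodic:
  fixes h :: "'a::euclidean_space => ennreal"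
  assumes h[measurable]: "h \<in> borel_lebesgue" and p: "\<And>x. h (x + d) = h x" and S: "S \<in> sets lebesgue"
    and I: "finite I" "B \<subseteq> (\<Union>k\<in>I. {x. x + of_int k *R d \<in> S})"
  shows "(\<integral>\<^sup>+x\<in>B. h x \<partial>lebesgue) \<le> of_nat (card I) * (\<integral>\<^sup>+x\<in>S. h x \<partial>lebesgue)"
proof -
  have m: "(\<lambda>x. h x * indicator S x) \<in> borel_lebesgue" using S by measurable
  have "(\<integral>\<^sup>+x\<in>B. h x \<partial>lebesgue) \<le> (\<integral>\<^sup>+x. (\<Sum>k\<in>I. h (1 *R x + of_int k *R d) * indicator S (1 *R x + of_int k *R d)) \<partial>lebesgue)"
  proof (intro nn_integral_mono)
    fix x
    show "h x * indicator B x \<le> (\<Sum>k\<in>I. h (1 *R x + of_int k *R d) * indicator S (1 *R x + of_int k *R d))"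
    proof (cases "x \<in> B")
      case True
      then obtain k where k: "k \<in> I" "x + of_int k *R d \<in> S" using I(2) by auto
      have "h x * indicator B x = h (1 *R x + of_int k *R d) * indicator S (1 *R x + of_int k *R d)"
        using True k int_period[of h d x k] p by simp
      also have "\<dots> \<le> (\<Sum>k\<in>I. h (1 *R x + of_int k *R d) * indicator S (1 *R x + of_int k *R d))" by (rule member_le_sum[OF k(1) _ I(1)]) simp
      finally show ?thesis .
    qed simp
  qed
  also have "\<dots> = (\<Sum>k\<in>I. \<integral>\<^sup>+x. h (1 *R x + of_int k *R d) * indicator S (1 *R x + of_int k *R d) \<partial>lebesgue)"
    by (rule nn_integral_sum, rule measurable_compose[OF lebesgue_affine_measurable' m]) simp
  also have "\<dots> = (\<Sum>k\<in>I. \<integral>\<^sup>+x\<in>S. h x \<partial>lebesgue)" by (intro sum.cong refl nn_integral_affine m) simp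
  finally show ?thesis by simp
qed

text \<open>One member of the sequence is at finite L2 distance from f and bounded on the bounded
  set E; that already makes f square integrable.\<close>

lemma L2_limit_integrable:
  fixes f :: "real^2 => 'b::euclidean_space"
  assumes E: "E \<in> sets lebesgue" "E \<subseteq> cball 0 R" and f: "(\<lambda>x. indicator E x *R f x) \<in> borel_lebesgue"
    and w: "\<And>n. continuous_on UNIV (w n)" "(\<lambda>n. \<integral>\<^sup>+x\<in>E. ennreal ((norm (w n x - f x))^2) \<partial>lebesgue) \<longlonglongrightarrow> 0"
  shows "lset_int E f" "lset_int E (\<lambda>x. (norm (f x))^2)"
proof -
  note [measurable] = E(1) f
  have El: "E \<in> lmeasurable" by (rule bounded_set_imp_lmeasurable[OF bounded_subset[OF bounded_cball E(2)] E(1)])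
  have "\<forall>\<^sub>F n in sequentially. (\<integral>\<^sup>+x\<in>E. ennreal ((norm (w n x - f x))^2) \<partial>lebesgue) < 1" by (rule order_tendstoD(2)[OF w(2)]) simp
  then obtain n where n: "(\<integral>\<^sup>+x\<in>E. ennreal ((norm (w n x - f x))^2) \<partial>lebesgue) < 1" using eventually_happens'[OF sequentially_bot] by blast
  have "bounded (w n ` cball 0 R)" by (intro compact_imp_bounded compact_continuous_image continuous_on_subset[OF w(1)]) auto
  then obtain M where M: "M > 0" "\<And>x. x \<in> E ==> norm (w n x) \<le> M" using E(2) by (auto simp: bounded_pos)
  have wm[measurable]: "w n \<in> borel_lebesgue" by (rule continuous_lebesgue_measurable[OF w(1)])
  have e: "(\<lambda>x. ennreal ((norm (w n x - f x))^2) * indicator E x) = (\<lambda>x. ennreal ((norm (indicator E x *R w n x - indicator E x *R f x))^2) * indicator E x)"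
    by (auto simp: indicator_def)
  have m1: "(\<lambda>x. ennreal ((norm (w n x - f x))^2) * indicator E x) \<in> borel_lebesgue" unfolding e by measurable
  have m2: "(\<lambda>x. ennreal (M^2) * indicator E x) \<in> borel_lebesgue" by measurable
  have "(\<integral>\<^sup>+x. ennreal (norm ((norm (indicator E x *R f x))^2)) \<partial>lebesgue)
    \<le> (\<integral>\<^sup>+x. 2 * (ennreal ((norm (w n x - f x))^2) * indicator E x) + 2 * (ennreal (M^2) * indicator E x) \<partial>lebesgue)"
  proof (intro nn_integral_mono)
    fix x
    show "ennreal (norm ((norm (indicator E x *R f x))^2)) \<le> 2 * (ennreal ((norm (w n x - f x))^2) * indicator E x) + 2 * (ennreal (M^2) * indicator E x)"
    proof (cases "x \<in> E")
      case True
      have "(norm (f x))^2 \<le> 2 * (norm (w n x - f x))^2 + 2 * (norm (w n x))^2" using norm_diff_sq_le[of "w n x" "w n x - f x"] by simp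
      also have "\<dots> \<le> 2 * (norm (w n x - f x))^2 + 2 * M^2" using M(2)[OF True] by (simp add: power_mono)
      finally have "ennreal ((norm (f x))^2) \<le> ennreal (2 * (norm (w n x - f x))^2 + 2 * M^2)" by (rule ennreal_leI)
      also have "\<dots> = 2 * ennreal ((norm (w n x - f x))^2) + 2 * ennreal (M^2)" by (subst ennreal_plus) (simp_all add: ennreal_mult)
      finally show ?thesis using True by simp
    qed simp
  qed
  also have "\<dots> = 2 * (\<integral>\<^sup>+x\<in>E. ennreal ((norm (w n x - f x))^2) \<partial>lebesgue) + 2 * (\<integral>\<^sup>+x. ennreal (M^2) * indicator E x \<partial>lebesgue)"
    by (rule nn_integral_two[OF m1 m2])
  also have "\<dots> < \<infinity>"
  proof -
    have "(\<integral>\<^sup>+x. ennreal (M^2) * indicator E x \<partial>lebesgue) = ennreal (M^2) * emeasure lebesgue E" by (rule nn_integral_cmult_indicator) simp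
    also have "\<dots> < \<infinity>" using El by (simp add: fmeasurable_def ennreal_mult_less_top)
    finally show ?thesis using n by (auto simp: ennreal_mult_less_top intro: less_trans[of _ 1])
  qed
  finally have fin: "(\<integral>\<^sup>+x. ennreal (norm ((norm (indicator E x *R f x))^2)) \<partial>lebesgue) < \<infinity>" .
  have "(\<lambda>x. (norm (indicator E x *R f x))^2) \<in> borel_lebesgue"
    by (intro borel_measurable_power measurable_compose[OF f borel_measurable_norm])
  from integrableI_bounded[OF this fin] have "integrable lebesgue (\<lambda>x. (norm (indicator E x *R f x))^2)" .
  moreover have "(norm (indicator E x *R f x))^2 = indicator E x *R (norm (f x))^2" for x by (auto simp: indicator_def)
  ultimately show s: "lset_int E (\<lambda>x. (norm (f x))^2)" by (simp add: set_integrable_def)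
  show "lset_int E f" by (rule sq_integrable_imp_set_integrable[OF El f s])
qed

lemma loc_int_indicator:
  fixes f :: "real^2 => 'b::euclidean_space"
  assumes "loc_int U f" "H \<in> sets lebesgue"
  shows "loc_int U (\<lambda>x. indicator H x *R f x)" unfolding loc_int_def set_integrable_def
proof (intro allI impI)
  fix K assume "compact K" "K \<subseteq> U"
  then have "integrable lebesgue (\<lambda>x. indicator K x *R f x)" using assms(1) by (simp add: loc_int_def set_integrable_def)
  then have "integrable lebesgue (\<lambda>x. indicator H x *R (indicator K x *R f x))" by (rule integrable_mult_indicator[OF assms(2)])
  then show "integrable lebesgue (\<lambda>x. indicator K x *R indicator H x *R f x)" by (subst scaleR_left_commute)
qed

lemma frechet_derivative_scaleR:
  assumes "C1_on \<phi> UNIV" "C1_on F UNIV"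
  shows "frechet_derivative (\<lambda>x. \<phi> x *R F x) (at x) v = frechet_derivative \<phi> (at x) v *R F x + \<phi> x *R frechet_derivative F (at x) v"
proof -
  have "((\<lambda>x. \<phi> x *R F x) has_derivative (\<lambda>h. \<phi> x *R frechet_derivative F (at x) h + frechet_derivative \<phi> (at x) h *R F x)) (at x)"
    by (intro has_derivative_scaleR Ck1_has_derivative[OF assms(1)] Ck1_has_derivative[OF assms(2)]) auto
  from frechet_derivative_at[OF this, symmetric] show ?thesis by simp
qed

text \<open>Two W12 pieces with the same trace form a W12 map across the line. Equality of traces is
  expressed by the approximating maps: their jump tends to 0 in L2 on bounded segments. Integration
  by parts on the two half planes leaves exactly that jump, tested with phi.\<close>

lemma w12l_glue:
  fixes f :: "real^2 => real^'n"
  assumes U: "open U" and f: "(\<lambda>x. indicator U x *R f x) \<in> borel_lebesgue"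
      "(\<lambda>x. indicator U x *R Df x) \<in> borel_lebesgue"
    and v: "\<And>n. C1_on (v n) UNIV" "\<And>R. W12_approx (U \<inter> cball 0 R \<inter> {x. x $ 2 \<le> m}) v f Df"
    and w: "\<And>n. C1_on (w n) UNIV" "\<And>R. W12_approx (U \<inter> cball 0 R \<inter> {x. m < x $ 2}) w f Df"
    and jump: "\<And>R. (\<lambda>n. \<integral>\<^sup>+\<theta>\<in>{-R..R}. ennreal ((norm (w n (V2 \<theta> m) - v n (V2 \<theta> m)))^2) \<partial>lebesgue) \<longlonglongrightarrow> 0"
  shows "w12l U f Df"
proof -
  define H1 :: "(real^2) set" where "H1 = {x. x $ 2 \<le> m}"
  define H2 :: "(real^2) set" where "H2 = {x. m < x $ 2}"
  have "closed H1" "open H2" unfolding H1_def H2_def by (intro closed_Collect_le open_Collect_less continuous_intros)+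
  then have Hm: "H1 \<in> sets lebesgue" "H2 \<in> sets lebesgue" by auto
  have H12: "H1 \<union> H2 = UNIV" "H1 \<inter> H2 = {}" by (auto simp: H1_def H2_def)
  have Um: "U \<in> sets lebesgue" using U by simp
  have piece: "lset_int (U \<inter> cball 0 R \<inter> H) F \<and> lset_int (U \<inter> cball 0 R \<inter> H) (\<lambda>x. (norm (F x))^2)"
    if Hs: "H \<in> sets lebesgue" and F: "(\<lambda>x. indicator U x *R F x) \<in> borel_lebesgue" and c: "\<And>n. continuous_on UNIV (z n)"
      and l: "(\<lambda>n. \<integral>\<^sup>+x\<in>U \<inter> cball 0 R \<inter> H. ennreal ((norm (z n x - F x))^2) \<partial>lebesgue) \<longlonglongrightarrow> 0"
    for H R z and F :: "real^2 => 'b::euclidean_space"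
  proof -
    have E: "U \<inter> cball 0 R \<inter> H \<in> sets lebesgue" by (intro sets.Int Um Hs fmeasurableD lmeasurable_cball)
    have "(\<lambda>x. indicator (U \<inter> cball 0 R \<inter> H) x *R (indicator U x *R F x)) \<in> borel_lebesgue"
      by (intro borel_measurable_scaleR F borel_measurable_indicator E)
    moreover have "(\<lambda>x. indicator (U \<inter> cball 0 R \<inter> H) x *R (indicator U x *R F x)) = (\<lambda>x. indicator (U \<inter> cball 0 R \<inter> H) x *R F x)"
      by (auto simp: indicator_def)
    ultimately have m: "(\<lambda>x. indicator (U \<inter> cball 0 R \<inter> H) x *R F x) \<in> borel_lebesgue" by simp
    show ?thesis using L2_limit_integrable[OF E _ m c l, of R] by auto
  qed
  have li: "loc_int U F" if "\<And>R. lset_int (U \<inter> cball 0 R \<inter> H1) F" "\<And>R. lset_int (U \<inter> cball 0 R \<inter> H2) F"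
    for F :: "real^2 => 'b::euclidean_space" unfolding loc_int_def
  proof (intro allI impI)
    fix K assume K: "compact K" "K \<subseteq> U"
    obtain R where R: "R > 0" "K \<subseteq> cball 0 R" using compact_subset_cball[OF K(1)] by blast
    have Km: "K \<in> sets lebesgue" using K lmeasurable_compact fmeasurableD by blast
    have 1: "lset_int (K \<inter> H1) F" by (rule set_integrable_subset[OF that(1)[of R]]) (use Km Hm K R in auto)
    have 2: "lset_int (K \<inter> H2) F" by (rule set_integrable_subset[OF that(2)[of R]]) (use Km Hm K R in auto)
    have "lset_int (K \<inter> H1 \<union> K \<inter> H2) F" by (rule set_integrable_Un[OF 1 2]) (use Km Hm in auto)
    then show "lset_int K F" using H12(1) by (simp add: Int_Un_distrib[symmetric])
  qed
  have cj: "continuous_on UNIV (\<lambda>x. jacobian z (at x))" if "C1_on z UNIV" for z :: "real^2 => real^'n"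
    by (rule jacobian_continuous[OF that])
  have pf1: "lset_int (U \<inter> cball 0 R \<inter> H1) f \<and> lset_int (U \<inter> cball 0 R \<inter> H1) (\<lambda>x. (norm (f x))^2)"
    and pD1: "lset_int (U \<inter> cball 0 R \<inter> H1) Df \<and> lset_int (U \<inter> cball 0 R \<inter> H1) (\<lambda>x. (norm (Df x))^2)"
    and pf2: "lset_int (U \<inter> cball 0 R \<inter> H2) f \<and> lset_int (U \<inter> cball 0 R \<inter> H2) (\<lambda>x. (norm (f x))^2)"
    and pD2: "lset_int (U \<inter> cball 0 R \<inter> H2) Df \<and> lset_int (U \<inter> cball 0 R \<inter> H2) (\<lambda>x. (norm (Df x))^2)" for R
    by (rule piece[OF Hm(1) f(1) Ck1_continuous[OF v(1)] W12_approx_parts(1)[OF v(2)[of R], folded H1_def]]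
       piece[OF Hm(1) f(2) cj[OF v(1)] W12_approx_parts(2)[OF v(2)[of R], folded H1_def]]
       piece[OF Hm(2) f(1) Ck1_continuous[OF w(1)] W12_approx_parts(1)[OF w(2)[of R], folded H2_def]]
       piece[OF Hm(2) f(2) cj[OF w(1)] W12_approx_parts(2)[OF w(2)[of R], folded H2_def]])+
  have lf: "loc_int U f" "loc_int U (\<lambda>x. (norm (f x))^2)" using pf1 pf2 by (auto intro!: li)
  have lD: "loc_int U Df" "loc_int U (\<lambda>x. (norm (Df x))^2)" using pD1 pD2 by (auto intro!: li)
  have "has_weak_grad U f Df"
  proof (rule has_weak_gradI[OF lf(1) lD(1)])
    fix \<phi> j assume \<phi>: "tst U \<phi>"
    note \<phi>1 = tst_C1[OF \<phi>]
    obtain K where K: "compact K" "K \<subseteq> U" "\<And>x. x \<notin> K ==> \<phi> x = 0"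
      "\<And>x. x \<notin> K ==> frechet_derivative \<phi> (at x) = (\<lambda>v. 0)" using tst_supp[OF \<phi>] by blast
    obtain R where R: "R > 0" "K \<subseteq> cball 0 R" using compact_subset_cball[OF K(1)] by blast
    let ?B = "U \<inter> cball 0 R"
    have BU: "?B \<subseteq> U" by auto
    have KB: "K \<subseteq> ?B" using K R by auto
    have wl: "(\<lambda>n. LINT x|lebesgue. c x *R (indicator H x *R z n x)) \<longlonglongrightarrow> (LINT x|lebesgue. c x *R (indicator H x *R F x))"
      if c: "continuous_on UNIV c" "\<And>x. x \<notin> K ==> c x = 0" and Hs: "H \<in> sets lebesgue" and F: "loc_int U F" "\<And>n. continuous_on UNIV (z n)"
        and l: "(\<lambda>n. \<integral>\<^sup>+x\<in>?B \<inter> H. ennreal ((norm (z n x - F x))^2) \<partial>lebesgue) \<longlonglongrightarrow> 0"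
      for c H z and F :: "real^2 => real^'n"
    proof (rule weak_convergence[OF c(1) K(1) KB c(2)])
      show "loc_int ?B (\<lambda>x. indicator H x *R F x)" by (intro loc_int_indicator loc_int_subset[OF F(1) BU] Hs)
      have "loc_int ?B (z n)" for n
        unfolding loc_int_def by (intro allI impI continuous_compact_set_integrable continuous_on_subset[OF F(2)]) auto
      then show "loc_int ?B (\<lambda>x. indicator H x *R z n x)" for n by (rule loc_int_indicator[OF _ Hs])
      have "(\<integral>\<^sup>+x\<in>?B. ennreal ((norm (indicator H x *R z n x - indicator H x *R F x))^2) \<partial>lebesgue)
        = (\<integral>\<^sup>+x\<in>?B \<inter> H. ennreal ((norm (z n x - F x))^2) \<partial>lebesgue)" for n by (intro nn_integral_cong) (auto simp: indicator_def)
      then show "(\<lambda>n. \<integral>\<^sup>+x\<in>?B. ennreal ((norm (indicator H x *R z n x - indicator H x *R F x))^2) \<partial>lebesgue) \<longlonglongrightarrow> 0" using l by simp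
    qed
    \<comment> \<open>\<open>Q\<close> integrates a partial derivative of phi F over H, and
      \<open>P\<close> is its expansion by the product rule. The latter still makes sense for the
      limit f, to which only weak derivatives are available.\<close>
    define Q where "Q H F = (LINT x|lebesgue. indicator H x *R pd (\<lambda>x. \<phi> x *R F x) j x)" for H and F :: "real^2 => real^'n"
    define P where "P H F DF = (LINT x|lebesgue. pd \<phi> j x *R (indicator H x *R F x)) + (LINT x|lebesgue. \<phi> x *R (indicator H x *R column j (DF x)))"
      for H and F :: "real^2 => real^'n" and DF
    have Pi: "integrable lebesgue (\<lambda>x. pd \<phi> j x *R (indicator H x *R F x))" "integrable lebesgue (\<lambda>x. \<phi> x *R (indicator H x *R column j (DF x)))"
      if "H \<in> sets lebesgue" "loc_int U F" "loc_int U DF" for H and F :: "real^2 => real^'n" and DF :: "real^2 => real^2^'n"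
      by (rule tst_integrable(2)[OF \<phi> loc_int_indicator[OF that(2,1)]]
          tst_integrable(1)[OF \<phi> loc_int_indicator[OF loc_int_column[OF that(3)] that(1)]])+
    have lc: "loc_int U F" "loc_int U (\<lambda>x. jacobian F (at x))" if "C1_on F UNIV" for F :: "real^2 => real^'n"
      using Ck1_has_weak_grad[OF U Ck1_subset[OF that subset_UNIV]] by (auto dest: has_weak_gradD)
    have QP: "Q H F = P H F (\<lambda>x. jacobian F (at x))" if "H \<in> sets lebesgue" "C1_on F UNIV" for H F
    proof -
      have "P H F (\<lambda>x. jacobian F (at x)) = (LINT x|lebesgue. pd \<phi> j x *R (indicator H x *R F x) + \<phi> x *R (indicator H x *R column j (jacobian F (at x))))"
        unfolding P_def by (rule Bochner_Integration.integral_add[symmetric]) (rule Pi that lc)+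
      also have "\<dots> = Q H F" unfolding Q_def column_jacobian frechet_derivative_scaleR[OF \<phi>1 that(2)]
        by (simp add: scaleR_add_right mult.commute)
      finally show ?thesis by simp
    qed
    have lim: "(\<lambda>n. Q H (z n)) \<longlonglongrightarrow> P H f Df" if Hs: "H \<in> sets lebesgue" and z: "\<And>n. C1_on (z n) UNIV" and a: "W12_approx (?B \<inter> H) z f Df" for H z
      unfolding QP[OF Hs z] unfolding P_def
    proof (intro tendsto_add wl Hs lf loc_int_column lD W12_approx_parts(1)[OF a] Ck1_continuous[OF z] Ck1_deriv_continuous[OF \<phi>1] Ck1_continuous[OF \<phi>1] K(3))
      show "continuous_on UNIV (\<lambda>x. column j (jacobian (z n) (at x)))" for n unfolding column_jacobian by (rule Ck1_deriv_continuous[OF z])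
      show "(\<lambda>n. \<integral>\<^sup>+x\<in>?B \<inter> H. ennreal ((norm (column j (jacobian (z n) (at x)) - column j (Df x)))^2) \<partial>lebesgue) \<longlonglongrightarrow> 0"
      proof (rule ennreal_squeeze_zero[OF _ W12_approx_parts(2)[OF a]], intro nn_integral_mono)
        fix n x
        have "column j (jacobian (z n) (at x)) - column j (Df x) = column j (jacobian (z n) (at x) - Df x)"
          by (simp add: column_def vec_eq_iff)
        then show "ennreal ((norm (column j (jacobian (z n) (at x)) - column j (Df x)))^2) * indicator (?B \<inter> H) x
          \<le> ennreal ((norm (jacobian (z n) (at x) - Df x))^2) * indicator (?B \<inter> H) x"
          by (auto simp: indicator_def intro!: ennreal_leI power_mono norm_column_le)
      qed
    qed (simp add: K(4))
    have split: "(LINT x|lebesgue. F x) = (LINT x|lebesgue. indicator H1 x *R F x) + (LINT x|lebesgue. indicator H2 x *R F x)"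
      if "integrable lebesgue F" for F :: "real^2 => real^'n"
    proof -
      have "(LINT x|lebesgue. F x) = (LINT x|lebesgue. indicator H1 x *R F x + indicator H2 x *R F x)"
        by (intro Bochner_Integration.integral_cong) (auto simp: H1_def H2_def indicator_def)
      also have "\<dots> = (LINT x|lebesgue. indicator H1 x *R F x) + (LINT x|lebesgue. indicator H2 x *R F x)"
        by (intro Bochner_Integration.integral_add integrable_mult_indicator Hm that)
      finally show ?thesis .
    qed
    have FC: "C1_on (\<lambda>x. \<phi> x *R F x) UNIV" if "C1_on F UNIV" for F :: "real^2 => real^'n" by (intro Ck1_scaleR \<phi>1 that) simp
    have Fz: "\<phi> x *R F x = 0" if "x \<notin> K" for F :: "real^2 => real^'n" and x using K(3)[OF that] by simp
    \<comment> \<open>phi F has compact support, so its derivative has total integral zero. Hence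
      the sum of the two half-plane terms is the upper term of the difference w - v.\<close>
    have Q12: "Q H1 F = - Q H2 F" if "C1_on F UNIV" for F
    proof -
      note z = integral_frechet_zero[OF FC[OF that] K(1) Fz[of _ F], where v = "axis j 1"]
      show ?thesis using z(1) split[OF z(2)] by (simp add: Q_def add_eq_0_iff2)
    qed
    have small: "(\<lambda>n. Q H1 (v n) + Q H2 (w n)) \<longlonglongrightarrow> 0"
    proof -
      define e where "e n x = w n x - v n x" for n x
      have eC: "C1_on (e n) UNIV" for n unfolding e_def[abs_def] by (intro Ck1_diff v w) simp
      have Qe: "Q H1 (v n) + Q H2 (w n) = Q H2 (e n)" for n
      proof -
        have i: "integrable lebesgue (\<lambda>x. indicator H2 x *R pd (\<lambda>x. \<phi> x *R F x) j x)" if "C1_on F UNIV" for F :: "real^2 => real^'n"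
          by (intro integrable_mult_indicator Hm integral_frechet_zero(2)[OF FC[OF that] K(1) Fz[of _ F]])
        have "pd (\<lambda>x. \<phi> x *R e n x) j x = pd (\<lambda>x. \<phi> x *R w n x) j x - pd (\<lambda>x. \<phi> x *R v n x) j x" for x
        proof -
          have "((\<lambda>x. \<phi> x *R w n x - \<phi> x *R v n x) has_derivative (\<lambda>h. frechet_derivative (\<lambda>x. \<phi> x *R w n x) (at x) h - frechet_derivative (\<lambda>x. \<phi> x *R v n x) (at x) h)) (at x)"
            by (intro has_derivative_diff Ck1_has_derivative[OF FC[OF w(1)]] Ck1_has_derivative[OF FC[OF v(1)]]) auto
          from frechet_derivative_at[OF this] show ?thesis by (simp add: e_def scaleR_diff_right) (metis (no_types))
        qed
        then have "Q H2 (e n) = Q H2 (w n) - Q H2 (v n)"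
          unfolding Q_def using i[OF v(1)[of n]] i[OF w(1)[of n]] by (simp add: scaleR_diff_right)
        then show ?thesis using Q12[OF v(1)] by simp
      qed
      consider "j = 1" | "j = 2" using exhaust_2 by blast
      then show ?thesis
      proof cases
        case 1
        \<comment> \<open>The first direction runs along the line, so no boundary term
          arises.\<close>
        have "Q H2 (e n) = 0" for n unfolding Q_def 1 H2_def by (rule half_plane_parts(1)[OF FC[OF eC] K(1) Fz[of _ "e n"]])
        then show ?thesis unfolding Qe by simp
      next
        case 2
        obtain M where M: "M > 0" "\<And>x. \<bar>\<phi> x\<bar> \<le> M"
        proof -
          have "bounded (\<phi> ` K)"
            by (intro compact_imp_bounded compact_continuous_image continuous_on_subset[OF Ck1_continuous[OF \<phi>1]] K) auto
          then obtain M where "M > 0" "\<forall>x\<in>K. \<bar>\<phi> x\<bar> \<le> M" by (auto simp: bounded_pos)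
          then show ?thesis using K(3) that[of M] by (metis abs_zero less_eq_real_def)
        qed
        define T where "T = R + 1"
        have T: "-T < T" "R < T" using R by (auto simp: T_def)
        define J where "J n = (\<integral>\<^sup>+\<theta>\<in>{-T..T}. ennreal ((norm (e n (V2 \<theta> m)))^2) \<partial>lebesgue)" for n
        have J: "J \<longlonglongrightarrow> 0" unfolding J_def[abs_def] e_def by (rule jump)
        \<comment> \<open>Here the boundary term is the integral of phi (w - v) over the line; the
          support of phi confines it to a segment, where Cauchy-Schwarz bounds it by the
          jump.\<close>
        have le: "ennreal ((norm (Q H2 (e n)))^2) \<le> ennreal (2 * T * M^2) * J n" for n
        proof -
          have ec: "continuous_on UNIV (\<lambda>\<theta>. e n (V2 \<theta> m))" "continuous_on UNIV (\<lambda>\<theta>. \<phi> (V2 \<theta> m))"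
            by (intro continuous_on_compose2[OF Ck1_continuous[OF eC] V2_cont(2)] continuous_on_compose2[OF Ck1_continuous[OF \<phi>1] V2_cont(2)]; simp)+
          have mk: "(\<lambda>\<theta>. \<phi> (V2 \<theta> m) *R e n (V2 \<theta> m)) \<in> borel_measurable borel"
            by (intro borel_measurable_continuous_onI continuous_intros ec)
          have "Q H2 (e n) = - (LINT \<theta>|lborel. \<phi> (V2 \<theta> m) *R e n (V2 \<theta> m))"
            unfolding Q_def 2 H2_def by (rule half_plane_parts(2)[OF FC[OF eC] K(1) Fz[of _ "e n"]])
          also have "(LINT \<theta>|lborel. \<phi> (V2 \<theta> m) *R e n (V2 \<theta> m)) = (LINT \<theta>|lborel. indicator {-T<..<T} \<theta> *R (\<phi> (V2 \<theta> m) *R e n (V2 \<theta> m)))"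
          proof (intro Bochner_Integration.integral_cong refl)
            fix \<theta>
            have "\<phi> (V2 \<theta> m) = 0" if "\<theta> \<notin> {-T<..<T}"
            proof (rule K(3))
              have "T \<le> \<bar>\<theta>\<bar>" using that by auto
              then have "R < norm (V2 \<theta> m)" using V2_norm(2)[of \<theta> m] T by linarith
              then show "V2 \<theta> m \<notin> K" using R(2) by (auto simp: subset_iff)
            qed
            then show "\<phi> (V2 \<theta> m) *R e n (V2 \<theta> m) = indicator {-T<..<T} \<theta> *R (\<phi> (V2 \<theta> m) *R e n (V2 \<theta> m))" by (cases "\<theta> \<in> {-T<..<T}") auto
          qed
          finally have "ennreal ((norm (Q H2 (e n)))^2) \<le> ennreal (T - - T) * (\<integral>\<^sup>+\<theta>\<in>{-T<..<T}. ennreal ((norm (\<phi> (V2 \<theta> m) *R e n (V2 \<theta> m)))^2) \<partial>lborel)"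
            using square_integral_le(1)[OF mk T(1)] by simp
          also have "\<dots> \<le> ennreal (2 * T) * (\<integral>\<^sup>+\<theta>. ennreal (M^2) * (ennreal ((norm (e n (V2 \<theta> m)))^2) * indicator {-T..T} \<theta>) \<partial>lborel)"
          proof (rule mult_mono[OF _ nn_integral_mono])
            fix \<theta>
            have "\<bar>\<phi> (V2 \<theta> m)\<bar>^2 \<le> M^2" by (rule power_mono[OF M(2)]) simp
            then have "(norm (\<phi> (V2 \<theta> m) *R e n (V2 \<theta> m)))^2 \<le> M^2 * (norm (e n (V2 \<theta> m)))^2"
              by (simp add: power_mult_distrib mult_right_mono)
            then show "ennreal ((norm (\<phi> (V2 \<theta> m) *R e n (V2 \<theta> m)))^2) * indicator {-T<..<T} \<theta>
              \<le> ennreal (M^2) * (ennreal ((norm (e n (V2 \<theta> m)))^2) * indicator {-T..T} \<theta>)"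
              by (auto simp: indicator_def ennreal_mult'[symmetric] intro!: ennreal_leI)
          qed auto
          also have "(\<integral>\<^sup>+\<theta>. ennreal (M^2) * (ennreal ((norm (e n (V2 \<theta> m)))^2) * indicator {-T..T} \<theta>) \<partial>lborel) = ennreal (M^2) * J n"
          proof -
            have [measurable]: "(\<lambda>\<theta>. e n (V2 \<theta> m)) \<in> borel_measurable borel" by (rule borel_measurable_continuous_onI[OF ec(1)])
            show ?thesis unfolding J_def nn_integral_completion by (rule nn_integral_cmult) measurable
          qed
          finally show ?thesis using T by (simp add: ennreal_mult mult.assoc)
        qed
        have "(\<lambda>n. ennreal (2 * T * M^2) * J n) \<longlonglongrightarrow> ennreal (2 * T * M^2) * 0" by (intro ennreal_tendsto_cmult J) simp
        then have "(\<lambda>n. ennreal ((norm (Q H2 (e n)))^2)) \<longlonglongrightarrow> 0" using ennreal_squeeze_zero[OF le] by simp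
        then have "(\<lambda>n. (norm (Q H2 (e n)))^2) \<longlonglongrightarrow> 0" by (subst (asm) ennreal_0[symmetric], subst (asm) tendsto_ennreal_iff) auto
        then have "(\<lambda>n. sqrt ((norm (Q H2 (e n)))^2)) \<longlonglongrightarrow> sqrt 0" by (rule tendsto_real_sqrt)
        then have "(\<lambda>n. norm (Q H2 (e n))) \<longlonglongrightarrow> 0" by simp
        then show ?thesis unfolding Qe by (rule tendsto_norm_zero_cancel)
      qed
    qed
    have "(\<lambda>n. Q H1 (v n) + Q H2 (w n)) \<longlonglongrightarrow> P H1 f Df + P H2 f Df"
      by (intro tendsto_add lim Hm v w v(2)[of R, folded H1_def] w(2)[of R, folded H2_def])
    then have "P H1 f Df + P H2 f Df = 0" using small LIMSEQ_unique by blast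
    moreover have "P H1 f Df + P H2 f Df = (LINT x|lebesgue. pd \<phi> j x *R f x) + (LINT x|lebesgue. \<phi> x *R column j (Df x))"
      using split[OF tst_integrable(2)[OF \<phi> lf(1), of "axis j 1"]] split[OF tst_integrable(1)[OF \<phi> loc_int_column[OF lD(1)], of j]]
      unfolding P_def by (simp add: mult.commute)
    ultimately show "(LINT x|lebesgue. pd \<phi> j x *R f x) = - (LINT x|lebesgue. \<phi> x *R column j (Df x))" by (simp add: add_eq_0_iff2)
  qed
  then show ?thesis using lf lD by (simp add: w12l_def)
qed

section \<open>Logarithmic polar coordinates\<close>

lemma circ_simps [simp]: "circ \<theta> $ 1 = cos \<theta>" "circ \<theta> $ 2 = sin \<theta>" by (simp_all add: circ_def)

lemma norm_circ: "norm (circ \<theta>) = 1" by (simp add: norm_vec_def L2_set_def sum_2)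

lemma circ_eq_iff: "circ a = circ b \<longleftrightarrow> (\<exists>n::int. a = b + 2 * pi * n)" using sin_cos_eq_iff[of a b] by (auto simp: vec_eq_iff forall_2)

lemma circ_eqD: "circ a = circ b ==> \<bar>a - b\<bar> < 2 * pi ==> a = b"
proof -
  assume "circ a = circ b" "\<bar>a - b\<bar> < 2 * pi"
  then obtain n :: int where n: "a = b + 2 * pi * n" using circ_eq_iff by blast
  then have "2 * pi * \<bar>real_of_int n\<bar> < 2 * pi * 1" using \<open>\<bar>a - b\<bar> < 2 * pi\<close> by (simp add: abs_mult)
  then have "\<bar>real_of_int n\<bar> < 1" by (subst (asm) mult_less_cancel_left_pos) auto
  then have "n = 0" by linarith
  with n show "a = b" by simp
qed

definition red :: "real => real" where "red \<theta> = \<theta> - 2 * pi * of_int \<lfloor>\<theta> / (2 * pi)\<rfloor>"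

lemma red: "0 \<le> red \<theta>" "red \<theta> < 2 * pi" "circ (red \<theta>) = circ \<theta>" "0 \<le> \<theta> ==> \<theta> < 2 * pi ==> red \<theta> = \<theta>"
proof -
  have f: "of_int \<lfloor>\<theta> / (2*pi)\<rfloor> \<le> \<theta> / (2*pi)" "\<theta> / (2*pi) < of_int \<lfloor>\<theta> / (2*pi)\<rfloor> + 1" by linarith+
  then have "of_int \<lfloor>\<theta> / (2*pi)\<rfloor> * (2*pi) \<le> \<theta>" "\<theta> < (of_int \<lfloor>\<theta> / (2*pi)\<rfloor> + 1) * (2*pi)"
    by (simp_all add: pos_le_divide_eq[symmetric] pos_divide_less_eq[symmetric])
  then show "0 \<le> red \<theta>" "red \<theta> < 2 * pi" unfolding red_def by (simp_all add: algebra_simps)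
  show "circ (red \<theta>) = circ \<theta>" by (subst circ_eq_iff) (auto simp: red_def intro!: exI[of _ "- \<lfloor>\<theta> / (2*pi)\<rfloor>"])
  show "red \<theta> = \<theta>" if "0 \<le> \<theta>" "\<theta> < 2 * pi"
  proof -
    have "\<lfloor>\<theta> / (2*pi)\<rfloor> = 0" using that by (auto simp: floor_eq_iff)
    then show ?thesis by (simp add: red_def)
  qed
qed

lemma red_measurable [measurable]: "red \<in> borel_measurable borel" unfolding red_def[abs_def] by measurable

text \<open>The angle in [0, 2 pi) of a point of the unit circle. Maps on the circle are given as
  functions on the plane, and \<open>g (ang p)\<close> turns a function of the angle into such a
  map.\<close>

definition ang :: "real^2 => real" where "ang p = (SOME \<theta>. 0 \<le> \<theta> \<and> \<theta> < 2 * pi \<and> circ \<theta> = p)"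

lemma ang_circ: "ang (circ \<theta>) = red \<theta>"
proof -
  have "0 \<le> ang (circ \<theta>) \<and> ang (circ \<theta>) < 2 * pi \<and> circ (ang (circ \<theta>)) = circ \<theta>"
    unfolding ang_def by (rule someI[of _ "red \<theta>"]) (simp add: red)
  then show ?thesis using red(1,2,3)[of \<theta>] by (intro circ_eqD) auto
qed

abbreviation per :: "real^2" where "per \<equiv> V2 (2 * pi) 0"

lemma periodic_red:
  assumes "\<And>x. f (x + per) = f x"
  shows "f (V2 (red (x $ 1)) (x $ 2)) = f x"
proof -
  have "V2 (red (x $ 1)) (x $ 2) = x + of_int (- \<lfloor>x $ 1 / (2 * pi)\<rfloor>) *R per" by (simp add: vec_eq_iff forall_2 red_def)
  then show ?thesis using int_period[of f per x "- \<lfloor>x $ 1 / (2 * pi)\<rfloor>"] assms by (simp only:)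
qed

definition PJ :: "real => real^2 => real^2^2" where
  "PJ r x = vector [vector [- (r * exp (x $ 2) * sin (x $ 1)), r * exp (x $ 2) * cos (x $ 1)],
     vector [r * exp (x $ 2) * cos (x $ 1), r * exp (x $ 2) * sin (x $ 1)]]"

text \<open>The complex exponential centred at s: height 0 is the circle of radius r, negative
  heights fill the punctured disc inside, and the angle has period 2 pi.\<close>

definition pol :: "real^2 => real => real^2 => real^2" where
  "pol s r x = s + (r * exp (x $ 2)) *R circ (x $ 1)"

text \<open>Acts on the height only. With a = 1/L it stretches a cylinder by the factor L, with a
  negative slope it also turns it upside down.\<close>

definition aff :: "real => real => real^2 => real^2" where
  "aff a b x = V2 (x $ 1) (a * x $ 2 + b)"

definition AJ :: "real => real^2^2" where "AJ a = vector [vector [1, 0], vector [0, a]]"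

lemma pol_derivative: "(pol s r has_derivative (*v) (PJ r x)) (at x)"
proof -
  have e: "pol s r = (\<lambda>x. s + (r * exp (x $ 2) * cos (x $ 1)) *R axis 1 1 + (r * exp (x $ 2) * sin (x $ 1)) *R axis 2 1)"
    using one_neq_two by (auto simp: pol_def fun_eq_iff vec_eq_iff forall_2 axis_def)
  have n: "((\<lambda>x::real^2. x $ i) has_derivative (\<lambda>h. h $ i)) (at x)" for i
    by (rule bounded_linear_imp_has_derivative) (rule bounded_linear_vec_nth)
  have "(pol s r has_derivative (\<lambda>h. (r * exp (x $ 2) * (h $ 2 * cos (x $ 1) - h $ 1 * sin (x $ 1))) *R axis 1 1
      + (r * exp (x $ 2) * (h $ 2 * sin (x $ 1) + h $ 1 * cos (x $ 1))) *R axis 2 1)) (at x)"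
    unfolding e by (auto intro!: derivative_eq_intros n simp: algebra_simps)
  moreover have "(\<lambda>h. (r * exp (x $ 2) * (h $ 2 * cos (x $ 1) - h $ 1 * sin (x $ 1))) *R axis 1 1
      + (r * exp (x $ 2) * (h $ 2 * sin (x $ 1) + h $ 1 * cos (x $ 1))) *R axis 2 1) = (*v) (PJ r x)"
    using one_neq_two by (auto simp: PJ_def fun_eq_iff vec_eq_iff forall_2 axis_def matrix_vector_mult_def sum_2 algebra_simps)
  ultimately show ?thesis by simp
qed

lemma aff_derivative: "(aff a b has_derivative (*v) (AJ a)) (at x)"
proof -
  have e: "aff a b = (\<lambda>x. (AJ a) *v x + V2 0 b)" by (auto simp: aff_def AJ_def fun_eq_iff vec_eq_iff forall_2 matrix_vector_mult_def sum_2)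
  have "((*v) (AJ a) has_derivative (*v) (AJ a)) (at x)" by (rule bounded_linear_imp_has_derivative) (rule matrix_vector_mul_bounded_linear)
  from has_derivative_add_const[OF this] show ?thesis unfolding e .
qed

lemma jacobian_eq: "(g has_derivative (*v) A) (at x) ==> jacobian g (at x) = (A :: real^2^2)"
  by (simp add: jacobian_def frechet_derivative_at[symmetric])

lemmas jacobian_pol = jacobian_eq[OF pol_derivative] and jacobian_aff = jacobian_eq[OF aff_derivative]

lemma det_PJ: "\<bar>det (PJ r x)\<bar> = (r * exp (x $ 2))^2"
proof -
  have a: "- (\<rho> * s) * (\<rho> * s) - \<rho> * c * (\<rho> * c) = - (\<rho>^2 * (s^2 + c^2))" for \<rho> s c :: real by (simp add: power2_eq_square algebra_simps)
  have "det (PJ r x) = - ((r * exp (x $ 2))^2 * ((sin (x $ 1))^2 + (cos (x $ 1))^2))" unfolding a[symmetric] by (simp add: det_2 PJ_def)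
  then show ?thesis by simp
qed

lemma det_AJ: "det (AJ a) = a" by (simp add: det_2 AJ_def)

text \<open>Polar coordinates are conformal, so they preserve the Dirichlet energy density.\<close>

lemma norm_mult_PJ: "(norm (A ** PJ r x))^2 = \<bar>det (PJ r x)\<bar> * (norm (A :: real^2^'n))^2"
proof -
  let ?c = "cos (x $ 1)" and ?s = "sin (x $ 1)" and ?\<rho> = "r * exp (x $ 2)"
  have sc: "?s\<^sup>2 + ?c^2 = 1" by simp
  have "(a * - (?\<rho> * ?s) + b * (?\<rho> * ?c))^2 + (a * (?\<rho> * ?c) + b * (?\<rho> * ?s))^2 = ?\<rho>^2 * (a^2 + b^2)" for a b
  proof -
    have "(a * - (\<rho> * s) + b * (\<rho> * c))^2 + (a * (\<rho> * c) + b * (\<rho> * s))^2 = \<rho>^2 * (a^2 + b^2) * (s^2 + c^2)" for \<rho> s c :: real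
      by (simp add: power2_eq_square algebra_simps)
    from this[of ?\<rho> ?s ?c] show ?thesis unfolding sc by simp
  qed
  then show ?thesis unfolding norm_matrix_sq2 det_PJ sum_distrib_left by (simp add: matrix_matrix_mult_def sum_2 PJ_def distrib_left)
qed

lemma pol_inj:
  assumes "0 < r" "pol s r x = pol s r y" "\<bar>x $ 1 - y $ 1\<bar> < 2 * pi"
  shows "x = y"
proof -
  have e: "(r * exp (x $ 2)) *R circ (x $ 1) = (r * exp (y $ 2)) *R circ (y $ 1)" using assms(2) by (simp add: pol_def)
  from arg_cong[OF this, of norm] have "r * exp (x $ 2) = r * exp (y $ 2)" using assms(1) by (simp add: norm_circ)
  then have "x $ 2 = y $ 2" using assms(1) by simp
  moreover with e have "circ (x $ 1) = circ (y $ 1)" using assms(1) by simp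
  ultimately show ?thesis using circ_eqD[OF _ assms(3)] by (simp add: vec_eq_iff forall_2)
qed

lemma pol_local_diffeo:
  assumes "0 < r" "open V"
  shows "local_diffeo (pol s r) V"
proof
  show "C1_on (pol s r) V"
  proof (rule Ck1I[OF assms(2) pol_derivative])
    show "continuous_on V (\<lambda>x. PJ r x *v v)" for v unfolding continuous_on_componentwise[of V "\<lambda>x. PJ r x *v v"]
      by (auto simp: PJ_def matrix_vector_mult_def sum_2 Basis_real2 inner_axis intro!: continuous_intros)
  qed
  show "det (jacobian (pol s r) (at x)) \<noteq> 0" for x using det_PJ[of r x] assms(1) by (auto simp: jacobian_pol)
  \<comment> \<open>Two angles within a unit ball differ by less than 2, hence by less than a full
    turn.\<close>
  have "inj_on (pol s r) (ball x 1)" for x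
  proof (rule inj_onI)
    fix y z assume yz: "y \<in> ball x 1" "z \<in> ball x 1" "pol s r y = pol s r z"
    have "dist y z < 2" using yz(1,2) dist_triangle2[of y z x] by (simp add: dist_commute)
    then have "\<bar>y $ 1 - z $ 1\<bar> < 2" using component_le_norm_cart[of "y - z" 1] by (simp add: dist_norm)
    then show "y = z" using pi_gt3 by (intro pol_inj[OF assms(1) yz(3)]) simp
  qed
  then show "\<exists>\<rho>>0. inj_on (pol s r) (ball x \<rho>)" for x by (intro exI[of _ 1]) simp
qed (rule assms)

lemma aff_inj: "a \<noteq> 0 ==> inj_on (aff a b) S" by (auto simp: inj_on_def aff_def vec_eq_iff forall_2)

lemma aff_local_diffeo:
  assumes "a \<noteq> 0" "open V"
  shows "local_diffeo (aff a b) V"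
proof
  show "C1_on (aff a b) V" by (rule Ck1I[OF assms(2) aff_derivative]) simp
  show "det (jacobian (aff a b) (at x)) \<noteq> 0" for x using assms(1) by (simp add: jacobian_aff det_AJ)
  show "\<exists>\<rho>>0. inj_on (aff a b) (ball x \<rho>)" for x using aff_inj[OF assms(1)] by (intro exI[of _ 1]) auto
qed (rule assms)

lemma dist_pol: "0 < r ==> dist s (pol s r x) = r * exp (x $ 2)" by (simp add: pol_def dist_norm norm_circ)

lemma pol_periodic: "pol s r (x + per) = pol s r x" "PJ r (x + per) = PJ r x" by (simp_all add: pol_def PJ_def circ_def)

text \<open>A change of the base radius is a vertical shift. One extension built at radius r
  therefore serves all other radii after a translation.\<close>

lemma pol_shift:
  assumes "0 < r" "0 < \<rho>"
  shows "pol s r (x + V2 0 (ln (\<rho> / r))) = pol s \<rho> x" "PJ r (x + V2 0 (ln (\<rho> / r))) = PJ \<rho> x"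
  using assms by (simp_all add: pol_def PJ_def exp_add mult_ac)

section \<open>Circle traces in polar coordinates\<close>

lemma norm_V2_le: "norm (x :: real^2) \<le> \<bar>x $ 1\<bar> + \<bar>x $ 2\<bar>" using norm_le_l1_cart[of x] by (simp add: sum_2)

lemma tcell_bounded: "\<sigma> = 1 \<or> \<sigma> = -1 ==> tcell m \<sigma> \<tau> \<subseteq> cball 0 (2 * pi + \<bar>m\<bar> + \<bar>\<tau>\<bar>)"
proof
  fix x assume "\<sigma> = 1 \<or> \<sigma> = -1" "x \<in> tcell m \<sigma> \<tau>"
  then have "\<bar>x $ 1\<bar> \<le> 2 * pi" "\<bar>x $ 2\<bar> \<le> \<bar>m\<bar> + \<bar>\<tau>\<bar>" by (auto simp: tcell_def)
  then show "x \<in> cball 0 (2 * pi + \<bar>m\<bar> + \<bar>\<tau>\<bar>)" using norm_V2_le[of x] by simp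
qed

lemma w12l_measurable:
  assumes "w12l U f Df" "open V" "V \<subseteq> U"
  shows "(\<lambda>x. indicator V x *R f x) \<in> borel_lebesgue" "(\<lambda>x. indicator V x *R Df x) \<in> borel_lebesgue"
  using w12l_subset[OF assms(1,3)] loc_int_measurable[OF assms(2)] by (auto simp: w12l_def dest: has_weak_gradD)

lemma pol_in:
  assumes "0 < \<rho>" "0 < \<delta>" "x \<in> tcell 0 1 (ln ((\<rho> + \<delta>) / \<rho>))"
  shows "pol s \<rho> x \<in> ball s (\<rho> + \<delta>) - cball s \<rho>"
proof -
  have "0 < x $ 2" "x $ 2 < ln ((\<rho> + \<delta>) / \<rho>)" using assms(3) by (auto simp: tcell_def)
  then have "1 < exp (x $ 2)" "exp (x $ 2) < (\<rho> + \<delta>) / \<rho>" using assms(1,2) by (simp, metis exp_less_mono exp_ln divide_pos_pos add_pos_pos)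
  then show ?thesis using assms(1) by (simp add: dist_pol field_simps)
qed

lemma pol_inj_on: "0 < r ==> (\<And>x. x \<in> S ==> 0 < x $ 1 \<and> x $ 1 < 2 * pi) ==> inj_on (pol s r) S"
  by (rule inj_onI, rule pol_inj[of r s]) (auto simp: abs_less_iff, (smt (verit))+)

lemma pol_pullback:
  fixes u :: "real^2 => real^'n"
  assumes \<rho>: "0 < \<rho>" "0 < \<delta>" and u: "w12l (ball s (\<rho> + \<delta>) - cball s \<rho>) u Du"
    and w: "\<And>n. C1_on (w n) UNIV" "W12_approx (ball s (\<rho> + \<delta>) - cball s \<rho>) w u Du"
  shows "W12_approx (tcell 0 1 (ln ((\<rho> + \<delta>) / \<rho>))) (\<lambda>n x. w n (pol s \<rho> x)) (\<lambda>x. u (pol s \<rho> x)) (\<lambda>x. Du (pol s \<rho> x) ** PJ \<rho> x)"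
proof -
  interpret p: local_diffeo "pol s \<rho>" UNIV by (rule pol_local_diffeo[OF \<rho>(1) open_UNIV])
  have "W12_approx (tcell 0 1 (ln ((\<rho> + \<delta>) / \<rho>))) (\<lambda>n x. w n (pol s \<rho> x)) (\<lambda>x. u (pol s \<rho> x)) (\<lambda>x. Du (pol s \<rho> x) ** jacobian (pol s \<rho>) (at x))"
  proof (rule p.W12_approx_compose[OF tcell_bounded compact_cball subset_UNIV _ _ _ _ _ _ w])
    show "inj_on (pol s \<rho>) (tcell 0 1 (ln ((\<rho> + \<delta>) / \<rho>)))" by (rule pol_inj_on[OF \<rho>(1)]) (auto simp: tcell_def)
    show "pol s \<rho> ` tcell 0 1 (ln ((\<rho> + \<delta>) / \<rho>)) \<subseteq> ball s (\<rho> + \<delta>) - cball s \<rho>" using pol_in[OF \<rho>] by blast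
  qed (use u open_tcell in \<open>auto simp: w12l_def dest: has_weak_gradD\<close>)
  then show ?thesis unfolding jacobian_pol .
qed

text \<open>Mollification needs a map on the whole plane, so u is cut off both outside the annulus
  and near the possibly singular centre.\<close>

lemma annulus_approx:
  fixes u :: "real^2 => real^'n"
  assumes A: "w12l A u Du" "ball s R - {s} \<subseteq> A" and \<rho>: "0 < \<rho>" "0 < \<delta>" "\<rho> + 2 * \<delta> < R"
  obtains w where "\<And>n. C1_on (w n) UNIV" "W12_approx (ball s (\<rho> + \<delta>) - cball s \<rho>) w u Du"
proof -
  let ?U = "ball s (\<rho> + \<delta>) - cball s \<rho>"
  \<comment> \<open>The difference of two ball cutoffs: 1 on the annulus, 0 within radius rho / 4 of
    the centre and beyond radius rho + 2 delta.\<close>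
  define \<zeta> where "\<zeta> x = ball_cutoff s (\<rho> + \<delta>) (\<rho> + 2 * \<delta>) x - ball_cutoff s (\<rho> / 4) (\<rho> / 2) x" for x
  define C where "C = cball s (\<rho> + 2 * \<delta>) - ball s (\<rho> / 4)"
  have o: "0 \<le> \<rho> + \<delta>" "\<rho> + \<delta> < \<rho> + 2 * \<delta>" "0 \<le> \<rho> / 4" "\<rho> / 4 < \<rho> / 2" using \<rho> by auto
  have \<zeta>: "C1_on \<zeta> UNIV" unfolding \<zeta>_def[abs_def] by (intro Ck1_diff ball_cutoff(1) o) simp
  have C: "closed C" "C \<subseteq> A" using \<rho> A(2) by (auto simp: C_def intro!: closed_Diff)
  have z: "\<zeta> x = 0" if "x \<notin> C" for x
  proof (cases "x \<in> ball s (\<rho> / 4)")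
    case True
    then have "x \<in> cball s (\<rho> + \<delta>)" "x \<in> cball s (\<rho> / 4)" using \<rho> by auto
    from ball_cutoff(2)[OF o(1,2) this(1)] ball_cutoff(2)[OF o(3,4) this(2)] show ?thesis by (simp only: \<zeta>_def)
  next
    case False
    then have "x \<notin> ball s (\<rho> + 2 * \<delta>)" "x \<notin> ball s (\<rho> / 2)" using that \<rho> by (auto simp: C_def)
    from ball_cutoff(3)[OF o(1,2) this(1)] ball_cutoff(3)[OF o(3,4) this(2)] show ?thesis by (simp only: \<zeta>_def)
  qed
  have one: "\<zeta> x = 1" if "x \<in> ?U" for x
  proof -
    have "x \<in> cball s (\<rho> + \<delta>)" "x \<notin> ball s (\<rho> / 2)" using that \<rho> by auto
    from ball_cutoff(2)[OF o(1,2) this(1)] ball_cutoff(3)[OF o(3,4) this(2)] show ?thesis by (simp only: \<zeta>_def)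
  qed
  have p: "frechet_derivative \<zeta> (at x) = (\<lambda>v. 0)" if "x \<in> ?U" for x
  proof -
    have "open ?U" by auto
    then have "(\<zeta> has_derivative (\<lambda>v. 0)) (at x)"
      by (rule has_derivative_transform_within_open[OF has_derivative_const[of 1] _ that]) (simp add: one)
    then show ?thesis by (rule frechet_derivative_at[symmetric])
  qed
  obtain w where w: "\<And>n. C1_on (w n) UNIV"
    "\<And>r. W12_approx (cball 0 r) w (\<lambda>x. \<zeta> x *R u x) (\<lambda>x. \<zeta> x *R Du x + outer (u x) (\<lambda>j. pd \<zeta> j x))"
    using w12l_mollify[OF w12l_cutoff[OF A(1) \<zeta> C z]] by blast
  have "bounded ?U" by (rule bounded_subset[OF bounded_ball]) auto
  then obtain r where "?U \<subseteq> ball 0 r" using bounded_subset_ballD by blast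
  then have "?U \<subseteq> cball 0 r" using ball_subset_cball by blast
  then have "W12_approx ?U w (\<lambda>x. \<zeta> x *R u x) (\<lambda>x. \<zeta> x *R Du x + outer (u x) (\<lambda>j. pd \<zeta> j x))" by (rule W12_approx_subset[OF w(2)])
  then have "W12_approx ?U w u Du"
  proof (rule W12_approx_cong_AE, intro AE_I2 impI)
    fix x assume "x \<in> ?U"
    then show "\<zeta> x *R u x = u x \<and> \<zeta> x *R Du x + outer (u x) (\<lambda>j. pd \<zeta> j x) = Du x" by (simp add: one p outer_def vec_eq_iff)
  qed
  then show ?thesis using that w(1) by blast
qed

text \<open>\<open>circle_trace\<close> is a choice and has the defining property only if some trace
  exists. One is found on a collar in polar coordinates by \<open>strip_trace\<close> and turned
  into a map on the circle.\<close>

lemma circle_trace_exists: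
  fixes u :: "real^2 => real^'n"
  assumes A: "w12l A u Du" "ball s R - {s} \<subseteq> A" and \<rho>: "0 < \<rho>" "\<rho> < R"
  shows "has_circle_trace u s \<rho> (circle_trace u s \<rho>)"
proof -
  define \<delta> where "\<delta> = (R - \<rho>) / 3"
  have \<delta>: "0 < \<delta>" "\<rho> + 2 * \<delta> < R" using \<rho> by (auto simp: \<delta>_def field_simps)
  let ?U = "ball s (\<rho> + \<delta>) - cball s \<rho>"
  have oU: "open ?U" by auto
  have UA: "?U \<subseteq> A" using \<rho> \<delta> A(2) by auto
  have uU: "w12l ?U u Du" by (rule w12l_subset[OF A(1) UA])
  obtain w where w: "\<And>n. C1_on (w n) UNIV" "W12_approx ?U w u Du" by (rule annulus_approx[OF A \<rho>(1) \<delta>]) blast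
  have hw: "has_weak_grad ?U u Du" using uU by (simp add: w12l_def)
  have W: "W12 ?U UNIV u"
  proof -
    define K where "K = cball s (\<rho> + \<delta>) - ball s \<rho>"
    have K: "compact K" "K \<subseteq> A" "?U \<subseteq> K" using \<rho> \<delta> A(2) by (auto simp: K_def intro!: compact_diff)
    have Um: "?U \<in> sets lebesgue" using oU by simp
    have i: "lset_int K (\<lambda>x. (norm (u x))^2)" "lset_int K (\<lambda>x. (norm (Du x))^2)" using A(1) K by (auto simp: w12l_def loc_int_def)
    note set_integrable_subset[OF i(1) Um K(3)] set_integrable_subset[OF i(2) Um K(3)]
    then show ?thesis unfolding W12_iff using uU by auto
  qed
  define \<tau> where "\<tau> = ln ((\<rho> + \<delta>) / \<rho>)"
  have \<tau>: "0 < \<tau>" using \<rho> \<delta> by (simp add: \<tau>_def field_simps)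
  interpret p: local_diffeo "pol s \<rho>" "tcell 0 1 \<tau>" by (rule pol_local_diffeo[OF \<rho>(1) open_tcell])
  have pU: "pol s \<rho> ` tcell 0 1 \<tau> \<subseteq> ?U" using pol_in[OF \<rho>(1) \<delta>(1)] by (auto simp: \<tau>_def)
  have pw: "w12l (tcell 0 1 \<tau>) (\<lambda>x. u (pol s \<rho> x)) (\<lambda>x. Du (pol s \<rho> x) ** PJ \<rho> x)"
    using p.w12l_compose[OF uU oU pU] unfolding jacobian_pol .
  obtain g where g: "g \<in> borel_measurable borel"
    "\<forall>w. (\<forall>n. C1_on (w n) UNIV) --> W12_approx (tcell 0 1 \<tau>) w (\<lambda>x. u (pol s \<rho> x)) (\<lambda>x. Du (pol s \<rho> x) ** PJ \<rho> x) -->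
      (\<lambda>n. \<integral>\<^sup>+\<theta>\<in>{0..2*pi}. ennreal ((norm (w n (V2 \<theta> 0) - g \<theta>))^2) \<partial>lebesgue) \<longlonglongrightarrow> 0"
    using strip_trace[OF \<tau> _ w12l_measurable[OF pw open_tcell subset_refl]] by blast
  have C: "C1_on (\<lambda>x. w n (pol s \<rho> x)) UNIV" for n
    using local_diffeo.C1[OF pol_local_diffeo[OF \<rho>(1) open_UNIV]] by (intro Ck1_compose[OF _ _ w(1)]) auto
  have "(\<lambda>n. \<integral>\<^sup>+\<theta>\<in>{0..2*pi}. ennreal ((norm (w n (pol s \<rho> (V2 \<theta> 0)) - g \<theta>))^2) \<partial>lebesgue) \<longlonglongrightarrow> 0"
    by (rule g(2)[rule_format, of "\<lambda>n x. w n (pol s \<rho> x)"]) (rule C pol_pullback[OF \<rho>(1) \<delta>(1) uU w, folded \<tau>_def])+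
  moreover have "(\<integral>\<^sup>+\<theta>\<in>{0..2*pi}. ennreal ((norm (w n (pol s \<rho> (V2 \<theta> 0)) - g \<theta>))^2) \<partial>lebesgue)
    = (\<integral>\<^sup>+\<theta>\<in>{0..2*pi}. ennreal ((norm (w n (s + \<rho> *R circ \<theta>) - g (ang (circ \<theta>))))^2) \<partial>lebesgue)" for n unfolding nn_integral_completion
  proof (rule nn_integral_cong_AE, rule eventually_mono[OF AE_lborel_singleton[of "2*pi"]])
    \<comment> \<open>\<open>ang\<close> has values in [0, 2 pi), so within the closed period the
      two integrands can differ only at the right endpoint.\<close>
    fix \<theta> :: real assume "\<theta> \<noteq> 2 * pi"
    then show "ennreal ((norm (w n (pol s \<rho> (V2 \<theta> 0)) - g \<theta>))^2) * indicator {0..2*pi} \<theta>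
      = ennreal ((norm (w n (s + \<rho> *R circ \<theta>) - g (ang (circ \<theta>))))^2) * indicator {0..2*pi} \<theta>"
      by (cases "\<theta> \<in> {0..2*pi}") (simp_all add: pol_def ang_circ red(4))
  qed
  ultimately have tr: "(\<lambda>n. \<integral>\<^sup>+\<theta>\<in>{0..2*pi}. ennreal ((norm (w n (s + \<rho> *R circ \<theta>) - g (ang (circ \<theta>))))^2) \<partial>lebesgue) \<longlonglongrightarrow> 0" by simp
  have m: "(\<lambda>\<theta>. g (ang (circ \<theta>))) \<in> borel_lebesgue" unfolding ang_circ by (rule measurable_completion) (use g(1) in measurable)
  have ae: "AE x in lebesgue. x \<in> ?U --> Du x = weak_grad ?U u x" by (rule has_weak_grad_unique[OF oU hw has_weak_grad_weak_grad[OF hw]])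
  have wa: "W12_approx ?U w u (weak_grad ?U u)" by (rule W12_approx_cong_AE[OF w(2)]) (use ae in auto)
  have "has_circle_trace u s \<rho> (\<lambda>p. g (ang p))" unfolding has_circle_trace_def Let_def One_nat_def using m W w(1) wa tr \<delta>(1) by blast
  then show ?thesis unfolding circle_trace_def by (rule someI[of "has_circle_trace u s \<rho>"])
qed

text \<open>Restates the trace on a circle as a trace at the bottom of a collar, with the given
  gradient in place of the one chosen on an annulus. This is the form in which strips and circles
  meet.\<close>

lemma polar_trace:
  fixes u :: "real^2 => real^'n"
  assumes A: "w12l A u Du" "ball s R - {s} \<subseteq> A" and \<rho>: "0 < \<rho>" "\<rho> < R"
  shows "(\<lambda>\<theta>. circle_trace u s \<rho> (circ \<theta>)) \<in> borel_lebesgue \<and>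
    (\<exists>\<tau> v. 0 < \<tau> \<and> (\<forall>n. C1_on (v n) UNIV) \<and>
       W12_approx (tcell 0 1 \<tau>) v (\<lambda>x. u (pol s \<rho> x)) (\<lambda>x. Du (pol s \<rho> x) ** PJ \<rho> x) \<and>
       L2conv (\<lambda>n \<theta>. v n (V2 \<theta> 0)) (\<lambda>n \<theta>. circle_trace u s \<rho> (circ \<theta>)))"
proof -
  let ?g = "circle_trace u s \<rho>"
  obtain \<delta>' w where \<delta>': "0 < \<delta>'" and W': "W12 (ball s (\<rho> + \<delta>') - cball s \<rho>) UNIV u"
    and w: "\<And>n. C1_on (w n) UNIV"
      "W12_approx (ball s (\<rho> + \<delta>') - cball s \<rho>) w u (weak_grad (ball s (\<rho> + \<delta>') - cball s \<rho>) u)"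
    and tr: "(\<lambda>n. \<integral>\<^sup>+\<theta>\<in>{0..2*pi}. ennreal ((norm (w n (s + \<rho> *R circ \<theta>) - ?g (circ \<theta>)))^2) \<partial>lebesgue) \<longlonglongrightarrow> 0"
    and m: "(\<lambda>\<theta>. ?g (circ \<theta>)) \<in> borel_lebesgue"
    using circle_trace_exists[OF A \<rho>] unfolding has_circle_trace_def Let_def One_nat_def by blast
  let ?U' = "ball s (\<rho> + \<delta>') - cball s \<rho>"
  define \<delta> where "\<delta> = min \<delta>' (R - \<rho>)"
  have \<delta>: "0 < \<delta>" "\<delta> \<le> \<delta>'" "\<rho> + \<delta> \<le> R" using \<delta>' \<rho> by (auto simp: \<delta>_def)
  let ?U = "ball s (\<rho> + \<delta>) - cball s \<rho>"
  have oU: "open ?U" by auto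
  have UU: "?U \<subseteq> ?U'" "?U \<subseteq> A" using \<rho> \<delta> A(2) by auto
  have uU: "w12l ?U u Du" by (rule w12l_subset[OF A(1) UU(2)])
  have hw: "has_weak_grad ?U u Du" using uU by (simp add: w12l_def)
  obtain D' where D': "has_weak_grad ?U' u D'" using W' by (auto simp: W12_def)
  have ae: "AE x in lebesgue. x \<in> ?U --> weak_grad ?U' u x = Du x" by (rule weak_grad_AE[OF oU UU(1) D' hw])
  have wa: "W12_approx ?U w u Du" by (rule W12_approx_cong_AE[OF W12_approx_subset[OF w(2) UU(1)]]) (use ae in auto)
  have C: "C1_on (\<lambda>x. w n (pol s \<rho> x)) UNIV" for n
    using local_diffeo.C1[OF pol_local_diffeo[OF \<rho>(1) open_UNIV]] by (intro Ck1_compose[OF _ _ w(1)]) auto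
  have "L2conv (\<lambda>n \<theta>. w n (pol s \<rho> (V2 \<theta> 0))) (\<lambda>n \<theta>. ?g (circ \<theta>))" using tr by (simp add: L2conv_def pol_def)
  moreover have "0 < ln ((\<rho> + \<delta>) / \<rho>)" using \<rho> \<delta> by (simp add: field_simps)
  ultimately show ?thesis using C m pol_pullback[OF \<rho>(1) \<delta>(1) uU w(1) wa]
    by (intro conjI exI[of _ "ln ((\<rho> + \<delta>) / \<rho>)"] exI[of _ "\<lambda>n x. w n (pol s \<rho> x)"] allI)
qed

section \<open>Competitors on the cylinder\<close>

lemma jacobian_periodic:
  fixes F :: "real^2 => real^'n"
  assumes F: "C1_on F UNIV" and p: "\<And>x. F (x + d) = F x"
  shows "jacobian F (at (x + d)) = jacobian F (at x)"
proof -
  have "((\<lambda>x. F (x + d)) has_derivative (\<lambda>h. frechet_derivative F (at (x + d)) h)) (at x)"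
    by (rule has_derivative_compose[OF _ Ck1_has_derivative[OF F]]) (auto intro!: derivative_eq_intros)
  then have "(F has_derivative frechet_derivative F (at (x + d))) (at x)" unfolding p .
  then show ?thesis by (simp add: jacobian_def frechet_derivative_at[symmetric])
qed

lemma AE_not_line: "AE x in lebesgue. x $ k \<noteq> (c :: real)" for k :: 2
proof -
  have "{x :: real^2. x $ k = c} \<in> null_sets lebesgue"
    using negligible_standard_hyperplane[of "axis k 1 :: real^2" c] by (simp add: negligible_iff_null_sets inner_axis axis_in_Basis_iff)
  from AE_not_in[OF this] show ?thesis by (rule eventually_mono) auto
qed

lemma open_strip: "open (strip T)" unfolding strip_def by (intro open_Collect_conj open_Collect_less continuous_intros)

lemma open_cyl_cell: "open (cyl_cell T)" unfolding cyl_cell_def by (intro open_Collect_conj open_Collect_less continuous_intros)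

lemma cyl_lift_periodic: "cyl_lift u (x + per) = cyl_lift u x" by (simp add: cyl_lift_def circ_def)

lemma V2_eta: "V2 (x $ 1) (x $ 2) = x" by (simp add: vec_eq_iff forall_2)

lemma periodic_cover: "cball (0 :: real^2) R \<subseteq> (\<Union>k\<in>{-\<lceil>R\<rceil> - 1..\<lceil>R\<rceil> + 1}. {x. x + of_int k *R per \<in> {y. 0 \<le> y $ 1 \<and> y $ 1 < 2 * pi}})"
proof
  fix x :: "real^2" assume "x \<in> cball 0 R"
  then have x: "\<bar>x $ 1\<bar> \<le> R" using component_le_norm_cart[of x 1] by simp
  let ?k = "- \<lfloor>x $ 1 / (2 * pi)\<rfloor>"
  have "\<bar>x $ 1 / (2 * pi)\<bar> \<le> \<bar>x $ 1\<bar> / 1" unfolding abs_divide using pi_gt3 by (intro divide_left_mono) auto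
  with x have "\<bar>x $ 1 / (2 * pi)\<bar> \<le> of_int \<lceil>R\<rceil>" by linarith
  then have "?k \<in> {-\<lceil>R\<rceil> - 1..\<lceil>R\<rceil> + 1}" by (auto simp: abs_le_iff floor_le_iff le_floor_iff; linarith)
  moreover have "0 \<le> (x + of_int ?k *R per) $ 1" "(x + of_int ?k *R per) $ 1 < 2 * pi"
    using red(1,2)[of "x $ 1"] by (simp_all add: red_def mult.commute)
  ultimately show "x \<in> (\<Union>k\<in>{-\<lceil>R\<rceil> - 1..\<lceil>R\<rceil> + 1}. {x. x + of_int k *R per \<in> {y. 0 \<le> y $ 1 \<and> y $ 1 < 2 * pi}})" by blast
qed

text \<open>Approximation on one cell extends to the whole strip after replacing the gradient by an exactly periodic version.\<close>

lemma cyl_extend: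
  fixes C :: "(real^2) \<times> real => real^'n"
  assumes C: "W12_cyl T N C"
    and w: "\<And>n. C1_on (w n) UNIV" "\<And>n x. w n (x + per) = w n x"
      "W12_approx (cyl_cell T) w (cyl_lift C) (cyl_grad T C)"
  shows "\<exists>D. w12l (strip T) (cyl_lift C) D \<and> (\<forall>x. D (x + per) = D x) \<and>
    (AE x in lebesgue. x \<in> cyl_cell T --> cyl_grad T C x = D x) \<and>
    (\<forall>R. W12_approx (strip T \<inter> cball 0 R) w (cyl_lift C) D)"
proof -
  let ?S = "strip T" and ?c = "cyl_lift C"
  note oS = open_strip[of T]
  obtain D0 where "has_weak_grad ?S ?c D0" using C by (auto simp: W12_cyl_def)
  then have g: "has_weak_grad ?S ?c (cyl_grad T C)" unfolding cyl_grad_def by (rule has_weak_grad_weak_grad)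
  have cm: "(\<lambda>x. indicator ?S x *R ?c x) \<in> borel_lebesgue" by (rule loc_int_measurable[OF oS has_weak_gradD(1)[OF g]])
  have gm: "(\<lambda>x. indicator ?S x *R cyl_grad T C x) \<in> borel_lebesgue" by (rule loc_int_measurable[OF oS has_weak_gradD(2)[OF g]])
  \<comment> \<open>A Borel version is needed because it is composed with the reduction of the angle
    below, and Lebesgue measurability is not stable under such compositions.\<close>
  obtain Db where Db: "Db \<in> borel_measurable borel" "AE x in lebesgue. indicator ?S x *R cyl_grad T C x = Db x"
    by (rule lebesgue_borel_version[OF gm])
  define D where "D x = Db (V2 (red (x $ 1)) (x $ 2))" for x :: "real^2"
  have rper: "red (\<theta> + 2 * pi) = red \<theta>" for \<theta> using ang_circ[of "\<theta> + 2 * pi"] ang_circ[of \<theta>] by (simp add: circ_def)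
  have Dper: "D (x + per) = D x" for x by (simp add: D_def rper)
  have Dm: "D \<in> borel_lebesgue"
  proof -
    have e: "(\<lambda>x::real^2. V2 (red (x $ 1)) (x $ 2)) = (\<lambda>x. red (x $ 1) *R axis 1 1 + (x $ 2) *R axis 2 1)"
      using one_neq_two by (auto simp: fun_eq_iff vec_eq_iff forall_2 axis_def)
    have n: "(\<lambda>x::real^2. x $ i) \<in> borel_measurable borel" for i by (intro borel_measurable_continuous_onI continuous_intros)
    have "(\<lambda>x::real^2. V2 (red (x $ 1)) (x $ 2)) \<in> borel_measurable borel"
      unfolding e by (intro borel_measurable_add borel_measurable_scaleR borel_measurable_const n measurable_compose[OF n red_measurable])
    from measurable_compose[OF this Db(1)] have "D \<in> borel_measurable borel" unfolding D_def .
    then show ?thesis by (intro measurable_completion) simp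
  qed
  have cellS: "cyl_cell T \<subseteq> ?S" by (auto simp: cyl_cell_def strip_def)
  have ae: "AE x in lebesgue. x \<in> cyl_cell T --> cyl_grad T C x = D x"
  proof (rule eventually_mono[OF Db(2)], rule impI)
    fix x assume 1: "indicator ?S x *R cyl_grad T C x = Db x" and x: "x \<in> cyl_cell T"
    then have "red (x $ 1) = x $ 1" by (intro red(4)) (auto simp: cyl_cell_def)
    then have "D x = Db x" by (simp add: D_def V2_eta)
    then show "cyl_grad T C x = D x" using 1 x cellS by auto
  qed
  have wc: "W12_approx (cyl_cell T) w ?c D" by (rule W12_approx_cong_AE[OF w(3)]) (use ae in auto)
  have app: "W12_approx (?S \<inter> cball 0 R) w ?c D" for R unfolding W12_approx_norm
  proof (rule ennreal_squeeze_zero)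
    define h where "h n x = ennreal ((norm (w n x - ?c x))^2 + (norm (jacobian (w n) (at x) - D x))^2) * indicator ?S x" for n x
    let ?I = "{-\<lceil>R\<rceil> - 1..\<lceil>R\<rceil> + 1}" and ?Q = "{y::real^2. 0 \<le> y $ 1 \<and> y $ 1 < 2 * pi}"
    have hper: "h n (x + per) = h n x" for n x
      unfolding h_def by (simp add: cyl_lift_periodic Dper w(2) jacobian_periodic[OF w(1) w(2)] strip_def indicator_def)
    have hm: "h n \<in> borel_lebesgue" for n
    proof -
      have e: "h n = (\<lambda>x. ennreal ((norm (w n x - indicator ?S x *R ?c x))^2 + (norm (jacobian (w n) (at x) - D x))^2) * indicator ?S x)"
        by (auto simp: h_def indicator_def)
      have [measurable]: "w n \<in> borel_lebesgue" "(\<lambda>x. jacobian (w n) (at x)) \<in> borel_lebesgue"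
        by (intro continuous_lebesgue_measurable Ck1_continuous w jacobian_continuous)+
      have [measurable]: "?S \<in> sets lebesgue" using oS by simp
      note [measurable] = cm Dm
      show ?thesis unfolding e by measurable
    qed
    have Qm: "?Q \<in> sets lebesgue"
    proof -
      have "closed {y::real^2. 0 \<le> y $ 1}" "open {y::real^2. y $ 1 < 2 * pi}"
        by (intro closed_Collect_le open_Collect_less continuous_intros)+
      then have "{y::real^2. 0 \<le> y $ 1} \<inter> {y. y $ 1 < 2 * pi} \<in> sets lebesgue" by (intro sets.Int) simp_all
      moreover have "?Q = {y. 0 \<le> y $ 1} \<inter> {y. y $ 1 < 2 * pi}" by auto
      ultimately show ?thesis by (simp only:)
    qed
    show "W12_err (?S \<inter> cball 0 R) (w n) ?c D
      \<le> of_nat (card ?I) * (W12_err (cyl_cell T) (w n) ?c D)" for n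
    proof -
      have "W12_err (?S \<inter> cball 0 R) (w n) ?c D = (\<integral>\<^sup>+x\<in>cball 0 R. h n x \<partial>lebesgue)"
        by (intro nn_integral_cong) (auto simp: h_def indicator_def)
      also have "\<dots> \<le> of_nat (card ?I) * (\<integral>\<^sup>+x\<in>?Q. h n x \<partial>lebesgue)" by (rule nn_periodic[OF hm hper Qm _ periodic_cover]) simp
      also have "(\<integral>\<^sup>+x\<in>?Q. h n x \<partial>lebesgue) = W12_err (cyl_cell T) (w n) ?c D"
        by (rule nn_integral_cong_AE, rule eventually_mono[OF AE_not_line[of 1 0]]) (auto simp: h_def indicator_def strip_def cyl_cell_def)
      finally show ?thesis .
    qed
    have "(\<lambda>n. of_nat (card ?I) * (W12_err (cyl_cell T) (w n) ?c D)) \<longlonglongrightarrow> of_nat (card ?I) * 0"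
      by (intro ennreal_tendsto_cmult wc[unfolded W12_approx_norm]) (simp add: of_nat_less_top)
    then show "(\<lambda>n. of_nat (card ?I) * (W12_err (cyl_cell T) (w n) ?c D)) \<longlonglongrightarrow> 0"
      by simp
  qed
  \<comment> \<open>The gluing line is at height 0, below the open strip. The lower piece is then
    empty and the jump is zero, so gluing reduces to the statement that limits of C1 maps are
    W12.\<close>
  have "w12l ?S ?c D"
  proof (rule w12l_glue[OF oS cm _ w(1) _ w(1)])
    show "(\<lambda>x. indicator ?S x *R D x) \<in> borel_lebesgue" by (intro borel_measurable_scaleR borel_measurable_indicator Dm) (use oS in simp)
    show "W12_approx (?S \<inter> cball 0 R \<inter> {x. x $ 2 \<le> 0}) w ?c D" "W12_approx (?S \<inter> cball 0 R \<inter> {x. 0 < x $ 2}) w ?c D" for R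
      by (rule W12_approx_subset[OF app[of R]], blast)+
  qed simp
  then show ?thesis using Dper ae app by blast
qed

lemma measure_cyl_cell: "0 < T ==> measure lebesgue (cyl_cell T) = 2 * pi * T" "cyl_cell T \<in> lmeasurable"
proof -
  have e: "cyl_cell T = box (V2 0 0) (V2 (2 * pi) T)" by (auto simp: cyl_cell_def mem_box_cart forall_2)
  show "cyl_cell T \<in> lmeasurable" unfolding e by simp
  show "measure lebesgue (cyl_cell T) = 2 * pi * T" if "0 < T" unfolding e using that one_neq_two
    by (subst measure_completion) (auto simp: measure_lborel_box_eq Basis_real2 inner_axis axis_eq_axis)
qed

text \<open>Inverse of \<open>cyl_lift\<close> on periodic maps: estimates are made on the strip,
  and this returns to the cylinder, on which the synharmony distance is defined.\<close>

definition cyl_map :: "(real^2 => 'b) => (real^2) \<times> real => 'b" where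
  "cyl_map V p = V (V2 (ang (fst p)) (snd p))"

lemma cyl_lift_map: "(\<And>x. V (x + per) = V x) ==> cyl_lift (cyl_map V) = V"
  using periodic_red[of V] by (auto simp: cyl_lift_def cyl_map_def ang_circ)

text \<open>The cutoff depends on the height only, so the product stays periodic and its
  mollifications do as well.\<close>

lemma w12l_half_plane_approx:
  fixes V :: "real^2 => real^'n"
  assumes V: "w12l {x. x $ 2 < T + \<delta>} V DV" "\<And>x. V (x + per) = V x" and \<delta>: "0 < \<delta>"
  obtains M where "\<And>n. C1_on (M n) UNIV" "\<And>n x. M n (x + per) = M n x"
    "\<And>E R. E \<subseteq> cball 0 R ==> (\<And>x. x \<in> E ==> x $ 2 < T) ==> W12_approx E M V DV"
proof -
  define \<zeta> :: "real^2 => real" where "\<zeta> x = ramp T (T + \<delta> / 2) (x $ 2)" for x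
  have lin: "C1_on (\<lambda>x::real^2. x $ 2) UNIV" by (intro Ck1_bounded_linear bounded_linear_vec_nth) simp
  have \<zeta>: "C1_on \<zeta> UNIV" unfolding \<zeta>_def[abs_def] by (intro Ck1_ramp lin) (use \<delta> in auto)
  let ?C = "{x::real^2. x $ 2 \<le> T + \<delta> / 2}"
  have C: "closed ?C" "?C \<subseteq> {x. x $ 2 < T + \<delta>}" using \<delta> by (auto intro!: closed_Collect_le continuous_intros)
  have z: "\<zeta> x = 0" if "x \<notin> ?C" for x using that by (auto simp: \<zeta>_def ramp_simps(2))
  have one: "\<zeta> x = 1" if "x $ 2 < T" for x using that \<delta> by (auto simp: \<zeta>_def ramp_simps(1))
  have p: "frechet_derivative \<zeta> (at x) = (\<lambda>v. 0)" if "x $ 2 < T" for x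
  proof -
    have "open {x::real^2. x $ 2 < T}" by (intro open_Collect_less continuous_intros)
    then have "(\<zeta> has_derivative (\<lambda>v. 0)) (at x)"
      by (rule has_derivative_transform_within_open[OF has_derivative_const[of 1]]) (use that in \<open>auto simp: one\<close>)
    then show ?thesis by (rule frechet_derivative_at[symmetric])
  qed
  obtain M where M: "\<And>n. C1_on (M n) UNIV"
    "\<And>r. W12_approx (cball 0 r) M (\<lambda>x. \<zeta> x *R V x) (\<lambda>x. \<zeta> x *R DV x + outer (V x) (\<lambda>j. pd \<zeta> j x))"
    "\<forall>q. (\<forall>y. \<zeta> (y + q) *R V (y + q) = \<zeta> y *R V y) --> (\<forall>n x. M n (x + q) = M n x)"
    using w12l_mollify[OF w12l_cutoff[OF V(1) \<zeta> C z]] by blast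
  show ?thesis
  proof (rule that[OF M(1)])
    have "\<zeta> (y + per) *R V (y + per) = \<zeta> y *R V y" for y by (simp add: V(2) \<zeta>_def)
    then show "M n (x + per) = M n x" for n x using M(3) by blast
    fix E :: "(real^2) set" and R :: real assume E: "E \<subseteq> cball 0 R" "\<And>x. x \<in> E ==> x $ 2 < T"
    show "W12_approx E M V DV"
    proof (rule W12_approx_cong_AE[OF W12_approx_subset[OF M(2) E(1)]], intro AE_I2 impI)
      fix x assume "x \<in> E"
      then show "\<zeta> x *R V x = V x \<and> \<zeta> x *R DV x + outer (V x) (\<lambda>j. pd \<zeta> j x) = DV x" by (simp add: one p E(2) outer_def vec_eq_iff)
    qed
  qed
qed

text \<open>V is defined beyond both ends of the cylinder, hence its mollifications are C1 up to the
  ends. The prescribed traces, witnessed by other sequences on collars, pass to the mollifications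
  by uniqueness of traces, and V becomes a competitor.\<close>

lemma synh_dist_le:
  fixes V :: "real^2 => real^'n"
  assumes V: "w12l {x. x $ 2 < T + \<delta>} V DV" "\<And>x. V (x + per) = V x" and \<delta>: "0 < \<delta>" and T: "0 < T"
    and N: "AE x in lebesgue. x $ 2 < T + \<delta> --> V x \<in> N"
    and g: "(\<lambda>\<theta>. g (circ \<theta>)) \<in> borel_lebesgue"
    and v: "0 < \<tau>" "\<tau> \<le> T" "\<And>n. C1_on (v n) UNIV" "W12_approx (tcell 0 1 \<tau>) v V DV"
      "L2conv (\<lambda>n \<theta>. v n (V2 \<theta> 0)) (\<lambda>n \<theta>. g (circ \<theta>))"
    and \<gamma>: "(\<lambda>\<theta>. \<gamma> (circ \<theta>)) \<in> borel_lebesgue"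
    and v': "0 < \<tau>'" "\<And>n. C1_on (v' n) UNIV" "W12_approx (tcell T (-1) \<tau>') v' V DV"
      "L2conv (\<lambda>n \<theta>. v' n (V2 \<theta> T)) (\<lambda>n \<theta>. \<gamma> (circ \<theta>))"
  shows "synh_dist N g \<gamma> \<le> ereal ((LINT x:cyl_cell T|lebesgue. (norm (DV x))^2) / 2 - (min_length N g)^2 / (4 * pi) * T)"
proof -
  let ?H = "{x::real^2. x $ 2 < T + \<delta>}"
  have oH: "open ?H" by (intro open_Collect_less continuous_intros)
  obtain M where M: "\<And>n. C1_on (M n) UNIV" "\<And>n x. M n (x + per) = M n x"
    "\<And>E R. E \<subseteq> cball 0 R ==> (\<And>x. x \<in> E ==> x $ 2 < T) ==> W12_approx E M V DV" using w12l_half_plane_approx[OF V \<delta>] by blast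
  let ?u = "cyl_map V"
  have lu: "cyl_lift ?u = V" by (rule cyl_lift_map) (rule V(2))
  have lm: "cyl_lift (cyl_map (M n)) = M n" for n by (rule cyl_lift_map) (rule M(2))
  have sH: "strip T \<subseteq> ?H" using \<delta> by (auto simp: strip_def)
  have sw: "has_weak_grad (strip T) V DV" using w12l_subset[OF V(1) sH] by (simp add: w12l_def)
  have ae: "AE x in lebesgue. x \<in> strip T --> DV x = cyl_grad T ?u x"
    unfolding cyl_grad_def lu by (rule has_weak_grad_unique[OF open_strip sw has_weak_grad_weak_grad[OF sw]])
  have cs: "cyl_cell T \<subseteq> strip T" by (auto simp: cyl_cell_def strip_def)
  have aec: "AE x in lebesgue. x \<in> cyl_cell T --> (norm (DV x))^2 = frob (cyl_grad T ?u x) (cyl_grad T ?u x)"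
    by (rule eventually_mono[OF ae]) (use cs in \<open>auto simp: frob_norm\<close>)
  have cb: "cyl_cell T \<subseteq> cball 0 (2 * pi + T)"
  proof
    fix x assume "x \<in> cyl_cell T"
    then show "x \<in> cball 0 (2 * pi + T)" using norm_V2_le[of x] by (auto simp: cyl_cell_def)
  qed
  have cm: "cyl_cell T \<in> sets lebesgue" using open_cyl_cell by simp
  have int: "lset_int (cyl_cell T) (\<lambda>x. (norm (V x))^2)" "lset_int (cyl_cell T) (\<lambda>x. (norm (DV x))^2)"
  proof -
    define K where "K = cball (0::real^2) (2 * pi + T) \<inter> {x. x $ 2 \<le> T}"
    have K: "compact K" "K \<subseteq> ?H" "cyl_cell T \<subseteq> K"
      using \<delta> cb by (auto simp: K_def cyl_cell_def intro!: compact_Int_closed closed_Collect_le continuous_intros)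
    have i: "lset_int K (\<lambda>x. (norm (V x))^2)" "lset_int K (\<lambda>x. (norm (DV x))^2)" using V(1) K by (auto simp: w12l_def loc_int_def)
    show "lset_int (cyl_cell T) (\<lambda>x. (norm (V x))^2)" by (rule set_integrable_subset[OF i(1) cm K(3)])
    show "lset_int (cyl_cell T) (\<lambda>x. (norm (DV x))^2)" by (rule set_integrable_subset[OF i(2) cm K(3)])
  qed
  have W: "W12_cyl T N ?u" unfolding W12_cyl_def lu
  proof (intro conjI exI[of _ DV])
    show "AE x in lebesgue. x \<in> strip T --> V x \<in> N" by (rule eventually_mono[OF N]) (use sH in auto)
  qed (use int sw in \<open>simp_all add: frob_norm\<close>)
  have Mapp: "W12_approx (cyl_cell T) M V DV" by (rule M(3)[OF cb]) (auto simp: cyl_cell_def)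
  have Mc: "W12_approx (cyl_cell T) (\<lambda>n. cyl_lift (cyl_map (M n))) (cyl_lift ?u) (cyl_grad T ?u)"
    unfolding lm lu by (rule W12_approx_cong_AE[OF Mapp]) (rule eventually_mono[OF ae], use cs in auto)
  have val: "cyl_map (M n) (circ \<theta>, t) = M n (V2 \<theta> t)" for n \<theta> t
    using lm[of n] by (auto simp: cyl_lift_def fun_eq_iff dest: spec[of _ "V2 \<theta> t"])
  have tr: "has_cyl_trace T ?u t q"
    if q: "(\<lambda>\<theta>. q (circ \<theta>)) \<in> borel_lebesgue" "L2conv (\<lambda>n \<theta>. M n (V2 \<theta> t)) (\<lambda>n \<theta>. q (circ \<theta>))" for t q
    unfolding has_cyl_trace_def One_nat_def using q Mc M(1) by (intro conjI exI[of _ "\<lambda>n. cyl_map (M n)"]) (simp_all add: lm val L2conv_def)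
  have tH: "tcell 0 1 \<tau> \<subseteq> ?H" "tcell T (-1) \<tau>' \<subseteq> ?H" using v(2) \<delta> by (auto simp: tcell_def)
  have t0: "has_cyl_trace T ?u 0 g"
  proof (rule tr[OF g])
    have "W12_approx (tcell 0 1 \<tau>) M V DV" by (rule M(3)[OF tcell_bounded]) (use v(2) in \<open>auto simp: tcell_def\<close>)
    then show "L2conv (\<lambda>n \<theta>. M n (V2 \<theta> 0)) (\<lambda>n \<theta>. g (circ \<theta>))"
      by (rule strip_trace_unique[OF v(1) _ w12l_measurable[OF V(1) open_tcell tH(1)] v(3,4) M(1) _ g v(5), rotated]) simp
  qed
  have tT: "has_cyl_trace T ?u T \<gamma>"
  proof (rule tr[OF \<gamma>])
    have "W12_approx (tcell T (-1) \<tau>') M V DV" by (rule M(3)[OF tcell_bounded]) (auto simp: tcell_def)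
    then show "L2conv (\<lambda>n \<theta>. M n (V2 \<theta> T)) (\<lambda>n \<theta>. \<gamma> (circ \<theta>))"
      by (rule strip_trace_unique[OF v'(1) _ w12l_measurable[OF V(1) open_tcell tH(2)] v'(2,3) M(1) _ \<gamma> v'(4), rotated]) simp
  qed
  let ?k = "(min_length N g)^2 / (8 * pi^2)"
  have "(LINT x:cyl_cell T|lebesgue. frob (cyl_grad T ?u x) (cyl_grad T ?u x) / 2 - ?k) = (LINT x:cyl_cell T|lebesgue. (norm (DV x))^2) / 2 - (min_length N g)^2 / (4 * pi) * T"
  proof -
    note e = set_integrable_cong_AE'[OF int(2) aec]
    have i: "lset_int (cyl_cell T) (\<lambda>x. frob (cyl_grad T ?u x) (cyl_grad T ?u x) / 2)" using e(1) by (rule set_integrable_divide)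
    have k: "lset_int (cyl_cell T) (\<lambda>x. ?k)" 
    proof -
      have "integrable lebesgue (indicator (cyl_cell T) :: real^2 => real)"
        using measure_cyl_cell(2)[of T] lmeasurable_iff_integrable by blast
      then show ?thesis unfolding set_integrable_def by (rule integrable_scaleR_left)
    qed
    have "(LINT x:cyl_cell T|lebesgue. frob (cyl_grad T ?u x) (cyl_grad T ?u x) / 2 - ?k)
      = (LINT x:cyl_cell T|lebesgue. frob (cyl_grad T ?u x) (cyl_grad T ?u x) / 2) - (LINT x:cyl_cell T|lebesgue. ?k)"
      by (rule set_integral_diff(2)[OF i k])
    also have "(LINT x:cyl_cell T|lebesgue. ?k) = measure lebesgue (cyl_cell T) * ?k"
      unfolding set_lebesgue_integral_def using measure_cyl_cell(2)[of T] by (simp add: fmeasurable_def)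
    \<comment> \<open>The cell has area 2 pi T, which turns the density with 8 pi^2 into the factor
      with 4 pi.\<close>
    also have "\<dots> = (min_length N g)^2 / (4 * pi) * T" unfolding measure_cyl_cell(1)[OF T] by (simp add: field_simps power2_eq_square)
    finally show ?thesis using e(2) by simp
  qed
  then have "ereal ((LINT x:cyl_cell T|lebesgue. (norm (DV x))^2) / 2 - (min_length N g)^2 / (4 * pi) * T)
    \<in> {ereal (LINT x:cyl_cell T|lebesgue. frob (cyl_grad T u x) (cyl_grad T u x) / 2 - (min_length N g)^2 / (8 * pi^2)) |T u.
          0 < T \<and> W12_cyl T N u \<and> has_cyl_trace T u 0 g \<and> has_cyl_trace T u T \<gamma>}"
    using T W t0 tT by (intro CollectI exI[of _ T] exI[of _ ?u]) simp
  then show ?thesis unfolding synh_dist_def by (rule Inf_lower)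
qed

lemma aff_approx:
  fixes c :: "real^2 => real^'n"
  assumes U: "open U" "loc_int U c" "loc_int U D" and w: "\<And>n. C1_on (w n) UNIV" "W12_approx U w c D"
    and a: "a \<noteq> 0" and E: "E \<in> sets lebesgue" "E \<subseteq> cball 0 r" "\<And>x. x \<in> E ==> aff a b x \<in> U"
  shows "W12_approx E (\<lambda>n x. w n (aff a b x)) (\<lambda>x. c (aff a b x)) (\<lambda>x. D (aff a b x) ** AJ a)"
proof -
  interpret p: local_diffeo "aff a b" UNIV by (rule aff_local_diffeo[OF a open_UNIV])
  show ?thesis using p.W12_approx_compose[OF E(2) compact_cball subset_UNIV E(1) aff_inj[OF a] _ U w] E(3) unfolding jacobian_aff by blast
qed

lemma W12_approx_cong_set:
  assumes "W12_approx E w f D" "AE x in lebesgue. x \<in> E' --> x \<in> E \<and> f' x = f x \<and> D' x = D x"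
  shows "W12_approx E' w f' D'" unfolding W12_approx_norm
proof (rule ennreal_squeeze_zero[OF _ assms(1)[unfolded W12_approx_norm]])
  show "W12_err E' (w n) f' D'
    \<le> W12_err E (w n) f D" for n
    by (rule nn_integral_mono_AE, rule eventually_mono[OF assms(2)]) (auto simp: indicator_def)
qed

lemma L2conv_periodic:
  assumes p: "\<And>n. continuous_on UNIV (p n)" "\<And>n. continuous_on UNIV (q n)"
    and per: "\<And>n \<theta>. p n (\<theta> + 2 * pi) = p n \<theta>" "\<And>n \<theta>. q n (\<theta> + 2 * pi) = q n \<theta>" and l: "L2conv p q"
  shows "(\<lambda>n. \<integral>\<^sup>+\<theta>\<in>{-R..R}. ennreal ((norm (p n \<theta> - q n \<theta>))^2) \<partial>lebesgue) \<longlonglongrightarrow> 0"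
proof (rule ennreal_squeeze_zero)
  let ?I = "{-\<lceil>R\<rceil> - 1..\<lceil>R\<rceil> + 1}"
  show "(\<integral>\<^sup>+\<theta>\<in>{-R..R}. ennreal ((norm (p n \<theta> - q n \<theta>))^2) \<partial>lebesgue)
    \<le> of_nat (card ?I) * (\<integral>\<^sup>+\<theta>\<in>{0..2*pi}. ennreal ((norm (p n \<theta> - q n \<theta>))^2) \<partial>lebesgue)" for n
  proof (rule nn_periodic[where d = "2 * pi"])
    show "(\<lambda>\<theta>. ennreal ((norm (p n \<theta> - q n \<theta>))^2)) \<in> borel_lebesgue"
      by (intro measurable_compose[OF _ measurable_ennreal] continuous_lebesgue_measurable continuous_intros p)
    show "{-R..R} \<subseteq> (\<Union>k\<in>?I. {x. x + of_int k *R (2 * pi) \<in> {0..2*pi}})"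
    proof
      fix \<theta> assume "\<theta> \<in> {-R..R}"
      then have "V2 \<theta> 0 \<in> cball 0 R" using norm_V2_le[of "V2 \<theta> 0"] by auto
      then obtain k where "k \<in> ?I" "V2 \<theta> 0 + of_int k *R per \<in> {y. 0 \<le> y $ 1 \<and> y $ 1 < 2 * pi}" using periodic_cover[of R] by blast
      then show "\<theta> \<in> (\<Union>k\<in>?I. {x. x + of_int k *R (2 * pi) \<in> {0..2*pi}})" by auto
    qed
  qed (simp_all add: per)
  have "(\<lambda>n. of_nat (card ?I) * (\<integral>\<^sup>+\<theta>\<in>{0..2*pi}. ennreal ((norm (p n \<theta> - q n \<theta>))^2) \<partial>lebesgue)) \<longlonglongrightarrow> of_nat (card ?I) * 0"
    by (intro ennreal_tendsto_cmult l[unfolded L2conv_def]) (simp add: of_nat_less_top)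
  then show "(\<lambda>n. of_nat (card ?I) * (\<integral>\<^sup>+\<theta>\<in>{0..2*pi}. ennreal ((norm (p n \<theta> - q n \<theta>))^2) \<partial>lebesgue)) \<longlonglongrightarrow> 0" by simp
qed

section \<open>Extension of the annulus by a stretched cylinder\<close>

lemma open_band: "open {x::real^2. a < x $ 2 \<and> x $ 2 < b}" "open {x::real^2. x $ 2 < b}"
  by (intro open_Collect_conj open_Collect_less continuous_intros)+

lemma Ck1_aff: "C1_on F UNIV ==> a \<noteq> 0 ==> C1_on (\<lambda>x. F (aff a b x)) UNIV"
  by (rule Ck1_compose[OF open_UNIV open_UNIV _ local_diffeo.C1[OF aff_local_diffeo[OF _ open_UNIV]] subset_UNIV])

text \<open>Below the circle of radius \<open>r0\<close> we use polar coordinates, above it a stretched cylinder, and then its mirror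
  image, which makes the top circle interior.\<close>

lemma cylinder_extension:
  fixes u :: "real^2 => real^'n"
  assumes A: "w12l A u Du" "open A" "ball s R - {s} \<subseteq> A" and r0: "0 < r0" "r0 < R"
    and N: "AE x in lebesgue. x \<in> A --> u x \<in> N"
    and C: "0 < T0" "W12_cyl T0 N C" "has_cyl_trace T0 C 0 (circle_trace u s r0)" "has_cyl_trace T0 C T0 \<gamma>" and L: "0 < L"
  shows "\<exists>V DV v. w12l {x. x $ 2 < L * T0 + L * T0} V DV \<and> (\<forall>x. V (x + per) = V x) \<and>
    (AE x in lebesgue. x $ 2 < L * T0 + L * T0 --> V x \<in> N) \<and>
    (\<forall>x. x $ 2 \<le> 0 --> V x = u (pol s r0 x) \<and> DV x = Du (pol s r0 x) ** PJ r0 x) \<and>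
    (\<forall>n. C1_on (v n) UNIV) \<and> W12_approx (cyl_cell (L * T0)) v V DV \<and>
    L2conv (\<lambda>n \<theta>. v n (V2 \<theta> (L * T0))) (\<lambda>n \<theta>. \<gamma> (circ \<theta>))"
proof -
  define T where "T = L * T0"
  have T: "0 < T" "T / L = T0" using L C(1) by (auto simp: T_def)
  define c where "c = cyl_lift C"
  have cper: "c (x + per) = c x" for x unfolding c_def by (rule cyl_lift_periodic)
  let ?g = "circle_trace u s r0"
  obtain w0 where w0: "\<And>n. C1_on (cyl_lift (w0 n)) UNIV" "W12_approx (cyl_cell T0) (\<lambda>n. cyl_lift (w0 n)) c (cyl_grad T0 C)"
    and w0t: "(\<lambda>n. \<integral>\<^sup>+\<theta>\<in>{0..2*pi}. ennreal ((norm (w0 n (circ \<theta>, 0) - ?g (circ \<theta>)))^2) \<partial>lebesgue) \<longlonglongrightarrow> 0"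
    using C(3) unfolding has_cyl_trace_def One_nat_def c_def by blast
  obtain w1 where w1: "\<And>n. C1_on (cyl_lift (w1 n)) UNIV" "W12_approx (cyl_cell T0) (\<lambda>n. cyl_lift (w1 n)) c (cyl_grad T0 C)"
    and w1t: "(\<lambda>n. \<integral>\<^sup>+\<theta>\<in>{0..2*pi}. ennreal ((norm (w1 n (circ \<theta>, T0) - \<gamma> (circ \<theta>)))^2) \<partial>lebesgue) \<longlonglongrightarrow> 0"
    using C(4) unfolding has_cyl_trace_def One_nat_def c_def by blast
  define c0 where "c0 n = cyl_lift (w0 n)" for n
  define c1 where "c1 n = cyl_lift (w1 n)" for n
  have c0C: "C1_on (c0 n) UNIV" and c1C: "C1_on (c1 n) UNIV" for n using w0 w1 by (auto simp: c0_def c1_def)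
  have c0per: "c0 n (x + per) = c0 n x" for n x unfolding c0_def by (rule cyl_lift_periodic)
  obtain D where D: "w12l (strip T0) c D" "\<And>x. D (x + per) = D x"
    "AE x in lebesgue. x \<in> cyl_cell T0 --> cyl_grad T0 C x = D x" "\<And>R. W12_approx (strip T0 \<inter> cball 0 R) c0 c D"
    using cyl_extend[OF C(2) c0C c0per w0(2)[unfolded c_def, folded c0_def]] unfolding c_def by blast
  have c1D: "W12_approx (cyl_cell T0) c1 c D" using W12_approx_cong_AE[OF w1(2), of c D] D(3) unfolding c1_def by auto
  have cl: "loc_int (strip T0) c" "loc_int (strip T0) D" using D(1) by (auto simp: w12l_def dest: has_weak_gradD)
  have cN: "AE x in lebesgue. x \<in> strip T0 --> c x \<in> N" using C(2) by (auto simp: W12_cyl_def c_def)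
  have iL: "1 / L \<noteq> 0" "- 1 / L \<noteq> 0" using L by auto
  define b where "b = ln (R / r0)"
  have b: "0 < b" using r0 by (simp add: b_def field_simps)
  let ?H0 = "{x::real^2. x $ 2 < b}" and ?P2 = "{x::real^2. 0 < x $ 2 \<and> x $ 2 < T}" and ?P3 = "{x::real^2. T < x $ 2 \<and> x $ 2 < T + T}"
  define f1 where "f1 x = u (pol s r0 x)" for x
  define D1 where "D1 x = Du (pol s r0 x) ** PJ r0 x" for x
  define f2 where "f2 x = c (aff (1 / L) 0 x)" for x
  define D2 where "D2 x = D (aff (1 / L) 0 x) ** AJ (1 / L)" for x
  \<comment> \<open>Height t is read at 2 T0 - t / L: the reflected copy starts at the upper end T0
    and runs back to 0 as t goes from T to 2 T.\<close>
  define f3 where "f3 x = c (aff (- 1 / L) (2 * T0) x)" for x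
  define D3 where "D3 x = D (aff (- 1 / L) (2 * T0) x) ** AJ (- 1 / L)" for x
  \<comment> \<open>The value on the line at height T is arbitrary, since a line is a null
    set.\<close>
  define V where "V x = (if x $ 2 \<le> 0 then f1 x else if x $ 2 < T then f2 x else if T < x $ 2 then f3 x else 0)" for x
  define DV where "DV x = (if x $ 2 \<le> 0 then D1 x else if x $ 2 < T then D2 x else if T < x $ 2 then D3 x else 0)" for x
  have in1: "pol s r0 x \<in> A" if "x $ 2 < b" for x
  proof -
    have "exp (x $ 2) < R / r0" using that r0 by (metis b_def divide_pos_pos exp_less_mono exp_ln order_less_trans)
    then have "r0 * exp (x $ 2) < R" "0 < r0 * exp (x $ 2)" using r0 by (simp_all add: field_simps)
    then have "pol s r0 x \<in> ball s R" "pol s r0 x \<noteq> s" using dist_pol[OF r0(1), of s x] by auto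
    then show ?thesis using A(3) by blast
  qed
  have in2: "aff (1 / L) 0 x \<in> strip T0" if "0 < x $ 2" "x $ 2 < T" for x using that L by (simp add: strip_def aff_def T_def field_simps)
  have in3: "aff (- 1 / L) (2 * T0) x \<in> strip T0" if "T < x $ 2" "x $ 2 < T + T" for x
    using that L by (simp add: strip_def aff_def T_def field_simps)
  interpret p1: local_diffeo "pol s r0" ?H0 by (rule pol_local_diffeo[OF r0(1) open_band(2)])
  interpret p2: local_diffeo "aff (1 / L) 0" ?P2 by (rule aff_local_diffeo[OF iL(1) open_band(1)])
  interpret p3: local_diffeo "aff (- 1 / L) (2 * T0)" ?P3 by (rule aff_local_diffeo[OF iL(2) open_band(1)])
  have w_1: "w12l ?H0 f1 D1" using p1.w12l_compose[OF A(1,2)] in1 unfolding jacobian_pol f1_def[abs_def] D1_def[abs_def] by blast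
  have w_2: "w12l ?P2 f2 D2" using p2.w12l_compose[OF D(1) open_strip] in2 unfolding jacobian_aff f2_def[abs_def] D2_def[abs_def] by blast
  have w_3: "w12l ?P3 f3 D3" using p3.w12l_compose[OF D(1) open_strip] in3 unfolding jacobian_aff f3_def[abs_def] D3_def[abs_def] by blast
  note m1 = w12l_measurable[OF w_1 open_band(2) subset_refl]
  note m2 = w12l_measurable[OF w_2 open_band(1) subset_refl]
  note m3 = w12l_measurable[OF w_3 open_band(1) subset_refl]
  have m0: "(\<lambda>x::real^2. indicator {x. x $ 2 \<le> 0} x :: real) \<in> borel_lebesgue"
  proof -
    have "closed {x::real^2. x $ 2 \<le> 0}" by (intro closed_Collect_le continuous_intros)
    then show ?thesis by (intro borel_measurable_indicator) simp
  qed
  let ?G = "{x::real^2. x $ 2 < T + T}"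
  have Ve: "indicator ?G x *R V x = indicator {x. x $ 2 \<le> 0} x *R (indicator ?H0 x *R f1 x) + indicator ?P2 x *R f2 x + indicator ?P3 x *R f3 x" for x
    using T b by (auto simp: V_def indicator_def)
  have De: "indicator ?G x *R DV x = indicator {x. x $ 2 \<le> 0} x *R (indicator ?H0 x *R D1 x) + indicator ?P2 x *R D2 x + indicator ?P3 x *R D3 x" for x
    using T b by (auto simp: DV_def indicator_def)
  have Vm: "(\<lambda>x. indicator ?G x *R V x) \<in> borel_lebesgue" "(\<lambda>x. indicator ?G x *R DV x) \<in> borel_lebesgue"
    unfolding Ve De by (intro borel_measurable_add borel_measurable_scaleR m0 m1 m2 m3)+
  have VmU: "(\<lambda>x. indicator U x *R V x) \<in> borel_lebesgue" "(\<lambda>x. indicator U x *R DV x) \<in> borel_lebesgue"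
    if "open U" "U \<subseteq> ?G" for U
  proof -
    have e: "(\<lambda>x. indicator U x *R F x) = (\<lambda>x. indicator U x *R (indicator ?G x *R F x))" for F :: "real^2 => 'b::real_vector"
    proof (rule ext)
      show "indicator U x *R F x = indicator U x *R (indicator ?G x *R F x)" for x
      proof (cases "x \<in> U")
        case True
        then have "x \<in> ?G" using that(2) by blast
        then show ?thesis by simp
      qed simp
    qed
    have i: "(indicator U :: real^2 => real) \<in> borel_lebesgue" using that(1) by (intro borel_measurable_indicator) simp
    show "(\<lambda>x. indicator U x *R V x) \<in> borel_lebesgue" "(\<lambda>x. indicator U x *R DV x) \<in> borel_lebesgue"
      by (subst e, intro borel_measurable_scaleR i Vm)+
  qed
  have Vper: "V (x + per) = V x" for x
  proof -
    have a: "aff p q (x + per) = aff p q x + per" for p q by (simp add: aff_def vec_eq_iff forall_2)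
    show ?thesis by (simp add: V_def f1_def f2_def f3_def a cper pol_periodic)
  qed
  obtain v1 where v1: "\<And>n. C1_on (v1 n) UNIV" "\<And>n x. v1 n (x + per) = v1 n x"
    "\<And>E R. E \<subseteq> cball 0 R ==> (\<And>x. x \<in> E ==> x $ 2 < b / 2) ==> W12_approx E v1 f1 D1"
  proof (rule w12l_half_plane_approx[of "b / 2" "b / 2" f1 D1])
    show "w12l {x. x $ 2 < b / 2 + b / 2} f1 D1" using w_1 by simp
    show "f1 (x + per) = f1 x" for x by (simp add: f1_def pol_periodic)
  qed (use b in auto)
  define v2 where "v2 n x = c0 n (aff (1 / L) 0 x)" for n x
  define v3 where "v3 n x = c0 n (aff (- 1 / L) (2 * T0) x)" for n x
  have v2C: "C1_on (v2 n) UNIV" and v3C: "C1_on (v3 n) UNIV" for n unfolding v2_def[abs_def] v3_def[abs_def] by (intro Ck1_aff c0C iL)+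
  have app: "W12_approx E (\<lambda>n x. c0 n (aff p q x)) (\<lambda>x. c (aff p q x)) (\<lambda>x. D (aff p q x) ** AJ p)"
    if p: "p \<noteq> 0" and E: "E \<in> sets lebesgue" "E \<subseteq> cball 0 r" "\<And>x. x \<in> E ==> aff p q x \<in> strip T0" for E p q r
  proof -
    define r' where "r' = r + \<bar>p\<bar> * r + \<bar>q\<bar> + 1"
    have nr: "aff p q x \<in> ball 0 r'" if "x \<in> E" for x
    proof -
      have x: "\<bar>x $ 1\<bar> \<le> r" "\<bar>x $ 2\<bar> \<le> r" using E(2) that component_le_norm_cart[of x 1] component_le_norm_cart[of x 2] by (auto simp: subset_iff intro: order_trans)
      have "norm (aff p q x) \<le> \<bar>x $ 1\<bar> + \<bar>p * x $ 2 + q\<bar>" using norm_V2_le[of "aff p q x"] by (simp add: aff_def)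
      also have "\<bar>p * x $ 2 + q\<bar> \<le> \<bar>p\<bar> * \<bar>x $ 2\<bar> + \<bar>q\<bar>" using abs_triangle_ineq[of "p * x $ 2" q] by (simp add: abs_mult)
      also have "\<bar>p\<bar> * \<bar>x $ 2\<bar> \<le> \<bar>p\<bar> * r" by (intro mult_left_mono x) simp
      finally show ?thesis using x(1) by (simp add: r'_def)
    qed
    have s: "strip T0 \<inter> ball 0 r' \<subseteq> strip T0" "strip T0 \<inter> ball 0 r' \<subseteq> strip T0 \<inter> cball 0 r'" by auto
    show ?thesis
      by (rule aff_approx[OF _ loc_int_subset[OF cl(1) s(1)] loc_int_subset[OF cl(2) s(1)] c0C W12_approx_subset[OF D(4) s(2)] p E(1,2)])
         (use nr E(3) open_strip in auto)
  qed
  have a2: "W12_approx (?P2 \<inter> cball 0 r) v2 f2 D2" for r unfolding v2_def[abs_def] f2_def[abs_def] D2_def[abs_def]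
  proof (rule app[OF iL(1)])
    show "?P2 \<inter> cball 0 r \<in> sets lebesgue" using open_band(1)[of 0 T] by (intro sets.Int) simp_all
  qed (use in2 in auto)
  have a3: "W12_approx (?P3 \<inter> cball 0 r) v3 f3 D3" for r unfolding v3_def[abs_def] f3_def[abs_def] D3_def[abs_def]
  proof (rule app[OF iL(2)])
    show "?P3 \<inter> cball 0 r \<in> sets lebesgue" using open_band(1)[of T "T + T"] by (intro sets.Int) simp_all
  qed (use in3 in auto)
  have lift_val: "cyl_lift F (V2 \<theta> t) = F (circ \<theta>, t)" for F :: "(real^2) \<times> real => real^'n" and \<theta> t by (simp add: cyl_lift_def)
  have gm: "(\<lambda>\<theta>. ?g (circ \<theta>)) \<in> borel_lebesgue" using polar_trace[OF A(1,3) r0] by blast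
  have mV2: "(\<lambda>\<theta>. F (V2 \<theta> t)) \<in> borel_lebesgue" and cV2: "continuous_on UNIV (\<lambda>\<theta>. F (V2 \<theta> t))"
    if "C1_on F UNIV" for F :: "real^2 => real^'n" and t
  proof -
    show "continuous_on UNIV (\<lambda>\<theta>. F (V2 \<theta> t))" by (intro continuous_on_compose2[OF Ck1_continuous[OF that] V2_cont(2)]) auto
    then show "(\<lambda>\<theta>. F (V2 \<theta> t)) \<in> borel_lebesgue" by (rule continuous_lebesgue_measurable)
  qed
  have v2val: "v2 n (V2 \<theta> 0) = w0 n (circ \<theta>, 0)" for n \<theta> by (simp add: v2_def aff_def c0_def lift_val)
  have t2: "L2conv (\<lambda>n \<theta>. v2 n (V2 \<theta> 0)) (\<lambda>n \<theta>. ?g (circ \<theta>))" using w0t by (simp add: L2conv_def v2val)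
  \<comment> \<open>The circle trace is taken from outside, that is from heights above 0, whereas V
    uses u below 0. The maps v1 approximate u on both sides and have one value on the line, so the
    outer trace is also the one seen from below.\<close>
  have t1: "L2conv (\<lambda>n \<theta>. v1 n (V2 \<theta> 0)) (\<lambda>n \<theta>. ?g (circ \<theta>))"
  proof -
    obtain \<tau> v where \<tau>: "0 < \<tau>" and v: "\<And>n. C1_on (v n) UNIV" "W12_approx (tcell 0 1 \<tau>) v f1 D1"
      "L2conv (\<lambda>n \<theta>. v n (V2 \<theta> 0)) (\<lambda>n \<theta>. ?g (circ \<theta>))" using polar_trace[OF A(1,3) r0] unfolding f1_def[abs_def] D1_def[abs_def] by blast
    define \<tau>' where "\<tau>' = min \<tau> (b / 4)"
    have \<tau>': "0 < \<tau>'" using \<tau> b by (simp add: \<tau>'_def)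
    have sub: "tcell 0 1 \<tau>' \<subseteq> tcell 0 1 \<tau>" "tcell 0 1 \<tau>' \<subseteq> ?H0" using b by (auto simp: tcell_def \<tau>'_def)
    have "W12_approx (tcell 0 1 \<tau>') v1 f1 D1" by (rule v1(3)[OF tcell_bounded]) (use b in \<open>auto simp: tcell_def \<tau>'_def\<close>)
    then show ?thesis
      by (rule strip_trace_unique[OF \<tau>' _ w12l_measurable[OF w_1 open_tcell sub(2)] v(1) W12_approx_subset[OF v(2) sub(1)] v1(1) _ gm v(3), rotated]) simp
  qed
  have jump0: "(\<lambda>n. \<integral>\<^sup>+\<theta>\<in>{-r..r}. ennreal ((norm (v2 n (V2 \<theta> 0) - v1 n (V2 \<theta> 0)))^2) \<partial>lebesgue) \<longlonglongrightarrow> 0" for r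
  proof (rule L2conv_periodic[OF cV2[OF v2C] cV2[OF v1(1)]])
    have sh: "V2 (\<theta> + 2 * pi) t = V2 \<theta> t + per" for \<theta> t by (simp add: vec_eq_iff forall_2)
    show "v1 n (V2 (\<theta> + 2 * pi) 0) = v1 n (V2 \<theta> 0)" for n \<theta> unfolding sh v1(2) ..
    show "v2 n (V2 (\<theta> + 2 * pi) 0) = v2 n (V2 \<theta> 0)" for n \<theta> unfolding v2val by (simp add: circ_def)
    show "L2conv (\<lambda>n \<theta>. v2 n (V2 \<theta> 0)) (\<lambda>n \<theta>. v1 n (V2 \<theta> 0))" by (rule L2conv_trans[OF mV2[OF v2C] gm mV2[OF v1(1)] t2 L2conv_sym[OF t1]])
  qed
  have g1: "w12l {x. -1 < x $ 2 \<and> x $ 2 < T} V DV" (is "w12l ?U1 V DV")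
  proof (rule w12l_glue[OF open_band(1) VmU v1(1) _ v2C _ jump0])
    show "W12_approx (?U1 \<inter> cball 0 r \<inter> {x. x $ 2 \<le> 0}) v1 V DV" for r
    proof (rule W12_approx_cong_set)
      show "W12_approx (cball 0 r \<inter> {x. x $ 2 \<le> 0}) v1 f1 D1" by (rule v1(3)[of _ r]) (use b in auto)
      show "AE x in lebesgue. x \<in> ?U1 \<inter> cball 0 r \<inter> {x. x $ 2 \<le> 0} --> x \<in> cball 0 r \<inter> {x. x $ 2 \<le> 0} \<and> V x = f1 x \<and> DV x = D1 x"
        by (intro AE_I2) (auto simp: V_def DV_def)
    qed
    show "W12_approx (?U1 \<inter> cball 0 r \<inter> {x. 0 < x $ 2}) v2 V DV" for r
      by (rule W12_approx_cong_set[OF a2[of r]], intro AE_I2) (auto simp: V_def DV_def)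
  qed (use T open_band(1) in auto)
  have g2: "w12l {x. 0 < x $ 2 \<and> x $ 2 < T + T} V DV" (is "w12l ?U2 V DV")
  proof (rule w12l_glue[OF open_band(1) VmU v2C _ v3C])
    show "W12_approx (?U2 \<inter> cball 0 r \<inter> {x. x $ 2 \<le> T}) v2 V DV" for r
      by (rule W12_approx_cong_set[OF a2[of r]], rule eventually_mono[OF AE_not_line[of 2 T]]) (auto simp: V_def DV_def)
    show "W12_approx (?U2 \<inter> cball 0 r \<inter> {x. T < x $ 2}) v3 V DV" for r
      by (rule W12_approx_cong_set[OF a3[of r]], intro AE_I2) (use T in \<open>auto simp: V_def DV_def\<close>)
    \<comment> \<open>By reflection the two approximations agree exactly at height T, so there is no
      jump.\<close>
    have "v3 n (V2 \<theta> T) = v2 n (V2 \<theta> T)" for n \<theta> using L by (simp add: v3_def v2_def aff_def T_def)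
    then show "(\<lambda>n. \<integral>\<^sup>+\<theta>\<in>{-r..r}. ennreal ((norm (v3 n (V2 \<theta> T) - v2 n (V2 \<theta> T)))^2) \<partial>lebesgue) \<longlonglongrightarrow> 0" for r by simp
  qed (use T open_band(1) in auto)
  have g0: "w12l {x. x $ 2 < 0} V DV"
  proof (rule w12l_cong_AE)
    show "w12l {x. x $ 2 < 0} f1 D1" by (rule w12l_subset[OF w_1]) (use b in auto)
  qed (auto simp: V_def DV_def)
  \<comment> \<open>Three overlapping open bands cover the half plane; the seams at heights 0 and T
    lie inside the second and the third.\<close>
  have W: "w12l ?G V DV"
  proof (rule w12l_locally)
    fix x :: "real^2" assume "x \<in> ?G"
    then consider "x \<in> {x. x $ 2 < 0}" | "x \<in> ?U1" | "x \<in> ?U2" using T by fastforce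
    then show "\<exists>U. open U \<and> x \<in> U \<and> w12l U V DV" by cases (use g0 g1 g2 open_band in blast)+
  qed
  have VN: "AE x in lebesgue. x $ 2 < T + T --> V x \<in> N"
  proof -
    have 1: "AE x in lebesgue. x \<in> ?H0 --> f1 x \<in> N" unfolding f1_def by (rule p1.AE_compose[OF N A(2)]) (use in1 in auto)
    have 2: "AE x in lebesgue. x \<in> ?P2 --> f2 x \<in> N" unfolding f2_def by (rule p2.AE_compose[OF cN open_strip]) (use in2 in auto)
    have 3: "AE x in lebesgue. x \<in> ?P3 --> f3 x \<in> N" unfolding f3_def by (rule p3.AE_compose[OF cN open_strip]) (use in3 in auto)
    from 1 2 3 AE_not_line[of 2 T] show ?thesis
    proof eventually_elim
      fix x assume "x \<in> ?H0 --> f1 x \<in> N" "x \<in> ?P2 --> f2 x \<in> N" "x \<in> ?P3 --> f3 x \<in> N" "x $ 2 \<noteq> T"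
      then show "x $ 2 < T + T --> V x \<in> N" using b T by (auto simp: V_def)
    qed
  qed
  have cell: "cyl_cell T \<subseteq> cball 0 (2 * pi + T)"
  proof
    fix x assume "x \<in> cyl_cell T"
    then show "x \<in> cball 0 (2 * pi + T)" using norm_V2_le[of x] by (auto simp: cyl_cell_def)
  qed
  have cellstrip: "cyl_cell T0 \<subseteq> strip T0" by (auto simp: cyl_cell_def strip_def)
  \<comment> \<open>The traces at the two ends of C may come with different approximating sequences.
    The first served at height 0; the second is stretched here to witness gamma at height T.\<close>
  have top: "W12_approx (cyl_cell T) (\<lambda>n x. c1 n (aff (1 / L) 0 x)) f2 D2" unfolding f2_def[abs_def] D2_def[abs_def]
  proof (rule aff_approx[OF open_cyl_cell loc_int_subset[OF cl(1) cellstrip] loc_int_subset[OF cl(2) cellstrip] c1C c1D iL(1) _ cell])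
    show "cyl_cell T \<in> sets lebesgue" using open_cyl_cell by simp
    show "aff (1 / L) 0 x \<in> cyl_cell T0" if "x \<in> cyl_cell T" for x using that L by (simp add: cyl_cell_def aff_def T_def field_simps)
  qed
  have topV: "W12_approx (cyl_cell T) (\<lambda>n x. c1 n (aff (1 / L) 0 x)) V DV"
    by (rule W12_approx_cong_set[OF top], intro AE_I2) (auto simp: V_def DV_def cyl_cell_def)
  have tT: "L2conv (\<lambda>n \<theta>. c1 n (aff (1 / L) 0 (V2 \<theta> T))) (\<lambda>n \<theta>. \<gamma> (circ \<theta>))"
    using w1t T(2) by (simp add: L2conv_def aff_def c1_def lift_val)
  have low: "\<forall>x. x $ 2 \<le> 0 --> V x = u (pol s r0 x) \<and> DV x = Du (pol s r0 x) ** PJ r0 x" by (simp add: V_def DV_def f1_def D1_def)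
  show ?thesis unfolding T_def[symmetric]
    by (rule exI[of _ V], rule exI[of _ DV], rule exI[of _ "\<lambda>n x. c1 n (aff (1 / L) 0 x)"], intro conjI)
       (use W Vper VN low topV tT Ck1_aff[OF c1C iL(1)] in auto)
qed

section \<open>Lower bound for the renormalised energy\<close>

lemma set_integral_le_subset:
  fixes f :: "real^2 => real"
  assumes "lset_int B f" "A \<in> sets lebesgue" "A \<subseteq> B" "\<And>x. 0 \<le> f x"
  shows "(LINT x:A|lebesgue. f x) \<le> (LINT x:B|lebesgue. f x)" unfolding set_lebesgue_integral_def
  by (rule integral_mono) (use assms set_integrable_subset[OF assms(1-3)] in \<open>auto simp: set_integrable_def indicator_def\<close>)

text \<open>The logarithm is paid for by the energy of u around s, up to a constant that does not
  depend on rho: half the energy of the fixed cylinder, plus 1 from the bound -1 on the synharmony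
  distance.\<close>

lemma singular_point_bound:
  fixes u :: "real^2 => real^'n"
  assumes A: "w12l A u Du" "open A" "ball s R - {s} \<subseteq> A" and R: "0 < R"
    and N: "AE x in lebesgue. x \<in> A --> u x \<in> N"
    and int: "\<And>\<rho>. 0 < \<rho> ==> lset_int (ball s R - cball s \<rho>) (\<lambda>x. (norm (Du x))^2)"
    and syn: "((\<lambda>\<rho>. synh_dist N (circle_trace u s \<rho>) \<gamma>) \<longlongrightarrow> 0) (at_right 0)"
  shows "\<exists>r0 C. 0 < r0 \<and> r0 < R \<and> (\<forall>\<^sub>F \<rho> in at_right 0. trace_cost N u s \<rho>
    \<le> (LINT x:cball s r0 - cball s \<rho>|lebesgue. (norm (Du x))^2) / 2 + C)"
proof -
  \<comment> \<open>An infimum over the empty set would be +infinity, so a distance below 1 provides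
    a connecting cylinder at some radius r0.\<close>
  have "\<forall>\<^sub>F \<rho> in at_right 0. synh_dist N (circle_trace u s \<rho>) \<gamma> < 1 \<and> 0 < \<rho> \<and> \<rho> < R"
    by (intro eventually_conj order_tendstoD(2)[OF syn] eventually_at_right_zero R) simp
  then obtain r0 where r0: "synh_dist N (circle_trace u s r0) \<gamma> < 1" "0 < r0" "r0 < R"
    using eventually_happens'[OF trivial_limit_at_right_real] by blast
  then obtain T0 C where C: "0 < T0" "W12_cyl T0 N C" "has_cyl_trace T0 C 0 (circle_trace u s r0)" "has_cyl_trace T0 C T0 \<gamma>"
    unfolding synh_dist_def Inf_less_iff by blast
  \<comment> \<open>The factor is large enough that the stretched height T is at least log(1/r0);
    the maximum with 1 keeps it positive when r0 exceeds 1.\<close>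
  define L where "L = max 1 (ln (1 / r0) / T0)"
  define T where "T = L * T0"
  have L: "0 < L" by (simp add: L_def)
  have T: "0 < T" using L C(1) by (simp add: T_def)
  have lT: "ln (1 / r0) \<le> T"
  proof -
    have "ln (1 / r0) / T0 \<le> L" by (simp add: L_def)
    then show ?thesis using C(1) by (simp add: T_def pos_divide_le_eq)
  qed
  obtain V DV v where V: "w12l {x. x $ 2 < T + T} V DV" "\<And>x. V (x + per) = V x"
    "AE x in lebesgue. x $ 2 < T + T --> V x \<in> N"
    "\<And>x. x $ 2 \<le> 0 ==> V x = u (pol s r0 x) \<and> DV x = Du (pol s r0 x) ** PJ r0 x"
    and v: "\<And>n. C1_on (v n) UNIV" "W12_approx (cyl_cell T) v V DV"
    "L2conv (\<lambda>n \<theta>. v n (V2 \<theta> T)) (\<lambda>n \<theta>. \<gamma> (circ \<theta>))" using cylinder_extension[OF A r0(2,3) N C L] unfolding T_def[symmetric] by blast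
  have \<gamma>m: "(\<lambda>\<theta>. \<gamma> (circ \<theta>)) \<in> borel_lebesgue" using C(4) by (simp add: has_cyl_trace_def)
  let ?G = "{x::real^2. x $ 2 < T + T}"
  have oG: "open ?G" by (rule open_band(2))
  define E0 where "E0 = (LINT x:cyl_cell T|lebesgue. (norm (DV x))^2)"
  have DVi: "lset_int E (\<lambda>x. (norm (DV x))^2)"
    if "E \<in> sets lebesgue" "E \<subseteq> cball 0 r" "\<And>x. x \<in> E ==> x $ 2 \<le> T" for E r
  proof -
    define K where "K = cball (0::real^2) r \<inter> {x. x $ 2 \<le> T}"
    have K: "compact K" "K \<subseteq> ?G" "E \<subseteq> K" using T that by (auto simp: K_def intro!: compact_Int_closed closed_Collect_le continuous_intros)
    have "lset_int K (\<lambda>x. (norm (DV x))^2)" using V(1) K by (auto simp: w12l_def loc_int_def)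
    then show ?thesis by (rule set_integrable_subset[OF _ that(1) K(3)])
  qed
  have main: "trace_cost N u s \<rho>
    \<le> (LINT x:cball s r0 - cball s \<rho>|lebesgue. (norm (Du x))^2) / 2 + (E0 / 2 + 1)"
    if low: "-1 < synh_dist N (circle_trace u s \<rho>) \<gamma>" and \<rho>: "0 < \<rho>" "\<rho> < r0" for \<rho>
  proof -
    let ?g = "circle_trace u s \<rho>"
    \<comment> \<open>The height of the circle of radius rho in coordinates based at r0. Shifting by
      it puts that circle at the bottom of the cylinder.\<close>
    define h where "h = ln (\<rho> / r0)"
    have h: "h < 0" using \<rho> by (simp add: h_def)
    define d where "d = V2 0 h"
    define Th where "Th = T - h"
    have Th: "0 < Th" "T < Th" using T h by (auto simp: Th_def)
    define W where "W x = V (x + d)" for x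
    define DW where "DW x = DV (x + d)" for x
    have td: "local_diffeo (\<lambda>x. x + d) U" if "open U" for U using translation.local[OF that, of "- d"] by simp
    have jd: "jacobian (\<lambda>x. x + d) (at x) = mat 1" for x using jacobian_translation[of "- d"] by simp
    have oT: "open {x::real^2. x $ 2 < Th + T}" by (rule open_band(2))
    interpret t: local_diffeo "\<lambda>x. x + d" "{x. x $ 2 < Th + T}" by (rule td[OF oT])
    have tG: "(\<lambda>x. x + d) ` {x. x $ 2 < Th + T} \<subseteq> ?G" by (auto simp: d_def Th_def)
    have W1: "w12l {x. x $ 2 < Th + T} W DW"
      using t.w12l_compose[OF V(1) oG tG] unfolding jd matrix_mul_rid W_def[abs_def] DW_def[abs_def] .
    have WN: "AE x in lebesgue. x $ 2 < Th + T --> W x \<in> N"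
    proof -
      have "AE x in lebesgue. x \<in> {x. x $ 2 < Th + T} --> V (x + d) \<in> N" by (rule t.AE_compose[OF _ oG tG]) (use V(3) in simp)
      then show ?thesis by (simp add: W_def)
    qed
    have Wper: "W (x + per) = W x" for x using V(2)[of "x + d"] by (simp add: W_def add.assoc add.commute[of per d])
    have Wlow: "W x = u (pol s \<rho> x) \<and> DW x = Du (pol s \<rho> x) ** PJ \<rho> x" if "x $ 2 \<le> - h" for x
    proof -
      have "(x + d) $ 2 \<le> 0" using that by (simp add: d_def)
      from V(4)[OF this] show ?thesis using pol_shift(1)[OF r0(2) \<rho>(1), of s x] pol_shift(2)[OF r0(2) \<rho>(1), of x] by (simp add: W_def DW_def d_def h_def)
    qed
    have \<rho>R: "\<rho> < R" using \<rho> r0 by simp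
    obtain \<tau> p where gm: "(\<lambda>\<theta>. ?g (circ \<theta>)) \<in> borel_lebesgue" and \<tau>: "0 < \<tau>" and p: "\<And>n. C1_on (p n) UNIV"
      "W12_approx (tcell 0 1 \<tau>) p (\<lambda>x. u (pol s \<rho> x)) (\<lambda>x. Du (pol s \<rho> x) ** PJ \<rho> x)"
      "L2conv (\<lambda>n \<theta>. p n (V2 \<theta> 0)) (\<lambda>n \<theta>. ?g (circ \<theta>))" using polar_trace[OF A(1,3) \<rho>(1) \<rho>R] by blast
    \<comment> \<open>Up to height -h the shifted map is u in polar coordinates based at rho, so
      this thinner collar carries the circle trace.\<close>
    define \<tau>' where "\<tau>' = min \<tau> (- h)"
    have \<tau>': "0 < \<tau>'" "\<tau>' \<le> Th" using \<tau> h T by (auto simp: \<tau>'_def Th_def)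
    have pW: "W12_approx (tcell 0 1 \<tau>') p W DW"
    proof (rule W12_approx_cong_set[OF p(2)], intro AE_I2 impI)
      fix x assume x: "x \<in> tcell 0 1 \<tau>'"
      then have "x $ 2 \<le> - h" "x \<in> tcell 0 1 \<tau>" by (auto simp: tcell_def \<tau>'_def)
      then show "x \<in> tcell 0 1 \<tau> \<and> W x = u (pol s \<rho> x) \<and> DW x = Du (pol s \<rho> x) ** PJ \<rho> x" using Wlow by blast
    qed
    define q where "q n x = v n (x + d)" for n x
    have qC: "C1_on (q n) UNIV" for n
      unfolding q_def[abs_def] by (rule Ck1_compose[OF open_UNIV open_UNIV v(1) local_diffeo.C1[OF td[OF open_UNIV]] subset_UNIV])
    have qW: "W12_approx (tcell Th (-1) T) q W DW"
    proof -
      interpret t': local_diffeo "\<lambda>x. x + d" UNIV by (rule td[OF open_UNIV])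
      have cG: "cyl_cell T \<subseteq> ?G" using T by (auto simp: cyl_cell_def)
      have l: "loc_int (cyl_cell T) V" "loc_int (cyl_cell T) DV" using w12l_subset[OF V(1) cG] by (auto simp: w12l_def dest: has_weak_gradD)
      have "W12_approx (tcell Th (-1) T) (\<lambda>n x. v n (x + d)) (\<lambda>x. V (x + d)) (\<lambda>x. DV (x + d) ** jacobian (\<lambda>x. x + d) (at x))"
        by (rule t'.W12_approx_compose[OF tcell_bounded compact_cball subset_UNIV _ _ _ open_cyl_cell l v(1,2)])
           (use open_tcell in \<open>auto simp: tcell_def cyl_cell_def d_def Th_def inj_on_def\<close>)
      then show ?thesis unfolding jd matrix_mul_rid q_def[abs_def] W_def[abs_def] DW_def[abs_def] .
    qed
    have qt: "L2conv (\<lambda>n \<theta>. q n (V2 \<theta> Th)) (\<lambda>n \<theta>. \<gamma> (circ \<theta>))"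
    proof -
      have "V2 \<theta> Th + d = V2 \<theta> T" for \<theta> by (simp add: d_def Th_def vec_eq_iff forall_2)
      then show ?thesis using v(3) by (simp add: q_def)
    qed
    have le: "synh_dist N ?g \<gamma> \<le> ereal ((LINT x:cyl_cell Th|lebesgue. (norm (DW x))^2) / 2 - (min_length N ?g)^2 / (4 * pi) * Th)"
      by (rule synh_dist_le[OF W1 Wper T Th(1) WN gm \<tau>' p(1) pW p(3) \<gamma>m T qC qW qt])
    \<comment> \<open>The lower bound on the distance and its upper bound by this competitor confine
      the subtracted term.\<close>
    have "(-1 :: ereal) = ereal (-1)" by (simp add: one_ereal_def)
    with less_le_trans[OF low le] have "ereal (-1) < ereal ((LINT x:cyl_cell Th|lebesgue. (norm (DW x))^2) / 2 - (min_length N ?g)^2 / (4 * pi) * Th)"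
      by (simp only:)
    then have 1: "(min_length N ?g)^2 / (4 * pi) * Th < (LINT x:cyl_cell Th|lebesgue. (norm (DW x))^2) / 2 + 1" by simp
    define Z1 where "Z1 = {x::real^2. 0 < x $ 1 \<and> x $ 1 < 2 * pi \<and> h < x $ 2 \<and> x $ 2 \<le> 0}"
    have Zb: "Z1 \<subseteq> cball 0 (2 * pi - h)" "cyl_cell T \<subseteq> cball 0 (2 * pi + T)"
    proof -
      show "Z1 \<subseteq> cball 0 (2 * pi - h)"
      proof
        fix x assume "x \<in> Z1"
        then show "x \<in> cball 0 (2 * pi - h)" using norm_V2_le[of x] by (auto simp: Z1_def)
      qed
      show "cyl_cell T \<subseteq> cball 0 (2 * pi + T)"
      proof
        fix x assume "x \<in> cyl_cell T"
        then show "x \<in> cball 0 (2 * pi + T)" using norm_V2_le[of x] by (auto simp: cyl_cell_def)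
      qed
    qed
    have Zm: "Z1 \<in> sets lebesgue"
    proof -
      have "open {x::real^2. 0 < x $ 1 \<and> x $ 1 < 2 * pi \<and> h < x $ 2}" "closed {x::real^2. x $ 2 \<le> 0}"
        by (intro open_Collect_conj open_Collect_less closed_Collect_le continuous_intros)+
      then have "{x::real^2. 0 < x $ 1 \<and> x $ 1 < 2 * pi \<and> h < x $ 2} \<inter> {x. x $ 2 \<le> 0} \<in> sets lebesgue" by (intro sets.Int) simp_all
      moreover have "Z1 = {x::real^2. 0 < x $ 1 \<and> x $ 1 < 2 * pi \<and> h < x $ 2} \<inter> {x. x $ 2 \<le> 0}" by (auto simp: Z1_def)
      ultimately show ?thesis by simp
    qed
    have cm: "cyl_cell T \<in> sets lebesgue" using open_cyl_cell by simp
    have i1: "lset_int Z1 (\<lambda>x. (norm (DV x))^2)" by (rule DVi[OF Zm Zb(1)]) (use T in \<open>auto simp: Z1_def\<close>)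
    have i2: "lset_int (cyl_cell T) (\<lambda>x. (norm (DV x))^2)" by (rule DVi[OF cm Zb(2)]) (auto simp: cyl_cell_def)
    \<comment> \<open>Undoing the shift splits the cell at height 0: \<open>Z1\<close> parametrises
      the annulus, and the rest is the fixed stretched cylinder with energy
      \<open>E0\<close>.\<close>
    have "(LINT x:cyl_cell Th|lebesgue. (norm (DW x))^2) = (LINT x|lebesgue. indicator (Z1 \<union> cyl_cell T) (1 *R x + d) *R (norm (DV (1 *R x + d)))^2)"
      unfolding set_lebesgue_integral_def DW_def
      by (intro Bochner_Integration.integral_cong refl) (use T h in \<open>auto simp: indicator_def cyl_cell_def Z1_def d_def Th_def\<close>)
    also have "\<dots> = (LINT x:Z1 \<union> cyl_cell T|lebesgue. (norm (DV x))^2)" unfolding set_lebesgue_integral_def by (rule integral_affine) simp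
    also have "\<dots> = (LINT x:Z1|lebesgue. (norm (DV x))^2) + E0"
      unfolding E0_def by (rule set_integral_Un[OF _ i1 i2]) (auto simp: Z1_def cyl_cell_def)
    finally have 2: "(LINT x:cyl_cell Th|lebesgue. (norm (DW x))^2) = (LINT x:Z1|lebesgue. (norm (DV x))^2) + E0" .
    let ?B = "cball s r0 - cball s \<rho>"
    have Bm: "?B \<in> sets lebesgue" by (intro sets.Diff fmeasurableD lmeasurable_cball)
    have iB: "lset_int ?B (\<lambda>x. (norm (Du x))^2)" by (rule set_integrable_subset[OF int[OF \<rho>(1)] Bm]) (use r0 in auto)
    have 3: "(LINT x:Z1|lebesgue. (norm (DV x))^2) \<le> (LINT x:?B|lebesgue. (norm (Du x))^2)"
    proof -
      interpret p: local_diffeo "pol s r0" UNIV by (rule pol_local_diffeo[OF r0(2) open_UNIV])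
      have inj: "inj_on (pol s r0) Z1" by (rule pol_inj_on[OF r0(2)]) (auto simp: Z1_def)
      have gB: "pol s r0 ` Z1 \<subseteq> ?B"
      proof (rule image_subsetI)
        fix x assume x: "x \<in> Z1"
        have "\<rho> = r0 * exp h" using \<rho> r0 by (simp add: h_def)
        moreover have "exp h < exp (x $ 2)" "exp (x $ 2) \<le> 1" using x by (auto simp: Z1_def)
        ultimately have "\<rho> < r0 * exp (x $ 2)" "r0 * exp (x $ 2) \<le> r0" using r0(2) by (auto simp: mult_le_cancel_left1)
        then show "pol s r0 x \<in> ?B" using dist_pol[OF r0(2), of s x] by simp
      qed
      have gm': "pol s r0 ` Z1 \<in> sets lebesgue" by (intro differentiable_image_in_sets_lebesgue Zm differentiable_at_imp_differentiable_on)
           (use p.C1 in \<open>auto simp: Ck1_iff\<close>)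
      have hm: "(\<lambda>x. indicator (pol s r0 ` Z1) x * (norm (Du x))^2) \<in> borel_lebesgue"
        using set_integrable_subset[OF iB gm' gB] by (simp add: set_integrable_def)
      have "ennreal (LINT x:Z1|lebesgue. (norm (DV x))^2) = (\<integral>\<^sup>+x. ennreal (indicator Z1 x *R (norm (DV x))^2) \<partial>lebesgue)"
        unfolding set_lebesgue_integral_def by (rule nn_integral_eq_integral[symmetric]) (use i1 in \<open>auto simp: set_integrable_def\<close>)
      also have "\<dots> = (\<integral>\<^sup>+x\<in>Z1. ennreal (\<bar>det (jacobian (pol s r0) (at x))\<bar> * (norm (Du (pol s r0 x)))^2) \<partial>lebesgue)"
      proof (intro nn_integral_cong)
        fix x
        show "ennreal (indicator Z1 x *R (norm (DV x))^2) = ennreal (\<bar>det (jacobian (pol s r0) (at x))\<bar> * (norm (Du (pol s r0 x)))^2) * indicator Z1 x"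
        proof (cases "x \<in> Z1")
          case True
          then have "DV x = Du (pol s r0 x) ** PJ r0 x" using V(4)[of x] by (auto simp: Z1_def)
          then show ?thesis using True by (simp add: jacobian_pol norm_mult_PJ)
        qed simp
      qed
      also have "\<dots> \<le> (\<integral>\<^sup>+x\<in>pol s r0 ` Z1. ennreal ((norm (Du x))^2) \<partial>lebesgue)" by (rule p.nn_le[OF Zm subset_UNIV inj hm]) simp
      also have "\<dots> \<le> (\<integral>\<^sup>+x. ennreal (indicator ?B x *R (norm (Du x))^2) \<partial>lebesgue)"
        by (intro nn_integral_mono) (use gB in \<open>auto simp: indicator_def\<close>)
      also have "\<dots> = ennreal (LINT x:?B|lebesgue. (norm (Du x))^2)"
        unfolding set_lebesgue_integral_def by (rule nn_integral_eq_integral) (use iB in \<open>auto simp: set_integrable_def\<close>)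
      finally show ?thesis by (subst (asm) ennreal_le_iff) (auto simp: set_lebesgue_integral_def intro!: integral_nonneg_AE)
    qed
    \<comment> \<open>Here the choice of L enters: the total height T - h dominates log(1/rho)
      itself and not merely log(r0/rho).\<close>
    have "ln (1 / \<rho>) = ln (1 / r0) - h" using \<rho> r0 by (simp add: h_def ln_div)
    then have "ln (1 / \<rho>) \<le> Th" using lT by (simp add: Th_def)
    then have "(min_length N ?g)^2 / (4 * pi) * ln (1 / \<rho>) \<le> (min_length N ?g)^2 / (4 * pi) * Th" by (intro mult_left_mono) auto
    with 1 2 3 show ?thesis by linarith
  qed
  have "\<forall>\<^sub>F \<rho> in at_right 0. trace_cost N u s \<rho>
    \<le> (LINT x:cball s r0 - cball s \<rho>|lebesgue. (norm (Du x))^2) / 2 + (E0 / 2 + 1)"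
  proof -
    have "\<forall>\<^sub>F \<rho> in at_right 0. -1 < synh_dist N (circle_trace u s \<rho>) \<gamma>" by (rule order_tendstoD(1)[OF syn]) simp
    then show ?thesis using eventually_at_right_zero[OF r0(2)] by eventually_elim (blast intro: main)
  qed
  then show ?thesis using r0 by blast
qed

text \<open>Each singular point pays for its own logarithm with the energy of its own annulus. The
  annuli are disjoint and the energy elsewhere is nonnegative, so the renormalised energies at small
  radii are bounded below uniformly.\<close>

lemma ren_energy_not_MInfty:
  fixes u :: "real^2 => real^'n"
  assumes \<Omega>: "open \<Omega>" and ren: "W12_ren \<Omega> N u" and hs: "has_sing \<Omega> N u k a \<gamma>"
  shows "ren_energy \<Omega> N u \<noteq> -\<infinity>"
proof -
  obtain S0 where S0: "ren_admissible \<Omega> N u S0" using ren by (auto simp: W12_ren_def)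
  define S where "S = bad_pts \<Omega> N u"
  have adm: "ren_admissible \<Omega> N u S" unfolding S_def by (rule ren_admissible_bad_pts[OF \<Omega> S0])
  have fS: "finite S" "S \<subseteq> \<Omega>" using adm by (auto simp: ren_admissible_def)
  have Sa: "S \<subseteq> a ` {..<k}" unfolding S_def by (rule bad_pts_loc_closure[OF \<Omega>]) (use hs in \<open>simp add: has_sing_def\<close>)
  obtain Du where Du: "w12l (\<Omega> - S) u Du" "\<And>\<rho>. 0 < \<rho> ==> lset_int (perforated \<Omega> S \<rho>) (\<lambda>x. (norm (Du x))^2)"
    by (rule w12l_off_singularities[OF \<Omega> adm]) blast
  have oA: "open (\<Omega> - S)" using \<Omega> fS(1) by (simp add: open_Diff finite_imp_closed)
  have N: "AE x in lebesgue. x \<in> \<Omega> - S --> u x \<in> N"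
  proof (rule AE_locally)
    fix x assume x: "x \<in> \<Omega> - S"
    obtain r where r: "r > 0" "ball x r \<subseteq> perforated \<Omega> S r" using ball_subset_perforated[OF \<Omega> fS(1)] x by blast
    have "AE y in lebesgue. y \<in> perforated \<Omega> S r --> u y \<in> N" using W12_perforated[OF \<Omega> adm r(1)] by (simp add: W12_def)
    then have "AE y in lebesgue. y \<in> ball x r --> u y \<in> N" by (rule eventually_mono) (use r(2) in blast)
    then show "\<exists>V. open V \<and> x \<in> V \<and> (AE y in lebesgue. y \<in> V --> u y \<in> N)" using r(1) by (intro exI[of _ "ball x r"]) simp
  qed
  \<comment> \<open>Half the distance to the nearest other singular point keeps the balls
    disjoint.\<close>
  have "\<exists>R>0. ball s R \<subseteq> \<Omega> \<and> (\<forall>t\<in>S. t \<noteq> s --> 2 * R \<le> dist s t)" if s: "s \<in> S" for s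
  proof -
    obtain r where r: "r > 0" "ball s r \<subseteq> \<Omega>" using \<Omega> s fS(2) by (meson open_contains_ball subset_iff)
    obtain e where e: "e > 0" "\<forall>x\<in>S. x \<noteq> s --> e \<le> dist s x" using finite_set_avoid[OF fS(1), of s] by blast
    show ?thesis using r e by (intro exI[of _ "min r (e / 2)"]) auto
  qed
  then obtain R where R: "\<And>s. s \<in> S ==> 0 < R s" "\<And>s. s \<in> S ==> ball s (R s) \<subseteq> \<Omega>"
    "\<And>s t. s \<in> S ==> t \<in> S ==> t \<noteq> s ==> 2 * R s \<le> dist s t" by metis
  have far: "R s < dist t x" if "s \<in> S" "t \<in> S" "t \<noteq> s" "x \<in> ball s (R s)" for s t x
    using R(3)[OF that(1-3)] that(4) dist_triangle[of s t x] by (simp add: dist_commute)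
  have perf: "ball s (R s) - cball s \<rho> \<subseteq> perforated \<Omega> S (min \<rho> (R s))" if "s \<in> S" for s \<rho>
  proof
    fix x assume x: "x \<in> ball s (R s) - cball s \<rho>"
    have "x \<notin> cball t (min \<rho> (R s))" if "t \<in> S" for t
    proof (cases "t = s")
      case False
      then show ?thesis using far[OF \<open>s \<in> S\<close> that False, of x] x by auto
    qed (use x in auto)
    then show "x \<in> perforated \<Omega> S (min \<rho> (R s))" using x R(2)[OF \<open>s \<in> S\<close>] by (auto simp: perforated_def)
  qed
  \<comment> \<open>The pair bundles the radius r0 and the constant C, so that a single application
    of choice fixes both for every singular point.\<close>
  have "\<forall>s\<in>S. \<exists>rC. 0 < fst rC \<and> fst rC < R s \<and> (\<forall>\<^sub>F \<rho> in at_right 0. trace_cost N u s \<rho>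
    \<le> (LINT x:cball s (fst rC) - cball s \<rho>|lebesgue. (norm (Du x))^2) / 2 + snd rC)"
  proof
    fix s assume s: "s \<in> S"
    then obtain i where i: "i < k" "s = a i" using Sa by auto
    have syn: "((\<lambda>\<rho>. synh_dist N (circle_trace u s \<rho>) (\<gamma> i)) \<longlongrightarrow> 0) (at_right 0)" using hs i by (simp add: has_sing_def)
    have sub: "ball s (R s) - {s} \<subseteq> \<Omega> - S"
    proof
      fix x assume x: "x \<in> ball s (R s) - {s}"
      have "x \<notin> S" using R(3)[OF s, of x] x R(1)[OF s] by auto
      then show "x \<in> \<Omega> - S" using x R(2)[OF s] by auto
    qed
    have int: "lset_int (ball s (R s) - cball s \<rho>) (\<lambda>x. (norm (Du x))^2)" if "0 < \<rho>" for \<rho>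
    proof (rule set_integrable_subset[OF Du(2)])
      show "0 < min \<rho> (R s)" using that R(1)[OF s] by simp
      have "open (ball s (R s) - cball s \<rho>)" by auto
      then show "ball s (R s) - cball s \<rho> \<in> sets lebesgue" by simp
    qed (rule perf[OF s])
    show "\<exists>rC. 0 < fst rC \<and> fst rC < R s \<and> (\<forall>\<^sub>F \<rho> in at_right 0. trace_cost N u s \<rho>
      \<le> (LINT x:cball s (fst rC) - cball s \<rho>|lebesgue. (norm (Du x))^2) / 2 + snd rC)"
    proof -
      obtain r0 C where "0 < r0" "r0 < R s" "\<forall>\<^sub>F \<rho> in at_right 0. trace_cost N u s \<rho>
        \<le> (LINT x:cball s r0 - cball s \<rho>|lebesgue. (norm (Du x))^2) / 2 + C"
        using singular_point_bound[OF Du(1) oA sub R(1)[OF s] N int syn] by blast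
      then show ?thesis by (intro exI[of _ "(r0, C)"]) (simp only: fst_conv snd_conv simp_thms)
    qed
  qed
  from bchoice[OF this] obtain rC where rC: "\<And>s. s \<in> S ==> 0 < fst (rC s)" "\<And>s. s \<in> S ==> fst (rC s) < R s"
    "\<forall>s\<in>S. \<forall>\<^sub>F \<rho> in at_right 0. trace_cost N u s \<rho>
    \<le> (LINT x:cball s (fst (rC s)) - cball s \<rho>|lebesgue. (norm (Du x))^2) / 2 + snd (rC s)" by blast
  have "\<forall>\<^sub>F \<rho> in at_right 0. \<forall>s\<in>S. \<rho> < R s"
  proof (rule eventually_ball_finite[OF fS(1)], rule ballI)
    show "\<forall>\<^sub>F \<rho> in at_right 0. \<rho> < R s" if "s \<in> S" for s by (rule eventually_mono[OF eventually_at_right_zero[OF R(1)[OF that]]]) simp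
  qed
  moreover have "\<forall>\<^sub>F \<rho> in at_right 0. \<forall>s\<in>S. trace_cost N u s \<rho>
    \<le> (LINT x:cball s (fst (rC s)) - cball s \<rho>|lebesgue. (norm (Du x))^2) / 2 + snd (rC s)" by (rule eventually_ball_finite[OF fS(1) rC(3)])
  moreover have "\<forall>\<^sub>F \<rho> in at_right (0::real). 0 < \<rho> \<and> \<rho> < 1" by (rule eventually_at_right_zero) simp
  ultimately have "\<forall>\<^sub>F \<rho> in at_right 0. ereal (- (\<Sum>s\<in>S. snd (rC s))) \<le> ereal (
       (LINT x:perforated \<Omega> S \<rho>|lebesgue.
          frob (weak_grad (perforated \<Omega> S \<rho>) u x) (weak_grad (perforated \<Omega> S \<rho>) u x) / 2)
       - (\<Sum>s\<in>S. trace_cost N u s \<rho>))"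
  proof eventually_elim
    fix \<rho> :: real
    assume \<rho>R: "\<forall>s\<in>S. \<rho> < R s" and \<rho>: "0 < \<rho> \<and> \<rho> < 1"
      and le: "\<forall>s\<in>S. trace_cost N u s \<rho>
        \<le> (LINT x:cball s (fst (rC s)) - cball s \<rho>|lebesgue. (norm (Du x))^2) / 2 + snd (rC s)"
    let ?P = "perforated \<Omega> S \<rho>" and ?A = "\<lambda>s. cball s (fst (rC s)) - cball s \<rho>"
    have oP: "open ?P" by (rule open_perforated[OF \<Omega> fS(1)])
    have PA: "?P \<subseteq> \<Omega> - S" using \<rho> by (auto simp: perforated_def)
    have g: "has_weak_grad ?P u Du" using w12l_subset[OF Du(1) PA] by (simp add: w12l_def)
    have ae: "AE x in lebesgue. x \<in> ?P --> (norm (Du x))^2 = frob (weak_grad ?P u x) (weak_grad ?P u x)"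
      by (rule eventually_mono[OF has_weak_grad_unique[OF oP g has_weak_grad_weak_grad[OF g]]]) (auto simp: frob_norm)
    note iP = Du(2)[OF conjunct1[OF \<rho>]]
    have e: "(LINT x:?P|lebesgue. frob (weak_grad ?P u x) (weak_grad ?P u x) / 2) = (LINT x:?P|lebesgue. (norm (Du x))^2) / 2"
      using set_integrable_cong_AE'(2)[OF iP ae] by simp
    have Am: "?A s \<in> sets lebesgue" for s by (intro sets.Diff fmeasurableD lmeasurable_cball)
    have AP: "?A s \<subseteq> ?P" if "s \<in> S" for s
    proof -
      have "?A s \<subseteq> ball s (R s) - cball s \<rho>" using rC(2)[OF that] by auto
      also have "\<dots> \<subseteq> perforated \<Omega> S (min \<rho> (R s))" by (rule perf[OF that])
      also have "min \<rho> (R s) = \<rho>" using \<rho>R that by auto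
      finally show ?thesis .
    qed
    have dj: "disjoint_family_on ?A S" unfolding disjoint_family_on_def
    proof (intro ballI impI)
      fix s t assume st: "s \<in> S" "t \<in> S" "s \<noteq> t"
      show "?A s \<inter> ?A t = {}"
      proof (rule ccontr)
        assume "?A s \<inter> ?A t \<noteq> {}"
        then obtain x where "dist s x \<le> fst (rC s)" "dist t x \<le> fst (rC t)" by auto
        then have "dist s x < R s" "dist t x < R t" using rC(2) st by force+
        then show False using R(3)[OF st(1,2)] R(3)[OF st(2,1)] st(3) dist_triangle2[of s t x] by (auto simp: dist_commute)
      qed
    qed
    \<comment> \<open>Disjoint annuli inside the perforated domain use at most its whole
      energy.\<close>
    have "(\<Sum>s\<in>S. LINT x:?A s|lebesgue. (norm (Du x))^2) = (LINT x:(\<Union>s\<in>S. ?A s)|lebesgue. (norm (Du x))^2)"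
      by (rule set_integral_finite_Union[OF fS(1) dj _ Am, symmetric]) (rule set_integrable_subset[OF iP Am AP])
    also have "\<dots> \<le> (LINT x:?P|lebesgue. (norm (Du x))^2)"
      by (rule set_integral_le_subset[OF iP]) (use AP Am fS(1) in \<open>auto intro!: sets.finite_UN\<close>)
    finally have "(\<Sum>s\<in>S. LINT x:?A s|lebesgue. (norm (Du x))^2) \<le> (LINT x:?P|lebesgue. (norm (Du x))^2)" .
    moreover have "(\<Sum>s\<in>S. trace_cost N u s \<rho>)
      \<le> (\<Sum>s\<in>S. (LINT x:?A s|lebesgue. (norm (Du x))^2) / 2 + snd (rC s))" using le by (intro sum_mono) auto
    ultimately show "ereal (- (\<Sum>s\<in>S. snd (rC s))) \<le> ereal (
       (LINT x:?P|lebesgue. frob (weak_grad ?P u x) (weak_grad ?P u x) / 2)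
       - (\<Sum>s\<in>S. trace_cost N u s \<rho>))"
      unfolding e by (simp add: sum.distrib sum_divide_distrib[symmetric])
  qed
  from Liminf_bounded[OF this] have "ereal (- (\<Sum>s\<in>S. snd (rC s))) \<le> ren_energy \<Omega> N u"
    unfolding ren_energy_def Inter_ren_admissible[OF \<Omega> S0] S_def[symmetric] ren_energy_wrt_def .
  then show ?thesis by auto
qed

theorem proposition7p9:
  fixes \<Omega> :: "(real^2) set"
    and N :: "(real^'n) set"
    and u :: "real^2 \<Rightarrow> real^'n"
  assumes "smooth_submanifold N" and "compact N" and "connected N"
    and "open \<Omega>"
    and "minimal_ren_singular_harmonic \<Omega> N u"
  shows "stationary_ren_singular_harmonic \<Omega> N u"
proof -
  obtain k a \<gamma> where ren: "W12_ren \<Omega> N u" and hs: "has_sing \<Omega> N u k a \<gamma>"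
    and mini: "\<And>v b. W12_ren \<Omega> N v \<Longrightarrow> has_sing \<Omega> N v k b \<gamma> \<Longrightarrow> ren_energy \<Omega> N u \<le> ren_energy \<Omega> N v"
    using assms(5) unfolding minimal_ren_singular_harmonic_def by blast
  have low: "ren_energy \<Omega> N u \<noteq> -\<infinity>" by (rule ren_energy_not_MInfty[OF assms(4) ren hs])
  \<comment> \<open>The representation of sing(u) that witnesses minimality also witnesses
    stationarity.\<close>
  show ?thesis
    unfolding stationary_ren_singular_harmonic_def Let_def
  proof (intro conjI exI[of _ k] exI[of _ a] exI[of _ \<gamma>] allI impI ren hs)
    fix \<psi> :: "real^2 \<Rightarrow> real^2"
    assume \<psi>: "Ck_compact_support 2 \<Omega> \<psi> \<and> (\<forall>i<k. \<exists>r>0. \<forall>x\<in>ball (a i) r. \<psi> x = \<psi> (a i))"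
    show "(LINT x:\<Omega>|lebesgue. frob (weak_grad (\<Omega> - a ` {..<k}) u x) (weak_grad (\<Omega> - a ` {..<k}) u x ** jacobian \<psi> (at x))) =
      1 / 2 * (LINT x:\<Omega>|lebesgue. frob (weak_grad (\<Omega> - a ` {..<k}) u x) (weak_grad (\<Omega> - a ` {..<k}) u x) * trace (jacobian \<psi> (at x)))"
      by (rule minimal_imp_stationary_identity[OF assms(4) ren hs mini low]) (use \<psi> in auto)
  qed
qed

end
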